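(* Let $(\rho_0,\rho_0v_0)\in\mathcal V_2(\mathbb R)$ and let $(\rho_t,\rho_tv_t)=\mathscr S_t(\rho_0,\rho_0v_0)\in\mathcal V_2(\mathbb R)$, $t\ge0$, be the semigroup solution of the sticky particle system. Then the Lipschitz curve $(\rho_t)_{t\ge0}$ in $\mathcal P_2(\mathbb R)$ solves the Evolution Variational Inequality $$\frac t2\frac{d}{dt}W_2^2(\rho_t,\eta)-\frac12W_2^2(\rho_t,\eta)\le\phi^{\rho_0}(\eta)-\phi^{\rho_0}(\rho_t)\quad\text{for a.e. }t\in(0,+\infty),\ \forall\,\eta\in\mathcal P_2(\mathbb R).\qquad(\ast)$$ Equivalently, the reparametrized curve $\hat\rho_\tau:=\rho_{e^\tau}$ satisfies $$\frac12\frac{d}{d\tau}W_2^2(\hat\rho_\tau,\eta)-\frac12W_2^2(\hat\rho_\tau,\eta)\le\phi^{\rho_0}(\eta)-\phi^{\rho_0}(\hat\rho_\tau)\quad\text{for a.e. }\tau\in\mathbb R,\ \forall\,\eta\in\mathcal P_2(\mathbb R),$$ and one has the representation formula $$\hat\rho_\tau=\mathscr G^{\rho_0}_{\tau-\delta}\hat\rho_\delta,\quad\text{or, equivalently,}\quad\rho_t=\mathscr G^{\rho_0}_{\log(t/\varepsilon)}\rho_\varepsilon\qquad\forall\,\tau=\log t\ge\delta=\log\varepsilon,\ \varepsilon>0.$$ Conversely, if $t\mapsto\rho_t$, $t\ge0$, is a Lipschitz curve in $\mathcal P_2(\mathbb R)$ starting at $\rho_0$ which satisfies $(\ast)$ and,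 for some $v_0\in L^2_{\rho_0}(\mathbb R)$, the initial velocity condition $$\lim_{t\downarrow0}t^{-2}\int_{\mathbb R\times\mathbb R}|x+tv_0(x)-y|^2\,d\boldsymbol\rho_t(x,y)=0,\qquad\boldsymbol\rho_t=\Gamma_o(\rho_0,\rho_t),$$ then there exists a unique Borel velocity vector field $v_t\in L^2_{\rho_t}(\mathbb R)$ such that $(\rho_t,\rho_tv_t)=\mathscr S_t(\rho_0,\rho_0v_0)$; $v_t$ is the Wasserstein velocity field of $\rho_t$.
   Context: Monotone rearrangement: for a Borel probability measure $\rho$ on $\mathbb R$, $X_\rho(w):=\inf\{x:\rho((-\infty,x])>w\}$, $w\in(0,1)$; $\lambda$ is Lebesgue measure on $(0,1)$, and $\Gamma_o(\rho^1,\rho^2):=(X_{\rho^1},X_{\rho^2})_\#\lambda$ is the optimal coupling. $\mathcal P_2(\mathbb R)$ is the set of Borel probability measures with finite second moment with the $L^2$-Wasserstein distance $W_2$. $L^2_\rho(\mathbb R)=L^2(\mathbb R,\rho)$. For $\sigma\in\mathcal P_2(\mathbb R)$, $\phi^\sigma(\rho):=-\frac12W_2^2(\rho,\sigma)$. $\mathscr G^\sigma_\tau:\mathcal P_2(\mathbb R)\to\mathcal P_2(\mathbb R)$, $\tau\ge0$, is the (Wasserstein gradient flow) semigroup of $\phi^\sigma$: by the theory of Ambrosio–Gigli–Savaré, it is the unique continuous semigroup, expanding distances at most by the factor $e^\tau$, whose locally Lipschitz trajectories $\hat\rho_\tau=\mathscr G^\sigma_\tau(\rho)$ are uniquely characterized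 by $\hat\rho_0=\rho$ and $\frac12\frac{d}{d\tau}W_2^2(\hat\rho_\tau,\eta)-\frac12W_2^2(\hat\rho_\tau,\eta)\le\phi^\sigma(\eta)-\phi^\sigma(\hat\rho_\tau)$ for a.e. $\tau>0$ and all $\eta\in\mathcal P_2(\mathbb R)$. Wasserstein velocity field of a Lipschitz curve $\rho_t$ in $\mathcal P_2(\mathbb R)$: the Borel field $v_t\in L^2_{\rho_t}(\mathbb R)$, determined for a.e. $t$, with $\partial_t\rho+\partial_x(\rho v)=0$ in distributions and $\|v_t\|_{L^2_{\rho_t}}$ equal to the metric derivative of $\rho_t$ for a.e. $t$. $\mathcal M(\mathbb R)$ is the space of signed Borel measures with finite total variation; weak convergence is in duality with bounded continuous functions. $\mathcal V_2(\mathbb R):=\{\mu=(\rho,\rho v)\in\mathcal P_2(\mathbb R)\times\mathcal M(\mathbb R):v\in L^2_\rho(\mathbb R)\}$ with the distance $D_2^2(\mu^1,\mu^2):=W_2^2(\rho^1,\rho^2)+\int_0^1|v^1(X_{\rho^1}(w))-v^2(X_{\rho^2}(w))|^2\,dw$. Semigroup $\mathscr S_t$. On the $D_2$-dense set $\hat{\mathcal V}(\mathbb R)$ of discrete data $\mu=(\sum_{i=1}^Nm_i\delta_{x_i},\sum_{i=1}^Nm_iv_i\delta_{x_i})$ ($m_i>0$, $\sum m_i=1$, $x_1<\dots<x_N$, $v_i\in\mathbb R$), $\mathscr S_t[\mu]:=(\sum_im_i\delta_{x_i(t)},\sum_im_iv_i(t)\delta_{x_i(t)})$, where $x_i(t)$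 are continuous, piecewise linear, ordered trajectories with right-continuous piecewise constant velocities $v_i(t)$ (right derivatives of $x_i$), $x_i(0)=x_i$, $v_i(0)=v_i$; the sets $J_i(t):=\{j:x_j(t)=x_i(t)\}$ are nondecreasing in $t$; velocities are constant between the finitely many collision times $t_k$ (times at which some $J_i$ grows), and $v_i(t_k+)=\sum_{j\in J_i(t_k)}m_jv_j(t_k-)/\sum_{j\in J_i(t_k)}m_j$. On $\mathcal V_2(\mathbb R)$, $\mathscr S_t$ is the unique extension which is strongly-weakly continuous, i.e. such that if $D_2(\mu^n,\mu)\to0$, $\mathscr S_t[\mu^n]=(\rho^n_t,\rho^n_tv^n_t)$, $\mathscr S_t[\mu]=(\rho_t,\rho_tv_t)$, then $W_2(\rho^n_t,\rho_t)\to0$ and $\rho^n_tv^n_t\rightharpoonup\rho_tv_t$ weakly in $\mathcal M(\mathbb R)$. *)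

theory Defs
  imports "HOL-Probability.Probability"
begin

section \<open>Probability measures on the line and the Wasserstein distance\<close>

definition P2 :: "real measure set" where
  "P2 = {\<rho>. prob_space \<rho> \<and> sets \<rho> = sets borel \<and> integrable \<rho> (\<lambda>x. x\<^sup>2)}"

text \<open>Elements of \<open>L2 \<rho>\<close> are Borel functions, not classes; identities between them are
  therefore always stated \<open>\<rho>\<close>-almost everywhere.\<close>

definition L2 :: "real measure \<Rightarrow> (real \<Rightarrow> real) set" where
  "L2 \<rho> = {v. v \<in> borel_measurable borel \<and> integrable \<rho> (\<lambda>x. (v x)\<^sup>2)}"

definition couplings :: "real measure \<Rightarrow> real measure \<Rightarrow> (real \<times> real) measure set" where
  "couplings \<rho> \<eta> =
    {\<gamma>. sets \<gamma> = sets borel \<and> distr \<gamma> borel fst = \<rho> \<and> distr \<gamma> borel snd = \<eta>}"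

definition W2 :: "real measure \<Rightarrow> real measure \<Rightarrow> real" where
  "W2 \<rho> \<eta> = sqrt (INF \<gamma>\<in>couplings \<rho> \<eta>. \<integral>z. (fst z - snd z)\<^sup>2 \<partial>\<gamma>)"

abbreviation unit_lebesgue :: "real measure" where
  "unit_lebesgue \<equiv> restrict_space lborel {0<..<1}"

definition rearr :: "real measure \<Rightarrow> real \<Rightarrow> real" where
  "rearr \<rho> w = Inf {x. measure \<rho> {..x} > w}"

definition opt_coupling :: "real measure \<Rightarrow> real measure \<Rightarrow> (real \<times> real) measure" where
  "opt_coupling \<rho> \<eta> = distr unit_lebesgue borel (\<lambda>w. (rearr \<rho> w, rearr \<eta> w))"

text \<open>The functional \<open>\<phi>\<^sup>\<sigma>\<close>.\<close>

definition phi :: "real measure \<Rightarrow> real measure \<Rightarrow> real" where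
  "phi \<sigma> \<rho> = - (1/2) * (W2 \<rho> \<sigma>)\<^sup>2"

text \<open>Curves are total functions of a real parameter; on \<open>[0, \<infinity>)\<close> they lie in \<open>P2\<close>, their
  values at negative times are irrelevant.\<close>

definition lipschitz_curve :: "(real \<Rightarrow> real measure) \<Rightarrow> bool" where
  "lipschitz_curve r \<longleftrightarrow>
    (\<forall>t\<ge>0. r t \<in> P2) \<and> (\<exists>L. \<forall>s\<ge>0. \<forall>t\<ge>0. W2 (r s) (r t) \<le> L * \<bar>s - t\<bar>)"

definition locally_lipschitz_curve :: "(real \<Rightarrow> real measure) \<Rightarrow> bool" where
  "locally_lipschitz_curve r \<longleftrightarrow>
    (\<forall>t\<ge>0. r t \<in> P2) \<and>
    (\<forall>T>0. \<exists>L. \<forall>s\<in>{0..T}. \<forall>t\<in>{0..T}. W2 (r s) (r t) \<le> L * \<bar>s - t\<bar>)"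


section \<open>Evolution variational inequalities and the gradient flow of \<open>phi \<sigma>\<close>\<close>

text \<open>Both inequalities are read with the exceptional null set of times independent of \<open>\<eta>\<close>,
  and they include the existence of the derivative.\<close>

definition EVI_on :: "real set \<Rightarrow> real measure \<Rightarrow> (real \<Rightarrow> real measure) \<Rightarrow> bool" where
  "EVI_on I \<sigma> r \<longleftrightarrow>
    (AE \<tau> in lborel. \<tau> \<in> I \<longrightarrow> (\<forall>\<eta>\<in>P2. \<exists>D.
      ((\<lambda>s. (W2 (r s) \<eta>)\<^sup>2) has_real_derivative D) (at \<tau>) \<and>
      (1/2) * D - (1/2) * (W2 (r \<tau>) \<eta>)\<^sup>2 \<le> phi \<sigma> \<eta> - phi \<sigma> (r \<tau>)))"

definition sticky_EVI :: "real measure \<Rightarrow> (real \<Rightarrow> real measure) \<Rightarrow> bool" where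
  "sticky_EVI \<sigma> r \<longleftrightarrow>
    (AE t in lborel. 0 < t \<longrightarrow> (\<forall>\<eta>\<in>P2. \<exists>D.
      ((\<lambda>s. (W2 (r s) \<eta>)\<^sup>2) has_real_derivative D) (at t) \<and>
      (t/2) * D - (1/2) * (W2 (r t) \<eta>)\<^sup>2 \<le> phi \<sigma> \<eta> - phi \<sigma> (r t)))"

definition flow_trajectory ::
    "real measure \<Rightarrow> real measure \<Rightarrow> (real \<Rightarrow> real measure) \<Rightarrow> bool" where
  "flow_trajectory \<sigma> \<rho> r \<longleftrightarrow>
    locally_lipschitz_curve r \<and> r 0 = \<rho> \<and> EVI_on {0<..} \<sigma> r"

text \<open>The gradient flow semigroup, given through its trajectories: for \<open>\<rho>, \<sigma> \<in> P2\<close> there is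
  exactly one solution of the evolution variational inequality on \<open>[0, \<infinity>)\<close> that starts
  from \<open>\<rho>\<close>. Arguments outside \<open>P2\<close> or \<open>\<tau> < 0\<close> carry no meaning.\<close>

definition grad_flow :: "real measure \<Rightarrow> real \<Rightarrow> real measure \<Rightarrow> real measure" where
  "grad_flow \<sigma> \<tau> \<rho> = (THE \<nu>. \<exists>r. flow_trajectory \<sigma> \<rho> r \<and> r \<tau> = \<nu>)"


section \<open>Signed measures and the space of mass-momentum pairs\<close>

text \<open>A signed measure is a real set function, normalised to be \<open>0\<close> off the Borel sets so that
  equality of functions is equality of measures. The value on the empty set is \<open>0\<close> by
  countable additivity; the last clause is finiteness of the total variation.\<close>

type_synonym signed = "real set \<Rightarrow> real"

definition signed_measures :: "signed set" where
  "signed_measures = {m.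
    (\<forall>A. A \<notin> sets borel \<longrightarrow> m A = 0) \<and>
    (\<forall>A :: nat \<Rightarrow> real set. range A \<subseteq> sets borel \<longrightarrow> disjoint_family A \<longrightarrow>
        (\<lambda>i. m (A i)) sums m (\<Union>i. A i)) \<and>
    (\<exists>C. \<forall>F. finite F \<longrightarrow> F \<subseteq> sets borel \<longrightarrow> disjoint F \<longrightarrow> (\<Sum>A\<in>F. \<bar>m A\<bar>) \<le> C)}"

text \<open>The integral of a bounded Borel function; it does not depend on the decomposition of the
  signed measure as a difference of finite positive measures.\<close>

definition signed_integral :: "signed \<Rightarrow> (real \<Rightarrow> real) \<Rightarrow> real" where
  "signed_integral m f = (THE I. \<exists>a b.
    finite_measure a \<and> finite_measure b \<and> sets a = sets borel \<and> sets b = sets borel \<and>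
    (\<forall>A\<in>sets borel. m A = measure a A - measure b A) \<and>
    I = (\<integral>x. f x \<partial>a) - (\<integral>x. f x \<partial>b))"

definition weakly_converges :: "(nat \<Rightarrow> signed) \<Rightarrow> signed \<Rightarrow> bool" where
  "weakly_converges mn m \<longleftrightarrow>
    (\<forall>f. continuous_on UNIV f \<longrightarrow> bounded (range f) \<longrightarrow>
      (\<lambda>n. signed_integral (mn n) f) \<longlonglongrightarrow> signed_integral m f)"

text \<open>The signed measure \<open>\<rho>v\<close>.\<close>

definition momentum :: "real measure \<Rightarrow> (real \<Rightarrow> real) \<Rightarrow> signed" where
  "momentum \<rho> v = (\<lambda>A. if A \<in> sets borel then set_lebesgue_integral \<rho> A v else 0)"

type_synonym state = "real measure \<times> signed"

definition V2 :: "state set" where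
  "V2 = {(\<rho>, m). \<rho> \<in> P2 \<and> m \<in> signed_measures \<and> (\<exists>v\<in>L2 \<rho>. m = momentum \<rho> v)}"

text \<open>On \<open>V2\<close> the velocity is determined \<open>\<rho>\<close>-almost everywhere.\<close>

definition velocity :: "state \<Rightarrow> real \<Rightarrow> real" where
  "velocity \<mu> = (SOME v. v \<in> L2 (fst \<mu>) \<and> snd \<mu> = momentum (fst \<mu>) v)"

definition D2 :: "state \<Rightarrow> state \<Rightarrow> real" where
  "D2 \<mu> \<nu> = sqrt ((W2 (fst \<mu>) (fst \<nu>))\<^sup>2 +
    (\<integral>w. (velocity \<mu> (rearr (fst \<mu>) w) - velocity \<nu> (rearr (fst \<nu>) w))\<^sup>2 \<partial>unit_lebesgue))"


section \<open>Sticky particles\<close>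

text \<open>A system of \<open>N\<close> particles is described by masses \<open>m i\<close>, positions \<open>x i\<close> and velocities
  \<open>v i\<close> for \<open>i < N\<close>. The associated state is
  \<open>(\<Sum>i<N. m i \<delta>\<^bsub>x i\<^esub>, \<Sum>i<N. m i v i \<delta>\<^bsub>x i\<^esub>)\<close>; the first component is
  obtained as the image under \<open>x\<close> of the measure on \<open>{..<N}\<close> with weights \<open>m\<close>.\<close>

definition particle_state ::
    "nat \<Rightarrow> (nat \<Rightarrow> real) \<Rightarrow> (nat \<Rightarrow> real) \<Rightarrow> (nat \<Rightarrow> real) \<Rightarrow> state" where
  "particle_state N m x v =
    (distr (point_measure {..<N} (\<lambda>i. ennreal (m i))) borel x,
     \<lambda>A. if A \<in> sets borel then (\<Sum>i<N. m i * v i * indicator A (x i)) else 0)"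

definition particle_data :: "nat \<Rightarrow> (nat \<Rightarrow> real) \<Rightarrow> (nat \<Rightarrow> real) \<Rightarrow> bool" where
  "particle_data N m x \<longleftrightarrow>
    (\<forall>i<N. 0 < m i) \<and> (\<Sum>i<N. m i) = 1 \<and> strict_mono_on {..<N} x"

text \<open>In the following \<open>X t i\<close> and \<open>V t i\<close> are position and velocity of particle \<open>i\<close> at
  time \<open>t\<close>.\<close>

definition cluster :: "nat \<Rightarrow> (real \<Rightarrow> nat \<Rightarrow> real) \<Rightarrow> real \<Rightarrow> nat \<Rightarrow> nat set" where
  "cluster N X t i = {j. j < N \<and> X t j = X t i}"

definition collision_times :: "nat \<Rightarrow> (real \<Rightarrow> nat \<Rightarrow> real) \<Rightarrow> real set" where
  "collision_times N X =
    {t. 0 < t \<and> (\<exists>i<N. \<forall>s. 0 \<le> s \<and> s < t \<longrightarrow> cluster N X s i \<subset> cluster N X t i)}"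

text \<open>Since a collision time may be the left end point \<open>s\<close> of an interval on which \<open>V\<close> is
  constant but not its right end point, \<open>V\<close> is right-continuous. \<open>V s i\<close> is the right
  derivative of \<open>X\<close> by the clause saying that \<open>X\<close> is affine between collisions.\<close>

definition sticky_motion ::
    "nat \<Rightarrow> (nat \<Rightarrow> real) \<Rightarrow> (nat \<Rightarrow> real) \<Rightarrow> (nat \<Rightarrow> real) \<Rightarrow>
     (real \<Rightarrow> nat \<Rightarrow> real) \<Rightarrow> (real \<Rightarrow> nat \<Rightarrow> real) \<Rightarrow> bool" where
  "sticky_motion N m x v X V \<longleftrightarrow>
    (\<forall>i<N. X 0 i = x i \<and> V 0 i = v i) \<and>
    (\<forall>i<N. continuous_on {0..} (\<lambda>t. X t i)) \<and>
    (\<forall>t\<ge>0. \<forall>i j. i \<le> j \<longrightarrow> j < N \<longrightarrow> X t i \<le> X t j) \<and>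
    (\<forall>i<N. \<forall>s t. 0 \<le> s \<longrightarrow> s \<le> t \<longrightarrow> cluster N X s i \<subseteq> cluster N X t i) \<and>
    finite (collision_times N X) \<and>
    (\<forall>i<N. \<forall>s t. 0 \<le> s \<longrightarrow> s \<le> t \<longrightarrow> collision_times N X \<inter> {s<..t} = {} \<longrightarrow>
        V t i = V s i) \<and>
    (\<forall>i<N. \<forall>s t. 0 \<le> s \<longrightarrow> s \<le> t \<longrightarrow> collision_times N X \<inter> {s<..<t} = {} \<longrightarrow>
        X t i = X s i + (t - s) * V s i) \<and>
    (\<forall>t\<in>collision_times N X. \<forall>i<N.
        V t i = (\<Sum>j\<in>cluster N X t i. m j * Lim (at_left t) (\<lambda>s. V s j))
                / (\<Sum>j\<in>cluster N X t i. m j))"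

definition is_sticky_semigroup :: "(real \<Rightarrow> state \<Rightarrow> state) \<Rightarrow> bool" where
  "is_sticky_semigroup S \<longleftrightarrow>
    (\<forall>t\<ge>0. \<forall>\<mu>\<in>V2. S t \<mu> \<in> V2) \<and>
    (\<forall>N m x v X V. particle_data N m x \<longrightarrow> sticky_motion N m x v X V \<longrightarrow>
        (\<forall>t\<ge>0. S t (particle_state N m x v) = particle_state N m (X t) (V t))) \<and>
    (\<forall>t\<ge>0. \<forall>\<mu>n \<mu>. (\<forall>n. \<mu>n n \<in> V2) \<longrightarrow> \<mu> \<in> V2 \<longrightarrow> (\<lambda>n. D2 (\<mu>n n) \<mu>) \<longlonglongrightarrow> 0 \<longrightarrow>
        (\<lambda>n. W2 (fst (S t (\<mu>n n))) (fst (S t \<mu>))) \<longlonglongrightarrow> 0 \<and>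
        weakly_converges (\<lambda>n. snd (S t (\<mu>n n))) (snd (S t \<mu>)))"

text \<open>Such a map exists and is unique for \<open>t \<ge> 0\<close> on \<open>V2\<close>; the choice only fixes its
  meaningless values elsewhere.\<close>

definition sticky_semigroup :: "real \<Rightarrow> state \<Rightarrow> state" where
  "sticky_semigroup = (SOME S. is_sticky_semigroup S)"


section \<open>The Wasserstein velocity field of a curve\<close>

text \<open>\<open>D i j\<close> is the partial derivative of order \<open>i\<close> in time and \<open>j\<close> in space.\<close>

definition smooth_plane :: "(real \<times> real \<Rightarrow> real) \<Rightarrow> bool" where
  "smooth_plane \<psi> \<longleftrightarrow> (\<exists>D :: nat \<Rightarrow> nat \<Rightarrow> real \<times> real \<Rightarrow> real. D 0 0 = \<psi> \<and>
    (\<forall>i j. continuous_on UNIV (D i j) \<and>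
      (\<forall>t x. ((\<lambda>s. D i j (s, x)) has_real_derivative D (Suc i) j (t, x)) (at t) \<and>
             ((\<lambda>y. D i j (t, y)) has_real_derivative D i (Suc j) (t, x)) (at x))))"

definition test_function :: "(real \<times> real \<Rightarrow> real) \<Rightarrow> bool" where
  "test_function \<psi> \<longleftrightarrow> smooth_plane \<psi> \<and>
    (\<exists>K. compact K \<and> K \<subseteq> {0<..} \<times> UNIV \<and> (\<forall>z. z \<notin> K \<longrightarrow> \<psi> z = 0))"

definition continuity_equation ::
    "(real \<Rightarrow> real measure) \<Rightarrow> (real \<Rightarrow> real \<Rightarrow> real) \<Rightarrow> bool" where
  "continuity_equation \<rho> v \<longleftrightarrow> (\<forall>\<psi>. test_function \<psi> \<longrightarrow>
    (LINT t:{0<..}|lborel. (LINT x|\<rho> t.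
        deriv (\<lambda>s. \<psi> (s, x)) t + v t x * deriv (\<lambda>y. \<psi> (t, y)) x)) = 0)"

text \<open>The limit in the last clause is the metric derivative of the curve at \<open>t\<close>.\<close>

definition wasserstein_velocity ::
    "(real \<Rightarrow> real measure) \<Rightarrow> (real \<Rightarrow> real \<Rightarrow> real) \<Rightarrow> bool" where
  "wasserstein_velocity \<rho> v \<longleftrightarrow>
    (\<lambda>(t, x). v t x) \<in> borel_measurable (restrict_space borel ({0<..} \<times> UNIV)) \<and>
    (AE t in lborel. 0 < t \<longrightarrow> v t \<in> L2 (\<rho> t)) \<and>
    continuity_equation \<rho> v \<and>
    (AE t in lborel. 0 < t \<longrightarrow>
      ((\<lambda>h. W2 (\<rho> (t + h)) (\<rho> t) / \<bar>h\<bar>) \<longlongrightarrow> sqrt (\<integral>x. (v t x)\<^sup>2 \<partial>\<rho> t)) (at 0))"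

end

theory Submission
  imports Defs
begin

text \<open>The monotone rearrangement is an isometry of \<open>P2\<close> onto the closed cone \<open>MK\<close> of monotone functions
  in the Hilbert space \<open>L\<^sup>2(0,1)\<close>. In these coordinates the sticky particle system is explicit: if
  \<open>a\<close> is the initial position and \<open>v\<close>, a function of \<open>a\<close>, the initial velocity, then the position
  \<open>X t\<close> is the projection of \<open>a + t v\<close> onto the cone, and the velocity \<open>V t\<close> is the conditional average
  of \<open>v\<close> on the level sets of \<open>X t\<close>. A vector normal to the cone at \<open>X\<close> is orthogonal to all
  functions of \<open>X\<close>, and averaging monotone functions on level sets obeys Chebyshev's inequality.
  Together these facts give the semigroup property, hence agreement with the sticky motion of discrete
  data, and \<open>t * inner (V t) (X t - Z) \<le> inner (X t - a) (X t - Z)\<close> for all \<open>Z\<close> in the cone. The norm of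
  \<open>V t\<close> is decreasing, so it is discontinuous at countably many times only; at all other times \<open>X\<close> has
  derivative \<open>V t\<close>, and the inequality is the evolution variational inequality. If \<open>\<rho>\<close> and \<open>\<rho>'\<close> solve
  the latter, then \<open>W2 (\<rho> t) (\<rho>' t) / t\<close> is nonincreasing, so a solution is determined by its initial velocity.\<close>

section \<open>Projection onto closed convex cones\<close>

text \<open>Both \<open>sticky_semigroup\<close> and \<open>grad_flow\<close> are given by choice,
  so each must be identified before anything can be said of it. For \<open>grad_flow\<close>,
  trajectories are shown to be unique and the sticky curve itself supplies one. For
  \<open>sticky_semigroup\<close>, the explicit map must have the defining properties, discrete data
  must be dense, and every discrete datum must possess a sticky motion, since otherwise its value
  would not be prescribed.

  The obstacle is dependence on the data: \<open>V t\<close> averages over level sets, which may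
  change abruptly. But the momentum at \<open>X t\<close> sees a velocity only through this very
  average, so the state at time \<open>t\<close> can be written with the initial velocity in place
  of \<open>V t\<close>. Position and velocity are then norm continuous in the data, and weak
  convergence of momenta follows.

  The exceptional times must be the same for all comparison measures; discontinuities of the norm of
  \<open>V t\<close> do not involve them. For two solutions the mixed increment of Lipschitz curves
  in a Hilbert space is quadratic in time, so their two inequalities can be added on the
  diagonal.\<close>

definition closed_cone :: "'a::real_inner set \<Rightarrow> bool" where
  "closed_cone K \<longleftrightarrow> closed K \<and> 0 \<in> K \<and> (\<forall>x\<in>K. \<forall>y\<in>K. x + y \<in> K) \<and>
    (\<forall>x\<in>K. \<forall>c\<ge>0. c *\<^sub>R x \<in> K)"

text \<open>For a cone, the variational inequality of the projection splits into a sign condition on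
  the whole cone and one orthogonality; this set is the usual normal cone at
  \<open>p\<close>.\<close>

definition normal_to :: "'a::real_inner set \<Rightarrow> 'a \<Rightarrow> 'a set" where
  "normal_to K p = {\<xi>. (\<forall>z\<in>K. inner \<xi> z \<le> 0) \<and> inner \<xi> p = 0}"

text \<open>Chosen by the optimality condition instead of minimal distance, since this is the form
  in which later projections are verified; \<open>normal_unique\<close> shows that the choice is
  forced.\<close>

definition cproj :: "'a::real_inner set \<Rightarrow> 'a \<Rightarrow> 'a" where
  "cproj K x = (SOME p. p \<in> K \<and> x - p \<in> normal_to K p)"

lemma parallelogram:
  fixes a b :: "'a::real_inner"
  shows "(norm (a + b))\<^sup>2 + (norm (a - b))\<^sup>2 = 2 * (norm a)\<^sup>2 + 2 * (norm b)\<^sup>2"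
  by (simp add: power2_norm_eq_inner inner_add_left inner_add_right inner_diff_left
      inner_diff_right inner_commute)

lemma norm_add_sq:
  fixes a b :: "'a::real_inner"
  shows "(norm (a + b))\<^sup>2 = (norm a)\<^sup>2 + 2 * inner a b + (norm b)\<^sup>2"
  by (simp add: power2_norm_eq_inner inner_add_left inner_add_right inner_commute)

lemma norm_diff_sq:
  fixes a b :: "'a::real_inner"
  shows "(norm (a - b))\<^sup>2 = (norm a)\<^sup>2 - 2 * inner a b + (norm b)\<^sup>2"
  by (simp add: power2_norm_eq_inner inner_diff_left inner_diff_right inner_commute)

text \<open>Midpoints of almost minimizers remain in \<open>K\<close>, so the parallelogram identity
  makes a minimizing sequence Cauchy.\<close>

lemma ex_closest:
  fixes K :: "'a::{real_inner, complete_space} set"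
  assumes cl: "closed K" and ne: "K \<noteq> {}"
    and mid: "\<And>y z. y \<in> K \<Longrightarrow> z \<in> K \<Longrightarrow> (1/2) *\<^sub>R (y + z) \<in> K"
  shows "\<exists>p\<in>K. \<forall>y\<in>K. norm (x - p) \<le> norm (x - y)"
proof -
  define d where "d = Inf ((\<lambda>y. (norm (x - y))\<^sup>2) ` K)"
  have bdd: "bdd_below ((\<lambda>y. (norm (x - y))\<^sup>2) ` K)" by (rule bdd_belowI[of _ 0]) auto
  have d_le: "d \<le> (norm (x - y))\<^sup>2" if "y \<in> K" for y
    unfolding d_def using that by (intro cInf_lower bdd) auto
  have "\<exists>y\<in>K. (norm (x - y))\<^sup>2 < d + e" if "e > 0" for e
  proof -
    have "d < d + e" using that by simp
    then show ?thesis unfolding d_def using ne bdd by (subst (asm) cInf_less_iff) auto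
  qed
  then have "\<exists>y. y \<in> K \<and> (norm (x - y))\<^sup>2 < d + 1 / real (Suc n)" for n
    by (meson divide_pos_pos of_nat_0_less_iff zero_less_Suc zero_less_one)
  then obtain s where s: "\<And>n. s n \<in> K" "\<And>n. (norm (x - s n))\<^sup>2 < d + 1 / real (Suc n)" by metis
  have ss: "(norm (s m - s n))\<^sup>2 \<le> 2 / real (Suc m) + 2 / real (Suc n)" for m n
  proof -
    have "(norm ((x - s m) + (x - s n)))\<^sup>2 = 4 * (norm (x - (1/2) *\<^sub>R (s m + s n)))\<^sup>2"
    proof -
      have "(x - s m) + (x - s n) = 2 *\<^sub>R (x - (1/2) *\<^sub>R (s m + s n))"
        by (simp add: algebra_simps scaleR_2)
      then show ?thesis by (simp only: norm_scaleR) (simp add: power_mult_distrib)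
    qed
    moreover have "4 * d \<le> 4 * (norm (x - (1/2) *\<^sub>R (s m + s n)))\<^sup>2"
      using d_le[OF mid[OF s(1) s(1)], of m n] by simp
    moreover have "(norm ((x - s m) - (x - s n)))\<^sup>2 = (norm (s m - s n))\<^sup>2"
      by (simp add: norm_minus_commute)
    ultimately show ?thesis
      using parallelogram[of "x - s m" "x - s n"] s(2)[of m] s(2)[of n] by simp
  qed
  have "Cauchy s"
  proof (rule metric_CauchyI)
    fix e :: real assume e: "e > 0"
    obtain N where N: "1 / real (Suc N) < e\<^sup>2 / 4"
      using nat_approx_posE[of "e\<^sup>2/4"] e by auto
    have "dist (s m) (s n) < e" if "m \<ge> N" "n \<ge> N" for m n
    proof -
      have "1 / real (Suc m) \<le> 1 / real (Suc N)" "1 / real (Suc n) \<le> 1 / real (Suc N)"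
        using that by (auto simp: field_simps)
      then have "(norm (s m - s n))\<^sup>2 < e\<^sup>2" using ss[of m n] N by linarith
      then show ?thesis using e by (simp add: dist_norm power_less_imp_less_base)
    qed
    then show "\<exists>M. \<forall>m\<ge>M. \<forall>n\<ge>M. dist (s m) (s n) < e" by blast
  qed
  then obtain p where p: "s \<longlonglongrightarrow> p" by (auto simp: Cauchy_convergent_iff convergent_def)
  have pK: "p \<in> K" using cl p s(1) closed_sequentially by blast
  have "(\<lambda>n. (norm (x - s n))\<^sup>2) \<longlonglongrightarrow> (norm (x - p))\<^sup>2" by (intro tendsto_intros p)
  moreover have "(\<lambda>n. d + 1 / real (Suc n)) \<longlonglongrightarrow> d"
    using LIMSEQ_inverse_real_of_nat_add[of d] by (simp add: inverse_eq_divide)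
  ultimately have "(norm (x - p))\<^sup>2 \<le> d"
    using s(2) by (intro LIMSEQ_le[of _ _ "\<lambda>n. d + 1 / real (Suc n)"]) (auto intro!: exI[of _ 0] less_imp_le)
  note dp = this
  have "norm (x - p) \<le> norm (x - y)" if "y \<in> K" for y
  proof (rule power2_le_imp_le)
    show "(norm (x - p))\<^sup>2 \<le> (norm (x - y))\<^sup>2"
      using order_trans[OF dp d_le[OF that]] .
  qed simp
  with pK show ?thesis by blast
qed

text \<open>First variation: \<open>p + e *\<^sub>R z\<close> for \<open>z\<close> in the cone and
  \<open>(1 - e) *\<^sub>R p\<close> are admissible competitors, and the terms linear in
  \<open>e\<close> must have the right sign.\<close>

lemma closest_normal:
  fixes K :: "'a::real_inner set"
  assumes K: "closed_cone K" and p: "p \<in> K" and min: "\<And>y. y \<in> K \<Longrightarrow> norm (x - p) \<le> norm (x - y)"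
  shows "x - p \<in> normal_to K p"
proof -
  have le0: "b \<le> 0" if "\<And>e. 0 < e \<Longrightarrow> e < 1 \<Longrightarrow> b \<le> e * c" for b c :: real
  proof (rule ccontr)
    assume "\<not> b \<le> 0"
    then have b: "b > 0" by simp
    \<comment> \<open>The second entry forces \<open>e * c\<close> to be at most
      \<open>b / 2\<close>, against \<open>b \<le> e * c\<close>.\<close>
    define e where "e = min (1/2) (b / (2 * (\<bar>c\<bar> + 1)))"
    have e: "0 < e" "e < 1" using b by (auto simp: e_def)
    have "e * c \<le> e * (\<bar>c\<bar> + 1)" using e by (intro mult_left_mono) auto
    also have "\<dots> \<le> b / (2 * (\<bar>c\<bar> + 1)) * (\<bar>c\<bar> + 1)"
      by (intro mult_right_mono) (auto simp: e_def)
    also have "\<dots> = b / 2" by (simp add: field_simps)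
    finally show False using that[OF e] b by simp
  qed
  have dir: "2 * inner (x - p) z \<le> e * (norm z)\<^sup>2" if "e > 0" "p + e *\<^sub>R z \<in> K" for z e
  proof -
    have "(norm (x - p))\<^sup>2 \<le> (norm ((x - p) - e *\<^sub>R z))\<^sup>2"
      using min[OF that(2)] by (intro power_mono) (auto simp: diff_diff_eq)
    then have "2 * (e * inner (x - p) z) \<le> e * (e * (norm z)\<^sup>2)"
      unfolding norm_diff_sq[of "x - p"] using that(1) by (simp add: ac_simps power_mult_distrib power2_eq_square)
    then have "e * (2 * inner (x - p) z) \<le> e * (e * (norm z)\<^sup>2)" by (simp add: algebra_simps)
    then show ?thesis using that(1) mult_le_cancel_left_pos by blast
  qed
  have a: "inner (x - p) z \<le> 0" if z: "z \<in> K" for z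
  proof -
    have "2 * inner (x - p) z \<le> 0"
      by (rule le0[of _ "(norm z)\<^sup>2"], rule dir) (use K p z in \<open>auto simp: closed_cone_def\<close>)
    then show ?thesis by simp
  qed
  \<comment> \<open>Moving from \<open>p\<close> towards the origin also stays in the cone; this
    supplies the inequality that turns the sign condition at \<open>p\<close> into an
    equation.\<close>
  have "2 * inner (x - p) (- p) \<le> 0"
  proof (rule le0)
    fix e :: real assume e: "0 < e" "e < 1"
    have "p + e *\<^sub>R (- p) = (1 - e) *\<^sub>R p" by (simp add: algebra_simps)
    also have "\<dots> \<in> K" using K p e by (auto simp: closed_cone_def)
    finally show "2 * inner (x - p) (- p) \<le> e * (norm (- p))\<^sup>2" using dir e by blast
  qed
  then have "inner (x - p) p = 0" using a[OF p] by simp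
  with a show ?thesis by (auto simp: normal_to_def)
qed

text \<open>Monotonicity of the normal cone. It yields at once the uniqueness of the projection
  (\<open>x = y\<close>) and its nonexpansiveness.\<close>

lemma normal_unique:
  assumes "p \<in> K" "x - p \<in> normal_to K p" "q \<in> K" "y - q \<in> normal_to K q"
  shows "norm (p - q) \<le> norm (x - y)"
proof -
  have "inner (x - p) q \<le> 0" "inner (x - p) p = 0" "inner (y - q) p \<le> 0" "inner (y - q) q = 0"
    using assms by (auto simp: normal_to_def)
  then have "(norm (p - q))\<^sup>2 \<le> inner (x - y) (p - q)"
    by (simp add: power2_norm_eq_inner inner_diff_left inner_diff_right inner_commute)
  also have "\<dots> \<le> norm (x - y) * norm (p - q)" by (rule norm_cauchy_schwarz)
  finally show ?thesis by (metis mult_right_le_imp_le norm_ge_zero order_le_less power2_eq_square)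
qed

context
  fixes K :: "'a::{real_inner, complete_space} set"
  assumes K: "closed_cone K"
begin

lemma cproj: "cproj K x \<in> K" "x - cproj K x \<in> normal_to K (cproj K x)"
proof -
  have "\<exists>p\<in>K. \<forall>y\<in>K. norm (x - p) \<le> norm (x - y)"
    using K by (intro ex_closest) (auto simp: closed_cone_def)
  then have "\<exists>p. p \<in> K \<and> x - p \<in> normal_to K p" using closest_normal[OF K] by blast
  then have "cproj K x \<in> K \<and> x - cproj K x \<in> normal_to K (cproj K x)"
    unfolding cproj_def by (rule someI_ex)
  then show "cproj K x \<in> K" "x - cproj K x \<in> normal_to K (cproj K x)" by auto
qed

lemma cproj_nonexpansive: "norm (cproj K x - cproj K y) \<le> norm (x - y)"
  by (intro normal_unique[of _ K] cproj)

lemma cproj_eqI: "p \<in> K \<Longrightarrow> x - p \<in> normal_to K p \<Longrightarrow> cproj K x = p"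
  using normal_unique[of "cproj K x" K x p x] cproj by simp

lemma cproj_self: "x \<in> K \<Longrightarrow> cproj K x = x"
  by (rule cproj_eqI) (auto simp: normal_to_def)

lemma cproj_closest: "y \<in> K \<Longrightarrow> norm (x - y) \<le> norm (x - cproj K x) \<Longrightarrow> cproj K x = y"
proof -
  assume y: "y \<in> K" and le: "norm (x - y) \<le> norm (x - cproj K x)"
  let ?p = "cproj K x"
  have "(norm (x - y))\<^sup>2 = (norm (x - ?p))\<^sup>2 + 2 * inner (x - ?p) (?p - y) + (norm (?p - y))\<^sup>2"
    using norm_add_sq[of "x - ?p" "?p - y"] by simp
  moreover have "inner (x - ?p) (?p - y) \<ge> 0"
    using cproj(2)[of x] y by (auto simp: normal_to_def inner_diff_right)
  moreover have "(norm (x - y))\<^sup>2 \<le> (norm (x - ?p))\<^sup>2" using le by (intro power_mono) auto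
  ultimately have "(norm (?p - y))\<^sup>2 \<le> 0" by linarith
  then show ?thesis by simp
qed

end

section \<open>The Hilbert space of square integrable functions on the unit interval\<close>

abbreviation "SQ \<equiv> L2 unit_lebesgue"

lemma prob_space_unit_lebesgue: "prob_space unit_lebesgue"
  by (rule prob_space_restrict_space) auto

interpretation UL: prob_space unit_lebesgue by (rule prob_space_unit_lebesgue)

lemma space_UL [simp]: "space unit_lebesgue = {0<..<1}"
  by (simp add: space_restrict_space)

lemma borel_measurable_UL [measurable_dest]:
  "f \<in> borel_measurable borel \<Longrightarrow> f \<in> borel_measurable unit_lebesgue"
  by (simp add: measurable_restrict_space1)

lemma AE_UL: "(AE w in unit_lebesgue. P w) \<longleftrightarrow> (AE w in lborel. 0 < w \<and> w < 1 \<longrightarrow> P w)"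
  by (subst AE_restrict_space_iff) auto

lemma AE_UL_space: "AE w in unit_lebesgue. 0 < w \<and> w < 1"
  by (simp add: AE_UL)

lemma SQ_measurable: "f \<in> SQ \<Longrightarrow> f \<in> borel_measurable borel"
  by (simp add: L2_def)

lemma SQ_measurable_UL: "f \<in> SQ \<Longrightarrow> f \<in> borel_measurable unit_lebesgue"
  by (intro borel_measurable_UL SQ_measurable)

lemma SQ_sq_integrable: "f \<in> SQ \<Longrightarrow> integrable unit_lebesgue (\<lambda>w. (f w)\<^sup>2)"
  by (simp add: L2_def)

lemma SQ_I: "f \<in> borel_measurable borel \<Longrightarrow> integrable unit_lebesgue (\<lambda>w. (f w)\<^sup>2) \<Longrightarrow> f \<in> SQ"
  by (simp add: L2_def)

lemma SQ_mult_integrable: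
  assumes "f \<in> SQ" "g \<in> SQ"
  shows "integrable unit_lebesgue (\<lambda>w. f w * g w)"
proof (rule Bochner_Integration.integrable_bound)
  show "integrable unit_lebesgue (\<lambda>w. (f w)\<^sup>2 + (g w)\<^sup>2)"
    using assms by (intro Bochner_Integration.integrable_add SQ_sq_integrable)
  show "(\<lambda>w. f w * g w) \<in> borel_measurable unit_lebesgue"
    using assms by (intro borel_measurable_UL borel_measurable_times SQ_measurable)
  have "\<bar>a * b\<bar> \<le> \<bar>a\<^sup>2 + b\<^sup>2\<bar>" for a b :: real
  proof -
    have "2 * \<bar>a\<bar> * \<bar>b\<bar> \<le> a\<^sup>2 + b\<^sup>2" using sum_squares_bound[of "\<bar>a\<bar>" "\<bar>b\<bar>"] by simp
    then have "2 * \<bar>a * b\<bar> \<le> a\<^sup>2 + b\<^sup>2" by (simp add: abs_mult mult.assoc)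
    then show ?thesis using abs_ge_zero[of "a * b"] abs_ge_self[of "a\<^sup>2 + b\<^sup>2"] by linarith
  qed
  then show "AE w in unit_lebesgue. norm (f w * g w) \<le> norm ((f w)\<^sup>2 + (g w)\<^sup>2)" by simp
qed

lemma SQ_const: "(\<lambda>_. c) \<in> SQ"
  by (rule SQ_I) auto

lemma SQ_integrable: "f \<in> SQ \<Longrightarrow> integrable unit_lebesgue f"
  using SQ_mult_integrable[OF _ SQ_const[of 1]] by simp

lemma SQ_add: "f \<in> SQ \<Longrightarrow> g \<in> SQ \<Longrightarrow> (\<lambda>w. f w + g w) \<in> SQ"
proof (rule SQ_I)
  assume fg: "f \<in> SQ" "g \<in> SQ"
  have "integrable unit_lebesgue (\<lambda>w. (f w)\<^sup>2 + 2 * (f w * g w) + (g w)\<^sup>2)"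
    using fg by (intro Bochner_Integration.integrable_add integrable_mult_right SQ_sq_integrable
        SQ_mult_integrable)
  then show "integrable unit_lebesgue (\<lambda>w. (f w + g w)\<^sup>2)"
    by (simp add: power2_sum ac_simps)
qed (intro borel_measurable_add SQ_measurable)

lemma SQ_scale: "f \<in> SQ \<Longrightarrow> (\<lambda>w. c * f w) \<in> SQ"
  by (auto simp: L2_def power_mult_distrib intro: borel_measurable_times)

lemma SQ_uminus: "f \<in> SQ \<Longrightarrow> (\<lambda>w. - f w) \<in> SQ"
  using SQ_scale[of f "-1"] by simp

lemma SQ_diff: "f \<in> SQ \<Longrightarrow> g \<in> SQ \<Longrightarrow> (\<lambda>w. f w - g w) \<in> SQ"
  using SQ_add[OF _ SQ_uminus, of f g] by simp

lemma SQ_bounded: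
  assumes "f \<in> borel_measurable borel" "\<And>w. 0 < w \<Longrightarrow> w < 1 \<Longrightarrow> \<bar>f w\<bar> \<le> C"
  shows "f \<in> SQ"
proof (rule SQ_I)
  have "(f w)\<^sup>2 \<le> C\<^sup>2" if "0 < w" "w < 1" for w
    using assms(2)[OF that] by (metis abs_ge_zero power2_abs power_mono)
  then show "integrable unit_lebesgue (\<lambda>w. (f w)\<^sup>2)"
    using assms(1) by (intro UL.integrable_const_bound[of _ "C\<^sup>2"])
      (auto simp: AE_UL intro!: borel_measurable_UL borel_measurable_power)
qed fact

lemma SQ_le:
  assumes "f \<in> borel_measurable borel" "g \<in> SQ" "AE w in unit_lebesgue. \<bar>f w\<bar> \<le> \<bar>g w\<bar>"
  shows "f \<in> SQ"
proof (rule SQ_I)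
  show "integrable unit_lebesgue (\<lambda>w. (f w)\<^sup>2)"
  proof (rule Bochner_Integration.integrable_bound[OF SQ_sq_integrable[OF assms(2)]])
    show "AE w in unit_lebesgue. norm ((f w)\<^sup>2) \<le> norm ((g w)\<^sup>2)"
      using assms(3) by eventually_elim (simp add: abs_le_square_iff)
  qed (use assms(1) in \<open>auto intro!: borel_measurable_UL borel_measurable_power\<close>)
qed fact

lemma SQ_cong_AE:
  assumes "f \<in> borel_measurable borel" "g \<in> SQ" "AE w in unit_lebesgue. f w = g w"
  shows "f \<in> SQ"
  using assms by (intro SQ_le[of f g]) auto

\<comment> \<open>The quotient is partial: the relation lives on \<open>SQ\<close> only, so every
  class has a Borel, square integrable representative \<open>fn a\<close>, defined on the whole line
  but relevant on the unit interval.\<close>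
quotient_type l2 = "real \<Rightarrow> real" / partial:
  "\<lambda>f g. f \<in> SQ \<and> g \<in> SQ \<and> (AE w in unit_lebesgue. f w = g w)"
proof (rule part_equivpI)
  show "\<exists>x. x \<in> SQ \<and> x \<in> SQ \<and> (AE w in unit_lebesgue. x w = x w)"
    using SQ_const by auto
  show "symp (\<lambda>f g. f \<in> SQ \<and> g \<in> SQ \<and> (AE w in unit_lebesgue. f w = g w))"
    by (auto intro!: sympI)
  show "transp (\<lambda>f g. f \<in> SQ \<and> g \<in> SQ \<and> (AE w in unit_lebesgue. f w = g w))"
    by (auto intro!: transpI)
qed

abbreviation "fn \<equiv> rep_l2"
abbreviation "cl \<equiv> abs_l2"

lemma fn_SQ: "fn a \<in> SQ"
  using Quotient3_l2 by (auto simp: Quotient3_def)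

lemma fn_measurable [measurable]: "fn a \<in> borel_measurable borel"
  by (rule SQ_measurable[OF fn_SQ])

lemma cl_fn [simp]: "cl (fn a) = a"
  using Quotient3_l2 by (auto simp: Quotient3_def)

lemma cl_eq_iff: "f \<in> SQ \<Longrightarrow> g \<in> SQ \<Longrightarrow> cl f = cl g \<longleftrightarrow> (AE w in unit_lebesgue. f w = g w)"
  using Quotient3_l2 unfolding Quotient3_def by metis

lemma cl_eqI: "f \<in> SQ \<Longrightarrow> g \<in> SQ \<Longrightarrow> AE w in unit_lebesgue. f w = g w \<Longrightarrow> cl f = cl g"
  by (simp add: cl_eq_iff)

lemma fn_cl: "f \<in> SQ \<Longrightarrow> AE w in unit_lebesgue. fn (cl f) w = f w"
  using cl_eq_iff[OF fn_SQ, of f "cl f"] by simp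

instantiation l2 :: real_inner
begin

lift_definition zero_l2 :: l2 is "\<lambda>_. 0" by (auto intro: SQ_const)
lift_definition plus_l2 :: "l2 \<Rightarrow> l2 \<Rightarrow> l2" is "\<lambda>f g w. f w + g w" by (auto intro: SQ_add)
lift_definition minus_l2 :: "l2 \<Rightarrow> l2 \<Rightarrow> l2" is "\<lambda>f g w. f w - g w" by (auto intro: SQ_diff)
lift_definition uminus_l2 :: "l2 \<Rightarrow> l2" is "\<lambda>f w. - f w" by (auto intro: SQ_uminus)
lift_definition scaleR_l2 :: "real \<Rightarrow> l2 \<Rightarrow> l2" is "\<lambda>c f w. c * f w" by (auto intro: SQ_scale)
lift_definition inner_l2 :: "l2 \<Rightarrow> l2 \<Rightarrow> real" is "\<lambda>f g. \<integral>w. f w * g w \<partial>unit_lebesgue"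
proof -
  fix f f' g g' :: "real \<Rightarrow> real"
  assume "f \<in> SQ \<and> f' \<in> SQ \<and> (AE w in unit_lebesgue. f w = f' w)"
    and "g \<in> SQ \<and> g' \<in> SQ \<and> (AE w in unit_lebesgue. g w = g' w)"
  then have "(\<lambda>w. f w * g w) \<in> borel_measurable unit_lebesgue"
    "(\<lambda>w. f' w * g' w) \<in> borel_measurable unit_lebesgue"
    "AE w in unit_lebesgue. f w * g w = f' w * g' w"
    by (auto intro: borel_measurable_times SQ_measurable_UL)
  then show "(\<integral>w. f w * g w \<partial>unit_lebesgue) = (\<integral>w. f' w * g' w \<partial>unit_lebesgue)"
    by (rule integral_cong_AE)
qed
definition norm_l2 :: "l2 \<Rightarrow> real" where "norm_l2 a = sqrt (inner a a)"
definition sgn_l2 :: "l2 \<Rightarrow> l2" where "sgn_l2 a = inverse (norm a) *\<^sub>R a"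
definition dist_l2 :: "l2 \<Rightarrow> l2 \<Rightarrow> real" where "dist_l2 a b = norm (a - b)"
definition uniformity_l2 :: "(l2 \<times> l2) filter" where
  "uniformity_l2 = (INF e\<in>{0 <..}. principal {(x, y). dist x y < e})"
definition open_l2 :: "l2 set \<Rightarrow> bool" where
  "open_l2 S \<longleftrightarrow> (\<forall>x\<in>S. \<forall>\<^sub>F (x', y) in uniformity. x' = x \<longrightarrow> y \<in> S)"

instance
proof
  fix a b c :: l2 and r s :: real and S :: "l2 set"
  show "a + b + c = a + (b + c)" by transfer (auto intro: SQ_add simp: add.assoc)
  show "a + b = b + a" by transfer (auto intro: SQ_add simp: add.commute)
  show "0 + a = a" by transfer auto
  show "- a + a = 0" by transfer (auto intro: SQ_const)
  show "a - b = a + - b" by transfer (auto intro: SQ_diff)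
  show "r *\<^sub>R (a + b) = r *\<^sub>R a + r *\<^sub>R b"
    by transfer (auto intro: SQ_add SQ_scale simp: distrib_left)
  show "(r + s) *\<^sub>R a = r *\<^sub>R a + s *\<^sub>R a"
    by transfer (auto intro: SQ_add SQ_scale simp: distrib_right)
  show "r *\<^sub>R s *\<^sub>R a = (r * s) *\<^sub>R a" by transfer (auto intro: SQ_scale simp: mult.assoc)
  show "1 *\<^sub>R a = a" by transfer auto
  show "inner a b = inner b a" by transfer (simp add: mult.commute)
  show "inner (a + b) c = inner a c + inner b c"
    by transfer (auto simp: distrib_right SQ_mult_integrable)
  show "inner (r *\<^sub>R a) b = r * inner a b" by transfer (auto simp: mult.assoc)
  show "0 \<le> inner a a" by transfer auto
  show "inner a a = 0 \<longleftrightarrow> a = 0"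
  proof transfer
    fix f assume "f \<in> SQ \<and> f \<in> SQ \<and> (AE w in unit_lebesgue. f w = f w)"
    then have f: "f \<in> SQ" by simp
    have "(\<integral>w. f w * f w \<partial>unit_lebesgue) = 0 \<longleftrightarrow> (AE w in unit_lebesgue. f w * f w = 0)"
      using f by (intro integral_nonneg_eq_0_iff_AE SQ_mult_integrable) auto
    then show "((\<integral>w. f w * f w \<partial>unit_lebesgue) = 0) \<longleftrightarrow>
      (f \<in> SQ \<and> (\<lambda>_. 0) \<in> SQ \<and> (AE w in unit_lebesgue. f w = 0))"
      using f SQ_const by simp
  qed
qed (rule norm_l2_def sgn_l2_def dist_l2_def uniformity_l2_def open_l2_def)+

end

lemma cl_add: "f \<in> SQ \<Longrightarrow> g \<in> SQ \<Longrightarrow> cl f + cl g = cl (\<lambda>w. f w + g w)"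
  by (simp add: plus_l2.abs_eq)

lemma cl_diff: "f \<in> SQ \<Longrightarrow> g \<in> SQ \<Longrightarrow> cl f - cl g = cl (\<lambda>w. f w - g w)"
  by (simp add: minus_l2.abs_eq)

lemma cl_scale: "f \<in> SQ \<Longrightarrow> c *\<^sub>R cl f = cl (\<lambda>w. c * f w)"
  by (simp add: scaleR_l2.abs_eq)

lemma cl_zero: "cl (\<lambda>_. 0) = 0"
  by (simp only: zero_l2_def map_fun_def id_apply)

lemma inner_cl: "f \<in> SQ \<Longrightarrow> g \<in> SQ \<Longrightarrow> inner (cl f) (cl g) = (\<integral>w. f w * g w \<partial>unit_lebesgue)"
  by (simp add: inner_l2.abs_eq)

lemma inner_fn: "inner a b = (\<integral>w. fn a w * fn b w \<partial>unit_lebesgue)"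
  using inner_cl[OF fn_SQ fn_SQ, of a b] by simp

lemma norm_fn_sq: "(norm a)\<^sup>2 = (\<integral>w. (fn a w)\<^sup>2 \<partial>unit_lebesgue)"
  unfolding power2_norm_eq_inner inner_fn by (simp add: power2_eq_square)

lemma norm_cl_sq: "f \<in> SQ \<Longrightarrow> (norm (cl f))\<^sup>2 = (\<integral>w. (f w)\<^sup>2 \<partial>unit_lebesgue)"
  unfolding power2_norm_eq_inner by (simp add: inner_cl power2_eq_square)

lemma dist_cl_sq:
  "f \<in> SQ \<Longrightarrow> g \<in> SQ \<Longrightarrow> (dist (cl f) (cl g))\<^sup>2 = (\<integral>w. (f w - g w)\<^sup>2 \<partial>unit_lebesgue)"
  by (simp add: dist_norm cl_diff norm_cl_sq SQ_diff)

lemma fn_diff: "AE w in unit_lebesgue. fn (a - b) w = fn a w - fn b w"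
  using fn_cl[OF SQ_diff[OF fn_SQ fn_SQ], of a b] cl_diff[OF fn_SQ fn_SQ, of a b] by simp

section \<open>Completeness and almost everywhere convergent subsequences\<close>

lemma integral_abs_le_norm:
  "(\<integral>w. \<bar>fn a w\<bar> \<partial>unit_lebesgue) \<le> norm a"
proof -
  have S: "(\<lambda>w. \<bar>fn a w\<bar>) \<in> SQ" using SQ_le[OF _ fn_SQ[of a], of "\<lambda>w. \<bar>fn a w\<bar>"] by simp
  have "(\<integral>w. \<bar>fn a w\<bar> \<partial>unit_lebesgue) = inner (cl (\<lambda>w. \<bar>fn a w\<bar>)) (cl (\<lambda>_. 1))"
    by (simp add: inner_cl S SQ_const)
  also have "\<dots> \<le> norm (cl (\<lambda>w. \<bar>fn a w\<bar>)) * norm (cl (\<lambda>_. 1))" by (rule norm_cauchy_schwarz)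
  also have "norm (cl (\<lambda>w. \<bar>fn a w\<bar>)) = norm a"
  proof (rule power2_eq_imp_eq)
    show "(norm (cl (\<lambda>w. \<bar>fn a w\<bar>)))\<^sup>2 = (norm a)\<^sup>2"
      unfolding norm_cl_sq[OF S] by (simp add: norm_fn_sq)
  qed auto
  also have "norm (cl (\<lambda>_. 1)) = 1"
  proof (rule power2_eq_imp_eq)
    show "(norm (cl (\<lambda>_. 1)))\<^sup>2 = 1\<^sup>2"
      using UL.prob_space by (simp add: norm_cl_sq[OF SQ_const])
  qed auto
  finally show ?thesis by simp
qed

lemma integral_dist_le: "(\<integral>w. \<bar>fn a w - fn b w\<bar> \<partial>unit_lebesgue) \<le> norm (a - b)"
proof -
  have "(\<integral>w. \<bar>fn a w - fn b w\<bar> \<partial>unit_lebesgue) = (\<integral>w. \<bar>fn (a - b) w\<bar> \<partial>unit_lebesgue)"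
    using fn_diff[of a b]
    by (intro integral_cong_AE) (auto intro!: borel_measurable_UL)
  then show ?thesis using integral_abs_le_norm[of "a - b"] by simp
qed

text \<open>Riesz-Fischer. Cauchy sequences are also Cauchy in the mean of order one, which gives an
  almost everywhere convergent subsequence; Fatou's lemma along it bounds the squared distance of
  \<open>f\<close> to the sequence.\<close>

lemma l2_Cauchy_AE_limit:
  assumes "Cauchy s"
  obtains r f where "strict_mono r" "f \<in> SQ" "AE w in unit_lebesgue. (\<lambda>n. fn (s (r n)) w) \<longlonglongrightarrow> f w"
    "s \<longlonglongrightarrow> cl f"
proof -
  have C: "\<exists>N. \<forall>i\<ge>N. \<forall>j\<ge>N. LINT w|unit_lebesgue. norm (fn (s i) w - fn (s j) w) < e"
    if e: "e > 0" for e
  proof -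
    obtain N where N: "\<And>i j. i \<ge> N \<Longrightarrow> j \<ge> N \<Longrightarrow> norm (s i - s j) < e"
      using metric_CauchyD[OF assms e] by (auto simp: dist_norm)
    show ?thesis
      using le_less_trans[OF integral_dist_le N] by (intro exI[of _ N]) auto
  qed
  obtain r where r: "strict_mono r" "AE w in unit_lebesgue. Cauchy (\<lambda>i. fn (s (r i)) w)"
    using cauchy_L1_AE_cauchy_subseq[OF SQ_integrable[OF fn_SQ] C] by blast
  define f where "f w = lim (\<lambda>i. fn (s (r i)) w)" for w
  have fm [measurable]: "f \<in> borel_measurable borel" unfolding f_def by measurable
  have lim: "AE w in unit_lebesgue. (\<lambda>n. fn (s (r n)) w) \<longlonglongrightarrow> f w"
    using r(2) by eventually_elim (simp add: f_def Cauchy_convergent_iff convergent_LIMSEQ_iff)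
  have main: "\<exists>N. \<forall>n\<ge>N. (\<lambda>w. f w - fn (s n) w) \<in> SQ \<and>
      (\<integral>w. (f w - fn (s n) w)\<^sup>2 \<partial>unit_lebesgue) \<le> e\<^sup>2" if e: "e > 0" for e
  proof -
    obtain N where N: "\<And>i j. i \<ge> N \<Longrightarrow> j \<ge> N \<Longrightarrow> norm (s i - s j) < e"
      using metric_CauchyD[OF assms e] by (auto simp: dist_norm)
    have "(\<lambda>w. f w - fn (s n) w) \<in> SQ \<and>
      (\<integral>w. (f w - fn (s n) w)\<^sup>2 \<partial>unit_lebesgue) \<le> e\<^sup>2" if n: "n \<ge> N" for n
    proof -
      have "(\<integral>\<^sup>+w. ennreal ((f w - fn (s n) w)\<^sup>2) \<partial>unit_lebesgue)
          = (\<integral>\<^sup>+w. liminf (\<lambda>k. ennreal ((fn (s (r k)) w - fn (s n) w)\<^sup>2)) \<partial>unit_lebesgue)"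
      proof (rule nn_integral_cong_AE)
        show "AE w in unit_lebesgue. ennreal ((f w - fn (s n) w)\<^sup>2) =
          liminf (\<lambda>k. ennreal ((fn (s (r k)) w - fn (s n) w)\<^sup>2))"
          using lim
        proof eventually_elim
          case (elim w)
          then have "(\<lambda>k. ennreal ((fn (s (r k)) w - fn (s n) w)\<^sup>2)) \<longlonglongrightarrow> ennreal ((f w - fn (s n) w)\<^sup>2)"
            by (intro tendsto_ennrealI tendsto_intros)
          then show ?case by (rule lim_imp_Liminf[OF trivial_limit_sequentially, symmetric])
        qed
      qed
      also have "\<dots> \<le> liminf (\<lambda>k. \<integral>\<^sup>+w. ennreal ((fn (s (r k)) w - fn (s n) w)\<^sup>2) \<partial>unit_lebesgue)"
        by (rule nn_integral_liminf) auto
      also have "\<dots> \<le> ennreal (e\<^sup>2)"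
      proof (rule Liminf_le)
        show "\<forall>\<^sub>F k in sequentially. (\<integral>\<^sup>+w. ennreal ((fn (s (r k)) w - fn (s n) w)\<^sup>2) \<partial>unit_lebesgue) \<le> ennreal (e\<^sup>2)"
        proof (rule eventually_sequentiallyI[of N])
          fix k assume "k \<ge> N"
          then have "r k \<ge> N" using seq_suble[OF r(1), of k] by simp
          then have "norm (s (r k) - s n) < e" using N n by simp
          then have "(norm (s (r k) - s n))\<^sup>2 \<le> e\<^sup>2" by (intro power_mono) auto
          moreover have "(norm (s (r k) - s n))\<^sup>2 = (\<integral>w. (fn (s (r k)) w - fn (s n) w)\<^sup>2 \<partial>unit_lebesgue)"
            using dist_cl_sq[OF fn_SQ fn_SQ, of "s (r k)" "s n"] by (simp add: dist_norm)
          moreover have "(\<integral>\<^sup>+w. ennreal ((fn (s (r k)) w - fn (s n) w)\<^sup>2) \<partial>unit_lebesgue)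
            = ennreal (\<integral>w. (fn (s (r k)) w - fn (s n) w)\<^sup>2 \<partial>unit_lebesgue)"
            by (intro nn_integral_eq_integral SQ_sq_integrable SQ_diff fn_SQ) auto
          ultimately show "(\<integral>\<^sup>+w. ennreal ((fn (s (r k)) w - fn (s n) w)\<^sup>2) \<partial>unit_lebesgue) \<le> ennreal (e\<^sup>2)"
            by (simp add: ennreal_leI)
        qed
      qed simp
      finally have fin: "(\<integral>\<^sup>+w. ennreal ((f w - fn (s n) w)\<^sup>2) \<partial>unit_lebesgue) \<le> ennreal (e\<^sup>2)" .
      have int: "integrable unit_lebesgue (\<lambda>w. (f w - fn (s n) w)\<^sup>2)"
        using fin by (intro integrableI_nonneg) (auto intro!: borel_measurable_UL simp: less_top[symmetric] top_unique)
      moreover have "ennreal (\<integral>w. (f w - fn (s n) w)\<^sup>2 \<partial>unit_lebesgue) \<le> ennreal (e\<^sup>2)"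
        using fin by (subst nn_integral_eq_integral[symmetric]) (use int in auto)
      ultimately show ?thesis by (auto intro!: SQ_I)
    qed
    then show ?thesis by blast
  qed
  \<comment> \<open>Fatou controls only the differences; adding back one member of the sequence
    shows that \<open>f\<close> itself is square integrable.\<close>
  obtain N0 where "(\<lambda>w. f w - fn (s N0) w) \<in> SQ" using main[of 1] by auto
  from SQ_add[OF this fn_SQ[of "s N0"]] have f: "f \<in> SQ" by simp
  have "s \<longlonglongrightarrow> cl f"
  proof (rule metric_LIMSEQ_I)
    fix e :: real assume e: "e > 0"
    obtain N where N: "\<And>n. n \<ge> N \<Longrightarrow> (\<integral>w. (f w - fn (s n) w)\<^sup>2 \<partial>unit_lebesgue) \<le> (e/2)\<^sup>2"
      using main[of "e/2"] e by auto
    have "dist (s n) (cl f) < e" if "n \<ge> N" for n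
    proof -
      have "(dist (cl f) (cl (fn (s n))))\<^sup>2 \<le> (e/2)\<^sup>2"
        unfolding dist_cl_sq[OF f fn_SQ] by (rule N[OF that])
      then have "dist (cl f) (cl (fn (s n))) \<le> e/2" by (rule power2_le_imp_le) (use e in auto)
      then show ?thesis using e by (simp add: dist_commute)
    qed
    then show "\<exists>no. \<forall>n\<ge>no. dist (s n) (cl f) < e" by blast
  qed
  with that r(1) f lim show thesis by blast
qed

instance l2 :: complete_space
proof
  fix s :: "nat \<Rightarrow> l2" assume "Cauchy s"
  then obtain f where "s \<longlonglongrightarrow> cl f" using l2_Cauchy_AE_limit by blast
  then show "convergent s" by (auto simp: convergent_def)
qed

lemma l2_LIMSEQ_AE_subseq:
  assumes "s \<longlonglongrightarrow> a"
  obtains r where "strict_mono r" "AE w in unit_lebesgue. (\<lambda>n. fn (s (r n)) w) \<longlonglongrightarrow> fn a w"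
proof -
  obtain r f where r: "strict_mono r" "f \<in> SQ" "AE w in unit_lebesgue. (\<lambda>n. fn (s (r n)) w) \<longlonglongrightarrow> f w"
    "s \<longlonglongrightarrow> cl f"
    using l2_Cauchy_AE_limit[OF LIMSEQ_imp_Cauchy[OF assms]] by blast
  have "a = cl f" using LIMSEQ_unique[OF assms r(4)] .
  then have "AE w in unit_lebesgue. fn a w = f w" using fn_cl[OF r(2)] by simp
  with r(3) have "AE w in unit_lebesgue. (\<lambda>n. fn (s (r n)) w) \<longlonglongrightarrow> fn a w" by eventually_elim simp
  with r(1) that show thesis by blast
qed

section \<open>Averaging over the level sets of a function\<close>

abbreviation \<mu>01 :: "real set \<Rightarrow> real" where "\<mu>01 \<equiv> measure unit_lebesgue"

definition lev :: "(real \<Rightarrow> real) \<Rightarrow> real \<Rightarrow> real set" where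
  "lev Y x = {w. 0 < w \<and> w < 1 \<and> Y w = x}"

definition dis :: "(real \<Rightarrow> real) \<Rightarrow> real \<Rightarrow> real" where
  "dis Y x = \<mu>01 {w. 0 < w \<and> w < 1 \<and> Y w \<le> x}"

text \<open>For monotone \<open>Y\<close> the distribution function \<open>dis Y\<close> inverts \<open>Y\<close> off its atoms, so that
  \<open>vel Y U \<circ> Y\<close> is the conditional expectation of \<open>U\<close> given \<open>Y\<close>.\<close>

definition vel :: "(real \<Rightarrow> real) \<Rightarrow> (real \<Rightarrow> real) \<Rightarrow> real \<Rightarrow> real" where
  "vel Y U x = (if \<mu>01 (lev Y x) > 0
     then (\<integral>w. U w * indicator (lev Y x) w \<partial>unit_lebesgue) / \<mu>01 (lev Y x) else U (dis Y x))"

definition atoms :: "(real \<Rightarrow> real) \<Rightarrow> real set" where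
  "atoms Y = {x. \<mu>01 (lev Y x) > 0}"

lemma sets_UL_I: "A \<in> sets borel \<Longrightarrow> {w. 0 < w \<and> w < 1 \<and> w \<in> A} \<in> sets unit_lebesgue"
proof -
  assume A: "A \<in> sets borel"
  have "{w. 0 < w \<and> w < 1 \<and> w \<in> A} = {0<..<1} \<inter> A" by auto
  then show ?thesis using A by (simp add: sets_restrict_space)
qed

lemma pred_sets_UL:
  "Y \<in> borel_measurable borel \<Longrightarrow> A \<in> sets borel \<Longrightarrow> {w. 0 < w \<and> w < 1 \<and> Y w \<in> A} \<in> sets unit_lebesgue"
  using sets_UL_I[of "Y -` A"] by (simp add: measurable_sets_borel)

lemma lev_sets [measurable]: "Y \<in> borel_measurable borel \<Longrightarrow> lev Y x \<in> sets unit_lebesgue"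
  using pred_sets_UL[of Y "{x}"] by (simp add: lev_def)

lemma dis_sets [measurable]:
  fixes Y :: "real \<Rightarrow> real"
  shows "Y \<in> borel_measurable borel \<Longrightarrow> {w. 0 < w \<and> w < 1 \<and> Y w \<le> x} \<in> sets unit_lebesgue"
  using pred_sets_UL[OF _ borel_closed[OF closed_atMost]] by auto

lemma lev_subset [simp]: "lev Y x \<inter> {0<..<1} = lev Y x"
  by (auto simp: lev_def)

lemma countable_atoms:
  assumes Y: "Y \<in> borel_measurable borel"
  shows "countable (atoms Y)"
proof -
  interpret D: prob_space "distr unit_lebesgue borel Y"
    by (rule UL.prob_space_distr) (rule borel_measurable_UL[OF Y])
  have "measure (distr unit_lebesgue borel Y) {x} = \<mu>01 (lev Y x)" for x
    by (subst measure_distr) (auto simp: borel_measurable_UL[OF Y] lev_def intro!: arg_cong[where f = \<mu>01])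
  then have "atoms Y = {x. measure (distr unit_lebesgue borel Y) {x} \<noteq> 0}"
    by (auto simp: atoms_def zero_less_measure_iff)
  then show ?thesis using D.countable_support by simp
qed

lemma dis_mono: "Y \<in> borel_measurable borel \<Longrightarrow> mono (dis Y)"
  unfolding dis_def by (intro monoI UL.finite_measure_mono) auto

text \<open>Off the countable set of atoms, \<open>vel Y U\<close> is \<open>U\<close> composed with
  the monotone function \<open>dis Y\<close>.\<close>

lemma vel_measurable:
  assumes Y: "Y \<in> borel_measurable borel" and U: "U \<in> borel_measurable borel"
  shows "vel Y U \<in> borel_measurable borel"
proof (rule measurable_discrete_difference)
  show "(\<lambda>x. U (dis Y x)) \<in> borel_measurable borel"
    using borel_measurable_mono[OF dis_mono[OF Y]] U by (rule measurable_compose)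
  show "countable (atoms Y)" by (rule countable_atoms[OF Y])
  show "U (dis Y x) = vel Y U x" if "x \<notin> atoms Y" for x
    using that by (simp add: atoms_def vel_def)
qed auto

text \<open>Countably many level sets of positive measure and the remainder partition the unit
  interval. Properties of the averages can thus be checked on each fibre, and pointwise on the
  remainder.\<close>

lemma nn_integral_le_atoms:
  fixes f g :: "real \<Rightarrow> ennreal"
  assumes Y: "Y \<in> borel_measurable borel"
    and f: "f \<in> borel_measurable unit_lebesgue" and g: "g \<in> borel_measurable unit_lebesgue"
    and at: "\<And>x. x \<in> atoms Y \<Longrightarrow>
      (\<integral>\<^sup>+w. f w * indicator (lev Y x) w \<partial>unit_lebesgue) \<le> (\<integral>\<^sup>+w. g w * indicator (lev Y x) w \<partial>unit_lebesgue)"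
    and off: "AE w in unit_lebesgue. Y w \<notin> atoms Y \<longrightarrow> f w \<le> g w"
  shows "(\<integral>\<^sup>+w. f w \<partial>unit_lebesgue) \<le> (\<integral>\<^sup>+w. g w \<partial>unit_lebesgue)"
proof -
  let ?D = "atoms Y"
  have D: "countable ?D" by (rule countable_atoms[OF Y])
  have DB: "?D \<in> sets borel" by (rule sets.countable[OF _ D]) auto
  \<comment> \<open>Indices that enumerate no atom receive the empty set, which covers the case of
    finitely many atoms.\<close>
  define B where "B n = (if n \<in> to_nat_on ?D ` ?D then lev Y (from_nat_into ?D n) else {})" for n
  define E where "E = {w. 0 < w \<and> w < 1 \<and> Y w \<notin> ?D}"
  have Bs [measurable]: "B n \<in> sets unit_lebesgue" for n using Y by (auto simp: B_def)
  have Es [measurable]: "E \<in> sets unit_lebesgue"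
    using pred_sets_UL[OF Y, of "- ?D"] DB by (simp add: E_def)
  have disj: "disjoint_family B"
    unfolding disjoint_family_on_def
  proof (intro ballI impI)
    fix m n :: nat assume "m \<noteq> n"
    then show "B m \<inter> B n = {}"
      using from_nat_into_inj[OF D, of m n] by (auto simp: B_def lev_def)
  qed
  have UB: "(\<Union>n. B n) = {w. 0 < w \<and> w < 1 \<and> Y w \<in> ?D}"
  proof (intro set_eqI iffI)
    fix w assume "w \<in> {w. 0 < w \<and> w < 1 \<and> Y w \<in> ?D}"
    then have "w \<in> B (to_nat_on ?D (Y w))" using D by (auto simp: B_def lev_def)
    then show "w \<in> (\<Union>n. B n)" by blast
  next
    fix w assume "w \<in> (\<Union>n. B n)"
    then obtain n where "n \<in> to_nat_on ?D ` ?D" "w \<in> lev Y (from_nat_into ?D n)"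
      by (auto simp: B_def split: if_splits)
    then show "w \<in> {w. 0 < w \<and> w < 1 \<and> Y w \<in> ?D}"
      using D by (auto simp: lev_def)
  qed
  have UBs: "(\<Union>n. B n) \<in> sets unit_lebesgue" using Bs by (intro sets.countable_UN) auto
  have UBE: "(\<Union>n. B n) \<inter> E = {}" unfolding UB E_def by auto
  have split: "(\<integral>\<^sup>+w. h w \<partial>unit_lebesgue) =
      (\<Sum>n. \<integral>\<^sup>+w. h w * indicator (B n) w \<partial>unit_lebesgue) + (\<integral>\<^sup>+w. h w * indicator E w \<partial>unit_lebesgue)"
    if h: "h \<in> borel_measurable unit_lebesgue" for h :: "real \<Rightarrow> ennreal"
  proof -
    have "(\<integral>\<^sup>+w. h w \<partial>unit_lebesgue) = (\<integral>\<^sup>+w. h w * indicator ((\<Union>n. B n) \<union> E) w \<partial>unit_lebesgue)"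
      unfolding UB E_def by (intro nn_integral_cong) (auto simp: indicator_def)
    also have "\<dots> = (\<integral>\<^sup>+w. h w * indicator (\<Union>n. B n) w \<partial>unit_lebesgue) + (\<integral>\<^sup>+w. h w * indicator E w \<partial>unit_lebesgue)"
      by (rule nn_integral_disjoint_pair[OF h UBs Es UBE])
    also have "(\<integral>\<^sup>+w. h w * indicator (\<Union>n. B n) w \<partial>unit_lebesgue) =
      (\<Sum>n. \<integral>\<^sup>+w. h w * indicator (B n) w \<partial>unit_lebesgue)"
      by (rule nn_integral_disjoint_family[OF h Bs disj])
    finally show ?thesis .
  qed
  have "(\<integral>\<^sup>+w. f w * indicator (B n) w \<partial>unit_lebesgue) \<le> (\<integral>\<^sup>+w. g w * indicator (B n) w \<partial>unit_lebesgue)" for n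
    using at D by (auto simp: B_def)
  moreover have "(\<integral>\<^sup>+w. f w * indicator E w \<partial>unit_lebesgue) \<le> (\<integral>\<^sup>+w. g w * indicator E w \<partial>unit_lebesgue)"
    using off by (intro nn_integral_mono_AE, eventually_elim) (simp add: E_def indicator_def)
  ultimately show ?thesis
    unfolding split[OF f] split[OF g] by (intro add_mono suminf_le) auto
qed

text \<open>Rewrites the sign of an integral as a comparison of the integrals of its negative and
  positive part, so that \<open>nn_integral_le_atoms\<close> applies to signed integrands.\<close>

lemma integral_nonneg_iff_nn:
  assumes "integrable M (h :: _ \<Rightarrow> real)"
  shows "0 \<le> integral\<^sup>L M h \<longleftrightarrow> (\<integral>\<^sup>+w. ennreal (- h w) \<partial>M) \<le> (\<integral>\<^sup>+w. ennreal (h w) \<partial>M)"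
proof -
  have "(\<integral>\<^sup>+w. ennreal (h w) \<partial>M) < \<top>" "(\<integral>\<^sup>+w. ennreal (- h w) \<partial>M) < \<top>"
    using assms by (auto simp: real_integrable_def less_top)
  then show ?thesis
    unfolding real_lebesgue_integral_def[OF assms]
    by (cases "\<integral>\<^sup>+w. ennreal (h w) \<partial>M"; cases "\<integral>\<^sup>+w. ennreal (- h w) \<partial>M") auto
qed

lemma integral_nonneg_atoms:
  fixes h :: "real \<Rightarrow> real"
  assumes Y: "Y \<in> borel_measurable borel" and h: "integrable unit_lebesgue h"
    and at: "\<And>x. x \<in> atoms Y \<Longrightarrow> 0 \<le> (\<integral>w. h w * indicator (lev Y x) w \<partial>unit_lebesgue)"
    and off: "AE w in unit_lebesgue. Y w \<notin> atoms Y \<longrightarrow> 0 \<le> h w"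
  shows "0 \<le> (\<integral>w. h w \<partial>unit_lebesgue)"
  unfolding integral_nonneg_iff_nn[OF h]
proof (rule nn_integral_le_atoms[OF Y])
  fix x assume "x \<in> atoms Y"
  have "integrable unit_lebesgue (\<lambda>w. h w * indicator (lev Y x) w)"
    using h Y by (intro integrable_real_mult_indicator) auto
  with at[OF \<open>x \<in> atoms Y\<close>] have "(\<integral>\<^sup>+w. ennreal (- (h w * indicator (lev Y x) w)) \<partial>unit_lebesgue)
      \<le> (\<integral>\<^sup>+w. ennreal (h w * indicator (lev Y x) w) \<partial>unit_lebesgue)"
    by (simp add: integral_nonneg_iff_nn)
  moreover have "ennreal (- (h w * indicator (lev Y x) w)) = ennreal (- h w) * indicator (lev Y x) w"
    "ennreal (h w * indicator (lev Y x) w) = ennreal (h w) * indicator (lev Y x) w" for w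
    by (auto simp: indicator_def)
  ultimately show "(\<integral>\<^sup>+w. ennreal (- h w) * indicator (lev Y x) w \<partial>unit_lebesgue)
      \<le> (\<integral>\<^sup>+w. ennreal (h w) * indicator (lev Y x) w \<partial>unit_lebesgue)" by simp
next
  show "AE w in unit_lebesgue. Y w \<notin> atoms Y \<longrightarrow> ennreal (- h w) \<le> ennreal (h w)"
    using off by eventually_elim (auto intro: ennreal_leI)
qed (use h in auto)

lemma integral_zero_atoms:
  fixes h :: "real \<Rightarrow> real"
  assumes Y: "Y \<in> borel_measurable borel" and h: "integrable unit_lebesgue h"
    and at: "\<And>x. x \<in> atoms Y \<Longrightarrow> (\<integral>w. h w * indicator (lev Y x) w \<partial>unit_lebesgue) = 0"
    and off: "AE w in unit_lebesgue. Y w \<notin> atoms Y \<longrightarrow> h w = 0"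
  shows "(\<integral>w. h w \<partial>unit_lebesgue) = 0"
proof -
  have "AE w in unit_lebesgue. Y w \<notin> atoms Y \<longrightarrow> 0 \<le> h w"
    "AE w in unit_lebesgue. Y w \<notin> atoms Y \<longrightarrow> 0 \<le> - h w"
    using off by (eventually_elim, simp)+
  note off' = this
  have "0 \<le> (\<integral>w. h w \<partial>unit_lebesgue)"
    by (rule integral_nonneg_atoms[OF Y h _ off'(1)]) (simp add: at)
  moreover have "0 \<le> (\<integral>w. - h w \<partial>unit_lebesgue)"
    by (rule integral_nonneg_atoms[OF Y _ _ off'(2)]) (simp_all add: at h)
  ultimately show ?thesis by simp
qed

section \<open>Monotone functions\<close>

definition mono01 :: "(real \<Rightarrow> real) \<Rightarrow> bool" where
  "mono01 f \<longleftrightarrow> (\<forall>w w'. 0 < w \<longrightarrow> w \<le> w' \<longrightarrow> w' < 1 \<longrightarrow> f w \<le> f w')"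

lemma mono01D: "mono01 f \<Longrightarrow> 0 < w \<Longrightarrow> w \<le> w' \<Longrightarrow> w' < 1 \<Longrightarrow> f w \<le> f w'"
  by (simp add: mono01_def)

lemma measure_UL_Ioc: "0 < w \<Longrightarrow> w < 1 \<Longrightarrow> \<mu>01 {0<..w} = w"
proof -
  assume "0 < w" "w < 1"
  then show ?thesis by (subst measure_restrict_space) auto
qed

lemma lev_null: "Y w \<notin> atoms Y \<Longrightarrow> \<mu>01 (lev Y (Y w)) = 0"
  by (auto simp: atoms_def zero_less_measure_iff)

text \<open>By monotonicity the sublevel set of \<open>Y w\<close> contains the interval up to
  \<open>w\<close> and exceeds it by at most the level set, which is null.\<close>

lemma dis_off_atoms:
  assumes Y: "Y \<in> borel_measurable borel" and mono: "mono01 Y"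
    and w: "0 < w" "w < 1" and off: "Y w \<notin> atoms Y"
  shows "dis Y (Y w) = w"
proof (rule antisym)
  have [measurable]: "{0<..w} \<in> sets unit_lebesgue"
    using w by (auto simp: sets_restrict_space_iff)
  have "{w'. 0 < w' \<and> w' < 1 \<and> Y w' \<le> Y w} \<subseteq> {0<..w} \<union> lev Y (Y w)"
  proof
    fix w' assume "w' \<in> {w'. 0 < w' \<and> w' < 1 \<and> Y w' \<le> Y w}"
    then show "w' \<in> {0<..w} \<union> lev Y (Y w)"
      using mono01D[OF mono, of w w'] w by (cases "w' \<le> w") (auto simp: lev_def)
  qed
  then have "dis Y (Y w) \<le> \<mu>01 ({0<..w} \<union> lev Y (Y w))"
    unfolding dis_def using Y by (intro UL.finite_measure_mono) auto
  also have "\<dots> \<le> \<mu>01 {0<..w} + \<mu>01 (lev Y (Y w))"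
    using Y by (intro measure_Un_le) auto
  finally show "dis Y (Y w) \<le> w" using w by (simp add: measure_UL_Ioc lev_null[OF off])
  have "\<mu>01 {0<..w} \<le> dis Y (Y w)"
    unfolding dis_def using Y w mono01D[OF mono, of _ w] by (intro UL.finite_measure_mono) auto
  then show "w \<le> dis Y (Y w)" using w by (simp add: measure_UL_Ioc)
qed

lemma vel_off_atoms:
  assumes "Y \<in> borel_measurable borel" "mono01 Y" "0 < w" "w < 1" "Y w \<notin> atoms Y"
  shows "vel Y U (Y w) = U w"
  using dis_off_atoms[OF assms] lev_null[OF assms(5)] by (simp add: vel_def)

lemma integral_indicator_lev:
  assumes "Y \<in> borel_measurable borel"
  shows "(\<integral>w. indicator (lev Y x) w \<partial>unit_lebesgue) = \<mu>01 (lev Y x)"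
  using lev_sets[OF assms] by simp

lemma SQ_lev:
  assumes Y: "Y \<in> borel_measurable borel"
  shows "indicator (lev Y x) \<in> SQ"
proof (rule SQ_bounded[of _ 1])
  have "lev Y x = {0<..<1} \<inter> Y -` {x}" by (auto simp: lev_def)
  then have "lev Y x \<in> sets borel" using measurable_sets_borel[OF Y, of "{x}"] by simp
  then show "indicator (lev Y x) \<in> borel_measurable borel" by (rule borel_measurable_indicator)
qed (auto simp: indicator_def)

lemma SQ_mult_lev:
  assumes Y: "Y \<in> borel_measurable borel" and U: "U \<in> SQ"
  shows "(\<lambda>w. U w * indicator (lev Y x) w) \<in> SQ"
proof (rule SQ_le[OF _ U])
  show "(\<lambda>w. U w * indicator (lev Y x) w) \<in> borel_measurable borel"
    by (intro borel_measurable_times SQ_measurable[OF U] SQ_measurable[OF SQ_lev[OF Y]])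
qed (auto simp: indicator_def)

lemma vel_atom_integral:
  assumes "x \<in> atoms Y"
  shows "(\<integral>w. U w * indicator (lev Y x) w \<partial>unit_lebesgue) = vel Y U x * \<mu>01 (lev Y x)"
  using assms by (simp add: vel_def atoms_def)

lemma integrable_mult_lev:
  assumes Y: "Y \<in> borel_measurable borel" and U: "U \<in> SQ" and V: "V \<in> SQ"
  shows "integrable unit_lebesgue (\<lambda>w. U w * V w * indicator (lev Y x) w)"
  using SQ_mult_integrable[OF U SQ_mult_lev[OF Y V, of x]] by (simp add: mult.assoc)

text \<open>Jensen's inequality on each fibre, obtained by expanding the square of \<open>U\<close>
  minus its mean; off the atoms nothing changes.\<close>

lemma vel_SQ:
  assumes Y: "Y \<in> borel_measurable borel" and mono: "mono01 Y" and U: "U \<in> SQ"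
  shows "(\<lambda>w. vel Y U (Y w)) \<in> SQ"
proof (rule SQ_I)
  show m: "(\<lambda>w. vel Y U (Y w)) \<in> borel_measurable borel"
    using vel_measurable[OF Y SQ_measurable[OF U]] Y by (rule measurable_compose[rotated])
  have "(\<integral>\<^sup>+w. ennreal ((vel Y U (Y w))\<^sup>2) \<partial>unit_lebesgue) \<le> (\<integral>\<^sup>+w. ennreal ((U w)\<^sup>2) \<partial>unit_lebesgue)"
  proof (rule nn_integral_le_atoms[OF Y])
    fix x assume x: "x \<in> atoms Y"
    let ?L = "lev Y x" and ?c = "vel Y U x"
    have i1: "integrable unit_lebesgue (\<lambda>w. U w * U w * indicator ?L w)"
      by (rule integrable_mult_lev[OF Y U U])
    have i2: "integrable unit_lebesgue (\<lambda>w. U w * indicator ?L w)"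
      by (rule SQ_integrable[OF SQ_mult_lev[OF Y U]])
    have i3: "integrable unit_lebesgue (\<lambda>w. indicator ?L w :: real)"
      by (rule SQ_integrable[OF SQ_lev[OF Y]])
    have "0 \<le> (\<integral>w. (U w - ?c)\<^sup>2 * indicator ?L w \<partial>unit_lebesgue)"
      by (intro Bochner_Integration.integral_nonneg) auto
    also have "(\<lambda>w. (U w - ?c)\<^sup>2 * indicator ?L w) = (\<lambda>w. U w * U w * indicator ?L w
        - 2 * ?c * (U w * indicator ?L w) + ?c\<^sup>2 * indicator ?L w)"
      by (auto simp: power2_eq_square algebra_simps)
    also have "(\<integral>w. \<dots> w \<partial>unit_lebesgue) = (\<integral>w. U w * U w * indicator ?L w \<partial>unit_lebesgue)
        - 2 * ?c * (\<integral>w. U w * indicator ?L w \<partial>unit_lebesgue) + ?c\<^sup>2 * \<mu>01 ?L"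
      using i1 i2 i3 integral_indicator_lev[OF Y] by simp
    also have "\<dots> = (\<integral>w. U w * U w * indicator ?L w \<partial>unit_lebesgue) - ?c\<^sup>2 * \<mu>01 ?L"
      unfolding vel_atom_integral[OF x] by (simp add: power2_eq_square algebra_simps)
    finally have le: "?c\<^sup>2 * \<mu>01 ?L \<le> (\<integral>w. U w * U w * indicator ?L w \<partial>unit_lebesgue)" by simp
    have "(\<integral>\<^sup>+w. ennreal ((vel Y U (Y w))\<^sup>2) * indicator ?L w \<partial>unit_lebesgue) =
        (\<integral>\<^sup>+w. ennreal (?c\<^sup>2) * indicator ?L w \<partial>unit_lebesgue)"
      by (intro nn_integral_cong) (auto simp: lev_def indicator_def)
    also have "\<dots> = ennreal (?c\<^sup>2 * \<mu>01 ?L)"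
      using lev_sets[OF Y, of x] by (subst nn_integral_cmult_indicator)
        (auto simp: UL.emeasure_eq_measure ennreal_mult)
    also have "\<dots> \<le> ennreal (\<integral>w. U w * U w * indicator ?L w \<partial>unit_lebesgue)"
      using le by (rule ennreal_leI)
    also have "\<dots> = (\<integral>\<^sup>+w. ennreal (U w * U w * indicator ?L w) \<partial>unit_lebesgue)"
      by (rule nn_integral_eq_integral[OF i1, symmetric]) auto
    also have "\<dots> = (\<integral>\<^sup>+w. ennreal ((U w)\<^sup>2) * indicator ?L w \<partial>unit_lebesgue)"
      by (intro nn_integral_cong) (auto simp: indicator_def power2_eq_square)
    finally show "(\<integral>\<^sup>+w. ennreal ((vel Y U (Y w))\<^sup>2) * indicator ?L w \<partial>unit_lebesgue)
      \<le> (\<integral>\<^sup>+w. ennreal ((U w)\<^sup>2) * indicator ?L w \<partial>unit_lebesgue)" .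
  next
    show "AE w in unit_lebesgue. Y w \<notin> atoms Y \<longrightarrow> ennreal ((vel Y U (Y w))\<^sup>2) \<le> ennreal ((U w)\<^sup>2)"
      using AE_UL_space by eventually_elim (auto simp: vel_off_atoms[OF Y mono])
  qed (use borel_measurable_UL[OF m] SQ_measurable_UL[OF U] in auto)
  also have "\<dots> < \<infinity>"
    using SQ_sq_integrable[OF U] by (simp add: real_integrable_def less_top)
  finally show "integrable unit_lebesgue (\<lambda>w. (vel Y U (Y w))\<^sup>2)"
    using borel_measurable_UL[OF m] by (intro integrableI_nonneg) auto
qed

text \<open>This is the defining property of the conditional expectation. On an atom
  \<open>g \<circ> Y\<close> is constant and \<open>U\<close> has mean \<open>vel Y U x\<close>;
  elsewhere the first factor vanishes.\<close>

lemma vel_orth: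
  assumes Y: "Y \<in> borel_measurable borel" and mono: "mono01 Y" and U: "U \<in> SQ"
    and g: "(\<lambda>w. g (Y w)) \<in> SQ"
  shows "(\<integral>w. (U w - vel Y U (Y w)) * g (Y w) \<partial>unit_lebesgue) = 0"
proof (rule integral_zero_atoms[OF Y])
  have V: "(\<lambda>w. vel Y U (Y w)) \<in> SQ" by (rule vel_SQ[OF Y mono U])
  show "integrable unit_lebesgue (\<lambda>w. (U w - vel Y U (Y w)) * g (Y w))"
    by (intro SQ_mult_integrable SQ_diff U V g)
  show "AE w in unit_lebesgue. Y w \<notin> atoms Y \<longrightarrow> (U w - vel Y U (Y w)) * g (Y w) = 0"
    using AE_UL_space by eventually_elim (auto simp: vel_off_atoms[OF Y mono])
  fix x assume x: "x \<in> atoms Y"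
  have "(\<lambda>w. (U w - vel Y U (Y w)) * g (Y w) * indicator (lev Y x) w) =
      (\<lambda>w. g x * (U w * indicator (lev Y x) w - vel Y U x * indicator (lev Y x) w))"
    by (auto simp: lev_def indicator_def)
  moreover have "(\<integral>w. U w * indicator (lev Y x) w - vel Y U x * indicator (lev Y x) w \<partial>unit_lebesgue) =
     (\<integral>w. U w * indicator (lev Y x) w \<partial>unit_lebesgue) - vel Y U x * \<mu>01 (lev Y x)"
    using SQ_integrable[OF SQ_mult_lev[OF Y U]] SQ_integrable[OF SQ_lev[OF Y]] integral_indicator_lev[OF Y]
    by simp
  ultimately show "(\<integral>w. (U w - vel Y U (Y w)) * g (Y w) * indicator (lev Y x) w \<partial>unit_lebesgue) = 0"
    using vel_atom_integral[OF x, of U] by simp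
qed

lemma vel_between:
  assumes Y: "Y \<in> borel_measurable borel" and U: "U \<in> SQ" and x: "x \<in> atoms Y"
  shows "(\<And>w. w \<in> lev Y x \<Longrightarrow> U w \<le> c) \<Longrightarrow> vel Y U x \<le> c"
    and "(\<And>w. w \<in> lev Y x \<Longrightarrow> c \<le> U w) \<Longrightarrow> c \<le> vel Y U x"
proof -
  have m: "\<mu>01 (lev Y x) > 0" using x by (simp add: atoms_def)
  have i: "integrable unit_lebesgue (\<lambda>w. U w * indicator (lev Y x) w)"
    "integrable unit_lebesgue (\<lambda>w. c * indicator (lev Y x) w)"
    using SQ_integrable[OF SQ_mult_lev[OF Y U]] SQ_integrable[OF SQ_lev[OF Y]] by auto
  have c: "(\<integral>w. c * indicator (lev Y x) w \<partial>unit_lebesgue) = c * \<mu>01 (lev Y x)"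
    using integral_indicator_lev[OF Y] by simp
  show "vel Y U x \<le> c" if "\<And>w. w \<in> lev Y x \<Longrightarrow> U w \<le> c"
  proof -
    have "(\<integral>w. U w * indicator (lev Y x) w \<partial>unit_lebesgue) \<le> (\<integral>w. c * indicator (lev Y x) w \<partial>unit_lebesgue)"
      using i that by (intro integral_mono) (auto simp: indicator_def)
    then show ?thesis using m unfolding c vel_atom_integral[OF x] by simp
  qed
  show "c \<le> vel Y U x" if "\<And>w. w \<in> lev Y x \<Longrightarrow> c \<le> U w"
  proof -
    have "(\<integral>w. c * indicator (lev Y x) w \<partial>unit_lebesgue) \<le> (\<integral>w. U w * indicator (lev Y x) w \<partial>unit_lebesgue)"
      using i that by (intro integral_mono) (auto simp: indicator_def)
    then show ?thesis using m unfolding c vel_atom_integral[OF x] by simp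
  qed
qed

text \<open>Level sets of a monotone function are ordered, so the average over a lower one is at
  most every value of \<open>U\<close> on a higher one; averaging those values in turn compares the
  two averages.\<close>

lemma vel_mono:
  assumes Y: "Y \<in> borel_measurable borel" and mono: "mono01 Y" and U: "U \<in> SQ" and Um: "mono01 U"
  shows "mono01 (\<lambda>w. vel Y U (Y w))"
  unfolding mono01_def
proof (intro allI impI)
  have lt: "s < s'" if "0 < s'" "s' < 1" "0 < s" "s < 1" "Y s < Y s'" for s s'
    using that mono01D[OF mono, of s' s] by (cases "s < s'") auto
  have le: "vel Y U (Y w) \<le> U s" if "0 < w" "w < 1" "0 < s" "s < 1" "Y w < Y s" for w s
  proof (cases "Y w \<in> atoms Y")
    case True
    show ?thesis
    proof (rule vel_between(1)[OF Y U True])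
      fix w' assume "w' \<in> lev Y (Y w)"
      then show "U w' \<le> U s" using lt[of s w'] that mono01D[OF Um, of w' s] by (auto simp: lev_def)
    qed
  next
    case False
    then show ?thesis
      using that lt[of s w] mono01D[OF Um, of w s] vel_off_atoms[OF Y mono _ _ False, of U] by auto
  qed
  fix w w' :: real assume w: "0 < w" "w \<le> w'" "w' < 1"
  show "vel Y U (Y w) \<le> vel Y U (Y w')"
  proof (cases "Y w = Y w'")
    case False
    then have yy: "Y w < Y w'" using mono01D[OF mono w] by simp
    show ?thesis
    proof (cases "Y w' \<in> atoms Y")
      case True
      show ?thesis
      proof (rule vel_between(2)[OF Y U True])
        fix s assume "s \<in> lev Y (Y w')"
        then show "vel Y U (Y w) \<le> U s" using le[of w s] w yy by (auto simp: lev_def)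
      qed
    next
      case False
      then show ?thesis using le[of w w'] w yy vel_off_atoms[OF Y mono _ _ False, of U] by auto
    qed
  qed simp
qed

text \<open>Chebyshev's association inequality on each level set: integrate
  \<open>(U s - U t) * (Z s - Z t) \<ge> 0\<close> first in \<open>t\<close>, then in \<open>s\<close>.\<close>

lemma vel_chebyshev:
  assumes Y: "Y \<in> borel_measurable borel" and mono: "mono01 Y"
    and U: "U \<in> SQ" "mono01 U" and Z: "Z \<in> SQ" "mono01 Z"
  shows "0 \<le> (\<integral>w. (U w - vel Y U (Y w)) * Z w \<partial>unit_lebesgue)"
proof (rule integral_nonneg_atoms[OF Y])
  have V: "(\<lambda>w. vel Y U (Y w)) \<in> SQ" by (rule vel_SQ[OF Y mono U(1)])
  show "integrable unit_lebesgue (\<lambda>w. (U w - vel Y U (Y w)) * Z w)"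
    by (intro SQ_mult_integrable SQ_diff U V Z)
  show "AE w in unit_lebesgue. Y w \<notin> atoms Y \<longrightarrow> 0 \<le> (U w - vel Y U (Y w)) * Z w"
    using AE_UL_space by eventually_elim (auto simp: vel_off_atoms[OF Y mono])
  fix x assume x: "x \<in> atoms Y"
  let ?I = "\<lambda>w. indicator (lev Y x) w :: real" and ?m = "\<mu>01 (lev Y x)"
  have m: "?m > 0" using x by (simp add: atoms_def)
  define u where "u = (\<integral>w. U w * ?I w \<partial>unit_lebesgue)"
  define z where "z = (\<integral>w. Z w * ?I w \<partial>unit_lebesgue)"
  define q where "q = (\<integral>w. U w * Z w * ?I w \<partial>unit_lebesgue)"
  have iu: "integrable unit_lebesgue (\<lambda>w. U w * ?I w)" by (rule SQ_integrable[OF SQ_mult_lev[OF Y U(1)]])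
  have iz: "integrable unit_lebesgue (\<lambda>w. Z w * ?I w)" by (rule SQ_integrable[OF SQ_mult_lev[OF Y Z(1)]])
  have iq: "integrable unit_lebesgue (\<lambda>w. U w * Z w * ?I w)" by (rule integrable_mult_lev[OF Y U(1) Z(1)])
  have i1: "integrable unit_lebesgue ?I" by (rule SQ_integrable[OF SQ_lev[OF Y]])
  have I1: "(\<integral>w. ?I w \<partial>unit_lebesgue) = ?m" by (rule integral_indicator_lev[OF Y])
  have pos: "0 \<le> (U s - U t) * (Z s - Z t)" if "s \<in> lev Y x" "t \<in> lev Y x" for s t
    using that mono01D[OF U(2), of s t] mono01D[OF U(2), of t s] mono01D[OF Z(2), of s t]
      mono01D[OF Z(2), of t s]
    by (cases "s \<le> t") (auto simp: lev_def intro: mult_nonpos_nonpos)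
  have inner: "0 \<le> (U s * Z s) * ?m - U s * z - Z s * u + q" if s: "s \<in> lev Y x" for s
  proof -
    have "0 \<le> (\<integral>t. (U s - U t) * (Z s - Z t) * ?I t \<partial>unit_lebesgue)"
      using pos[OF s] by (intro Bochner_Integration.integral_nonneg) (auto simp: indicator_def)
    also have "(\<lambda>t. (U s - U t) * (Z s - Z t) * ?I t) = (\<lambda>t. (U s * Z s) * ?I t - U s * (Z t * ?I t)
        - Z s * (U t * ?I t) + U t * Z t * ?I t)"
      by (auto simp: algebra_simps)
    also have "(\<integral>t. \<dots> t \<partial>unit_lebesgue) = (U s * Z s) * ?m - U s * z - Z s * u + q"
      using iu iz iq i1 I1 by (simp add: u_def z_def q_def)
    finally show ?thesis .
  qed
  have "0 \<le> (\<integral>s. ((U s * Z s) * ?m - U s * z - Z s * u + q) * ?I s \<partial>unit_lebesgue)"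
    using inner by (intro Bochner_Integration.integral_nonneg) (auto simp: indicator_def)
  also have "(\<lambda>s. ((U s * Z s) * ?m - U s * z - Z s * u + q) * ?I s) =
     (\<lambda>s. ?m * (U s * Z s * ?I s) - z * (U s * ?I s) - u * (Z s * ?I s) + q * ?I s)"
    by (auto simp: algebra_simps)
  also have "(\<integral>s. \<dots> s \<partial>unit_lebesgue) = ?m * q - z * u - u * z + q * ?m"
    using iu iz iq i1 I1 by (simp add: u_def z_def q_def)
  finally have "u * z \<le> ?m * q" by (simp add: algebra_simps)
  moreover have "u = vel Y U x * ?m" unfolding u_def by (rule vel_atom_integral[OF x])
  ultimately have "?m * (vel Y U x * z) \<le> ?m * q" by (simp add: algebra_simps)
  then have qz: "vel Y U x * z \<le> q" using m by simp
  have "(\<lambda>w. (U w - vel Y U (Y w)) * Z w * ?I w) = (\<lambda>w. U w * Z w * ?I w - vel Y U x * (Z w * ?I w))"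
    by (auto simp: lev_def indicator_def algebra_simps)
  moreover have "(\<integral>w. U w * Z w * ?I w - vel Y U x * (Z w * ?I w) \<partial>unit_lebesgue) = q - vel Y U x * z"
    using iq iz by (simp add: q_def z_def)
  ultimately show "0 \<le> (\<integral>w. (U w - vel Y U (Y w)) * Z w * ?I w \<partial>unit_lebesgue)"
    using qz by simp
qed

section \<open>The cone of monotone functions and its faces\<close>

definition MK :: "l2 set" where
  "MK = cl ` {f. f \<in> SQ \<and> mono01 f}"

text \<open>A representative that is monotone at every point of the unit interval, so that pointwise
  arguments need no exceptional sets.\<close>

definition mrep :: "l2 \<Rightarrow> real \<Rightarrow> real" where
  "mrep a = (SOME f. f \<in> SQ \<and> mono01 f \<and> cl f = a)"

text \<open>\<open>Hs a\<close> consists of the functions of \<open>a\<close>; it is \<open>L\<^sup>2\<close> of the law of \<open>a\<close>, seen in Lagrangian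
  coordinates, and \<open>avg a\<close> is the orthogonal projection onto it.\<close>

definition Hs :: "l2 \<Rightarrow> l2 set" where
  "Hs a = {cl (\<lambda>w. g (fn a w)) | g. g \<in> borel_measurable borel \<and> (\<lambda>w. g (fn a w)) \<in> SQ}"

definition avg :: "l2 \<Rightarrow> l2 \<Rightarrow> l2" where
  "avg a u = cl (\<lambda>w. vel (mrep a) (fn u) (mrep a w))"

lemma MK_I: "f \<in> SQ \<Longrightarrow> mono01 f \<Longrightarrow> cl f \<in> MK"
  by (auto simp: MK_def)

lemma mrep:
  assumes "a \<in> MK"
  shows "mrep a \<in> SQ" "mono01 (mrep a)" "cl (mrep a) = a"
proof -
  have "\<exists>f. f \<in> SQ \<and> mono01 f \<and> cl f = a" using assms by (auto simp: MK_def)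
  then have "mrep a \<in> SQ \<and> mono01 (mrep a) \<and> cl (mrep a) = a" unfolding mrep_def by (rule someI_ex)
  then show "mrep a \<in> SQ" "mono01 (mrep a)" "cl (mrep a) = a" by auto
qed

lemma fn_mrep: "a \<in> MK \<Longrightarrow> AE w in unit_lebesgue. fn a w = mrep a w"
  using fn_cl[OF mrep(1), of a] mrep(3)[of a] by simp

text \<open>The representative takes the supremum of the values to the left.\<close>

lemma AE_mono_ex_mono01:
  assumes G: "AE w in unit_lebesgue. w \<in> G" and mono: "\<And>w w'. w \<in> G \<Longrightarrow> w' \<in> G \<Longrightarrow> w \<le> w' \<Longrightarrow> f w \<le> f w'"
    and f: "f \<in> SQ"
  shows "cl f \<in> MK"
proof -
  define G' where "G' = {w \<in> G. 0 < w \<and> w < 1}"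
  \<comment> \<open>A set of full measure meets every subinterval. Hence the suprema below are taken
    over nonempty sets, bounded above by a value further to the right.\<close>
  have near: "\<exists>s\<in>G'. a < s \<and> s < b" if ab: "0 \<le> a" "a < b" "b \<le> 1" for a b
  proof (rule ccontr)
    assume none: "\<not> (\<exists>s\<in>G'. a < s \<and> s < b)"
    have "AE w in unit_lebesgue. w \<notin> {a<..<b}"
      using G AE_UL_space by eventually_elim (use none in \<open>auto simp: G'_def\<close>)
    moreover have "{a<..<b} \<in> sets unit_lebesgue" using ab by (auto simp: sets_restrict_space_iff)
    ultimately have "\<mu>01 {a<..<b} = 0"
      by (subst (asm) AE_iff_measurable[of "{a<..<b}"]) (use ab in \<open>auto simp: measure_def\<close>)
    moreover have "\<mu>01 {a<..<b} = b - a"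
      using ab by (subst measure_restrict_space) auto
    ultimately show False using ab by simp
  qed
  define h where "h w = (if 0 < w \<and> w < 1 then Sup (f ` {s\<in>G'. s \<le> w}) else 0)" for w
  have ne: "f ` {s\<in>G'. s \<le> w} \<noteq> {}" if "0 < w" "w < 1" for w
    using near[of 0 w] that by auto
  have bdd: "bdd_above (f ` {s\<in>G'. s \<le> w})" if w: "0 < w" "w < 1" for w
  proof -
    obtain t where t: "t \<in> G'" "w < t" using near[of w 1] w by auto
    then show ?thesis using mono by (intro bdd_aboveI[of _ "f t"]) (auto simp: G'_def)
  qed
  have hm: "mono01 h"
    unfolding mono01_def
  proof (intro allI impI)
    fix w w' :: real assume w: "0 < w" "w \<le> w'" "w' < 1"
    then have "Sup (f ` {s\<in>G'. s \<le> w}) \<le> Sup (f ` {s\<in>G'. s \<le> w'})"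
      by (intro cSup_subset_mono ne bdd) auto
    then show "h w \<le> h w'" using w by (simp add: h_def)
  qed
  have hf: "h w = f w" if "w \<in> G'" for w
  proof -
    have "Sup (f ` {s\<in>G'. s \<le> w}) = f w"
      using that mono by (intro cSup_eq_maximum) (auto simp: G'_def)
    then show ?thesis using that by (auto simp: h_def G'_def)
  qed
  have hb: "h \<in> borel_measurable borel"
  proof -
    have "mono_on {0<..<1} h" using hm by (auto simp: mono01_def mono_on_def)
    then have "h \<in> borel_measurable (restrict_space borel {0<..<1})" by (rule borel_measurable_mono_on_fnc)
    then have "(\<lambda>w. indicator {0<..<1} w *\<^sub>R h w) \<in> borel_measurable borel"
      by (subst (asm) borel_measurable_restrict_space_iff) auto
    moreover have "(\<lambda>w. indicator {0<..<1} w *\<^sub>R h w) = h" by (auto simp: h_def indicator_def)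
    ultimately show ?thesis by simp
  qed
  have AE: "AE w in unit_lebesgue. h w = f w"
    using G AE_UL_space by eventually_elim (auto simp: G'_def hf)
  have "h \<in> SQ" by (rule SQ_cong_AE[OF hb f AE])
  with hm have "cl h \<in> MK" by (rule MK_I[rotated])
  also have "cl h = cl f" by (rule cl_eqI[OF \<open>h \<in> SQ\<close> f AE])
  finally show ?thesis .
qed

text \<open>Along a subsequence the monotone representatives converge almost everywhere, and
  monotonicity survives on the set of convergence.\<close>

lemma closed_MK: "closed MK"
  unfolding closed_sequential_limits
proof (intro allI impI)
  fix s a assume "(\<forall>n. s n \<in> MK) \<and> s \<longlonglongrightarrow> a"
  then have s: "\<And>n. s n \<in> MK" and lim: "s \<longlonglongrightarrow> a" by auto
  obtain r where r: "strict_mono r" "AE w in unit_lebesgue. (\<lambda>n. fn (s (r n)) w) \<longlonglongrightarrow> fn a w"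
    using l2_LIMSEQ_AE_subseq[OF lim] by blast
  define G where "G = {w. 0 < w \<and> w < 1 \<and> (\<lambda>n. mrep (s (r n)) w) \<longlonglongrightarrow> fn a w}"
  have "AE w in unit_lebesgue. \<forall>n. fn (s (r n)) w = mrep (s (r n)) w"
    unfolding AE_all_countable using fn_mrep[OF s] by blast
  then have G: "AE w in unit_lebesgue. w \<in> G"
    using r(2) AE_UL_space by eventually_elim (simp add: G_def)
  have "cl (fn a) \<in> MK"
  proof (rule AE_mono_ex_mono01[OF G _ fn_SQ])
    fix w w' assume "w \<in> G" "w' \<in> G" "w \<le> w'"
    then show "fn a w \<le> fn a w'"
      using mono01D[OF mrep(2)[OF s]]
      by (intro LIMSEQ_le[of "\<lambda>n. mrep (s (r n)) w" _ "\<lambda>n. mrep (s (r n)) w'"]) (auto simp: G_def)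
  qed
  then show "a \<in> MK" by simp
qed

lemma closed_cone_MK: "closed_cone MK"
  unfolding closed_cone_def
proof (intro conjI ballI allI impI)
  show "0 \<in> MK" using MK_I[OF SQ_const[of 0]] by (simp add: cl_zero mono01_def)
  fix x y assume x: "x \<in> MK" and y: "y \<in> MK"
  then obtain f g where f: "f \<in> SQ" "mono01 f" "x = cl f" and g: "g \<in> SQ" "mono01 g" "y = cl g"
    by (auto simp: MK_def)
  show "x + y \<in> MK" using f g by (auto simp: cl_add mono01_def intro!: MK_I SQ_add add_mono)
next
  fix x and c :: real assume x: "x \<in> MK" and c: "0 \<le> c"
  then obtain f where f: "f \<in> SQ" "mono01 f" "x = cl f" by (auto simp: MK_def)
  show "c *\<^sub>R x \<in> MK" using f c by (auto simp: cl_scale mono01_def intro!: MK_I SQ_scale mult_left_mono)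
qed (rule closed_MK)

section \<open>The subspace of functions of a given element and the averaging projection\<close>

lemma Hs_cl_I:
  assumes Y: "Y \<in> SQ" and g: "g \<in> borel_measurable borel" "(\<lambda>w. g (Y w)) \<in> SQ"
  shows "cl (\<lambda>w. g (Y w)) \<in> Hs (cl Y)"
proof -
  have AE: "AE w in unit_lebesgue. g (fn (cl Y) w) = g (Y w)"
    using fn_cl[OF Y] by eventually_elim simp
  have m: "(\<lambda>w. g (fn (cl Y) w)) \<in> borel_measurable borel"
    using g(1) by measurable
  have S: "(\<lambda>w. g (fn (cl Y) w)) \<in> SQ" by (rule SQ_cong_AE[OF m g(2) AE])
  have "cl (\<lambda>w. g (fn (cl Y) w)) = cl (\<lambda>w. g (Y w))" by (rule cl_eqI[OF S g(2) AE])
  then show ?thesis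
    unfolding Hs_def using S g(1) by (intro CollectI exI[of _ g]) simp
qed

lemma Hs_cl_E:
  assumes Y: "Y \<in> SQ" and z: "z \<in> Hs (cl Y)"
  obtains g where "g \<in> borel_measurable borel" "(\<lambda>w. g (Y w)) \<in> SQ" "z = cl (\<lambda>w. g (Y w))"
proof -
  from z obtain g where g: "g \<in> borel_measurable borel" "(\<lambda>w. g (fn (cl Y) w)) \<in> SQ"
    "z = cl (\<lambda>w. g (fn (cl Y) w))" unfolding Hs_def by blast
  have AE: "AE w in unit_lebesgue. g (Y w) = g (fn (cl Y) w)"
    using fn_cl[OF Y] by eventually_elim simp
  have m: "(\<lambda>w. g (Y w)) \<in> borel_measurable borel"
    using SQ_measurable[OF Y] g(1) by (rule measurable_compose)
  have S: "(\<lambda>w. g (Y w)) \<in> SQ" by (rule SQ_cong_AE[OF m g(2) AE])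
  show thesis using that[OF g(1) S] cl_eqI[OF S g(2) AE] g(3) by simp
qed

lemma Hs_self: "a \<in> Hs a"
  using Hs_cl_I[OF fn_SQ[of a], of "\<lambda>x. x"] fn_SQ by simp

lemma Hs_E:
  assumes "x \<in> Hs a"
  obtains f where "f \<in> borel_measurable borel" "(\<lambda>w. f (fn a w)) \<in> SQ" "x = cl (\<lambda>w. f (fn a w))"
  using assms unfolding Hs_def by blast

lemma Hs_add: "x \<in> Hs a \<Longrightarrow> y \<in> Hs a \<Longrightarrow> x + y \<in> Hs a"
proof (elim Hs_E)
  fix f g assume fg: "f \<in> borel_measurable borel" "(\<lambda>w. f (fn a w)) \<in> SQ" "x = cl (\<lambda>w. f (fn a w))"
    "g \<in> borel_measurable borel" "(\<lambda>w. g (fn a w)) \<in> SQ" "y = cl (\<lambda>w. g (fn a w))"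
  then show "x + y \<in> Hs a"
    using Hs_cl_I[OF fn_SQ, of "\<lambda>v. f v + g v" a] by (simp add: cl_add SQ_add)
qed

lemma Hs_scale: "x \<in> Hs a \<Longrightarrow> c *\<^sub>R x \<in> Hs a"
proof (elim Hs_E)
  fix f assume f: "f \<in> borel_measurable borel" "(\<lambda>w. f (fn a w)) \<in> SQ" "x = cl (\<lambda>w. f (fn a w))"
  then show "c *\<^sub>R x \<in> Hs a"
    using Hs_cl_I[OF fn_SQ, of "\<lambda>v. c * f v" a] by (simp add: cl_scale SQ_scale)
qed

lemma Hs_diff: "x \<in> Hs a \<Longrightarrow> y \<in> Hs a \<Longrightarrow> x - y \<in> Hs a"
  using Hs_add[of x a "(-1) *\<^sub>R y"] Hs_scale[of y a "-1"] by simp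

lemmas Hs_lincomb = Hs_add Hs_diff Hs_scale

lemma Hs_trans:
  assumes "b \<in> Hs a"
  shows "Hs b \<subseteq> Hs a"
proof
  fix z assume z: "z \<in> Hs b"
  obtain g where g: "g \<in> borel_measurable borel" "(\<lambda>w. g (fn a w)) \<in> SQ" "b = cl (\<lambda>w. g (fn a w))"
    using assms unfolding Hs_def by blast
  obtain h where h: "h \<in> borel_measurable borel" "(\<lambda>w. h (g (fn a w))) \<in> SQ"
    "z = cl (\<lambda>w. h (g (fn a w)))"
    using Hs_cl_E[OF g(2)] z g(3) by blast
  show "z \<in> Hs a"
    using Hs_cl_I[OF fn_SQ, of "\<lambda>v. h (g v)" a] g h by simp
qed

lemma avg_Hs:
  assumes "a \<in> MK"
  shows "avg a u \<in> Hs a"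
  using Hs_cl_I[OF mrep(1)[OF assms] vel_measurable vel_SQ] mrep[OF assms]
  by (simp add: avg_def fn_SQ SQ_measurable)

lemma avg_SQ: "a \<in> MK \<Longrightarrow> (\<lambda>w. vel (mrep a) (fn u) (mrep a w)) \<in> SQ"
  by (intro vel_SQ SQ_measurable mrep fn_SQ)

lemma avg_orth:
  assumes a: "a \<in> MK" and z: "z \<in> Hs a"
  shows "inner (u - avg a u) z = 0"
proof -
  note M = mrep[OF a]
  obtain g where g: "g \<in> borel_measurable borel" "(\<lambda>w. g (mrep a w)) \<in> SQ" "z = cl (\<lambda>w. g (mrep a w))"
    using Hs_cl_E[OF M(1)] z M(3) by metis
  have "u - avg a u = cl (\<lambda>w. fn u w - vel (mrep a) (fn u) (mrep a w))"
    using cl_diff[OF fn_SQ[of u] avg_SQ[OF a]] by (simp add: avg_def)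
  then show ?thesis
    using vel_orth[OF SQ_measurable[OF M(1)] M(2) fn_SQ g(2)] g
    by (simp add: inner_cl SQ_diff avg_SQ[OF a] fn_SQ)
qed

text \<open>The difference of two candidates lies in the subspace and is orthogonal to it.
  Linearity, the tower rule and all explicit evaluations of \<open>avg\<close> are derived from this
  characterization.\<close>

lemma avg_unique:
  assumes a: "a \<in> MK" and c: "c \<in> Hs a" and orth: "\<And>z. z \<in> Hs a \<Longrightarrow> inner (u - c) z = 0"
  shows "avg a u = c"
proof -
  have z: "avg a u - c \<in> Hs a" by (intro Hs_lincomb avg_Hs[OF a] c)
  have "inner (avg a u - c) (avg a u - c) = inner (u - c) (avg a u - c) - inner (u - avg a u) (avg a u - c)"
    by (simp add: inner_diff_left)
  also have "\<dots> = 0" using orth[OF z] avg_orth[OF a z] by simp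
  finally show ?thesis by simp
qed

lemma avg_id: "a \<in> MK \<Longrightarrow> u \<in> Hs a \<Longrightarrow> avg a u = u"
  by (rule avg_unique) auto

lemma avg_add: "a \<in> MK \<Longrightarrow> avg a (u + v) = avg a u + avg a v"
proof (rule avg_unique)
  assume a: "a \<in> MK"
  show "avg a u + avg a v \<in> Hs a" by (intro Hs_lincomb avg_Hs a)
  show "inner (u + v - (avg a u + avg a v)) z = 0" if "z \<in> Hs a" for z
    using avg_orth[OF a that, of u] avg_orth[OF a that, of v]
    by (simp add: inner_diff_left inner_add_left)
qed

lemma avg_scale: "a \<in> MK \<Longrightarrow> avg a (c *\<^sub>R u) = c *\<^sub>R avg a u"
proof (rule avg_unique)
  assume a: "a \<in> MK"
  show "c *\<^sub>R avg a u \<in> Hs a" by (intro Hs_lincomb avg_Hs a)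
  show "inner (c *\<^sub>R u - c *\<^sub>R avg a u) z = 0" if "z \<in> Hs a" for z
    using avg_orth[OF a that, of u] by (simp add: inner_diff_left)
qed

lemma avg_diff: "a \<in> MK \<Longrightarrow> avg a (u - v) = avg a u - avg a v"
  using avg_add[of a u "(-1) *\<^sub>R v"] avg_scale[of a "-1" v] by simp

lemma avg_tower:
  assumes "a \<in> MK" "b \<in> MK" "b \<in> Hs a"
  shows "avg b (avg a u) = avg b u"
proof (rule avg_unique[OF assms(2) avg_Hs[OF assms(2)]])
  fix z assume z: "z \<in> Hs b"
  then have "z \<in> Hs a" using Hs_trans[OF assms(3)] by blast
  then show "inner (avg a u - avg b u) z = 0"
    using avg_orth[OF assms(1), of z u] avg_orth[OF assms(2) z, of u] by (simp add: inner_diff_left)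
qed

lemma avg_pythagoras: "a \<in> MK \<Longrightarrow> (norm (u - avg a u))\<^sup>2 = (norm u)\<^sup>2 - (norm (avg a u))\<^sup>2"
  using avg_orth[OF _ avg_Hs, of a u u] norm_add_sq[of "u - avg a u" "avg a u"] by simp

lemma inner_avg: "a \<in> MK \<Longrightarrow> z \<in> Hs a \<Longrightarrow> inner u z = inner (avg a u) z"
  using avg_orth[of a z u] by (simp add: inner_diff_left)

lemma norm_avg_le: "a \<in> MK \<Longrightarrow> norm (avg a u) \<le> norm u"
proof (rule power2_le_imp_le)
  assume "a \<in> MK"
  then show "(norm (avg a u))\<^sup>2 \<le> (norm u)\<^sup>2"
    using avg_pythagoras[of a u] zero_le_power2[of "norm (u - avg a u)"] by linarith
qed simp

text \<open>The definition of \<open>avg\<close> uses \<open>fn u\<close>, which is monotone only up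
  to a null set; passing to \<open>mrep u\<close> makes \<open>vel_mono\<close> and
  \<open>vel_chebyshev\<close> applicable.\<close>

lemma avg_via_mrep:
  assumes a: "a \<in> MK" and u: "u \<in> MK"
  shows "avg a u = cl (\<lambda>w. vel (mrep a) (mrep u) (mrep a w))"
proof (rule avg_unique[OF a])
  note A = mrep[OF a] and U = mrep[OF u]
  have S: "(\<lambda>w. vel (mrep a) (mrep u) (mrep a w)) \<in> SQ" by (intro vel_SQ SQ_measurable A U)
  show "cl (\<lambda>w. vel (mrep a) (mrep u) (mrep a w)) \<in> Hs a"
    using Hs_cl_I[OF A(1) vel_measurable S] A U by (simp add: SQ_measurable)
  fix z assume "z \<in> Hs a"
  then obtain g where g: "(\<lambda>w. g (mrep a w)) \<in> SQ" "z = cl (\<lambda>w. g (mrep a w))"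
    using Hs_cl_E[OF A(1)] A(3) by metis
  have "u - cl (\<lambda>w. vel (mrep a) (mrep u) (mrep a w)) = cl (\<lambda>w. mrep u w - vel (mrep a) (mrep u) (mrep a w))"
    using cl_diff[OF U(1) S] U(3) by simp
  then show "inner (u - cl (\<lambda>w. vel (mrep a) (mrep u) (mrep a w))) z = 0"
    using vel_orth[OF SQ_measurable[OF A(1)] A(2) U(1) g(1)] g by (simp add: inner_cl SQ_diff S U)
qed

lemma avg_MK: "a \<in> MK \<Longrightarrow> u \<in> MK \<Longrightarrow> avg a u \<in> MK"
  unfolding avg_via_mrep by (intro MK_I vel_SQ vel_mono SQ_measurable mrep)

text \<open>Together with \<open>avg_orth\<close> this makes \<open>avg a u - u\<close> a normal
  vector of the cone at each of its points that is a function of \<open>a\<close>.\<close>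

lemma avg_chebyshev:
  assumes a: "a \<in> MK" and u: "u \<in> MK" and z: "z \<in> MK"
  shows "0 \<le> inner (u - avg a u) z"
proof -
  note A = mrep[OF a] and U = mrep[OF u] and Z = mrep[OF z]
  have S: "(\<lambda>w. vel (mrep a) (mrep u) (mrep a w)) \<in> SQ" by (intro vel_SQ SQ_measurable A U)
  have "u - avg a u = cl (\<lambda>w. mrep u w - vel (mrep a) (mrep u) (mrep a w))"
    unfolding avg_via_mrep[OF a u] using cl_diff[OF U(1) S] U(3) by simp
  then have "inner (u - avg a u) z = (\<integral>w. (mrep u w - vel (mrep a) (mrep u) (mrep a w)) * mrep z w \<partial>unit_lebesgue)"
    using inner_cl[OF SQ_diff[OF U(1) S] Z(1)] Z(3) by simp
  then show ?thesis using vel_chebyshev[OF SQ_measurable[OF A(1)] A(2) U(1,2) Z(1,2)] by simp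
qed

text \<open>The image under \<open>Y\<close> of the signed measure with density \<open>U\<close>
  vanishes on half lines. Its two parts \<open>a\<close> and \<open>b\<close> are finite on half
  lines and agree there, hence they are equal.\<close>

lemma pushforward_zero:
  fixes Y U g :: "real \<Rightarrow> real"
  assumes Y: "Y \<in> borel_measurable borel" and U: "U \<in> borel_measurable borel" "integrable unit_lebesgue U"
    and half: "\<And>x. (\<integral>w. indicator {x<..} (Y w) * U w \<partial>unit_lebesgue) = 0"
    and g: "g \<in> borel_measurable borel" "integrable unit_lebesgue (\<lambda>w. g (Y w) * U w)"
  shows "(\<integral>w. g (Y w) * U w \<partial>unit_lebesgue) = 0"
proof -
  note [measurable] = Y U(1) g(1) borel_measurable_UL[OF Y] borel_measurable_UL[OF U(1)]
  define a where "a = distr (density unit_lebesgue (\<lambda>w. ennreal (U w))) borel Y"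
  define b where "b = distr (density unit_lebesgue (\<lambda>w. ennreal (- U w))) borel Y"
  have ea: "(\<integral>\<^sup>+x. h x \<partial>a) = (\<integral>\<^sup>+w. ennreal (U w) * h (Y w) \<partial>unit_lebesgue)"
    and eb: "(\<integral>\<^sup>+x. h x \<partial>b) = (\<integral>\<^sup>+w. ennreal (- U w) * h (Y w) \<partial>unit_lebesgue)"
    if [measurable]: "h \<in> borel_measurable borel" for h
    unfolding a_def b_def by (simp_all add: nn_integral_distr nn_integral_density)
  have ab: "a = b"
  proof (rule measure_eqI_lessThan)
    show "sets a = sets borel" "sets b = sets borel" by (simp_all add: a_def b_def)
    fix x :: real
    have e1: "emeasure a {x<..} = (\<integral>\<^sup>+w. ennreal (indicator {x<..} (Y w) * U w) \<partial>unit_lebesgue)"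
    proof -
      have "emeasure a {x<..} = (\<integral>\<^sup>+y. indicator {x<..} y \<partial>a)" by (simp add: a_def)
      also have "\<dots> = (\<integral>\<^sup>+w. ennreal (U w) * indicator {x<..} (Y w) \<partial>unit_lebesgue)"
        by (rule ea) simp
      finally show ?thesis by (simp add: indicator_def cong: nn_integral_cong) (auto intro!: nn_integral_cong)
    qed
    have e2: "emeasure b {x<..} = (\<integral>\<^sup>+w. ennreal (- (indicator {x<..} (Y w) * U w)) \<partial>unit_lebesgue)"
    proof -
      have "emeasure b {x<..} = (\<integral>\<^sup>+y. indicator {x<..} y \<partial>b)" by (simp add: b_def)
      also have "\<dots> = (\<integral>\<^sup>+w. ennreal (- U w) * indicator {x<..} (Y w) \<partial>unit_lebesgue)"
        by (rule eb) simp
      finally show ?thesis by (simp add: indicator_def cong: nn_integral_cong) (auto intro!: nn_integral_cong)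
    qed
    have i: "integrable unit_lebesgue (\<lambda>w. indicator {x<..} (Y w) * U w)"
      by (rule Bochner_Integration.integrable_bound[OF U(2)]) (auto simp: indicator_def)
    then show "emeasure a {x<..} < \<infinity>" unfolding e1 by (simp add: real_integrable_def less_top)
    have "0 \<le> (\<integral>w. indicator {x<..} (Y w) * U w \<partial>unit_lebesgue)"
      "0 \<le> (\<integral>w. - (indicator {x<..} (Y w) * U w) \<partial>unit_lebesgue)" using half i by simp_all
    then show "emeasure a {x<..} = emeasure b {x<..}"
      using i unfolding e1 e2 integral_nonneg_iff_nn[OF i]
      by (subst (asm) integral_nonneg_iff_nn) auto
  qed
  \<comment> \<open>Positive and negative part of \<open>U\<close> integrate functions of
    \<open>Y\<close> equally. Applied to both parts of \<open>g\<close>, this interchanges the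
    positive and the negative part of the product.\<close>
  have eq: "(\<integral>\<^sup>+w. ennreal (U w) * h (Y w) \<partial>unit_lebesgue) = (\<integral>\<^sup>+w. ennreal (- U w) * h (Y w) \<partial>unit_lebesgue)"
    if "h \<in> borel_measurable borel" for h
    using ea[OF that] eb[OF that] ab by simp
  have "(\<integral>\<^sup>+w. ennreal (g (Y w) * U w) \<partial>unit_lebesgue) =
     (\<integral>\<^sup>+w. ennreal (U w) * ennreal (g (Y w)) + ennreal (- U w) * ennreal (- g (Y w)) \<partial>unit_lebesgue)"
  proof (intro nn_integral_cong)
    fix w show "ennreal (g (Y w) * U w) = ennreal (U w) * ennreal (g (Y w)) + ennreal (- U w) * ennreal (- g (Y w))"
      by (cases "U w \<ge> 0"; cases "g (Y w) \<ge> 0")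
        (auto simp: ennreal_mult[symmetric] ennreal_neg mult.commute mult_le_0_iff zero_le_mult_iff)
  qed
  also have "\<dots> = (\<integral>\<^sup>+w. ennreal (- U w) * ennreal (g (Y w)) + ennreal (U w) * ennreal (- g (Y w)) \<partial>unit_lebesgue)"
    using eq[of "\<lambda>x. ennreal (g x)"] eq[of "\<lambda>x. ennreal (- g x)"]
    by (simp add: nn_integral_add)
  also have "\<dots> = (\<integral>\<^sup>+w. ennreal (- (g (Y w) * U w)) \<partial>unit_lebesgue)"
  proof (intro nn_integral_cong)
    fix w show "ennreal (- U w) * ennreal (g (Y w)) + ennreal (U w) * ennreal (- g (Y w)) = ennreal (- (g (Y w) * U w))"
      by (cases "U w \<ge> 0"; cases "g (Y w) \<ge> 0")
        (auto simp: ennreal_mult[symmetric] ennreal_neg mult.commute mult_le_0_iff zero_le_mult_iff)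
  qed
  finally show ?thesis unfolding real_lebesgue_integral_def[OF g(2)] by simp
qed

text \<open>A Lipschitz approximation of the indicator of a half line. Being monotone it yields
  competitors in the cone, and being bounded and continuous it is a test function for weak
  convergence.\<close>

definition ramp :: "real \<Rightarrow> nat \<Rightarrow> real \<Rightarrow> real" where
  "ramp x n y = max 0 (min 1 (real n * (y - x)))"

lemma ramp_measurable [measurable]: "ramp x n \<in> borel_measurable borel"
  unfolding ramp_def by measurable

lemma ramp_bounds: "0 \<le> ramp x n y" "ramp x n y \<le> 1"
  by (auto simp: ramp_def)

lemma ramp_mono: "y \<le> y' \<Longrightarrow> ramp x n y \<le> ramp x n y'"
  unfolding ramp_def by (intro max.mono min.mono mult_left_mono) auto

lemma ramp_lipschitz: "y \<le> y' \<Longrightarrow> ramp x n y' - ramp x n y \<le> real n * (y' - y)"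
proof -
  assume "y \<le> y'"
  then have "0 \<le> real n * (y' - y)" by simp
  moreover have "real n * (y' - x) = real n * (y - x) + real n * (y' - y)"
    by (simp add: algebra_simps)
  ultimately show ?thesis unfolding ramp_def by linarith
qed

lemma ramp_tendsto: "(\<lambda>n. ramp x n y) \<longlonglongrightarrow> indicator {x<..} y"
proof (cases "x < y")
  case True
  obtain N where N: "1 / (y - x) \<le> real N" using real_arch_simple by blast
  have "ramp x n y = 1" if "n \<ge> N" for n
  proof -
    have "1 / (y - x) \<le> real n" using N that by (meson of_nat_le_iff order_trans)
    then have "1 \<le> real n * (y - x)" using True by (simp add: field_simps)
    then show ?thesis by (simp add: ramp_def)
  qed
  then have "\<forall>\<^sub>F n in sequentially. ramp x n y = 1" by (auto simp: eventually_sequentially)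
  then show ?thesis using True by (auto intro: tendsto_eventually)
next
  case False
  then have "real n * (y - x) \<le> 0" for n by (simp add: mult_nonneg_nonpos)
  then have "ramp x n y = 0" for n unfolding ramp_def by (intro max_absorb1 min.coboundedI2)
  then show ?thesis using False by simp
qed

lemma pushforward_zero_ramp:
  fixes Y U g :: "real \<Rightarrow> real"
  assumes Y: "Y \<in> borel_measurable borel" and U: "U \<in> borel_measurable borel" "integrable unit_lebesgue U"
    and r: "\<And>x n. n > 0 \<Longrightarrow> (\<integral>w. ramp x n (Y w) * U w \<partial>unit_lebesgue) = 0"
    and g: "g \<in> borel_measurable borel" "integrable unit_lebesgue (\<lambda>w. g (Y w) * U w)"
  shows "(\<integral>w. g (Y w) * U w \<partial>unit_lebesgue) = 0"
proof (rule pushforward_zero[OF Y U _ g])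
  fix x
  note [measurable] = Y U(1) borel_measurable_UL[OF Y] borel_measurable_UL[OF U(1)]
  have "(\<lambda>n. \<integral>w. ramp x n (Y w) * U w \<partial>unit_lebesgue) \<longlonglongrightarrow> (\<integral>w. indicator {x<..} (Y w) * U w \<partial>unit_lebesgue)"
  proof (rule integral_dominated_convergence)
    show "integrable unit_lebesgue (\<lambda>w. \<bar>U w\<bar>)" using U(2) by simp
    show "AE w in unit_lebesgue. (\<lambda>n. ramp x n (Y w) * U w) \<longlonglongrightarrow> indicator {x<..} (Y w) * U w"
      by (intro AE_I2 tendsto_intros ramp_tendsto)
    show "AE w in unit_lebesgue. norm (ramp x n (Y w) * U w) \<le> \<bar>U w\<bar>" for n
    proof (intro AE_I2)
      fix w
      have "\<bar>ramp x n (Y w)\<bar> * \<bar>U w\<bar> \<le> 1 * \<bar>U w\<bar>"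
        using ramp_bounds[of x n "Y w"] by (intro mult_right_mono) auto
      then show "norm (ramp x n (Y w) * U w) \<le> \<bar>U w\<bar>" by (simp add: abs_mult)
    qed
  qed measurable
  moreover have "\<forall>\<^sub>F n in sequentially. (\<integral>w. ramp x n (Y w) * U w \<partial>unit_lebesgue) = 0"
    using r by (auto simp: eventually_sequentially intro!: exI[of _ 1])
  then have "(\<lambda>n. \<integral>w. ramp x n (Y w) * U w \<partial>unit_lebesgue) \<longlonglongrightarrow> 0" by (rule tendsto_eventually)
  ultimately show "(\<integral>w. indicator {x<..} (Y w) * U w \<partial>unit_lebesgue) = 0"
    by (rule LIMSEQ_unique)
qed

lemma SQ_ramp: "Y \<in> borel_measurable borel \<Longrightarrow> (\<lambda>w. ramp x n (Y w)) \<in> SQ"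
  using ramp_bounds by (intro SQ_bounded[of _ 1]) (auto intro: measurable_compose[OF _ ramp_measurable])

text \<open>Ramps converge boundedly to indicators of half lines, and these determine the image
  measure. Testing with ramps therefore replaces testing with all functions of
  \<open>Y\<close>.\<close>

lemma orth_Hs_ramp:
  assumes Y: "Y \<in> SQ" and r: "\<And>x n. n > 0 \<Longrightarrow> inner \<xi> (cl (\<lambda>w. ramp x n (Y w))) = 0"
    and z: "z \<in> Hs (cl Y)"
  shows "inner \<xi> z = 0"
proof -
  note Ym = SQ_measurable[OF Y]
  obtain g where g: "g \<in> borel_measurable borel" "(\<lambda>w. g (Y w)) \<in> SQ" "z = cl (\<lambda>w. g (Y w))"
    using Hs_cl_E[OF Y z] .
  have "(\<integral>w. g (Y w) * fn \<xi> w \<partial>unit_lebesgue) = 0"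
  proof (rule pushforward_zero_ramp[OF Ym fn_measurable SQ_integrable[OF fn_SQ] _ g(1)])
    show "integrable unit_lebesgue (\<lambda>w. g (Y w) * fn \<xi> w)" by (rule SQ_mult_integrable[OF g(2) fn_SQ])
    fix x and n :: nat assume "n > 0"
    show "(\<integral>w. ramp x n (Y w) * fn \<xi> w \<partial>unit_lebesgue) = 0"
      using r[OF \<open>n > 0\<close>, of x] inner_cl[OF fn_SQ SQ_ramp[OF Ym], of \<xi> x n]
      by (simp add: mult.commute)
  qed
  then show ?thesis
    using g inner_cl[OF fn_SQ g(2), of \<xi>] by (simp add: mult.commute)
qed

text \<open>Both \<open>ramp x n \<circ> Y\<close> and \<open>Y - (1/n) * (ramp x n \<circ> Y)\<close> are monotone if \<open>Y\<close> is, so a normal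
  vector at \<open>Y\<close> is orthogonal to every function of \<open>Y\<close>.\<close>

lemma normal_orth:
  assumes p: "p \<in> MK" and \<xi>: "\<xi> \<in> normal_to MK p" and z: "z \<in> Hs p"
  shows "inner \<xi> z = 0"
proof -
  note P = mrep[OF p]
  note Ym = SQ_measurable[OF P(1)]
  have neg: "\<And>z. z \<in> MK \<Longrightarrow> inner \<xi> z \<le> 0" and zero: "inner \<xi> p = 0"
    using \<xi> by (auto simp: normal_to_def)
  have "inner \<xi> (cl (\<lambda>w. ramp x n (mrep p w))) = 0" if n: "n > 0" for x n
  proof (rule antisym)
    have R: "(\<lambda>w. ramp x n (mrep p w)) \<in> SQ" by (rule SQ_ramp[OF Ym])
    show "inner \<xi> (cl (\<lambda>w. ramp x n (mrep p w))) \<le> 0"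
      using P(2) by (intro neg MK_I[OF R]) (auto simp: mono01_def intro!: ramp_mono)
    have "cl (\<lambda>w. mrep p w - (1 / real n) * ramp x n (mrep p w)) \<in> MK"
    proof (rule MK_I)
      show "(\<lambda>w. mrep p w - (1 / real n) * ramp x n (mrep p w)) \<in> SQ"
        by (intro SQ_diff SQ_scale P(1) R)
      show "mono01 (\<lambda>w. mrep p w - (1 / real n) * ramp x n (mrep p w))"
        unfolding mono01_def
      proof (intro allI impI)
        fix w w' :: real assume "0 < w" "w \<le> w'" "w' < 1"
        then have "ramp x n (mrep p w') - ramp x n (mrep p w) \<le> real n * (mrep p w' - mrep p w)"
          using P(2) by (intro ramp_lipschitz) (auto simp: mono01_def)
        then have "(ramp x n (mrep p w') - ramp x n (mrep p w)) / real n \<le> mrep p w' - mrep p w"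
          using n by (simp add: divide_le_eq mult.commute)
        then show "mrep p w - (1 / real n) * ramp x n (mrep p w) \<le> mrep p w' - (1 / real n) * ramp x n (mrep p w')"
          by (simp add: diff_divide_distrib)
      qed
    qed
    also have "cl (\<lambda>w. mrep p w - (1 / real n) * ramp x n (mrep p w)) =
        p - (1 / real n) *\<^sub>R cl (\<lambda>w. ramp x n (mrep p w))"
      using cl_diff[OF P(1) SQ_scale[OF R, of "1 / real n"]] cl_scale[OF R, of "1 / real n"] P(3)
      by simp
    finally have "p - (1 / real n) *\<^sub>R cl (\<lambda>w. ramp x n (mrep p w)) \<in> MK" .
    from neg[OF this] show "0 \<le> inner \<xi> (cl (\<lambda>w. ramp x n (mrep p w)))"
      using zero n by (simp add: inner_diff_right zero_le_divide_iff)
  qed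
  then show ?thesis using orth_Hs_ramp[OF P(1)] z P(3) by simp
qed

section \<open>The sticky evolution as a projection\<close>

lemma avg_closest: "a \<in> MK \<Longrightarrow> z \<in> Hs a \<Longrightarrow> norm (u - avg a u) \<le> norm (u - z)"
proof (rule power2_le_imp_le)
  assume a: "a \<in> MK" and z: "z \<in> Hs a"
  have "inner (u - avg a u) (avg a u - z) = 0"
    by (rule avg_orth[OF a Hs_diff[OF avg_Hs[OF a] z]])
  then have "(norm (u - z))\<^sup>2 = (norm (u - avg a u))\<^sup>2 + (norm (avg a u - z))\<^sup>2"
    using norm_add_sq[of "u - avg a u" "avg a u - z"] by simp
  then show "(norm (u - avg a u))\<^sup>2 \<le> (norm (u - z))\<^sup>2" by simp
qed simp

text \<open>A closed cone that is symmetric is a closed subspace, so \<open>cproj\<close> is the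
  orthogonal projection. The residual of \<open>v\<close> is orthogonal to all ramps, hence to
  \<open>v\<close>, hence it vanishes.\<close>

lemma Hs_subset_closed_subspace:
  assumes Y: "Y \<in> SQ" and C: "closed_cone C" "\<And>u. u \<in> C \<Longrightarrow> - u \<in> C"
    and ramp: "\<And>x n. n > 0 \<Longrightarrow> cl (\<lambda>w. ramp x n (Y w)) \<in> C"
  shows "Hs (cl Y) \<subseteq> C"
proof
  fix v assume v: "v \<in> Hs (cl Y)"
  let ?p = "cproj C v"
  have orth: "inner (v - ?p) u = 0" if "u \<in> C" for u
  proof -
    have le: "inner (v - ?p) z \<le> 0" if "z \<in> C" for z
      using cproj(2)[OF C(1), of v] that by (simp add: normal_to_def)
    show ?thesis using le[OF that] le[OF C(2)[OF that]] by simp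
  qed
  have "inner (v - ?p) v = 0"
    by (rule orth_Hs_ramp[OF Y orth[OF ramp] v])
  then have "inner (v - ?p) (v - ?p) = 0"
    using orth[OF cproj(1)[OF C(1)], of v] by (simp add: inner_diff_right)
  then show "v \<in> C" using cproj(1)[OF C(1), of v] by simp
qed

text \<open>The vectors that are asymptotically fixed by a family of averages form a closed subspace.\<close>

lemma avg_tendsto:
  assumes b: "\<forall>\<^sub>F t in F. b t \<in> MK" and Y: "Y \<in> SQ"
    and ramp: "\<And>x n. n > 0 \<Longrightarrow>
      ((\<lambda>t. avg (b t) (cl (\<lambda>w. ramp x n (Y w)))) \<longlongrightarrow> cl (\<lambda>w. ramp x n (Y w))) F"
    and v: "v \<in> Hs (cl Y)"
  shows "((\<lambda>t. avg (b t) v) \<longlongrightarrow> v) F"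
proof -
  define C where "C = {u. ((\<lambda>t. avg (b t) u) \<longlongrightarrow> u) F}"
  have lin: "c *\<^sub>R u + u' \<in> C" if "u \<in> C" "u' \<in> C" for c u u'
  proof -
    have "((\<lambda>t. c *\<^sub>R avg (b t) u + avg (b t) u') \<longlongrightarrow> c *\<^sub>R u + u') F"
      using that by (intro tendsto_intros) (auto simp: C_def)
    moreover have "\<forall>\<^sub>F t in F. c *\<^sub>R avg (b t) u + avg (b t) u' = avg (b t) (c *\<^sub>R u + u')"
      using b by eventually_elim (simp add: avg_add avg_scale)
    ultimately show ?thesis unfolding C_def by (simp add: tendsto_cong)
  qed
  have zero: "0 \<in> C"
  proof -
    have "\<forall>\<^sub>F t in F. avg (b t) 0 = 0"
      using b by eventually_elim (use avg_scale[of _ 0 0] in simp)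
    then show ?thesis by (simp add: C_def tendsto_eventually)
  qed
  have "closed C"
    unfolding closed_sequential_limits
  proof (intro allI impI)
    fix s u assume s: "(\<forall>n. s n \<in> C) \<and> s \<longlonglongrightarrow> u"
    show "u \<in> C"
      unfolding C_def mem_Collect_eq
    proof (rule tendstoI)
      fix e :: real assume e: "e > 0"
      obtain n where n: "dist (s n) u < e / 2"
        using s e metric_LIMSEQ_D[of s u "e/2"] by (metis half_gt_zero order_refl)
      have "\<forall>\<^sub>F t in F. dist (avg (b t) (s n)) (s n) < e / 2"
        using s e unfolding C_def by (auto dest!: tendstoD[of _ _ _ "e/2"] spec[of _ n])
      with b show "\<forall>\<^sub>F t in F. dist (avg (b t) u) u < e"
      proof eventually_elim
        case (elim t)
        \<comment> \<open>\<open>avg (b t) (s n)\<close> lies in \<open>Hs (b t)\<close> and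
          therefore competes with the best approximation \<open>avg (b t) u\<close>.\<close>
        have "norm (u - avg (b t) u) \<le> norm (u - avg (b t) (s n))"
          by (intro avg_closest avg_Hs elim)
        also have "\<dots> \<le> norm (u - s n) + norm (s n - avg (b t) (s n))"
          using norm_triangle_ineq[of "u - s n" "s n - avg (b t) (s n)"] by simp
        also have "\<dots> < e" using n elim(2) by (simp add: dist_norm norm_minus_commute)
        finally show ?case by (simp add: dist_norm norm_minus_commute)
      qed
    qed
  qed
  then have "closed_cone C"
    using lin[of _ _ 1] lin[OF _ zero] zero by (auto simp: closed_cone_def)
  moreover have "- u \<in> C" if "u \<in> C" for u using lin[OF that zero, of "-1"] by simp
  moreover have "cl (\<lambda>w. ramp x n (Y w)) \<in> C" if "n > 0" for x n
    using ramp[OF that] by (simp add: C_def)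
  ultimately have "v \<in> C" using Hs_subset_closed_subspace[OF Y] v by blast
  then show ?thesis by (simp add: C_def)
qed

lemma norm_ramp_diff_le:
  assumes "Y \<in> SQ" "Z \<in> SQ"
  shows "norm (cl (\<lambda>w. ramp x n (Y w)) - cl (\<lambda>w. ramp x n (Z w))) \<le> real n * norm (cl Y - cl Z)"
proof (rule power2_le_imp_le)
  note R = SQ_ramp[OF SQ_measurable[OF assms(1)], of x n] SQ_ramp[OF SQ_measurable[OF assms(2)], of x n]
  have "\<bar>ramp x n y - ramp x n z\<bar> \<le> real n * \<bar>y - z\<bar>" for y z
    using ramp_lipschitz[of y z x n] ramp_lipschitz[of z y x n] ramp_mono[of y z x n] ramp_mono[of z y x n]
    by (cases "y \<le> z") auto
  then have le: "(ramp x n y - ramp x n z)\<^sup>2 \<le> (real n)\<^sup>2 * (y - z)\<^sup>2" for y z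
    by (metis abs_ge_zero power2_abs power_mono power_mult_distrib)
  have "(norm (cl (\<lambda>w. ramp x n (Y w)) - cl (\<lambda>w. ramp x n (Z w))))\<^sup>2 =
      (\<integral>w. (ramp x n (Y w) - ramp x n (Z w))\<^sup>2 \<partial>unit_lebesgue)"
    using dist_cl_sq[OF R] by (simp add: dist_norm)
  also have "\<dots> \<le> (\<integral>w. (real n)\<^sup>2 * (Y w - Z w)\<^sup>2 \<partial>unit_lebesgue)"
    using le by (intro integral_mono integrable_mult_right SQ_sq_integrable SQ_diff R assms)
  also have "\<dots> = (real n)\<^sup>2 * (norm (cl Y - cl Z))\<^sup>2"
    using dist_cl_sq[OF assms] by (simp add: dist_norm)
  finally show "(norm (cl (\<lambda>w. ramp x n (Y w)) - cl (\<lambda>w. ramp x n (Z w))))\<^sup>2 \<le> (real n * norm (cl Y - cl Z))\<^sup>2"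
    by (simp add: power_mult_distrib)
qed simp

text \<open>A ramp of \<open>b t\<close> is a function of \<open>b t\<close> and is close to the
  same ramp of \<open>a\<close>, so averaging over \<open>b t\<close> moves the latter little. This
  is used as time tends to zero and for the density of discrete data.\<close>

lemma avg_tendsto_of_tendsto:
  assumes b: "\<forall>\<^sub>F t in F. b t \<in> MK" and lim: "(b \<longlongrightarrow> a) F" and v: "v \<in> Hs a"
  shows "((\<lambda>t. avg (b t) v) \<longlongrightarrow> v) F"
proof (rule avg_tendsto[OF b fn_SQ[of a]])
  show "v \<in> Hs (cl (fn a))" using v by simp
  fix x and n :: nat assume n: "n > 0"
  let ?u = "\<lambda>a. cl (\<lambda>w. ramp x n (fn a w))"
  have "((\<lambda>t. norm (b t - a)) \<longlongrightarrow> 0) F" using lim by (simp add: LIM_zero tendsto_norm_zero)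
  then have "((\<lambda>t. real n * norm (b t - a)) \<longlongrightarrow> 0) F" by (rule tendsto_mult_right_zero)
  moreover have "\<forall>\<^sub>F t in F. dist (avg (b t) (?u a)) (?u a) \<le> real n * norm (b t - a)"
    using b
  proof eventually_elim
    case (elim t)
    have "?u (b t) \<in> Hs (b t)"
      using Hs_cl_I[OF fn_SQ ramp_measurable SQ_ramp[OF fn_measurable]] by simp
    then have "norm (?u a - avg (b t) (?u a)) \<le> norm (?u a - ?u (b t))" by (rule avg_closest[OF elim])
    also have "\<dots> \<le> real n * norm (b t - a)"
      using norm_ramp_diff_le[OF fn_SQ fn_SQ, of x n a "b t"] by (simp add: norm_minus_commute)
    finally show ?case by (simp add: dist_norm norm_minus_commute)
  qed
  ultimately have "((\<lambda>t. avg (b t) (?u a) - ?u a) \<longlongrightarrow> 0) F"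
    unfolding dist_norm by (rule Lim_null_comparison[rotated])
  then show "((\<lambda>t. avg (b t) (?u a)) \<longlongrightarrow> ?u a) F" by (rule LIM_zero_cancel)
qed

text \<open>Particles at the same place with the same velocity stay together. Averaging over
  \<open>y\<close> fixes \<open>y + u\<close> and does not increase distances, so the averaged
  projection is a monotone competitor as good as the projection and equals it.\<close>

lemma cproj_Hs:
  assumes y: "y \<in> MK" and u: "u \<in> Hs y"
  shows "cproj MK (y + u) \<in> Hs y"
proof -
  let ?p = "cproj MK (y + u)"
  have "norm (y + u - avg y ?p) = norm (avg y (y + u - ?p))"
    using y u by (simp add: avg_diff avg_id Hs_self Hs_add)
  also have "\<dots> \<le> norm (y + u - ?p)" by (rule norm_avg_le[OF y])
  finally have "?p = avg y ?p"
    by (intro cproj_closest closed_cone_MK avg_MK y cproj)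
  then show ?thesis using avg_Hs[OF y] by metis
qed

section \<open>The evolution: semigroup property, dissipation and differentiability\<close>

definition sticky :: "l2 \<Rightarrow> l2 \<Rightarrow> real \<Rightarrow> l2" where
  "sticky a v t = cproj MK (a + t *\<^sub>R v)"

definition svel :: "l2 \<Rightarrow> l2 \<Rightarrow> real \<Rightarrow> l2" where
  "svel a v t = avg (sticky a v t) v"

lemma sticky_MK: "sticky a v t \<in> MK"
  unfolding sticky_def by (rule cproj(1)[OF closed_cone_MK])

lemma sticky_normal: "a + t *\<^sub>R v - sticky a v t \<in> normal_to MK (sticky a v t)"
  unfolding sticky_def by (rule cproj(2)[OF closed_cone_MK])

lemma sticky_0: "a \<in> MK \<Longrightarrow> sticky a v 0 = a"
  by (simp add: sticky_def cproj_self[OF closed_cone_MK])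

lemma sticky_dist: "norm (sticky a v t - sticky a' v' t') \<le> norm (a + t *\<^sub>R v - (a' + t' *\<^sub>R v'))"
  unfolding sticky_def by (rule cproj_nonexpansive[OF closed_cone_MK])

lemma sticky_lipschitz: "norm (sticky a v t - sticky a v s) \<le> \<bar>t - s\<bar> * norm v"
  using sticky_dist[of a v t a v s] by (simp add: scaleR_diff_left[symmetric])

lemma sticky_tendsto: "((\<lambda>s. sticky a v s) \<longlongrightarrow> sticky a v t) (at t within S)"
proof -
  have "\<forall>\<^sub>F x in at t within S. norm (sticky a v x - sticky a v t) \<le> \<bar>x - t\<bar> * norm v"
    using sticky_lipschitz by simp
  moreover have "((\<lambda>x. \<bar>x - t\<bar> * norm v) \<longlongrightarrow> \<bar>t - t\<bar> * norm v) (at t within S)"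
    by (intro tendsto_intros)
  then have "((\<lambda>x. \<bar>x - t\<bar> * norm v) \<longlongrightarrow> 0) (at t within S)" by simp
  ultimately have "((\<lambda>x. sticky a v x - sticky a v t) \<longlongrightarrow> 0) (at t within S)"
    by (rule Lim_null_comparison)
  then show ?thesis by (rule LIM_zero_cancel)
qed

lemma svel_Hs: "svel a v t \<in> Hs (sticky a v t)"
  unfolding svel_def by (rule avg_Hs[OF sticky_MK])

text \<open>The residual of the projection is orthogonal to all functions of the position. Hence the
  mean initial position of a cluster is found by following its present velocity back to time
  zero.\<close>

lemma avg_sticky: "avg (sticky a v t) a = sticky a v t - t *\<^sub>R svel a v t"
proof -
  have "avg (sticky a v t) (a + t *\<^sub>R v) = sticky a v t"
    by (rule avg_unique[OF sticky_MK Hs_self normal_orth[OF sticky_MK sticky_normal]])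
  then show ?thesis by (simp add: svel_def avg_add avg_scale sticky_MK algebra_simps)
qed

context
  fixes a v :: l2
  assumes a: "a \<in> MK" and v: "v \<in> Hs a"
begin

lemma svel_0: "svel a v 0 = v"
  by (simp add: svel_def sticky_0[OF a] avg_id[OF a v])

text \<open>Semigroup property. With \<open>r = t / s\<close>, the normal vector \<open>a + t v - Z\<close> is the sum of three
  normal vectors at \<open>Z\<close>: that of the projection from time \<open>s\<close>, \<open>r\<close> times the one of time \<open>s\<close>, and
  \<open>r - 1\<close> times \<open>avg a - a\<close>, which is normal by Chebyshev's inequality.\<close>

lemma sticky_step:
  assumes s: "0 \<le> s" and t: "s \<le> t"
  shows "sticky a v t = cproj MK (sticky a v s + (t - s) *\<^sub>R svel a v s)"
proof (cases "s = 0")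
  case True
  then show ?thesis by (simp add: svel_0 sticky_0[OF a] sticky_def[of a v t])
next
  case False
  then have s: "s > 0" using s by simp
  define X where "X = sticky a v s"
  define V where "V = svel a v s"
  define b where "b = avg X a"
  define Z where "Z = cproj MK (X + (t - s) *\<^sub>R V)"
  define r where "r = t / s"
  have r: "r \<ge> 1" "r * s = t" using s t by (auto simp: r_def)
  have X: "X \<in> MK" unfolding X_def by (rule sticky_MK)
  have VH: "(t - s) *\<^sub>R V \<in> Hs X" unfolding X_def V_def by (intro Hs_scale svel_Hs)
  have Z: "Z \<in> Hs X" unfolding Z_def by (rule cproj_Hs[OF X VH])
  have ZM: "Z \<in> MK" unfolding Z_def by (rule cproj(1)[OF closed_cone_MK])
  have b: "b = X - s *\<^sub>R V" unfolding b_def X_def V_def by (rule avg_sticky)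
  have \<xi>: "a + s *\<^sub>R v - X \<in> normal_to MK X" unfolding X_def by (rule sticky_normal)
  have \<zeta>: "X + (t - s) *\<^sub>R V - Z \<in> normal_to MK Z" unfolding Z_def by (rule cproj(2)[OF closed_cone_MK])
  have eq: "a + t *\<^sub>R v - Z = (X + (t - s) *\<^sub>R V - Z) + r *\<^sub>R (a + s *\<^sub>R v - X) + (r - 1) *\<^sub>R (b - a)"
    unfolding b r(2)[symmetric] by (simp add: algebra_simps)
  have "a + t *\<^sub>R v - Z \<in> normal_to MK Z"
    unfolding normal_to_def mem_Collect_eq
  proof (intro conjI ballI)
    fix z assume z: "z \<in> MK"
    have "inner (b - a) z \<le> 0"
      using avg_chebyshev[OF X a z] by (simp add: b_def inner_diff_left)
    moreover have "inner (a + s *\<^sub>R v - X) z \<le> 0" "inner (X + (t - s) *\<^sub>R V - Z) z \<le> 0"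
      using \<xi> \<zeta> z by (auto simp: normal_to_def)
    ultimately show "inner (a + t *\<^sub>R v - Z) z \<le> 0"
      unfolding eq inner_add_left[of "_ + _"] inner_add_left[of "X + (t - s) *\<^sub>R V - Z"] inner_scaleR_left
      using r by (intro add_nonpos_nonpos mult_nonneg_nonpos) auto
  next
    have "inner (b - a) Z = 0"
      using avg_orth[OF X Z, of a] by (simp add: b_def inner_diff_left)
    \<comment> \<open>\<open>Z\<close> is a function of \<open>X\<close>, so
      \<open>normal_orth\<close> carries the orthogonality of the residual from \<open>X\<close>
      over to \<open>Z\<close>.\<close>
    moreover have "inner (a + s *\<^sub>R v - X) Z = 0" by (rule normal_orth[OF X \<xi> Z])
    moreover have "inner (X + (t - s) *\<^sub>R V - Z) Z = 0" using \<zeta> by (auto simp: normal_to_def)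
    ultimately show "inner (a + t *\<^sub>R v - Z) Z = 0"
      unfolding eq inner_add_left[of "_ + _"] inner_add_left[of "X + (t - s) *\<^sub>R V - Z"] inner_scaleR_left
      by simp
  qed
  then have "sticky a v t = Z"
    unfolding sticky_def by (intro cproj_eqI closed_cone_MK ZM)
  then show ?thesis by (simp add: Z_def X_def V_def)
qed

lemma sticky_Hs:
  assumes "0 \<le> s" "s \<le> t"
  shows "sticky a v t \<in> Hs (sticky a v s)"
  unfolding sticky_step[OF assms] by (intro cproj_Hs sticky_MK Hs_scale svel_Hs)

text \<open>Level sets only merge, so averaging in stages agrees with averaging at once. For
  particles this is the collision rule.\<close>

lemma avg_svel:
  assumes "0 \<le> s" "s \<le> t"
  shows "avg (sticky a v t) (svel a v s) = svel a v t"
  unfolding svel_def by (rule avg_tower[OF sticky_MK sticky_MK sticky_Hs[OF assms]])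

text \<open>The loss of squared norm measures the squared change of velocity, because the later
  velocity is an orthogonal projection of the earlier one.\<close>

lemma norm_svel_diff:
  assumes "0 \<le> s" "s \<le> t"
  shows "(norm (svel a v s - svel a v t))\<^sup>2 = (norm (svel a v s))\<^sup>2 - (norm (svel a v t))\<^sup>2"
  using avg_pythagoras[OF sticky_MK, of "svel a v s" a v t] avg_svel[OF assms] by simp

lemma norm_svel_antimono: "0 \<le> s \<Longrightarrow> s \<le> t \<Longrightarrow> norm (svel a v t) \<le> norm (svel a v s)"
  using norm_avg_le[OF sticky_MK, of a v t "svel a v s"] avg_svel[of s t] by simp

text \<open>Conservation of momentum: the barycentre of the mass that forms a cluster at time
  \<open>t\<close> has moved since time \<open>s\<close> with the velocity of that cluster.\<close>

lemma avg_sticky_diff: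
  assumes "0 \<le> s" "s \<le> t"
  shows "avg (sticky a v t) (sticky a v t - sticky a v s) = (t - s) *\<^sub>R svel a v t"
proof -
  have "sticky a v s = avg (sticky a v s) a + s *\<^sub>R svel a v s" by (simp add: avg_sticky)
  then have "avg (sticky a v t) (sticky a v s) = avg (sticky a v t) a + s *\<^sub>R svel a v t"
    using avg_add[OF sticky_MK, of a v t] avg_scale[OF sticky_MK] avg_svel[OF assms]
      avg_tower[OF sticky_MK sticky_MK sticky_Hs[OF assms], of a] by metis
  then show ?thesis
    by (simp add: avg_diff sticky_MK avg_id Hs_self avg_sticky algebra_simps)
qed

text \<open>The component of the displacement along \<open>svel a v t\<close> is known exactly from
  the motion of barycentres, and its length is at most the earlier speed times the elapsed time;
  what remains is controlled by the dissipated energy.\<close>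

lemma sticky_increment:
  assumes st: "0 \<le> s" "s \<le> t"
  shows "norm (sticky a v t - sticky a v s - (t - s) *\<^sub>R svel a v t)
      \<le> (t - s) * sqrt ((norm (svel a v s))\<^sup>2 - (norm (svel a v t))\<^sup>2)"
proof (rule power2_le_imp_le)
  let ?d = "sticky a v t - sticky a v s" and ?V = "svel a v t"
  have E: "(norm ?V)\<^sup>2 \<le> (norm (svel a v s))\<^sup>2" using norm_svel_antimono[OF st] by (intro power_mono) auto
  have "norm ?d \<le> (t - s) * norm (svel a v s)"
  proof -
    have "norm ?d \<le> norm (sticky a v s + (t - s) *\<^sub>R svel a v s - sticky a v s)"
      using cproj_nonexpansive[OF closed_cone_MK, of "sticky a v s + (t - s) *\<^sub>R svel a v s" "sticky a v s"]
      by (simp add: sticky_step[OF st, symmetric] cproj_self[OF closed_cone_MK sticky_MK])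
    then show ?thesis using st by simp
  qed
  then have d: "(norm ?d)\<^sup>2 \<le> (t - s)\<^sup>2 * (norm (svel a v s))\<^sup>2"
    by (metis norm_ge_zero power_mono power_mult_distrib)
  have "inner ?d ?V = (t - s) * (norm ?V)\<^sup>2"
    using inner_avg[OF sticky_MK svel_Hs, of ?d a v t] avg_sticky_diff[OF st]
    by (simp add: power2_norm_eq_inner)
  then have "(norm (?d - (t - s) *\<^sub>R ?V))\<^sup>2 = (norm ?d)\<^sup>2 - (t - s)\<^sup>2 * (norm ?V)\<^sup>2"
    unfolding norm_diff_sq[of ?d] by (simp add: power_mult_distrib power2_eq_square)
  also have "\<dots> \<le> (t - s)\<^sup>2 * ((norm (svel a v s))\<^sup>2 - (norm ?V)\<^sup>2)"
    using d by (simp add: right_diff_distrib)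
  also have "\<dots> = ((t - s) * sqrt ((norm (svel a v s))\<^sup>2 - (norm ?V)\<^sup>2))\<^sup>2"
    using E by (simp add: power_mult_distrib)
  finally show "(norm (?d - (t - s) *\<^sub>R ?V))\<^sup>2 \<le> ((t - s) * sqrt ((norm (svel a v s))\<^sup>2 - (norm ?V)\<^sup>2))\<^sup>2" .
qed (use st norm_svel_antimono[OF st] in \<open>simp add: power_mono\<close>)

text \<open>The factor 2 comes from \<open>t < s\<close>: there the bound holds with the later
  velocity \<open>svel a v s\<close>, and exchanging it for \<open>svel a v t\<close> costs the
  dissipation once more.\<close>

lemma sticky_increment':
  assumes "0 \<le> s" "0 \<le> t"
  shows "norm (sticky a v s - sticky a v t - (s - t) *\<^sub>R svel a v t)
      \<le> 2 * \<bar>s - t\<bar> * sqrt \<bar>(norm (svel a v s))\<^sup>2 - (norm (svel a v t))\<^sup>2\<bar>"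
proof (cases "s \<le> t")
  case True
  have E: "(norm (svel a v t))\<^sup>2 \<le> (norm (svel a v s))\<^sup>2"
    using norm_svel_antimono[OF assms(1) True] by (intro power_mono) auto
  have "sticky a v s - sticky a v t - (s - t) *\<^sub>R svel a v t =
    - (sticky a v t - sticky a v s - (t - s) *\<^sub>R svel a v t)" by (simp add: algebra_simps)
  then have "norm (sticky a v s - sticky a v t - (s - t) *\<^sub>R svel a v t) \<le>
    (t - s) * sqrt ((norm (svel a v s))\<^sup>2 - (norm (svel a v t))\<^sup>2)"
    using sticky_increment[OF assms(1) True] by (simp only: norm_minus_cancel)
  also have "\<dots> \<le> 2 * (t - s) * sqrt ((norm (svel a v s))\<^sup>2 - (norm (svel a v t))\<^sup>2)"
    using True E by (intro mult_right_mono) auto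
  finally show ?thesis using True E by simp
next
  case False
  then have ts: "t \<le> s" by simp
  have E: "(norm (svel a v s))\<^sup>2 \<le> (norm (svel a v t))\<^sup>2"
    using norm_svel_antimono[OF assms(2) ts] by (intro power_mono) auto
  let ?q = "sqrt ((norm (svel a v t))\<^sup>2 - (norm (svel a v s))\<^sup>2)"
  have "norm (svel a v t - svel a v s) = ?q"
    using norm_svel_diff[OF assms(2) ts] by (metis norm_ge_zero real_sqrt_unique)
  then have "norm ((s - t) *\<^sub>R (svel a v s - svel a v t)) = (s - t) * ?q"
    using ts by (simp add: norm_minus_commute)
  moreover have eq: "sticky a v s - sticky a v t - (s - t) *\<^sub>R svel a v t =
     (sticky a v s - sticky a v t - (s - t) *\<^sub>R svel a v s) + (s - t) *\<^sub>R (svel a v s - svel a v t)"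
    by (simp add: algebra_simps)
  ultimately have "norm (sticky a v s - sticky a v t - (s - t) *\<^sub>R svel a v t) \<le> (s - t) * ?q + (s - t) * ?q"
    using sticky_increment[OF assms(2) ts]
      norm_triangle_ineq[of "sticky a v s - sticky a v t - (s - t) *\<^sub>R svel a v s"
        "(s - t) *\<^sub>R (svel a v s - svel a v t)"] unfolding eq by linarith
  moreover have "2 * \<bar>s - t\<bar> * sqrt \<bar>(norm (svel a v s))\<^sup>2 - (norm (svel a v t))\<^sup>2\<bar> =
      (s - t) * ?q + (s - t) * ?q"
    using ts E by (simp add: algebra_simps)
  ultimately show ?thesis by simp
qed

text \<open>Stated through the norm alone, so this set can serve as the exceptional set of the
  evolution variational inequality for every comparison measure simultaneously.\<close>

definition bad_times :: "real set" where
  "bad_times = {t. 0 < t \<and> \<not> isCont (\<lambda>s. (norm (svel a v s))\<^sup>2) t}"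

lemma countable_bad_times: "countable bad_times"
proof -
  have "mono_on {0<..} (\<lambda>s. - (norm (svel a v s))\<^sup>2)"
    using norm_svel_antimono by (auto simp: mono_on_def intro!: power_mono)
  then have "countable {t \<in> {0<..}. \<not> isCont (\<lambda>s. - (norm (svel a v s))\<^sup>2) t}"
    by (intro mono_on_ctble_discont_open) auto
  moreover have "bad_times \<subseteq> {t \<in> {0<..}. \<not> isCont (\<lambda>s. - (norm (svel a v s))\<^sup>2) t}"
    using continuous_minus[of "at _" "\<lambda>s. - (norm (svel a v s))\<^sup>2"] by (auto simp: bad_times_def)
  ultimately show ?thesis by (rule countable_subset[rotated])
qed

text \<open>By \<open>norm_svel_diff\<close> the velocity can jump only where its norm does.\<close>

lemma svel_isCont:
  assumes t: "0 < t" "t \<notin> bad_times"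
  shows "isCont (svel a v) t"
proof -
  have c: "((\<lambda>s. (norm (svel a v s))\<^sup>2) \<longlongrightarrow> (norm (svel a v t))\<^sup>2) (at t)"
    using t by (auto simp: bad_times_def isCont_def)
  then have "((\<lambda>s. sqrt \<bar>(norm (svel a v s))\<^sup>2 - (norm (svel a v t))\<^sup>2\<bar>) \<longlongrightarrow>
      sqrt \<bar>(norm (svel a v t))\<^sup>2 - (norm (svel a v t))\<^sup>2\<bar>) (at t)"
    by (intro tendsto_real_sqrt tendsto_rabs tendsto_diff tendsto_const)
  then have c': "((\<lambda>s. sqrt \<bar>(norm (svel a v s))\<^sup>2 - (norm (svel a v t))\<^sup>2\<bar>) \<longlongrightarrow> 0) (at t)" by simp
  have "\<forall>\<^sub>F s in at t. norm (svel a v s - svel a v t) \<le> sqrt \<bar>(norm (svel a v s))\<^sup>2 - (norm (svel a v t))\<^sup>2\<bar>"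
  proof -
    have "\<forall>\<^sub>F s in at t. 0 < s" using t(1) by (rule order_tendstoD(1)[OF tendsto_ident_at])
    then show ?thesis
    proof eventually_elim
      case (elim s)
      have "(norm (svel a v s - svel a v t))\<^sup>2 = \<bar>(norm (svel a v s))\<^sup>2 - (norm (svel a v t))\<^sup>2\<bar>"
        using norm_svel_diff[of s t] norm_svel_diff[of t s] elim t(1)
          zero_le_power2[of "norm (svel a v s - svel a v t)"]
        by (cases "s \<le> t") (auto simp: norm_minus_commute)
      then show ?case by (metis norm_ge_zero real_sqrt_unique order_refl)
    qed
  qed
  then have "((\<lambda>s. svel a v s - svel a v t) \<longlongrightarrow> 0) (at t)"
    using c' by (rule Lim_null_comparison)
  then show ?thesis unfolding isCont_def by (rule LIM_zero_cancel)
qed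

lemma sticky_deriv:
  assumes t: "0 < t" "t \<notin> bad_times"
  shows "((\<lambda>h. (1 / h) *\<^sub>R (sticky a v (t + h) - sticky a v t)) \<longlongrightarrow> svel a v t) (at 0)"
proof -
  have "((\<lambda>s. (norm (svel a v s))\<^sup>2) \<longlongrightarrow> (norm (svel a v t))\<^sup>2) (at t)"
    using t by (auto simp: bad_times_def isCont_def)
  then have c: "((\<lambda>h. (norm (svel a v (t + h)))\<^sup>2) \<longlongrightarrow> (norm (svel a v t))\<^sup>2) (at 0)"
    using LIM_offset_zero by blast
  then have "((\<lambda>h. 2 * sqrt \<bar>(norm (svel a v (t + h)))\<^sup>2 - (norm (svel a v t))\<^sup>2\<bar>) \<longlongrightarrow>
      2 * sqrt \<bar>(norm (svel a v t))\<^sup>2 - (norm (svel a v t))\<^sup>2\<bar>) (at 0)"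
    by (intro tendsto_mult tendsto_real_sqrt tendsto_rabs tendsto_diff tendsto_const)
  then have c': "((\<lambda>h. 2 * sqrt \<bar>(norm (svel a v (t + h)))\<^sup>2 - (norm (svel a v t))\<^sup>2\<bar>) \<longlongrightarrow> 0) (at 0)" by simp
  have "\<forall>\<^sub>F h in at 0. norm ((1 / h) *\<^sub>R (sticky a v (t + h) - sticky a v t) - svel a v t)
      \<le> 2 * sqrt \<bar>(norm (svel a v (t + h)))\<^sup>2 - (norm (svel a v t))\<^sup>2\<bar>"
    unfolding eventually_at
  proof (intro exI[of _ t] conjI ballI impI)
    fix h :: real assume h: "h \<noteq> 0 \<and> dist h 0 < t"
    then have th: "0 \<le> t + h" by (auto simp: dist_real_def)
    have "(1 / h) *\<^sub>R (sticky a v (t + h) - sticky a v t) - svel a v t =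
        (1 / h) *\<^sub>R (sticky a v (t + h) - sticky a v t - h *\<^sub>R svel a v t)"
      using h by (simp add: scaleR_diff_right)
    then have "norm ((1 / h) *\<^sub>R (sticky a v (t + h) - sticky a v t) - svel a v t) =
        norm (sticky a v (t + h) - sticky a v t - h *\<^sub>R svel a v t) / \<bar>h\<bar>"
      by simp
    also have "\<dots> \<le> (2 * \<bar>h\<bar> * sqrt \<bar>(norm (svel a v (t + h)))\<^sup>2 - (norm (svel a v t))\<^sup>2\<bar>) / \<bar>h\<bar>"
      using sticky_increment'[OF th, of t] t by (intro divide_right_mono) auto
    finally show "norm ((1 / h) *\<^sub>R (sticky a v (t + h) - sticky a v t) - svel a v t)
      \<le> 2 * sqrt \<bar>(norm (svel a v (t + h)))\<^sup>2 - (norm (svel a v t))\<^sup>2\<bar>" using h by simp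
  qed (use t in simp)
  then have "((\<lambda>h. (1 / h) *\<^sub>R (sticky a v (t + h) - sticky a v t) - svel a v t) \<longlongrightarrow> 0) (at 0)"
    using c' by (rule Lim_null_comparison)
  then show ?thesis by (rule LIM_zero_cancel)
qed

text \<open>Here it matters that \<open>v\<close> is a function of \<open>a\<close>: positions
  converge to \<open>a\<close>, so averaging over them asymptotically preserves \<open>v\<close>,
  and both error terms of \<open>sticky_increment\<close> are of smaller order than
  \<open>t\<close>.\<close>

lemma sticky_initial:
  "((\<lambda>t. norm (sticky a v t - (a + t *\<^sub>R v)) / t) \<longlongrightarrow> 0) (at_right 0)"
proof -
  have "((\<lambda>t. sticky a v t) \<longlongrightarrow> a) (at_right 0)"
    using sticky_tendsto[of a v 0] by (simp add: sticky_0[OF a])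
  then have "((\<lambda>t. svel a v t) \<longlongrightarrow> v) (at_right 0)"
    unfolding svel_def by (intro avg_tendsto_of_tendsto[OF _ _ v]) (simp_all add: sticky_MK)
  then have "((\<lambda>t. sqrt \<bar>(norm v)\<^sup>2 - (norm (svel a v t))\<^sup>2\<bar> + norm (svel a v t - v)) \<longlongrightarrow>
     sqrt \<bar>(norm v)\<^sup>2 - (norm v)\<^sup>2\<bar> + norm (v - v)) (at_right 0)"
    by (intro tendsto_intros)
  then have lim: "((\<lambda>t. sqrt \<bar>(norm v)\<^sup>2 - (norm (svel a v t))\<^sup>2\<bar> + norm (svel a v t - v)) \<longlongrightarrow> 0) (at_right 0)"
    by simp
  have "\<forall>\<^sub>F t in at_right 0. norm (norm (sticky a v t - (a + t *\<^sub>R v)) / t)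
     \<le> sqrt \<bar>(norm v)\<^sup>2 - (norm (svel a v t))\<^sup>2\<bar> + norm (svel a v t - v)"
    unfolding eventually_at_right_field
  proof (intro exI[of _ 1] conjI allI impI)
    fix t :: real assume t: "0 < t" "t < 1"
    have "norm (sticky a v t - a - t *\<^sub>R svel a v t) \<le> t * sqrt \<bar>(norm v)\<^sup>2 - (norm (svel a v t))\<^sup>2\<bar>"
      using sticky_increment[of 0 t] t norm_svel_antimono[of 0 t]
      by (simp add: sticky_0[OF a] svel_0 power_mono)
    moreover have eq: "sticky a v t - (a + t *\<^sub>R v) = (sticky a v t - a - t *\<^sub>R svel a v t) + t *\<^sub>R (svel a v t - v)"
      by (simp add: algebra_simps)
    ultimately have "norm (sticky a v t - (a + t *\<^sub>R v)) \<le>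
       t * sqrt \<bar>(norm v)\<^sup>2 - (norm (svel a v t))\<^sup>2\<bar> + t * norm (svel a v t - v)"
      using norm_triangle_ineq[of "sticky a v t - a - t *\<^sub>R svel a v t" "t *\<^sub>R (svel a v t - v)"] t
      unfolding eq by simp
    then show "norm (norm (sticky a v t - (a + t *\<^sub>R v)) / t)
     \<le> sqrt \<bar>(norm v)\<^sup>2 - (norm (svel a v t))\<^sup>2\<bar> + norm (svel a v t - v)"
      using t by (simp add: divide_le_eq algebra_simps)
  qed simp
  then show ?thesis using lim by (rule Lim_null_comparison)
qed

text \<open>By Chebyshev's inequality and orthogonality, \<open>avg ?X a - a\<close> is normal to
  the cone at the present position. Substituting \<open>avg_sticky\<close> for the average gives the
  inequality.\<close>

lemma sticky_evi:
  assumes t: "0 \<le> t" and Y: "Y \<in> MK"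
  shows "t * inner (svel a v t) (sticky a v t - Y) \<le> inner (sticky a v t - a) (sticky a v t - Y)"
proof -
  let ?X = "sticky a v t"
  have "inner (a - avg ?X a) ?X = 0" by (rule avg_orth[OF sticky_MK Hs_self])
  moreover have "0 \<le> inner (a - avg ?X a) Y" by (rule avg_chebyshev[OF sticky_MK a Y])
  ultimately have "inner (a - (?X - t *\<^sub>R svel a v t)) (?X - Y) \<le> 0"
    by (simp add: avg_sticky inner_diff_right)
  then show ?thesis by (simp add: inner_diff_left)
qed

end

section \<open>Monotone rearrangements and the Wasserstein distance\<close>

definition qf :: "real measure \<Rightarrow> l2" where
  "qf \<rho> = cl (rearr \<rho>)"

definition law :: "l2 \<Rightarrow> real measure" where
  "law a = distr unit_lebesgue borel (fn a)"

lemma P2D: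
  assumes "\<rho> \<in> P2"
  shows "prob_space \<rho>" "sets \<rho> = sets borel" "space \<rho> = UNIV" "integrable \<rho> (\<lambda>x. x\<^sup>2)"
    "real_distribution \<rho>"
proof -
  show 1: "prob_space \<rho>" "sets \<rho> = sets borel" "integrable \<rho> (\<lambda>x. x\<^sup>2)"
    using assms by (auto simp: P2_def)
  then show "space \<rho> = UNIV" by (metis sets_eq_imp_space_eq space_borel)
  show "real_distribution \<rho>"
    using 1 by (simp add: real_distribution_def real_distribution_axioms_def)
qed

context
  fixes \<rho> :: "real measure"
  assumes \<rho>: "real_distribution \<rho>"
begin

interpretation R: real_distribution \<rho> by (rule \<rho>)

lemma rearr_set:
  assumes w: "0 < w" "w < 1"
  shows "{x. measure \<rho> {..x} > w} \<noteq> {}" "bdd_below {x. measure \<rho> {..x} > w}"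
proof -
  have "\<forall>\<^sub>F x in at_top. cdf \<rho> x > w"
    using R.cdf_lim_at_top_prob w by (intro order_tendstoD) auto
  then obtain x where "cdf \<rho> x > w" by (auto simp: eventually_at_top_linorder)
  then show "{x. measure \<rho> {..x} > w} \<noteq> {}" by (auto simp: cdf_def)
  have "\<forall>\<^sub>F x in at_bot. cdf \<rho> x < w"
    using R.cdf_lim_at_bot w by (intro order_tendstoD) auto
  then obtain y where y: "\<And>x. x \<le> y \<Longrightarrow> cdf \<rho> x < w" by (auto simp: eventually_at_bot_linorder)
  show "bdd_below {x. measure \<rho> {..x} > w}"
  proof (rule bdd_belowI[of _ y])
    fix x assume "x \<in> {x. measure \<rho> {..x} > w}"
    then show "y \<le> x" using y[of x] by (cases "x \<le> y") (auto simp: cdf_def)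
  qed
qed

lemma rearr_le: "0 < w \<Longrightarrow> w < 1 \<Longrightarrow> w < measure \<rho> {..x} \<Longrightarrow> rearr \<rho> w \<le> x"
  unfolding rearr_def by (intro cInf_lower rearr_set) auto

text \<open>Right continuity of the distribution function closes the strict inequality in
  \<open>rearr\<close>. Together with \<open>rearr_le\<close> this is a Galois connection up to the
  single value \<open>w = measure \<rho> {..x}\<close>.\<close>

lemma rearr_leD:
  assumes w: "0 < w" "w < 1" and le: "rearr \<rho> w \<le> x"
  shows "w \<le> measure \<rho> {..x}"
proof -
  have "w \<le> cdf \<rho> y" if "x < y" for y
  proof -
    have "Inf {x. measure \<rho> {..x} > w} < y" using le that by (simp add: rearr_def)
    then obtain z where "z < y" "measure \<rho> {..z} > w"
      using rearr_set[OF w] by (subst (asm) cInf_less_iff) auto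
    then show ?thesis using R.cdf_nondecreasing[of z y] by (simp add: cdf_def)
  qed
  then have "\<forall>\<^sub>F y in at_right x. w \<le> cdf \<rho> y"
    by (simp add: eventually_at_filter)
  moreover have "(cdf \<rho> \<longlongrightarrow> cdf \<rho> x) (at_right x)"
    using R.cdf_is_right_cont by (simp add: continuous_within)
  ultimately have "w \<le> cdf \<rho> x" by (intro tendsto_lowerbound) auto
  then show ?thesis by (simp add: cdf_def)
qed

lemma rearr_mono01: "mono01 (rearr \<rho>)"
  unfolding mono01_def
proof (intro allI impI)
  fix w w' :: real assume w: "0 < w" "w \<le> w'" "w' < 1"
  then show "rearr \<rho> w \<le> rearr \<rho> w'"
    unfolding rearr_def by (intro cInf_superset_mono rearr_set) auto
qed

lemma rearr_measurable: "rearr \<rho> \<in> borel_measurable borel"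
proof (rule borel_measurable_piecewise_mono)
  \<comment> \<open>For negative \<open>w\<close>, and from 1 on, the set in \<open>rearr\<close> is
    the whole line or empty, so the infimum is constant there; the point 0 forms a piece of its
    own.\<close>
  let ?C = "{{..<0::real}, {0}, {0<..<1}, {1..}}"
  show "countable ?C" "\<Union>?C = UNIV" by auto
  fix c assume c: "c \<in> ?C"
  then show "c \<in> sets borel" by auto
  have "{x. measure \<rho> {..x} > w} = UNIV" if "w < 0" for w
    using that by (auto intro: less_le_trans)
  moreover have "{x. measure \<rho> {..x} > w} = {}" if "1 \<le> w" for w
    using that R.prob_le_1 by (auto simp: not_less intro: order_trans)
  ultimately show "mono_on c (rearr \<rho>)"
    using c rearr_mono01 by (auto simp: mono_on_def mono01_def rearr_def)
qed

text \<open>The sublevel set at \<open>x\<close> lies between the open and the half-open interval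
  from 0 to \<open>measure \<rho> {..x}\<close>, which have the same length.\<close>

lemma distr_rearr: "distr unit_lebesgue borel (rearr \<rho>) = \<rho>"
proof (rule cdf_unique)
  let ?D = "distr unit_lebesgue borel (rearr \<rho>)"
  have [measurable]: "rearr \<rho> \<in> borel_measurable unit_lebesgue"
    by (rule borel_measurable_UL[OF rearr_measurable])
  show "real_distribution ?D"
    by (intro real_distribution.intro UL.prob_space_distr real_distribution_axioms.intro) simp_all
  show "real_distribution \<rho>" by (rule \<rho>)
  show "cdf ?D = cdf \<rho>"
  proof
    fix x
    let ?c = "measure \<rho> {..x}"
    have c: "0 \<le> ?c" "?c \<le> 1" using R.prob_le_1 by auto
    let ?S = "{w. 0 < w \<and> w < 1 \<and> rearr \<rho> w \<le> x}"
    have S: "?S \<in> sets unit_lebesgue" by (rule dis_sets[OF rearr_measurable])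
    have 0: "cdf ?D x = \<mu>01 ?S"
      unfolding cdf_def by (subst measure_distr) (auto intro!: arg_cong[where f=\<mu>01])
    have I: "{0<..<?c} \<in> sets unit_lebesgue" "{0<..?c} \<inter> {0<..<1} \<in> sets unit_lebesgue"
      by (auto simp: sets_restrict_space_iff intro: less_le_trans[OF _ c(2)])
    have "\<mu>01 {0<..<?c} \<le> \<mu>01 ?S"
    proof (intro UL.finite_measure_mono S subsetI)
      fix w assume w: "w \<in> {0<..<?c}"
      then have "w < 1" using less_le_trans[OF _ c(2)] by simp
      then show "w \<in> ?S" using w rearr_le[of w x] by simp
    qed
    moreover have "\<mu>01 {0<..<?c} = ?c"
      using c(1) by (subst measure_restrict_space) (auto intro: less_le_trans[OF _ c(2)])
    moreover have "\<mu>01 ?S \<le> \<mu>01 ({0<..?c} \<inter> {0<..<1})"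
      using rearr_leD by (intro UL.finite_measure_mono I) auto
    moreover have "\<mu>01 ({0<..?c} \<inter> {0<..<1}) \<le> ?c"
    proof -
      have "\<mu>01 ({0<..?c} \<inter> {0<..<1}) = measure lborel ({0<..?c} \<inter> {0<..<1})"
        by (rule measure_restrict_space) auto
      also have "\<dots> \<le> measure lborel {0<..?c}"
        using c by (intro measure_mono_fmeasurable) (auto simp: fmeasurable_def)
      finally show ?thesis using c by simp
    qed
    ultimately show "cdf ?D x = cdf \<rho> x" unfolding 0 by (simp add: cdf_def)
  qed
qed

end

section \<open>The correspondence between \<open>P2\<close> and the cone \<open>MK\<close>\<close>

lemma rearr_SQ:
  assumes "\<rho> \<in> P2"
  shows "rearr \<rho> \<in> SQ"
proof (rule SQ_I)
  note R = P2D(5)[OF assms]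
  show m: "rearr \<rho> \<in> borel_measurable borel" by (rule rearr_measurable[OF R])
  have "integrable (distr unit_lebesgue borel (rearr \<rho>)) (\<lambda>x. x\<^sup>2)"
    unfolding distr_rearr[OF R] by (rule P2D(4)[OF assms])
  then show "integrable unit_lebesgue (\<lambda>w. (rearr \<rho> w)\<^sup>2)"
    by (subst (asm) integrable_distr_eq) (auto intro: borel_measurable_UL[OF m])
qed

lemma qf_MK: "\<rho> \<in> P2 \<Longrightarrow> qf \<rho> \<in> MK"
  unfolding qf_def by (intro MK_I rearr_SQ rearr_mono01 P2D(5))

lemma law_cl:
  assumes "f \<in> SQ"
  shows "law (cl f) = distr unit_lebesgue borel f"
  unfolding law_def
proof (rule distr_cong_AE)
  show "AE w in unit_lebesgue. fn (cl f) w = f w" by (rule fn_cl[OF assms])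
qed (auto intro: borel_measurable_UL SQ_measurable_UL[OF assms])

lemma law_qf: "\<rho> \<in> P2 \<Longrightarrow> law (qf \<rho>) = \<rho>"
  unfolding qf_def by (simp add: law_cl rearr_SQ distr_rearr P2D(5))

lemma law_P2: "law a \<in> P2"
proof -
  note m = borel_measurable_UL[OF fn_measurable[of a]]
  have "integrable (law a) (\<lambda>x. x\<^sup>2)"
    unfolding law_def by (subst integrable_distr_eq) (auto intro: m SQ_sq_integrable fn_SQ)
  moreover have "prob_space (law a)" unfolding law_def by (rule UL.prob_space_distr[OF m])
  ultimately show ?thesis by (simp add: P2_def law_def)
qed

lemma qf_inj: "\<rho> \<in> P2 \<Longrightarrow> \<eta> \<in> P2 \<Longrightarrow> qf \<rho> = qf \<eta> \<Longrightarrow> \<rho> = \<eta>"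
  by (metis law_qf)

lemma measure_law_cl:
  assumes f: "f \<in> SQ"
  shows "measure (law (cl f)) {..x} = \<mu>01 {w. 0 < w \<and> w < 1 \<and> f w \<le> x}"
  unfolding law_cl[OF f]
  by (subst measure_distr) (auto intro: SQ_measurable_UL[OF f] intro!: arg_cong[where f=\<mu>01])

text \<open>The monotone representative lies below the rearrangement of its law, which in turn lies
  below all values of the representative further right. The two agree at continuity points, hence
  off a countable set.\<close>

lemma qf_law:
  assumes "a \<in> MK"
  shows "qf (law a) = a"
proof -
  let ?f = "mrep a" and ?\<rho> = "law a"
  note M = mrep[OF assms]
  note R = P2D(5)[OF law_P2[of a]]
  have meas: "measure ?\<rho> {..x} = \<mu>01 {w. 0 < w \<and> w < 1 \<and> ?f w \<le> x}" for x
    using measure_law_cl[OF M(1)] M(3) by simp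
  note S = dis_sets[OF SQ_measurable[OF M(1)]]
  have I: "{0<..w} \<in> sets unit_lebesgue" if "w < 1" for w
    using that by (auto simp: sets_restrict_space_iff)
  have lo: "?f w \<le> rearr ?\<rho> w" if w: "0 < w" "w < 1" for w
    unfolding rearr_def
  proof (intro cInf_greatest rearr_set[OF R w])
    fix x assume "x \<in> {x. measure ?\<rho> {..x} > w}"
    then have x: "\<mu>01 {w'. 0 < w' \<and> w' < 1 \<and> ?f w' \<le> x} > w" by (simp add: meas)
    show "?f w \<le> x"
    proof (rule ccontr)
      assume x': "\<not> ?f w \<le> x"
      have "{w'. 0 < w' \<and> w' < 1 \<and> ?f w' \<le> x} \<subseteq> {0<..w}"
      proof
        fix w' assume "w' \<in> {w'. 0 < w' \<and> w' < 1 \<and> ?f w' \<le> x}"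
        then show "w' \<in> {0<..w}" using mono01D[OF M(2), of w w'] w x' by (cases "w' \<le> w") auto
      qed
      then have "\<mu>01 {w'. 0 < w' \<and> w' < 1 \<and> ?f w' \<le> x} \<le> \<mu>01 {0<..w}"
        by (intro UL.finite_measure_mono I w)
      then show False using x w by (simp add: measure_UL_Ioc)
    qed
  qed
  have up: "rearr ?\<rho> w \<le> ?f w'" if w: "0 < w" "w < w'" "w' < 1" for w w'
  proof (rule rearr_le[OF R])
    have "\<mu>01 {0<..w'} \<le> measure ?\<rho> {..?f w'}"
      unfolding meas using mono01D[OF M(2), of _ w'] w by (intro UL.finite_measure_mono S) auto
    then show "w < measure ?\<rho> {..?f w'}" using w by (simp add: measure_UL_Ioc)
  qed (use w in auto)
  have cnt: "countable {w \<in> {0<..<1}. \<not> isCont ?f w}"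
    using M(2) by (intro mono_on_ctble_discont_open) (auto simp: mono_on_def mono01_def)
  have eq: "rearr ?\<rho> w = ?f w" if w: "0 < w" "w < 1" "isCont ?f w" for w
  proof (rule antisym)
    have "(?f \<longlongrightarrow> ?f w) (at_right w)"
      using w(3) by (simp add: isCont_def filterlim_at_split)
    moreover have "\<forall>\<^sub>F w' in at_right w. rearr ?\<rho> w \<le> ?f w'"
      unfolding eventually_at_right_field using up w by (intro exI[of _ 1]) auto
    ultimately show "rearr ?\<rho> w \<le> ?f w" by (intro tendsto_lowerbound) auto
  qed (rule lo[OF w(1,2)])
  have "AE w in lborel. w \<notin> {w \<in> {0<..<1}. \<not> isCont ?f w}"
    by (rule AE_not_in[OF countable_imp_null_set_lborel[OF cnt]])
  then have "AE w in unit_lebesgue. rearr ?\<rho> w = ?f w"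
    unfolding AE_UL by eventually_elim (use eq in auto)
  then have "qf ?\<rho> = cl ?f"
    unfolding qf_def by (intro cl_eqI rearr_SQ law_P2 M(1))
  then show ?thesis using M(3) by simp
qed

text \<open>Hoeffding's representation
  \<open>(x - y)\<^sup>2 = 2 * \<integral>\<integral> 1[a \<le> b] * (1[y \<le> a, b < x] + 1[x \<le> a, b < y]) da db\<close> reduces optimality of the
  monotone coupling to a bound on the mass of quadrants.\<close>

lemma half_square_nn_integral:
  fixes x y :: real
  shows "(\<integral>\<^sup>+b. \<integral>\<^sup>+a. (if y \<le> a \<and> a \<le> b \<and> b < x then 1 else 0) \<partial>lborel \<partial>lborel) = ennreal ((max 0 (x - y))\<^sup>2 / 2)"
proof -
  have "(\<integral>\<^sup>+a. (if y \<le> a \<and> a \<le> b \<and> b < x then 1 else 0) \<partial>lborel) = ennreal (b - y) * indicator {y..<x} b" for b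
  proof (cases "y \<le> b \<and> b < x")
    case True
    have "(\<integral>\<^sup>+a. (if y \<le> a \<and> a \<le> b \<and> b < x then 1 else 0) \<partial>lborel) = (\<integral>\<^sup>+a. indicator {y..b} a \<partial>lborel)"
      using True by (intro nn_integral_cong) (auto simp: indicator_def)
    then show ?thesis using True by simp
  next
    case False
    then have "(\<integral>\<^sup>+a. (if y \<le> a \<and> a \<le> b \<and> b < x then 1 else 0) \<partial>lborel) = (\<integral>\<^sup>+a. 0 \<partial>(lborel :: real measure))"
      by (intro nn_integral_cong) auto
    then show ?thesis using False by auto
  qed
  then have "(\<integral>\<^sup>+b. \<integral>\<^sup>+a. (if y \<le> a \<and> a \<le> b \<and> b < x then 1 else 0) \<partial>lborel \<partial>lborel) =
     (\<integral>\<^sup>+b. ennreal (b - y) * indicator {y..<x} b \<partial>lborel)" by simp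
  also have "\<dots> = ennreal ((max 0 (x - y))\<^sup>2 / 2)"
  proof (cases "y \<le> x")
    case True
    have "(\<integral>\<^sup>+b. ennreal (b - y) * indicator {y..<x} b \<partial>lborel) = (\<integral>\<^sup>+b. ennreal (b - y) * indicator {y..x} b \<partial>lborel)"
    proof (rule nn_integral_cong_AE)
      have "AE b in lborel. b \<noteq> x" by (rule AE_lborel_singleton)
      then show "AE b in lborel. ennreal (b - y) * indicator {y..<x} b = ennreal (b - y) * indicator {y..x} b"
        by eventually_elim (auto simp: indicator_def)
    qed
    also have "\<dots> = ennreal ((x - y)\<^sup>2 / 2 - (y - y)\<^sup>2 / 2)"
      using True by (intro nn_integral_FTC_Icc[where F = "\<lambda>b. (b - y)\<^sup>2 / 2"])
        (auto intro!: derivative_eq_intros)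
    finally show ?thesis using True by simp
  next
    case False
    then have "{y..<x} = {}" by auto
    then show ?thesis using False by simp
  qed
  finally show ?thesis .
qed

text \<open>Tonelli moves the integral over the sample space inside, where it becomes the mass of a
  quadrant.\<close>

lemma hoeffding_half:
  fixes \<gamma> :: "'a measure" and f g :: "'a \<Rightarrow> real"
  assumes \<gamma>: "prob_space \<gamma>" and [measurable]: "f \<in> borel_measurable \<gamma>" "g \<in> borel_measurable \<gamma>"
  shows "(\<integral>\<^sup>+z. ennreal ((max 0 (f z - g z))\<^sup>2 / 2) \<partial>\<gamma>) =
    (\<integral>\<^sup>+b. \<integral>\<^sup>+a. (if a \<le> b then emeasure \<gamma> {z \<in> space \<gamma>. g z \<le> a \<and> b < f z} else 0) \<partial>lborel \<partial>lborel)"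
proof -
  interpret G: prob_space \<gamma> by fact
  interpret P: pair_sigma_finite \<gamma> "lborel :: real measure" ..
  let ?k = "\<lambda>z b a. (if g z \<le> a \<and> a \<le> b \<and> b < f z then 1 else 0) :: ennreal"
  have "(\<integral>\<^sup>+z. ennreal ((max 0 (f z - g z))\<^sup>2 / 2) \<partial>\<gamma>) = (\<integral>\<^sup>+z. \<integral>\<^sup>+b. \<integral>\<^sup>+a. ?k z b a \<partial>lborel \<partial>lborel \<partial>\<gamma>)"
    by (simp only: half_square_nn_integral)
  also have "\<dots> = (\<integral>\<^sup>+b. \<integral>\<^sup>+z. \<integral>\<^sup>+a. ?k z b a \<partial>lborel \<partial>\<gamma> \<partial>lborel)"
    by (rule P.Fubini'[symmetric]) measurable
  also have "\<dots> = (\<integral>\<^sup>+b. \<integral>\<^sup>+a. \<integral>\<^sup>+z. ?k z b a \<partial>\<gamma> \<partial>lborel \<partial>lborel)"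
    by (intro nn_integral_cong P.Fubini'[symmetric]) measurable
  also have "\<dots> = (\<integral>\<^sup>+b. \<integral>\<^sup>+a. (if a \<le> b then emeasure \<gamma> {z \<in> space \<gamma>. g z \<le> a \<and> b < f z} else 0) \<partial>lborel \<partial>lborel)"
  proof (intro nn_integral_cong)
    fix a b :: real
    show "(\<integral>\<^sup>+z. ?k z b a \<partial>\<gamma>) = (if a \<le> b then emeasure \<gamma> {z \<in> space \<gamma>. g z \<le> a \<and> b < f z} else 0)"
    proof (cases "a \<le> b")
      case True
      have "(\<integral>\<^sup>+z. ?k z b a \<partial>\<gamma>) = (\<integral>\<^sup>+z. indicator {z \<in> space \<gamma>. g z \<le> a \<and> b < f z} z \<partial>\<gamma>)"
        using True by (intro nn_integral_cong) (auto simp: indicator_def)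
      then show ?thesis using True by simp
    qed simp
  qed
  finally show ?thesis .
qed

lemma sq_split_max: "ennreal ((x - y)\<^sup>2) = 2 * (ennreal ((max 0 (x - y))\<^sup>2 / 2) + ennreal ((max 0 (y - x))\<^sup>2 / 2))"
proof -
  have "(x - y)\<^sup>2 = 2 * ((max 0 (x - y))\<^sup>2 / 2 + (max 0 (y - x))\<^sup>2 / 2)"
    by (cases "x \<le> y") (auto simp: power2_commute)
  then have "ennreal ((x - y)\<^sup>2) = ennreal (2 * ((max 0 (x - y))\<^sup>2 / 2 + (max 0 (y - x))\<^sup>2 / 2))"
    by (simp only:)
  also have "\<dots> = 2 * ennreal ((max 0 (x - y))\<^sup>2 / 2 + (max 0 (y - x))\<^sup>2 / 2)"
    by (subst ennreal_mult) auto
  also have "ennreal ((max 0 (x - y))\<^sup>2 / 2 + (max 0 (y - x))\<^sup>2 / 2) =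
      ennreal ((max 0 (x - y))\<^sup>2 / 2) + ennreal ((max 0 (y - x))\<^sup>2 / 2)"
    by (rule ennreal_plus) auto
  finally show ?thesis .
qed

lemma nn_integral_sq_split:
  assumes [measurable]: "f \<in> borel_measurable \<gamma>" "g \<in> borel_measurable \<gamma>"
  shows "(\<integral>\<^sup>+z. ennreal ((f z - g z)\<^sup>2) \<partial>\<gamma>) =
    2 * ((\<integral>\<^sup>+z. ennreal ((max 0 (f z - g z))\<^sup>2 / 2) \<partial>\<gamma>) + (\<integral>\<^sup>+z. ennreal ((max 0 (g z - f z))\<^sup>2 / 2) \<partial>\<gamma>))"
  unfolding sq_split_max by (subst nn_integral_cmult) (auto simp: nn_integral_add)

text \<open>Every coupling gives the quadrant at least the mass that the first marginal cannot
  absorb, \<open>?G - ?F\<close>; the monotone coupling puts at most the positive part of this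
  number there.\<close>

lemma quadrant_bound:
  assumes R: "real_distribution \<rho>" "real_distribution \<eta>" and \<gamma>: "prob_space \<gamma>"
    and [measurable]: "f \<in> borel_measurable \<gamma>" "g \<in> borel_measurable \<gamma>"
    and f: "distr \<gamma> borel f = \<rho>" and g: "distr \<gamma> borel g = \<eta>"
  shows "emeasure unit_lebesgue {w \<in> space unit_lebesgue. rearr \<eta> w \<le> a \<and> b < rearr \<rho> w}
    \<le> emeasure \<gamma> {z \<in> space \<gamma>. g z \<le> a \<and> b < f z}"
proof -
  interpret G: prob_space \<gamma> by fact
  let ?F = "measure \<rho> {..b}" and ?G = "measure \<eta> {..a}"
  have FG: "0 \<le> ?F" "?F \<le> 1" "0 \<le> ?G" "?G \<le> 1"
    using real_distribution.axioms(1)[OF R(1)] real_distribution.axioms(1)[OF R(2)]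
    by (auto intro: prob_space.prob_le_1)
  have mF: "?F = measure \<gamma> {z \<in> space \<gamma>. f z \<le> b}"
    unfolding f[symmetric] by (subst measure_distr) (auto intro!: arg_cong[where f="measure \<gamma>"])
  have mG: "?G = measure \<gamma> {z \<in> space \<gamma>. g z \<le> a}"
    unfolding g[symmetric] by (subst measure_distr) (auto intro!: arg_cong[where f="measure \<gamma>"])
  have "?G \<le> measure \<gamma> ({z \<in> space \<gamma>. g z \<le> a \<and> b < f z} \<union> {z \<in> space \<gamma>. f z \<le> b})"
    unfolding mG by (intro G.finite_measure_mono) auto
  also have "\<dots> \<le> measure \<gamma> {z \<in> space \<gamma>. g z \<le> a \<and> b < f z} + ?F"
    unfolding mF by (intro measure_Un_le) auto
  finally have lower: "?G - ?F \<le> measure \<gamma> {z \<in> space \<gamma>. g z \<le> a \<and> b < f z}" by simp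
  let ?S = "{w \<in> space unit_lebesgue. rearr \<eta> w \<le> a \<and> b < rearr \<rho> w}"
  have sub: "?S \<subseteq> {?F..?G} \<inter> {0<..<1}"
  proof
    fix w assume w: "w \<in> ?S"
    then have "w \<le> ?G" using rearr_leD[OF R(2), of w a] by simp
    moreover have "?F \<le> w" using rearr_le[OF R(1), of w b] w by force
    ultimately show "w \<in> {?F..?G} \<inter> {0<..<1}" using w by simp
  qed
  have "{?F..?G} \<inter> {0<..<1} \<in> sets unit_lebesgue" by (auto simp: sets_restrict_space_iff)
  then have "emeasure unit_lebesgue ?S \<le> emeasure unit_lebesgue ({?F..?G} \<inter> {0<..<1})"
    by (rule emeasure_mono[OF sub])
  also have "\<dots> = emeasure lborel ({?F..?G} \<inter> {0<..<1})"
    by (rule emeasure_restrict_space) auto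
  also have "\<dots> \<le> emeasure lborel {?F..?G}" by (rule emeasure_mono) auto
  also have "\<dots> = ennreal (max 0 (?G - ?F))" by (auto simp: max_def ennreal_neg)
  also have "\<dots> \<le> ennreal (measure \<gamma> {z \<in> space \<gamma>. g z \<le> a \<and> b < f z})"
    using lower by (intro ennreal_leI) auto
  also have "\<dots> = emeasure \<gamma> {z \<in> space \<gamma>. g z \<le> a \<and> b < f z}"
    by (simp add: G.emeasure_eq_measure)
  finally show ?thesis .
qed

lemma rearr_optimal:
  assumes R: "real_distribution \<rho>" "real_distribution \<eta>" and \<gamma>: "prob_space \<gamma>"
    and fg [measurable]: "f \<in> borel_measurable \<gamma>" "g \<in> borel_measurable \<gamma>"
    and f: "distr \<gamma> borel f = \<rho>" and g: "distr \<gamma> borel g = \<eta>"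
  shows "(\<integral>\<^sup>+w. ennreal ((rearr \<rho> w - rearr \<eta> w)\<^sup>2) \<partial>unit_lebesgue) \<le> (\<integral>\<^sup>+z. ennreal ((f z - g z)\<^sup>2) \<partial>\<gamma>)"
proof -
  have [measurable]: "rearr \<rho> \<in> borel_measurable unit_lebesgue" "rearr \<eta> \<in> borel_measurable unit_lebesgue"
    using R by (auto intro: borel_measurable_UL rearr_measurable)
  have "(\<integral>\<^sup>+w. ennreal ((max 0 (rearr \<rho> w - rearr \<eta> w))\<^sup>2 / 2) \<partial>unit_lebesgue)
      \<le> (\<integral>\<^sup>+z. ennreal ((max 0 (f z - g z))\<^sup>2 / 2) \<partial>\<gamma>)"
    if "real_distribution \<rho>" "real_distribution \<eta>" "f \<in> borel_measurable \<gamma>" "g \<in> borel_measurable \<gamma>"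
      "distr \<gamma> borel f = \<rho>" "distr \<gamma> borel g = \<eta>" for \<rho> \<eta> f g
  proof -
    have m: "rearr \<rho> \<in> borel_measurable unit_lebesgue" "rearr \<eta> \<in> borel_measurable unit_lebesgue"
      using that by (auto intro: borel_measurable_UL rearr_measurable)
    show ?thesis
      unfolding hoeffding_half[OF \<gamma> that(3,4)] hoeffding_half[OF UL.prob_space_axioms m]
      using quadrant_bound[OF that(1,2) \<gamma> that(3-6)] by (intro nn_integral_mono) auto
  qed
  from this[OF R fg f g] this[OF R(2,1) fg(2,1) g f] show ?thesis
    by (subst (1 2) nn_integral_sq_split) (auto intro!: mult_left_mono add_mono)
qed

lemma W2_eq:
  assumes \<rho>: "\<rho> \<in> P2" and \<eta>: "\<eta> \<in> P2"
  shows "W2 \<rho> \<eta> = dist (qf \<rho>) (qf \<eta>)"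
proof -
  note R = P2D(5)[OF \<rho>] P2D(5)[OF \<eta>]
  have [measurable]: "rearr \<rho> \<in> borel_measurable unit_lebesgue" "rearr \<eta> \<in> borel_measurable unit_lebesgue"
    using R by (auto intro: borel_measurable_UL rearr_measurable)
  let ?d = "\<integral>w. (rearr \<rho> w - rearr \<eta> w)\<^sup>2 \<partial>unit_lebesgue"
  have int: "integrable unit_lebesgue (\<lambda>w. (rearr \<rho> w - rearr \<eta> w)\<^sup>2)"
    by (intro SQ_sq_integrable SQ_diff rearr_SQ \<rho> \<eta>)
  let ?I = "\<lambda>\<gamma>. \<integral>z. (fst z - snd z)\<^sup>2 \<partial>\<gamma>"
  have opt: "opt_coupling \<rho> \<eta> \<in> couplings \<rho> \<eta>" "?I (opt_coupling \<rho> \<eta>) = ?d"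
  proof -
    have "distr (opt_coupling \<rho> \<eta>) borel fst = \<rho>"
      unfolding opt_coupling_def
      by (subst distr_distr) (auto simp: comp_def distr_rearr R borel_prod[symmetric])
    moreover have "distr (opt_coupling \<rho> \<eta>) borel snd = \<eta>"
      unfolding opt_coupling_def
      by (subst distr_distr) (auto simp: comp_def distr_rearr R borel_prod[symmetric])
    ultimately show "opt_coupling \<rho> \<eta> \<in> couplings \<rho> \<eta>" by (simp add: couplings_def opt_coupling_def)
    show "?I (opt_coupling \<rho> \<eta>) = ?d"
      unfolding opt_coupling_def by (subst integral_distr) (auto intro!: borel_measurable_Pair simp: borel_prod[symmetric])
  qed
  have low: "?d \<le> ?I \<gamma>" if \<gamma>: "\<gamma> \<in> couplings \<rho> \<eta>" for \<gamma>
  proof -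
    have s: "sets \<gamma> = sets borel" and m1: "distr \<gamma> borel fst = \<rho>" and m2: "distr \<gamma> borel snd = \<eta>"
      using \<gamma> by (auto simp: couplings_def)
    have [measurable]: "fst \<in> borel_measurable \<gamma>" "snd \<in> borel_measurable \<gamma>"
      using s by (simp_all cong: measurable_cong_sets add: borel_prod[symmetric])
    \<comment> \<open>Total mass one is inherited from the marginal.\<close>
    have P: "prob_space \<gamma>"
      using prob_space_distrD[of fst \<gamma> borel] P2D(1)[OF \<rho>] m1 by simp
    have "integrable \<gamma> (\<lambda>z. (fst z)\<^sup>2)" "integrable \<gamma> (\<lambda>z. (snd z)\<^sup>2)"
      using P2D(4)[OF \<rho>] P2D(4)[OF \<eta>] unfolding m1[symmetric] m2[symmetric]
      by (auto simp: integrable_distr_eq)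
    then have "integrable \<gamma> (\<lambda>z. 2 * (fst z)\<^sup>2 + 2 * (snd z)\<^sup>2)" by simp
    \<comment> \<open>The Bochner integral of a non-integrable cost would be 0 and undercut the
      infimum; finite second moments exclude this case.\<close>
    then have i: "integrable \<gamma> (\<lambda>z. (fst z - snd z)\<^sup>2)"
    proof (rule Bochner_Integration.integrable_bound)
      have "(x - y)\<^sup>2 \<le> 2 * x\<^sup>2 + 2 * y\<^sup>2" for x y :: real
        using zero_le_power2[of "x + y"] by (simp add: power2_sum power2_diff)
      then show "AE z in \<gamma>. norm ((fst z - snd z)\<^sup>2) \<le> norm (2 * (fst z)\<^sup>2 + 2 * (snd z)\<^sup>2)" by simp
    qed measurable
    have "ennreal ?d \<le> ennreal (?I \<gamma>)"
      using rearr_optimal[OF R P _ _ m1 m2] int i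
      by (simp add: nn_integral_eq_integral)
    then show ?thesis by (subst (asm) ennreal_le_iff) (auto intro: Bochner_Integration.integral_nonneg)
  qed
  have "(INF \<gamma>\<in>couplings \<rho> \<eta>. ?I \<gamma>) = ?d"
  proof (rule cInf_eq_minimum)
    show "?d \<in> ?I ` couplings \<rho> \<eta>"
      by (rule image_eqI[where x = "opt_coupling \<rho> \<eta>"]) (simp_all add: opt)
    fix x assume "x \<in> ?I ` couplings \<rho> \<eta>"
    then obtain \<gamma> where "\<gamma> \<in> couplings \<rho> \<eta>" "x = ?I \<gamma>" by blast
    then show "?d \<le> x" using low by simp
  qed
  then have "(W2 \<rho> \<eta>)\<^sup>2 = ?d"
    unfolding W2_def by (simp add: Bochner_Integration.integral_nonneg)
  also have "\<dots> = (dist (qf \<rho>) (qf \<eta>))\<^sup>2"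
    unfolding qf_def by (rule dist_cl_sq[symmetric]) (intro rearr_SQ \<rho> \<eta>)+
  finally show ?thesis
  proof (rule power2_eq_imp_eq)
    have "0 \<le> (INF \<gamma>\<in>couplings \<rho> \<eta>. ?I \<gamma>)"
    proof (rule cINF_greatest)
      show "couplings \<rho> \<eta> \<noteq> {}" using opt(1) by auto
    qed simp
    then show "0 \<le> W2 \<rho> \<eta>" by (simp add: W2_def)
  qed simp
qed

section \<open>Evolution variational inequalities\<close>

text \<open>Passing to the completion turns exceptional sets into negligible sets, whose images
  under differentiable and Lipschitz maps are again negligible.\<close>

lemma AE_lborel_iff_negligible: "(AE x in lborel. P x) \<longleftrightarrow> negligible {x::real. \<not> P x}"
proof -
  have "(AE x in lborel. P x) \<longleftrightarrow> (AE x in lebesgue. P x)" by (rule AE_completion_iff[symmetric])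
  also have "\<dots> \<longleftrightarrow> negligible {x. \<not> P x}"
  proof
    assume "AE x in lebesgue. P x"
    then obtain N where "N \<in> null_sets lebesgue" "{x. \<not> P x} \<subseteq> N"
      by (auto simp: eventually_ae_filter)
    then show "negligible {x. \<not> P x}"
      using negligible_subset negligible_iff_null_sets by blast
  next
    assume "negligible {x. \<not> P x}"
    then show "AE x in lebesgue. P x"
      using AE_not_in[of "{x. \<not> P x}" lebesgue] by (simp add: negligible_iff_null_sets)
  qed
  finally show ?thesis .
qed

text \<open>The bad parameters are contained in the image under \<open>k\<close> of the bad times,
  and differentiable images of negligible sets are negligible.\<close>

lemma AE_lborel_reparam:
  fixes h k :: "real \<Rightarrow> real"
  assumes Q: "AE t in lborel. t \<in> S \<longrightarrow> Q t" and k: "k differentiable_on S"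
    and hk: "\<And>\<tau>. \<tau> \<in> T \<Longrightarrow> h \<tau> \<in> S \<and> k (h \<tau>) = \<tau>"
  shows "AE \<tau> in lborel. \<tau> \<in> T \<longrightarrow> Q (h \<tau>)"
  unfolding AE_lborel_iff_negligible
proof (rule negligible_subset)
  have "negligible {t \<in> S. \<not> Q t}"
    using Q unfolding AE_lborel_iff_negligible by (simp add: conj_commute)
  then show "negligible (k ` {t \<in> S. \<not> Q t})"
    by (intro negligible_differentiable_image_negligible) (auto intro: differentiable_on_subset[OF k])
  show "{\<tau>. \<not> (\<tau> \<in> T \<longrightarrow> Q (h \<tau>))} \<subseteq> k ` {t \<in> S. \<not> Q t}"
  proof
    fix \<tau> assume "\<tau> \<in> {\<tau>. \<not> (\<tau> \<in> T \<longrightarrow> Q (h \<tau>))}"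
    then show "\<tau> \<in> k ` {t \<in> S. \<not> Q t}"
      using hk[of \<tau>] by (intro image_eqI[of _ _ "h \<tau>"]) auto
  qed
qed

text \<open>The Lipschitz image of the exceptional null set is negligible; a level that avoids it would be
  crossed upwards for the last time at a point where the derivative is negative.\<close>

lemma lipschitz_AE_deriv_nonpos:
  fixes f :: "real \<Rightarrow> real"
  assumes ab: "a \<le> b" and L: "\<And>s t. s \<in> {a..b} \<Longrightarrow> t \<in> {a..b} \<Longrightarrow> \<bar>f s - f t\<bar> \<le> L * \<bar>s - t\<bar>"
    and d: "AE t in lborel. t \<in> {a<..<b} \<longrightarrow> (\<exists>D\<le>0. (f has_real_derivative D) (at t))"
  shows "f b \<le> f a"
proof (rule ccontr)
  assume "\<not> f b \<le> f a"
  then have ab': "a < b" and fab: "f a < f b" using ab by (auto simp: le_less)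
  \<comment> \<open>Half the mean slope: subtracting \<open>e * t\<close> leaves half of the rise,
    while it makes every nonpositive derivative strictly negative.\<close>
  define e where "e = (f b - f a) / 2 / (b - a)"
  have e: "e > 0" using ab' fab by (simp add: e_def)
  define g where "g t = f t - e * t" for t
  have gab: "g a < g b"
  proof -
    have "e * (b - a) = (f b - f a) / 2" unfolding e_def
      by (rule nonzero_eq_divide_eq[THEN iffD1, OF _ refl]) (use ab' in simp)
    then show ?thesis using fab by (simp add: g_def algebra_simps)
  qed
  have gL: "\<bar>g s - g t\<bar> \<le> (L + e) * \<bar>s - t\<bar>" if "s \<in> {a..b}" "t \<in> {a..b}" for s t
  proof -
    have "g s - g t = (f s - f t) - e * (s - t)" by (simp add: g_def algebra_simps)
    then have "\<bar>g s - g t\<bar> \<le> \<bar>f s - f t\<bar> + \<bar>e * (s - t)\<bar>"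
      by (simp only: abs_triangle_ineq4)
    also have "\<bar>e * (s - t)\<bar> = e * \<bar>s - t\<bar>" using e by (simp add: abs_mult)
    finally show ?thesis using L[OF that] by (simp add: distrib_right)
  qed
  have L0: "0 \<le> L + e"
  proof -
    have "0 \<le> (L + e) * \<bar>a - b\<bar>" using order_trans[OF abs_ge_zero gL[of a b]] ab by simp
    then show ?thesis using ab' by (simp add: zero_le_mult_iff)
  qed
  have cont: "continuous_on {a..b} g"
    by (rule lipschitz_on_continuous_on[of "L + e"], rule lipschitz_onI)
      (use gL L0 in \<open>auto simp: dist_real_def\<close>)
  define N where "N = {t \<in> {a<..<b}. \<not> (\<exists>D\<le>0. (f has_real_derivative D) (at t))}"
  have "negligible N"
    using d unfolding AE_lborel_iff_negligible N_def by (simp add: conj_commute)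
  then have "negligible (g ` N)"
  proof (rule negligible_locally_Lipschitz_image[OF order_refl])
    fix x assume "x \<in> N"
    then show "\<exists>T B. open T \<and> x \<in> T \<and> (\<forall>y\<in>N \<inter> T. norm (g y - g x) \<le> B * norm (y - x))"
      using gL by (intro exI[of _ UNIV] exI[of _ "L + e"]) (auto simp: N_def)
  qed
  moreover have "\<not> negligible {g a<..<g b}"
    using gab by (intro open_not_negligible) auto
  ultimately obtain y where y: "g a < y" "y < g b" "y \<notin> g ` N"
    using negligible_subset by (metis greaterThanLessThan_iff subsetI)
  let ?S = "{t \<in> {a..b}. g t \<le> y}"
  have C: "compact ?S"
  proof -
    have "closed ({a..b} \<inter> g -` {..y})" by (rule continuous_closed_preimage[OF cont]) auto
    moreover have "?S = {a..b} \<inter> g -` {..y}" by auto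
    ultimately show ?thesis by (metis bounded_closed_interval bounded_subset compact_eq_bounded_closed inf_le1)
  qed
  have NE: "?S \<noteq> {}" using y(1) ab by (auto intro!: exI[of _ a])
  from compact_attains_sup[OF C NE] obtain s where s0: "s \<in> ?S" "\<forall>t\<in>?S. t \<le> s" ..
  then have s: "s \<in> ?S" "\<And>t. t \<in> ?S \<Longrightarrow> t \<le> s" by simp_all
  have sb: "s < b" using s y by (cases "s = b") auto
  have gs: "g s = y"
  proof (rule antisym)
    show "g s \<le> y" using s by simp
    have "continuous_on {s..b} g" using cont s by (auto intro: continuous_on_subset)
    then obtain t where "s \<le> t" "t \<le> b" "g t = y"
      using IVT'[of g s y b] s(1) sb y by auto
    then show "y \<le> g s" using s(2)[of t] s(1) by auto
  qed
  have sa: "a < s" using gs y s by (cases "s = a") auto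
  then have "s \<in> {a<..<b}" "s \<notin> N" using sb gs y by auto
  then obtain D where D: "D \<le> 0" "(f has_real_derivative D) (at s)" by (auto simp: N_def)
  have "(g has_real_derivative (D - e)) (at s)"
    unfolding g_def using D(2) by (auto intro!: derivative_eq_intros)
  moreover have "D - e < 0" using D e by simp
  ultimately obtain \<delta> where \<delta>: "\<delta> > 0" "\<And>h. 0 < h \<Longrightarrow> h < \<delta> \<Longrightarrow> g (s + h) < g s"
    using DERIV_neg_dec_right by blast
  define h where "h = min (\<delta> / 2) (b - s)"
  have h: "0 < h" "h < \<delta>" "s + h \<le> b" using \<delta> sb by (auto simp: h_def)
  then have "s + h \<in> ?S" using \<delta>(2)[of h] gs s(1) by auto
  then show False using s(2) h by fastforce
qed

lemma has_real_derivative_zero_quadratic: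
  fixes g :: "real \<Rightarrow> real"
  assumes e: "e > 0" and C: "\<And>s. \<bar>s - t\<bar> < e \<Longrightarrow> \<bar>g s\<bar> \<le> C * (s - t)\<^sup>2"
  shows "(g has_real_derivative 0) (at t)"
proof -
  have g0: "g t = 0" using C[of t] e by simp
  have "((\<lambda>h. (g (t + h) - g t) / h) \<longlongrightarrow> 0) (at 0)"
  proof (rule Lim_null_comparison)
    show "\<forall>\<^sub>F h in at 0. norm ((g (t + h) - g t) / h) \<le> \<bar>C * h\<bar>"
      unfolding eventually_at
    proof (intro exI[of _ e] conjI ballI impI)
      fix h :: real assume h: "h \<noteq> 0 \<and> dist h 0 < e"
      then have "\<bar>g (t + h)\<bar> \<le> C * h\<^sup>2" using C[of "t + h"] by (simp add: dist_real_def)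
      then have "\<bar>g (t + h)\<bar> / \<bar>h\<bar> \<le> C * h\<^sup>2 / \<bar>h\<bar>" by (intro divide_right_mono) auto
      also have "\<dots> = C * \<bar>h\<bar>" using h by (simp add: power2_eq_square) (simp add: field_simps)
      also have "\<dots> \<le> \<bar>C * h\<bar>" by (simp add: abs_mult mult_right_mono)
      finally show "norm ((g (t + h) - g t) / h) \<le> \<bar>C * h\<bar>" by (simp add: g0)
    qed (rule e)
    have "((\<lambda>h. \<bar>C * h\<bar>) \<longlongrightarrow> \<bar>C * 0\<bar>) (at 0)" by (intro tendsto_intros)
    then show "((\<lambda>h. \<bar>C * h\<bar>) \<longlongrightarrow> 0) (at 0)" by simp
  qed
  then show ?thesis by (simp add: DERIV_def)
qed

text \<open>Isolates the interaction of two moving points in the product of their increments. For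
  Lipschitz curves this product is quadratic in time, so the diagonal can be differentiated one
  curve at a time.\<close>

lemma norm_diff_curves:
  fixes x y x' y' :: "'a::real_inner"
  shows "(norm (x' - y'))\<^sup>2 = (norm (x' - y))\<^sup>2 + (norm (y' - x))\<^sup>2 - (norm (x - y))\<^sup>2 - 2 * inner (x' - x) (y' - y)"
  by (simp add: power2_norm_eq_inner inner_diff_left inner_diff_right inner_commute)

text \<open>Each curve is tested against the current position of the other. Adding the two
  inequalities cancels the values of \<phi> and leaves a derivative of the squared distance of at
  most twice that distance; the factor \<open>exp (- 2 * t)\<close> then makes it nonincreasing, as
  in Gronwall's lemma.\<close>

lemma evi_contraction:
  fixes X Y :: "real \<Rightarrow> 'a::real_inner" and \<phi> :: "'a \<Rightarrow> real"
  assumes ab: "a \<le> b"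
    and LX: "\<And>s t. s \<in> {a..b} \<Longrightarrow> t \<in> {a..b} \<Longrightarrow> norm (X s - X t) \<le> L * \<bar>s - t\<bar>"
    and LY: "\<And>s t. s \<in> {a..b} \<Longrightarrow> t \<in> {a..b} \<Longrightarrow> norm (Y s - Y t) \<le> M * \<bar>s - t\<bar>"
    and K: "\<And>t. t \<in> {a..b} \<Longrightarrow> X t \<in> K \<and> Y t \<in> K"
    and EX: "AE t in lborel. t \<in> {a<..<b} \<longrightarrow> (\<forall>\<eta>\<in>K. \<exists>D. ((\<lambda>s. (norm (X s - \<eta>))\<^sup>2) has_real_derivative D) (at t) \<and>
        (1/2) * D - (1/2) * (norm (X t - \<eta>))\<^sup>2 \<le> \<phi> \<eta> - \<phi> (X t))"
    and EY: "AE t in lborel. t \<in> {a<..<b} \<longrightarrow> (\<forall>\<eta>\<in>K. \<exists>D. ((\<lambda>s. (norm (Y s - \<eta>))\<^sup>2) has_real_derivative D) (at t) \<and>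
        (1/2) * D - (1/2) * (norm (Y t - \<eta>))\<^sup>2 \<le> \<phi> \<eta> - \<phi> (Y t))"
  shows "norm (X b - Y b) \<le> exp (b - a) * norm (X a - Y a)"
proof -
  define F where "F t = (norm (X t - Y t))\<^sup>2" for t
  define f where "f t = exp (- 2 * t) * F t" for t
  have LM: "L * \<bar>s - t\<bar> \<ge> 0" "M * \<bar>s - t\<bar> \<ge> 0" if "s \<in> {a..b}" "t \<in> {a..b}" for s t
    using order_trans[OF norm_ge_zero LX[OF that]] order_trans[OF norm_ge_zero LY[OF that]] .
  define B where "B = norm (X a - Y a) + L * \<bar>b - a\<bar> + M * \<bar>b - a\<bar>"
  have incr: "norm (X t - Y t) \<le> norm (X s - Y s) + L * \<bar>t - s\<bar> + M * \<bar>t - s\<bar>"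
    if "s \<in> {a..b}" "t \<in> {a..b}" for s t
  proof -
    have eq: "X t - Y t = (X s - Y s) + (X t - X s) - (Y t - Y s)" by simp
    have "norm (X t - Y t) \<le> norm (X s - Y s) + norm (X t - X s) + norm (Y t - Y s)"
      unfolding eq using norm_triangle_ineq4[of "(X s - Y s) + (X t - X s)" "Y t - Y s"]
        norm_triangle_ineq[of "X s - Y s" "X t - X s"] by linarith
    then show ?thesis using LX[OF that(2,1)] LY[OF that(2,1)] by linarith
  qed
  have LMp: "(L + M) * \<bar>s - t\<bar> \<ge> 0" if "s \<in> {a..b}" "t \<in> {a..b}" for s t
    using LM[OF that] by (simp add: distrib_right)
  have nB: "norm (X t - Y t) \<le> B" if t: "t \<in> {a..b}" for t
  \<comment> \<open>On a one-point interval the Lipschitz constants may be negative; otherwise they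
    are not.\<close>
  proof (cases "a = b")
    case False
    have "0 \<le> L" "0 \<le> M" using LM[of a b] ab False by (auto simp: zero_le_mult_iff)
    then have "L * \<bar>t - a\<bar> \<le> L * \<bar>b - a\<bar>" "M * \<bar>t - a\<bar> \<le> M * \<bar>b - a\<bar>"
      using t by (auto intro: mult_left_mono)
    then show ?thesis using incr[of a t] t by (simp add: B_def)
  qed (use t in \<open>simp add: B_def\<close>)
  have B0: "0 \<le> B" using order_trans[OF norm_ge_zero nB[of a]] ab by simp
  have FL: "\<bar>F s - F t\<bar> \<le> 2 * B * (L + M) * \<bar>s - t\<bar>" if st: "s \<in> {a..b}" "t \<in> {a..b}" for s t
  proof -
    let ?p = "norm (X s - Y s)" and ?q = "norm (X t - Y t)"
    have "\<bar>?p - ?q\<bar> \<le> (L + M) * \<bar>s - t\<bar>"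
      using incr[OF st] incr[OF st(2,1)] by (simp add: distrib_right abs_minus_commute abs_le_iff)
    moreover have "\<bar>?p + ?q\<bar> \<le> 2 * B" using nB[OF st(1)] nB[OF st(2)] by simp
    ultimately have "\<bar>?p + ?q\<bar> * \<bar>?p - ?q\<bar> \<le> 2 * B * ((L + M) * \<bar>s - t\<bar>)"
      using B0 by (intro mult_mono) auto
    moreover have "F s - F t = (?p + ?q) * (?p - ?q)" by (simp add: F_def power2_eq_square algebra_simps)
    ultimately show ?thesis by (simp add: abs_mult mult.assoc)
  qed
  have FB: "\<bar>F t\<bar> \<le> B\<^sup>2" if "t \<in> {a..b}" for t
    using nB[OF that] by (simp add: F_def power_mono)
  have eL: "\<bar>exp (- 2 * s) - exp (- 2 * t)\<bar> \<le> 2 * exp (- 2 * a) * \<bar>s - t\<bar>"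
    if "s \<in> {a..b}" "t \<in> {a..b}" for s t
  proof -
    have "norm (exp (- 2 * s) - exp (- 2 * t)) \<le> 2 * exp (- 2 * a) * norm (s - t)"
    proof (rule field_differentiable_bound[where S = "{a..b}" and f' = "\<lambda>t. - 2 * exp (- 2 * t)"])
      show "((\<lambda>t. exp (- 2 * t)) has_real_derivative - 2 * exp (- 2 * z)) (at z within {a..b})" for z
        by (auto intro!: derivative_eq_intros)
    qed (use that in auto)
    then show ?thesis by simp
  qed
  have "f b \<le> f a"
  proof (rule lipschitz_AE_deriv_nonpos[OF ab])
    fix s t assume st: "s \<in> {a..b}" "t \<in> {a..b}"
    have "f s - f t = exp (- 2 * s) * (F s - F t) + (exp (- 2 * s) - exp (- 2 * t)) * F t"
      by (simp add: f_def algebra_simps)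
    then have "\<bar>f s - f t\<bar> \<le> exp (- 2 * s) * \<bar>F s - F t\<bar> + \<bar>exp (- 2 * s) - exp (- 2 * t)\<bar> * \<bar>F t\<bar>"
      using abs_triangle_ineq[of "exp (- 2 * s) * (F s - F t)" "(exp (- 2 * s) - exp (- 2 * t)) * F t"]
      by (simp only: abs_mult abs_exp_cancel)
    also have "\<dots> \<le> exp (- 2 * a) * (2 * B * (L + M) * \<bar>s - t\<bar>) + (2 * exp (- 2 * a) * \<bar>s - t\<bar>) * B\<^sup>2"
      using st FL[OF st] FB[OF st(2)] eL[OF st] by (intro add_mono mult_mono) auto
    finally show "\<bar>f s - f t\<bar> \<le> (exp (- 2 * a) * (2 * B * (L + M)) + 2 * exp (- 2 * a) * B\<^sup>2) * \<bar>s - t\<bar>"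
      by (simp add: algebra_simps)
  next
    show "AE t in lborel. t \<in> {a<..<b} \<longrightarrow> (\<exists>D\<le>0. (f has_real_derivative D) (at t))"
      using EX EY
    proof eventually_elim
      case (elim t)
      show ?case
      proof
        assume t: "t \<in> {a<..<b}"
        then have tab: "t \<in> {a..b}" by simp
        obtain D1 where D1: "((\<lambda>s. (norm (X s - Y t))\<^sup>2) has_real_derivative D1) (at t)"
          "(1/2) * D1 - (1/2) * (norm (X t - Y t))\<^sup>2 \<le> \<phi> (Y t) - \<phi> (X t)"
          using elim(1) t K[OF tab] by blast
        obtain D2 where D2: "((\<lambda>s. (norm (Y s - X t))\<^sup>2) has_real_derivative D2) (at t)"
          "(1/2) * D2 - (1/2) * (norm (Y t - X t))\<^sup>2 \<le> \<phi> (X t) - \<phi> (Y t)"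
          using elim(2) t K[OF tab] by blast
        have q: "((\<lambda>s. inner (X s - X t) (Y s - Y t)) has_real_derivative 0) (at t)"
        proof (rule has_real_derivative_zero_quadratic)
          show "min (t - a) (b - t) > 0" using t by simp
          fix s assume "\<bar>s - t\<bar> < min (t - a) (b - t)"
          then have s: "s \<in> {a..b}" by auto
          have "\<bar>inner (X s - X t) (Y s - Y t)\<bar> \<le> norm (X s - X t) * norm (Y s - Y t)"
            by (rule Cauchy_Schwarz_ineq2)
          also have "\<dots> \<le> (L * \<bar>s - t\<bar>) * (M * \<bar>s - t\<bar>)"
            using LX[OF s tab] LY[OF s tab] LM[OF s tab] by (intro mult_mono) auto
          also have "\<dots> = L * M * (s - t)\<^sup>2" by (simp add: power2_eq_square)
          finally show "\<bar>inner (X s - X t) (Y s - Y t)\<bar> \<le> L * M * (s - t)\<^sup>2" .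
        qed
        have "F = (\<lambda>s. (norm (X s - Y t))\<^sup>2 + (norm (Y s - X t))\<^sup>2 - (norm (X t - Y t))\<^sup>2
            - 2 * inner (X s - X t) (Y s - Y t))"
          unfolding F_def using norm_diff_curves by blast
        then have F: "(F has_real_derivative (D1 + D2)) (at t)"
          using DERIV_diff[OF DERIV_diff[OF DERIV_add[OF D1(1) D2(1)] DERIV_const] DERIV_cmult[OF q, of 2]]
          by simp
        have D: "D1 + D2 \<le> 2 * F t" using D1(2) D2(2) by (simp add: F_def norm_minus_commute)
        have "(f has_real_derivative (exp (- 2 * t) * (D1 + D2 - 2 * F t))) (at t)"
          unfolding f_def using F by (auto intro!: derivative_eq_intros simp: algebra_simps)
        moreover have "exp (- 2 * t) * (D1 + D2 - 2 * F t) \<le> 0" using D by (simp add: mult_le_0_iff)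
        ultimately show "\<exists>D\<le>0. (f has_real_derivative D) (at t)" by blast
      qed
    qed
  qed
  then have "exp (2 * b) * (exp (- 2 * b) * F b) \<le> exp (2 * b) * (exp (- 2 * a) * F a)"
    by (simp add: f_def)
  then have "F b \<le> exp (2 * b - 2 * a) * F a"
    by (simp add: exp_minus exp_diff field_simps)
  also have "exp (2 * b - 2 * a) = (exp (b - a))\<^sup>2"
    by (simp add: exp_double[symmetric] algebra_simps)
  finally have "(norm (X b - Y b))\<^sup>2 \<le> (exp (b - a) * norm (X a - Y a))\<^sup>2"
    by (simp add: F_def power_mult_distrib)
  then show ?thesis by (rule power2_le_imp_le) simp
qed

section \<open>Uniqueness of gradient flow trajectories\<close>

lemma W2_sq: "\<rho> \<in> P2 \<Longrightarrow> \<eta> \<in> P2 \<Longrightarrow> (W2 \<rho> \<eta>)\<^sup>2 = (norm (qf \<rho> - qf \<eta>))\<^sup>2"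
  by (simp add: W2_eq dist_norm)

lemma phi_eq: "\<rho> \<in> P2 \<Longrightarrow> \<sigma> \<in> P2 \<Longrightarrow> phi \<sigma> \<rho> = - (1/2) * (norm (qf \<rho> - qf \<sigma>))\<^sup>2"
  by (simp add: phi_def W2_sq)

lemma DERIV_cong_open:
  fixes f g :: "real \<Rightarrow> real"
  assumes "(f has_real_derivative D) (at t)" "open S" "t \<in> S" "\<And>s. s \<in> S \<Longrightarrow> f s = g s"
  shows "(g has_real_derivative D) (at t)"
  using assms(4) DERIV_cong_ev[OF refl eventually_nhds_in_open[OF assms(2,3), THEN eventually_mono] refl, of f g D] assms(1)
  by blast

text \<open>Each \<open>y\<close> in the cone is tested through its law. Openness of
  \<open>I\<close> lets the derivative be taken of a function known only for times in
  \<open>I\<close>.\<close>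

lemma EVI_norm_form:
  assumes E: "AE t in lborel. t \<in> I \<longrightarrow> (\<forall>\<eta>\<in>P2. \<exists>D.
      ((\<lambda>s. (W2 (r s) \<eta>)\<^sup>2) has_real_derivative D) (at t) \<and>
      (1/2) * D - (1/2) * (W2 (r t) \<eta>)\<^sup>2 \<le> phi \<sigma> \<eta> - phi \<sigma> (r t))"
    and \<sigma>: "\<sigma> \<in> P2" and I: "open I" and r: "\<And>t. t \<in> I \<Longrightarrow> r t \<in> P2"
  shows "AE t in lborel. t \<in> I \<longrightarrow> (\<forall>y\<in>MK. \<exists>D.
      ((\<lambda>s. (norm (qf (r s) - y))\<^sup>2) has_real_derivative D) (at t) \<and>
      (1/2) * D - (1/2) * (norm (qf (r t) - y))\<^sup>2
        \<le> - (1/2) * (norm (y - qf \<sigma>))\<^sup>2 - (- (1/2) * (norm (qf (r t) - qf \<sigma>))\<^sup>2))"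
  using E
proof eventually_elim
  case (elim t)
  show ?case
  proof (intro impI ballI)
    fix y assume t: "t \<in> I" and y: "y \<in> MK"
    obtain D where D: "((\<lambda>s. (W2 (r s) (law y))\<^sup>2) has_real_derivative D) (at t)"
      "(1/2) * D - (1/2) * (W2 (r t) (law y))\<^sup>2 \<le> phi \<sigma> (law y) - phi \<sigma> (r t)"
      using elim t law_P2[of y] by blast
    have "((\<lambda>s. (norm (qf (r s) - y))\<^sup>2) has_real_derivative D) (at t)"
      by (rule DERIV_cong_open[OF D(1) I t]) (simp add: W2_sq r law_P2 qf_law y)
    then show "\<exists>D. ((\<lambda>s. (norm (qf (r s) - y))\<^sup>2) has_real_derivative D) (at t) \<and>
      (1/2) * D - (1/2) * (norm (qf (r t) - y))\<^sup>2
        \<le> - (1/2) * (norm (y - qf \<sigma>))\<^sup>2 - (- (1/2) * (norm (qf (r t) - qf \<sigma>))\<^sup>2)"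
      using D(2) by (intro exI[of _ D]) (simp add: W2_sq phi_eq r t law_P2 qf_law y \<sigma>)
  qed
qed

lemma EVI_on_subset: "EVI_on I \<sigma> r \<Longrightarrow> J \<subseteq> I \<Longrightarrow> EVI_on J \<sigma> r"
  unfolding EVI_on_def by (elim eventually_mono) blast

lemma EVI_on_contraction:
  assumes ab: "a \<le> b" and \<sigma>: "\<sigma> \<in> P2"
    and r: "\<And>t. t \<in> {a..b} \<Longrightarrow> r t \<in> P2" and q: "\<And>t. t \<in> {a..b} \<Longrightarrow> q t \<in> P2"
    and Lr: "\<And>s t. s \<in> {a..b} \<Longrightarrow> t \<in> {a..b} \<Longrightarrow> W2 (r s) (r t) \<le> L * \<bar>s - t\<bar>"
    and Lq: "\<And>s t. s \<in> {a..b} \<Longrightarrow> t \<in> {a..b} \<Longrightarrow> W2 (q s) (q t) \<le> M * \<bar>s - t\<bar>"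
    and Er: "EVI_on {a<..<b} \<sigma> r" and Eq: "EVI_on {a<..<b} \<sigma> q"
  shows "W2 (r b) (q b) \<le> exp (b - a) * W2 (r a) (q a)"
proof -
  have "norm (qf (r b) - qf (q b)) \<le> exp (b - a) * norm (qf (r a) - qf (q a))"
  proof (rule evi_contraction[OF ab, where K = MK and \<phi> = "\<lambda>y. - (1/2) * (norm (y - qf \<sigma>))\<^sup>2"])
    show "norm (qf (r s) - qf (r t)) \<le> L * \<bar>s - t\<bar>" "norm (qf (q s) - qf (q t)) \<le> M * \<bar>s - t\<bar>"
      if "s \<in> {a..b}" "t \<in> {a..b}" for s t
      using Lr[OF that] Lq[OF that] that by (simp_all add: W2_eq r q dist_norm)
    show "qf (r t) \<in> MK \<and> qf (q t) \<in> MK" if "t \<in> {a..b}" for t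
      using that by (simp add: qf_MK r q)
    show "AE t in lborel. t \<in> {a<..<b} \<longrightarrow> (\<forall>\<eta>\<in>MK. \<exists>D. ((\<lambda>s. (norm (qf (r s) - \<eta>))\<^sup>2) has_real_derivative D) (at t) \<and>
        (1/2) * D - (1/2) * (norm (qf (r t) - \<eta>))\<^sup>2
         \<le> - (1/2) * (norm (\<eta> - qf \<sigma>))\<^sup>2 - (- (1/2) * (norm (qf (r t) - qf \<sigma>))\<^sup>2))"
      by (rule EVI_norm_form[OF Er[unfolded EVI_on_def] \<sigma>]) (auto intro: r)
    show "AE t in lborel. t \<in> {a<..<b} \<longrightarrow> (\<forall>\<eta>\<in>MK. \<exists>D. ((\<lambda>s. (norm (qf (q s) - \<eta>))\<^sup>2) has_real_derivative D) (at t) \<and>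
        (1/2) * D - (1/2) * (norm (qf (q t) - \<eta>))\<^sup>2
         \<le> - (1/2) * (norm (\<eta> - qf \<sigma>))\<^sup>2 - (- (1/2) * (norm (qf (q t) - qf \<sigma>))\<^sup>2))"
      by (rule EVI_norm_form[OF Eq[unfolded EVI_on_def] \<sigma>]) (auto intro: q)
  qed
  then show ?thesis using ab by (simp add: W2_eq r q dist_norm)
qed

lemma W2_self: "\<rho> \<in> P2 \<Longrightarrow> W2 \<rho> \<rho> = 0"
  by (simp add: W2_eq)

lemma W2_zeroD: "\<rho> \<in> P2 \<Longrightarrow> \<eta> \<in> P2 \<Longrightarrow> W2 \<rho> \<eta> \<le> 0 \<Longrightarrow> \<rho> = \<eta>"
  using qf_inj[of \<rho> \<eta>] by (simp add: W2_eq)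

lemma W2_nonneg: "\<rho> \<in> P2 \<Longrightarrow> \<eta> \<in> P2 \<Longrightarrow> 0 \<le> W2 \<rho> \<eta>"
  by (simp add: W2_eq)

lemma flow_trajectory_unique:
  assumes \<sigma>: "\<sigma> \<in> P2" and r: "flow_trajectory \<sigma> \<rho> r" and q: "flow_trajectory \<sigma> \<rho> q" and t: "0 \<le> t"
  shows "r t = q t"
proof (cases "t = 0")
  case True
  then show ?thesis using r q by (simp add: flow_trajectory_def)
next
  case False
  then have t: "t > 0" using t by simp
  have rP: "\<And>t. 0 \<le> t \<Longrightarrow> r t \<in> P2" and qP: "\<And>t. 0 \<le> t \<Longrightarrow> q t \<in> P2" and 0: "r 0 = \<rho>" "q 0 = \<rho>"
    using r q by (auto simp: flow_trajectory_def locally_lipschitz_curve_def)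
  obtain L where L: "\<forall>s\<in>{0..t}. \<forall>t\<in>{0..t}. W2 (r s) (r t) \<le> L * \<bar>s - t\<bar>"
    using r t by (auto simp: flow_trajectory_def locally_lipschitz_curve_def)
  obtain M where M: "\<forall>s\<in>{0..t}. \<forall>t\<in>{0..t}. W2 (q s) (q t) \<le> M * \<bar>s - t\<bar>"
    using q t by (auto simp: flow_trajectory_def locally_lipschitz_curve_def)
  have E: "EVI_on {0<..<t} \<sigma> r" "EVI_on {0<..<t} \<sigma> q"
    using r q by (auto simp: flow_trajectory_def intro: EVI_on_subset)
  have "W2 (r t) (q t) \<le> exp (t - 0) * W2 (r 0) (q 0)"
    by (rule EVI_on_contraction[OF _ \<sigma> _ _ _ _ E, of L M]) (use t rP qP L M in auto)
  also have "\<dots> = 0" using W2_self[OF rP[of 0]] by (simp add: 0)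
  finally show ?thesis using W2_zeroD rP qP t by simp
qed

text \<open>All trajectories from \<rho> pass through the same point at time \<open>t\<close>, so
  exhibiting a single one evaluates the description by \<open>THE\<close>.\<close>

lemma grad_flow_eq:
  assumes "\<sigma> \<in> P2" "flow_trajectory \<sigma> \<rho> r" "0 \<le> t"
  shows "grad_flow \<sigma> t \<rho> = r t"
  unfolding grad_flow_def
proof (rule the_equality)
  show "\<exists>q. flow_trajectory \<sigma> \<rho> q \<and> q t = r t" using assms(2) by blast
  show "\<nu> = r t" if "\<exists>q. flow_trajectory \<sigma> \<rho> q \<and> q t = \<nu>" for \<nu>
    using that flow_trajectory_unique[OF assms(1) _ assms(2,3)] by blast
qed

section \<open>Logarithmic time\<close>

lemma EVI_deriv_exp_iff:
  fixes f :: "real \<Rightarrow> real"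
  assumes t: "t > 0"
  shows "((\<lambda>\<tau>. f (exp \<tau>)) has_real_derivative t * D) (at (ln t)) \<longleftrightarrow> (f has_real_derivative D) (at t)"
proof
  assume "(f has_real_derivative D) (at t)"
  then have "(f has_real_derivative D) (at (exp (ln t)))" using t by simp
  from DERIV_chain2[OF this DERIV_exp] show "((\<lambda>\<tau>. f (exp \<tau>)) has_real_derivative t * D) (at (ln t))"
    using t by (simp add: mult.commute)
next
  assume "((\<lambda>\<tau>. f (exp \<tau>)) has_real_derivative t * D) (at (ln t))"
  from DERIV_chain2[OF this DERIV_ln_divide[OF t]]
  have "((\<lambda>x. f (exp (ln x))) has_real_derivative D) (at t)" using t by simp
  then show "(f has_real_derivative D) (at t)"
    by (rule DERIV_cong_open[where S = "{0<..}"]) (use t in auto)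
qed

text \<open>The weight \<open>t\<close> in front of the derivative is the derivative of the
  exponential at \<open>ln t\<close>, and null sets of times correspond under \<open>exp\<close> and
  \<open>ln\<close>.\<close>

lemma sticky_EVI_iff_EVI_exp: "sticky_EVI \<sigma> r \<longleftrightarrow> EVI_on UNIV \<sigma> (\<lambda>\<tau>. r (exp \<tau>))"
proof -
  define P where "P t \<longleftrightarrow> (\<forall>\<eta>\<in>P2. \<exists>D.
      ((\<lambda>s. (W2 (r s) \<eta>)\<^sup>2) has_real_derivative D) (at t) \<and>
      (t/2) * D - (1/2) * (W2 (r t) \<eta>)\<^sup>2 \<le> phi \<sigma> \<eta> - phi \<sigma> (r t))" for t
  define Q where "Q \<tau> \<longleftrightarrow> (\<forall>\<eta>\<in>P2. \<exists>D.
      ((\<lambda>s. (W2 (r (exp s)) \<eta>)\<^sup>2) has_real_derivative D) (at \<tau>) \<and>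
      (1/2) * D - (1/2) * (W2 (r (exp \<tau>)) \<eta>)\<^sup>2 \<le> phi \<sigma> \<eta> - phi \<sigma> (r (exp \<tau>)))" for \<tau>
  have PQ: "P t \<longleftrightarrow> Q (ln t)" if t: "0 < t" for t
  proof -
    have "(\<exists>D. ((\<lambda>s. (W2 (r s) \<eta>)\<^sup>2) has_real_derivative D) (at t) \<and> (t/2) * D - c \<le> d) \<longleftrightarrow>
        (\<exists>D. ((\<lambda>s. (W2 (r (exp s)) \<eta>)\<^sup>2) has_real_derivative D) (at (ln t)) \<and> (1/2) * D - c \<le> d)" for \<eta> c d
    proof
      assume "\<exists>D. ((\<lambda>s. (W2 (r s) \<eta>)\<^sup>2) has_real_derivative D) (at t) \<and> (t/2) * D - c \<le> d"
      then obtain D where "((\<lambda>s. (W2 (r s) \<eta>)\<^sup>2) has_real_derivative D) (at t)" "(t/2) * D - c \<le> d" by blast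
      then show "\<exists>D. ((\<lambda>s. (W2 (r (exp s)) \<eta>)\<^sup>2) has_real_derivative D) (at (ln t)) \<and> (1/2) * D - c \<le> d"
        using EVI_deriv_exp_iff[OF t, of "\<lambda>s. (W2 (r s) \<eta>)\<^sup>2" D] by (intro exI[of _ "t * D"]) auto
    next
      assume "\<exists>D. ((\<lambda>s. (W2 (r (exp s)) \<eta>)\<^sup>2) has_real_derivative D) (at (ln t)) \<and> (1/2) * D - c \<le> d"
      then obtain D where "((\<lambda>s. (W2 (r (exp s)) \<eta>)\<^sup>2) has_real_derivative D) (at (ln t))" "(1/2) * D - c \<le> d" by blast
      then show "\<exists>D. ((\<lambda>s. (W2 (r s) \<eta>)\<^sup>2) has_real_derivative D) (at t) \<and> (t/2) * D - c \<le> d"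
        using EVI_deriv_exp_iff[OF t, of "\<lambda>s. (W2 (r s) \<eta>)\<^sup>2" "D / t"] t by (intro exI[of _ "D / t"]) auto
    qed
    then show ?thesis using t by (simp add: P_def Q_def)
  qed
  have "(AE t in lborel. t \<in> {0<..} \<longrightarrow> P t) \<longleftrightarrow> (AE \<tau> in lborel. \<tau> \<in> UNIV \<longrightarrow> Q \<tau>)"
  proof
    assume "AE t in lborel. t \<in> {0<..} \<longrightarrow> P t"
    then have "AE \<tau> in lborel. \<tau> \<in> UNIV \<longrightarrow> P (exp \<tau>)"
    proof (rule AE_lborel_reparam[where h = exp and k = ln])
      show "ln differentiable_on {0::real<..}"
        unfolding differentiable_on_def real_differentiable_def
        by (auto intro!: exI DERIV_ln_divide[THEN has_field_derivative_at_within])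
    qed auto
    then show "AE \<tau> in lborel. \<tau> \<in> UNIV \<longrightarrow> Q \<tau>" by (rule eventually_mono) (simp add: PQ)
  next
    assume "AE \<tau> in lborel. \<tau> \<in> UNIV \<longrightarrow> Q \<tau>"
    then have "AE t in lborel. t \<in> {0<..} \<longrightarrow> Q (ln t)"
    proof (rule AE_lborel_reparam[where h = ln and k = exp])
      show "exp differentiable_on (UNIV :: real set)"
        unfolding differentiable_on_def real_differentiable_def
        by (auto intro!: exI DERIV_exp[THEN has_field_derivative_at_within])
    qed auto
    then show "AE t in lborel. t \<in> {0<..} \<longrightarrow> P t" by (rule eventually_mono) (simp add: PQ)
  qed
  then show ?thesis by (simp add: sticky_EVI_def EVI_on_def P_def[abs_def] Q_def[abs_def])
qed

lemma EVI_on_shift: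
  assumes "EVI_on UNIV \<sigma> r"
  shows "EVI_on UNIV \<sigma> (\<lambda>\<tau>. r (c + \<tau>))"
proof -
  let ?Q = "\<lambda>r \<tau>. \<forall>\<eta>\<in>P2. \<exists>D. ((\<lambda>s. (W2 (r s) \<eta>)\<^sup>2) has_real_derivative D) (at \<tau>) \<and>
      (1/2) * D - (1/2) * (W2 (r \<tau>) \<eta>)\<^sup>2 \<le> phi \<sigma> \<eta> - phi \<sigma> (r \<tau>)"
  have "AE \<tau> in lborel. \<tau> \<in> UNIV \<longrightarrow> ?Q r \<tau>" using assms by (simp add: EVI_on_def)
  then have "AE \<tau> in lborel. \<tau> \<in> UNIV \<longrightarrow> ?Q r (c + \<tau>)"
    by (rule AE_lborel_reparam[where k = "\<lambda>t. t - c"]) (auto intro!: derivative_intros)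
  then show ?thesis
    unfolding EVI_on_def
  proof eventually_elim
    case (elim \<tau>)
    show ?case
    proof (intro impI ballI)
      fix \<eta> assume "\<eta> \<in> P2"
      then obtain D where D: "((\<lambda>s. (W2 (r s) \<eta>)\<^sup>2) has_real_derivative D) (at (c + \<tau>))"
        "(1/2) * D - (1/2) * (W2 (r (c + \<tau>)) \<eta>)\<^sup>2 \<le> phi \<sigma> \<eta> - phi \<sigma> (r (c + \<tau>))"
        using elim by blast
      have "((\<lambda>s. (W2 (r (c + s)) \<eta>)\<^sup>2) has_real_derivative D) (at \<tau>)"
        using D(1) DERIV_shift[of "\<lambda>s. (W2 (r s) \<eta>)\<^sup>2" D \<tau> c] by (simp add: add.commute)
      with D(2) show "\<exists>D. ((\<lambda>s. (W2 (r (c + s)) \<eta>)\<^sup>2) has_real_derivative D) (at \<tau>) \<and>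
        (1/2) * D - (1/2) * (W2 (r (c + \<tau>)) \<eta>)\<^sup>2 \<le> phi \<sigma> \<eta> - phi \<sigma> (r (c + \<tau>))" by blast
    qed
  qed
qed

lemma exp_lipschitz_on:
  fixes s t :: real
  assumes "s \<le> b" "t \<le> b"
  shows "\<bar>exp s - exp t\<bar> \<le> exp b * \<bar>s - t\<bar>"
proof -
  have "norm (exp s - exp t) \<le> exp b * norm (s - t)"
  proof (rule field_differentiable_bound[where S = "{..b}" and f' = exp])
    show "(exp has_real_derivative exp z) (at z within {..b})" for z
      by (auto intro!: derivative_eq_intros)
  qed (use assms in auto)
  then show ?thesis by simp
qed

text \<open>The exponential is Lipschitz on half lines bounded above, so the constant is uniform
  over all times before \<open>b\<close>, however early.\<close>

lemma lipschitz_curve_exp: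
  assumes "lipschitz_curve r"
  shows "\<exists>L. \<forall>s t. s \<le> b \<longrightarrow> t \<le> b \<longrightarrow> W2 (r (exp s)) (r (exp t)) \<le> L * \<bar>s - t\<bar>"
proof -
  obtain L where L: "\<And>s t. 0 \<le> s \<Longrightarrow> 0 \<le> t \<Longrightarrow> W2 (r s) (r t) \<le> L * \<bar>s - t\<bar>"
    using assms by (auto simp: lipschitz_curve_def)
  have "W2 (r (exp s)) (r (exp t)) \<le> (\<bar>L\<bar> * exp b) * \<bar>s - t\<bar>" if "s \<le> b" "t \<le> b" for s t
  proof -
    have "W2 (r (exp s)) (r (exp t)) \<le> L * \<bar>exp s - exp t\<bar>" by (rule L) auto
    also have "\<dots> \<le> \<bar>L\<bar> * \<bar>exp s - exp t\<bar>" by (intro mult_right_mono) auto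
    also have "\<dots> \<le> \<bar>L\<bar> * (exp b * \<bar>s - t\<bar>)" by (intro mult_left_mono exp_lipschitz_on that) auto
    finally show ?thesis by (simp add: mult.assoc)
  qed
  then show ?thesis by blast
qed

lemma sticky_EVI_flow:
  assumes \<sigma>: "\<sigma> \<in> P2" and r: "lipschitz_curve r" and E: "sticky_EVI \<sigma> r" and \<delta>: "\<delta> \<le> \<tau>"
  shows "r (exp \<tau>) = grad_flow \<sigma> (\<tau> - \<delta>) (r (exp \<delta>))"
proof -
  have "flow_trajectory \<sigma> (r (exp \<delta>)) (\<lambda>s. r (exp (\<delta> + s)))"
    unfolding flow_trajectory_def locally_lipschitz_curve_def
  proof (intro conjI allI impI)
    show "EVI_on {0<..} \<sigma> (\<lambda>s. r (exp (\<delta> + s)))"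
      using EVI_on_shift[of \<sigma> "\<lambda>s. r (exp s)" \<delta>] E sticky_EVI_iff_EVI_exp EVI_on_subset[OF _ subset_UNIV] by blast
    fix T :: real assume "0 < T"
    obtain L where L: "\<And>s t. s \<le> \<delta> + T \<Longrightarrow> t \<le> \<delta> + T \<Longrightarrow> W2 (r (exp s)) (r (exp t)) \<le> L * \<bar>s - t\<bar>"
      using lipschitz_curve_exp[OF r] by blast
    show "\<exists>L. \<forall>s\<in>{0..T}. \<forall>t\<in>{0..T}. W2 (r (exp (\<delta> + s))) (r (exp (\<delta> + t))) \<le> L * \<bar>s - t\<bar>"
      using L[of "\<delta> + _" "\<delta> + _"] by (intro exI[of _ L]) force
  next
    show "r (exp (\<delta> + t)) \<in> P2" for t using r by (simp add: lipschitz_curve_def)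
  qed simp
  from grad_flow_eq[OF \<sigma> this, of "\<tau> - \<delta>"] \<delta> show ?thesis by simp
qed

lemma sticky_EVI_flow_log:
  assumes \<sigma>: "\<sigma> \<in> P2" and r: "lipschitz_curve r" and E: "sticky_EVI \<sigma> r" and "0 < e" "e \<le> t"
  shows "r t = grad_flow \<sigma> (ln (t / e)) (r e)"
  using sticky_EVI_flow[OF assms(1-3), of "ln e" "ln t"] assms(4,5) by (simp add: ln_div)

text \<open>The expansion rate in logarithmic time, \<open>exp (ln t - ln e)\<close>, is exactly
  \<open>t / e\<close>. Hence an initial distance of smaller order than the time forces the distance
  to vanish.\<close>

lemma sticky_EVI_unique:
  assumes \<sigma>: "\<sigma> \<in> P2" and r: "lipschitz_curve r" "sticky_EVI \<sigma> r"
    and q: "lipschitz_curve q" "sticky_EVI \<sigma> q"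
    and init: "((\<lambda>t. W2 (r t) (q t) / t) \<longlongrightarrow> 0) (at_right 0)" and t: "0 < t"
  shows "r t = q t"
proof -
  have P: "r s \<in> P2" "q s \<in> P2" if "0 \<le> s" for s
    using r q that by (auto simp: lipschitz_curve_def)
  obtain L where L: "\<And>s s'. s \<le> ln t \<Longrightarrow> s' \<le> ln t \<Longrightarrow> W2 (r (exp s)) (r (exp s')) \<le> L * \<bar>s - s'\<bar>"
    using lipschitz_curve_exp[OF r(1)] by blast
  obtain M where M: "\<And>s s'. s \<le> ln t \<Longrightarrow> s' \<le> ln t \<Longrightarrow> W2 (q (exp s)) (q (exp s')) \<le> M * \<bar>s - s'\<bar>"
    using lipschitz_curve_exp[OF q(1)] by blast
  have "W2 (r t) (q t) / t \<le> W2 (r e) (q e) / e" if e: "0 < e" "e \<le> t" for e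
  proof -
    have E: "EVI_on {ln e<..<ln t} \<sigma> (\<lambda>\<tau>. r (exp \<tau>))" "EVI_on {ln e<..<ln t} \<sigma> (\<lambda>\<tau>. q (exp \<tau>))"
      using r(2) q(2) sticky_EVI_iff_EVI_exp EVI_on_subset[OF _ subset_UNIV] by blast+
    have "W2 (r (exp (ln t))) (q (exp (ln t))) \<le> exp (ln t - ln e) * W2 (r (exp (ln e))) (q (exp (ln e)))"
      by (rule EVI_on_contraction[OF _ \<sigma> _ _ _ _ E, of L M]) (use e t P L M in auto)
    then have "W2 (r t) (q t) \<le> t / e * W2 (r e) (q e)" using e t by (simp add: exp_diff)
    then show ?thesis using e t by (simp add: field_simps)
  qed
  then have "\<forall>\<^sub>F e in at_right 0. W2 (r t) (q t) / t \<le> W2 (r e) (q e) / e"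
    unfolding eventually_at_right_field using t by (intro exI[of _ t]) auto
  then have "W2 (r t) (q t) / t \<le> 0"
    by (intro tendsto_lowerbound[OF init]) auto
  then have "W2 (r t) (q t) \<le> 0" using t by (simp add: divide_le_0_iff)
  then show ?thesis using W2_zeroD P t by simp
qed

section \<open>The sticky evolution solves the evolution variational inequality\<close>

context
  fixes a v :: l2
  assumes a: "a \<in> MK" and v: "v \<in> Hs a"
begin

lemma W2_law: "b \<in> MK \<Longrightarrow> c \<in> MK \<Longrightarrow> W2 (law b) (law c) = norm (b - c)"
  by (simp add: W2_eq law_P2 qf_law dist_norm)

lemma lipschitz_curve_sticky:
  assumes r: "\<And>t. 0 \<le> t \<Longrightarrow> r t = law (sticky a v t)"
  shows "lipschitz_curve r"
  unfolding lipschitz_curve_def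
proof (intro conjI allI impI exI[of _ "norm v"])
  show "r t \<in> P2" if "0 \<le> t" for t using r[OF that] law_P2 by simp
  fix s t :: real assume "0 \<le> s" "0 \<le> t"
  then show "W2 (r s) (r t) \<le> norm v * \<bar>s - t\<bar>"
    using r W2_law[OF sticky_MK sticky_MK] sticky_lipschitz[of a v s t] by (simp add: mult.commute)
qed

lemma sticky_norm_deriv:
  assumes t: "0 < t" "t \<notin> bad_times a v"
  shows "((\<lambda>s. (norm (sticky a v s - y))\<^sup>2) has_real_derivative 2 * inner (svel a v t) (sticky a v t - y)) (at t)"
proof -
  let ?X = "sticky a v"
  let ?q = "\<lambda>h. (1 / h) *\<^sub>R (?X (t + h) - ?X t)"
  have lim: "(?q \<longlongrightarrow> svel a v t) (at 0)" by (rule sticky_deriv[OF a v t])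
  have "((\<lambda>h. 2 * inner (?q h) (?X t - y) + h * inner (?q h) (?q h)) \<longlongrightarrow>
      2 * inner (svel a v t) (?X t - y) + 0 * inner (svel a v t) (svel a v t)) (at 0)"
    by (intro tendsto_intros lim)
  moreover have "\<forall>\<^sub>F h in at 0. 2 * inner (?q h) (?X t - y) + h * inner (?q h) (?q h) =
      ((norm (?X (t + h) - y))\<^sup>2 - (norm (?X t - y))\<^sup>2) / h"
    unfolding eventually_at
  proof (intro exI[of _ 1] conjI ballI impI)
    fix h :: real assume h: "h \<noteq> 0 \<and> dist h 0 < 1"
    define z where "z = ?q h"
    have "?X (t + h) - y = (?X t - y) + h *\<^sub>R z" using h by (simp add: z_def)
    then have "(norm (?X (t + h) - y))\<^sup>2 = (norm (?X t - y))\<^sup>2 + 2 * (h * inner (?X t - y) z) + h\<^sup>2 * inner z z"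
      by (simp only: norm_add_sq inner_scaleR_right norm_scaleR power_mult_distrib power2_norm_eq_inner[of z])
        (simp add: power2_norm_eq_inner)
    then have "(norm (?X (t + h) - y))\<^sup>2 - (norm (?X t - y))\<^sup>2 =
        h * (2 * inner z (?X t - y) + h * inner z z)"
      by (simp add: power2_eq_square algebra_simps inner_commute)
    then show "2 * inner (?q h) (?X t - y) + h * inner (?q h) (?q h) =
      ((norm (?X (t + h) - y))\<^sup>2 - (norm (?X t - y))\<^sup>2) / h" using h unfolding z_def by (metis nonzero_mult_div_cancel_left)
  qed simp
  ultimately show ?thesis
    unfolding DERIV_def by (simp add: tendsto_cong)
qed

lemma AE_not_bad: "AE t in lborel. t \<notin> bad_times a v"
  by (rule AE_not_in[OF countable_imp_null_set_lborel[OF countable_bad_times[OF a v]]])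

text \<open>Expanding the square of \<open>?y - a\<close> around the present position turns the
  inner product in \<open>sticky_evi\<close> into the three squared distances of the variational
  inequality.\<close>

lemma sticky_EVI_sticky:
  assumes r: "\<And>t. 0 \<le> t \<Longrightarrow> r t = law (sticky a v t)"
  shows "sticky_EVI (law a) r"
  unfolding sticky_EVI_def
  using AE_not_bad
proof eventually_elim
  case (elim t)
  show ?case
  proof (intro impI ballI)
    fix \<eta> assume t: "0 < t" and \<eta>: "\<eta> \<in> P2"
    let ?X = "sticky a v" and ?y = "qf \<eta>"
    have y: "?y \<in> MK" by (rule qf_MK[OF \<eta>])
    have W: "(W2 (r s) \<eta>)\<^sup>2 = (norm (?X s - ?y))\<^sup>2" if "0 \<le> s" for s
      using W2_sq[OF law_P2 \<eta>, of "?X s"] r[OF that] by (simp add: qf_law sticky_MK)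
    have "((\<lambda>s. (W2 (r s) \<eta>)\<^sup>2) has_real_derivative 2 * inner (svel a v t) (?X t - ?y)) (at t)"
      by (rule DERIV_cong_open[OF sticky_norm_deriv[OF t elim, of ?y], of "{0<..}"]) (use t W in auto)
    moreover have "(t/2) * (2 * inner (svel a v t) (?X t - ?y)) - (1/2) * (W2 (r t) \<eta>)\<^sup>2
        \<le> phi (law a) \<eta> - phi (law a) (r t)"
    proof -
      have p: "phi (law a) \<eta> = - (1/2) * (norm (?y - a))\<^sup>2" "phi (law a) (r t) = - (1/2) * (norm (?X t - a))\<^sup>2"
        using t by (simp_all add: phi_eq \<eta> law_P2 qf_law a r sticky_MK)
      have "t * inner (svel a v t) (?X t - ?y) \<le> inner (?X t - a) (?X t - ?y)"
        by (rule sticky_evi[OF a v]) (use t y in auto)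
      also have "\<dots> = (1/2) * (norm (?X t - a))\<^sup>2 + (1/2) * (norm (?X t - ?y))\<^sup>2 - (1/2) * (norm (?y - a))\<^sup>2"
      proof -
        have "(norm (?y - a))\<^sup>2 = (norm (?X t - a))\<^sup>2 - 2 * inner (?X t - a) (?X t - ?y) + (norm (?X t - ?y))\<^sup>2"
          using norm_diff_sq[of "?X t - a" "?X t - ?y"] by simp
        then show ?thesis by linarith
      qed
      finally show ?thesis using W[of t] t by (simp add: p)
    qed
    ultimately show "\<exists>D. ((\<lambda>s. (W2 (r s) \<eta>)\<^sup>2) has_real_derivative D) (at t) \<and>
      (t/2) * D - (1/2) * (W2 (r t) \<eta>)\<^sup>2 \<le> phi (law a) \<eta> - phi (law a) (r t)" by blast
  qed
qed

end

section \<open>Momentum measures\<close>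

definition mom :: "l2 \<Rightarrow> l2 \<Rightarrow> signed" where
  "mom a u = (\<lambda>A. if A \<in> sets borel
     then \<integral>w. indicator A (fn a w) * fn u w \<partial>unit_lebesgue else 0)"

lemma SQ_indicator: "Y \<in> borel_measurable borel \<Longrightarrow> A \<in> sets borel \<Longrightarrow> (\<lambda>w. indicator A (Y w)) \<in> SQ"
proof (rule SQ_bounded[of _ 1])
  assume Y: "Y \<in> borel_measurable borel" and A: "A \<in> sets borel"
  show "(\<lambda>w. indicator A (Y w)) \<in> borel_measurable borel"
    using Y borel_measurable_indicator[OF A] by (rule measurable_compose)
qed (auto simp: indicator_def)

lemma mom_inner: "A \<in> sets borel \<Longrightarrow> mom a u A = inner u (cl (\<lambda>w. indicator A (fn a w)))"
  by (simp add: mom_def inner_cl[OF fn_SQ SQ_indicator[OF fn_measurable], of A u a, simplified] mult.commute)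

lemma indicator_Hs: "A \<in> sets borel \<Longrightarrow> cl (\<lambda>w. indicator A (fn a w)) \<in> Hs a"
  using Hs_cl_I[OF fn_SQ[of a] borel_measurable_indicator SQ_indicator[OF fn_measurable], of A] by simp

lemma mom_cl:
  assumes Y: "Y \<in> SQ" and U: "U \<in> SQ" and A: "A \<in> sets borel"
  shows "mom (cl Y) (cl U) A = (\<integral>w. indicator A (Y w) * U w \<partial>unit_lebesgue)"
proof -
  have "cl (\<lambda>w. indicator A (fn (cl Y) w)) = cl (\<lambda>w. indicator A (Y w) :: real)"
  proof (rule cl_eqI)
    show "AE w in unit_lebesgue. indicator A (fn (cl Y) w) = (indicator A (Y w) :: real)"
      using fn_cl[OF Y] by eventually_elim simp
  qed (intro SQ_indicator fn_measurable SQ_measurable[OF Y] A)+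
  then show ?thesis
    by (simp add: mom_inner A inner_cl[OF U SQ_indicator[OF SQ_measurable[OF Y] A]] mult.commute)
qed

text \<open>The value on a Borel set is an inner product with a function of \<open>a\<close>, which
  sees only the average of \<open>u\<close>.\<close>

lemma mom_avg: "a \<in> MK \<Longrightarrow> mom a (avg a u) = mom a u"
proof
  fix A assume a: "a \<in> MK"
  show "mom a (avg a u) A = mom a u A"
  proof (cases "A \<in> sets borel")
    case True
    then show ?thesis using inner_avg[OF a indicator_Hs[OF True], of u] by (simp add: mom_inner)
  qed (simp add: mom_def)
qed

lemma mom_orth:
  assumes eq: "\<And>x. mom a u {x<..} = mom a u' {x<..}" and z: "z \<in> Hs a"
  shows "inner u z = inner u' z"
proof -
  obtain g where g: "g \<in> borel_measurable borel" "(\<lambda>w. g (fn a w)) \<in> SQ" "z = cl (\<lambda>w. g (fn a w))"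
    using Hs_E[OF z] .
  have "(\<integral>w. g (fn a w) * fn (u - u') w \<partial>unit_lebesgue) = 0"
  proof (rule pushforward_zero[OF fn_measurable fn_measurable SQ_integrable[OF fn_SQ] _ g(1)])
    show "integrable unit_lebesgue (\<lambda>w. g (fn a w) * fn (u - u') w)"
      by (rule SQ_mult_integrable[OF g(2) fn_SQ])
    fix x :: real
    have "mom a (u - u') {x<..} = 0" using eq[of x] by (simp add: mom_inner inner_diff_left)
    then show "(\<integral>w. indicator {x<..} (fn a w) * fn (u - u') w \<partial>unit_lebesgue) = 0"
      by (simp add: mom_def)
  qed
  then have "inner (u - u') z = 0"
    using inner_cl[OF fn_SQ g(2), of "u - u'"] g(3) by (simp add: mult.commute)
  then show ?thesis by (simp add: inner_diff_left)
qed

text \<open>On functions of \<open>a\<close> the measure loses nothing: equality on half lines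
  already gives equal inner products with all of \<open>Hs a\<close>.\<close>

lemma mom_inj: "a \<in> MK \<Longrightarrow> mom a u = mom a u' \<Longrightarrow> u \<in> Hs a \<Longrightarrow> u' \<in> Hs a \<Longrightarrow> u = u'"
proof -
  assume a: "a \<in> MK" and m: "mom a u = mom a u'" and u: "u \<in> Hs a" "u' \<in> Hs a"
  have "avg a u = u'" by (rule avg_unique[OF a u(2)]) (use mom_orth[of a u u'] m in \<open>simp add: inner_diff_left\<close>)
  then show ?thesis using avg_id[OF a u(1)] by simp
qed

lemma SQ_comp_L2:
  assumes Y: "Y \<in> SQ" and v: "v \<in> borel_measurable borel"
  shows "(\<lambda>w. v (Y w)) \<in> SQ \<longleftrightarrow> v \<in> L2 (law (cl Y))"
proof -
  have "integrable (law (cl Y)) (\<lambda>x. (v x)\<^sup>2) \<longleftrightarrow> integrable unit_lebesgue (\<lambda>w. (v (Y w))\<^sup>2)"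
    unfolding law_cl[OF Y] using v by (intro integrable_distr_eq) (auto intro: SQ_measurable_UL[OF Y])
  then show ?thesis
    using measurable_compose[OF SQ_measurable[OF Y] v] v by (simp add: L2_def)
qed

lemma momentum_law:
  assumes Y: "Y \<in> SQ" and v: "v \<in> L2 (law (cl Y))"
  shows "momentum (law (cl Y)) v = mom (cl Y) (cl (\<lambda>w. v (Y w)))"
proof
  fix A
  have vm: "v \<in> borel_measurable borel" using v by (simp add: L2_def)
  have S: "(\<lambda>w. v (Y w)) \<in> SQ" using v SQ_comp_L2[OF Y vm] by simp
  show "momentum (law (cl Y)) v A = mom (cl Y) (cl (\<lambda>w. v (Y w))) A"
  proof (cases "A \<in> sets borel")
    case True
    have "momentum (law (cl Y)) v A = (\<integral>x. indicator A x *\<^sub>R v x \<partial>distr unit_lebesgue borel Y)"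
      using True by (simp add: momentum_def set_lebesgue_integral_def law_cl[OF Y])
    also have "\<dots> = (\<integral>w. indicator A (Y w) *\<^sub>R v (Y w) \<partial>unit_lebesgue)"
      using True vm by (intro integral_distr SQ_measurable_UL[OF Y]) auto
    finally show ?thesis by (simp add: mom_cl[OF Y S True])
  qed (simp add: momentum_def mom_def)
qed

text \<open>The Eulerian velocity is the Borel function that represents \<open>avg a u\<close> as a
  function of \<open>a\<close>.\<close>

lemma mom_eq_momentum:
  assumes a: "a \<in> MK"
  shows "\<exists>v\<in>L2 (law a). mom a u = momentum (law a) v"
proof -
  obtain g where g: "g \<in> borel_measurable borel" "(\<lambda>w. g (fn a w)) \<in> SQ" "avg a u = cl (\<lambda>w. g (fn a w))"
    using Hs_E[OF avg_Hs[OF a, of u]] .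
  have "g \<in> L2 (law a)" using SQ_comp_L2[OF fn_SQ g(1), of a] g(2) by simp
  moreover have "mom a u = momentum (law a) g"
    using momentum_law[OF fn_SQ, of g a] calculation g(3) mom_avg[OF a, of u] by simp
  ultimately show ?thesis by blast
qed

text \<open>Since \<open>ennreal\<close> sends negative numbers to 0, the density is the positive
  part of \<open>U\<close>; the pair for \<open>U\<close> and \<open>- U\<close> decomposes the
  momentum.\<close>

definition pmeas :: "l2 \<Rightarrow> (real \<Rightarrow> real) \<Rightarrow> real measure" where
  "pmeas a U = distr (density unit_lebesgue (\<lambda>w. ennreal (U w))) borel (fn a)"

lemma pmeas:
  assumes U: "integrable unit_lebesgue U" "U \<in> borel_measurable borel"
  shows "sets (pmeas a U) = sets borel" "finite_measure (pmeas a U)"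
    and "\<And>f. f \<in> borel_measurable borel \<Longrightarrow>
      (\<integral>\<^sup>+x. f x \<partial>pmeas a U) = (\<integral>\<^sup>+w. ennreal (U w) * f (fn a w) \<partial>unit_lebesgue)"
proof -
  note [measurable] = borel_measurable_UL[OF U(2)] borel_measurable_UL[OF fn_measurable[of a]]
  show "sets (pmeas a U) = sets borel" by (simp add: pmeas_def)
  show *: "(\<integral>\<^sup>+x. f x \<partial>pmeas a U) = (\<integral>\<^sup>+w. ennreal (U w) * f (fn a w) \<partial>unit_lebesgue)"
    if [measurable]: "f \<in> borel_measurable borel" for f
    unfolding pmeas_def by (simp add: nn_integral_distr nn_integral_density)
  show "finite_measure (pmeas a U)"
  proof
    have "emeasure (pmeas a U) (space (pmeas a U)) = (\<integral>\<^sup>+x. 1 \<partial>pmeas a U)" by simp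
    also have "\<dots> = (\<integral>\<^sup>+w. ennreal (U w) \<partial>unit_lebesgue)" by (subst *) auto
    also have "\<dots> < \<infinity>" using U(1) by (simp add: real_integrable_def less_top)
    finally show "emeasure (pmeas a U) (space (pmeas a U)) \<noteq> \<infinity>" by simp
  qed
qed

lemma pmeas_integral:
  fixes f :: "real \<Rightarrow> real"
  assumes U: "integrable unit_lebesgue U" "U \<in> borel_measurable borel"
    and f: "f \<in> borel_measurable borel"
  shows "(\<integral>x. f x \<partial>pmeas a U) = (\<integral>w. max 0 (U w) * f (fn a w) \<partial>unit_lebesgue)"
proof -
  note [measurable] = borel_measurable_UL[OF U(2)] borel_measurable_UL[OF fn_measurable[of a]] f
  have "(\<lambda>w. ennreal (U w)) = (\<lambda>w. ennreal (max 0 (U w)))" by (auto simp: max_def ennreal_neg)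
  then have "(\<integral>x. f x \<partial>pmeas a U) = (\<integral>w. f (fn a w) \<partial>density unit_lebesgue (\<lambda>w. ennreal (max 0 (U w))))"
    unfolding pmeas_def by (subst integral_distr) auto
  also have "\<dots> = (\<integral>w. max 0 (U w) *\<^sub>R f (fn a w) \<partial>unit_lebesgue)"
    by (rule integral_density) auto
  finally show ?thesis by simp
qed

lemma mom_decomp:
  assumes A: "A \<in> sets borel"
  shows "mom a u A = measure (pmeas a (fn u)) A - measure (pmeas a (\<lambda>w. - fn u w)) A"
proof -
  have U: "integrable unit_lebesgue (fn u)" "fn u \<in> borel_measurable borel"
    "integrable unit_lebesgue (\<lambda>w. - fn u w)" "(\<lambda>w. - fn u w) \<in> borel_measurable borel"
    using SQ_integrable[OF fn_SQ] by auto
  have m: "measure (pmeas a U) A = (\<integral>w. max 0 (U w) * indicator A (fn a w) \<partial>unit_lebesgue)"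
    if U: "integrable unit_lebesgue U" "U \<in> borel_measurable borel" for U
    using pmeas_integral[OF U borel_measurable_indicator[OF A], of a] pmeas(1)[OF U] A
      sets_eq_imp_space_eq[OF pmeas(1)[OF U]] by simp
  have i: "integrable unit_lebesgue (\<lambda>w. max 0 (U w) * indicator A (fn a w))"
    if U: "U \<in> SQ" for U
  proof (rule SQ_mult_integrable[OF _ SQ_indicator[OF fn_measurable A]])
    show "(\<lambda>w. max 0 (U w)) \<in> SQ" by (rule SQ_le[OF _ U]) (use SQ_measurable[OF U] in auto)
  qed
  have "(\<lambda>w. indicator A (fn a w) * fn u w) =
     (\<lambda>w. max 0 (fn u w) * indicator A (fn a w) - max 0 (- fn u w) * indicator A (fn a w))"
    by (auto simp: max_def indicator_def)
  then have "mom a u A = (\<integral>w. max 0 (fn u w) * indicator A (fn a w) - max 0 (- fn u w) * indicator A (fn a w) \<partial>unit_lebesgue)"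
    using A by (simp add: mom_def)
  also have "\<dots> = measure (pmeas a (fn u)) A - measure (pmeas a (\<lambda>w. - fn u w)) A"
    unfolding m[OF U(1,2)] m[OF U(3,4)]
    by (rule Bochner_Integration.integral_diff) (intro i fn_SQ SQ_uminus)+
  finally show ?thesis .
qed

lemma mom_signed: "mom a u \<in> signed_measures"
proof -
  let ?p = "pmeas a (fn u)" and ?n = "pmeas a (\<lambda>w. - fn u w)"
  have U: "integrable unit_lebesgue (fn u)" "fn u \<in> borel_measurable borel"
    "integrable unit_lebesgue (\<lambda>w. - fn u w)" "(\<lambda>w. - fn u w) \<in> borel_measurable borel"
    using SQ_integrable[OF fn_SQ] by auto
  note p = pmeas[OF U(1,2), where a = a] and n = pmeas[OF U(3,4), where a = a]
  interpret P: finite_measure ?p by (rule p(2))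
  interpret N: finite_measure ?n by (rule n(2))
  have "mom a u A = 0" if "A \<notin> sets borel" for A using that by (simp add: mom_def)
  moreover have "(\<lambda>i. mom a u (A i)) sums mom a u (\<Union>i. A i)"
    if A: "range A \<subseteq> sets borel" "disjoint_family A" for A :: "nat \<Rightarrow> real set"
  proof -
    have "(\<lambda>i. measure ?p (A i) - measure ?n (A i)) sums (measure ?p (\<Union>i. A i) - measure ?n (\<Union>i. A i))"
      using A p(1) n(1) by (intro sums_diff P.finite_measure_UNION N.finite_measure_UNION) auto
    moreover have "A i \<in> sets borel" "(\<Union>i. A i) \<in> sets borel" for i using A(1) by auto
    ultimately show ?thesis by (simp add: mom_decomp)
  qed
  moreover have "(\<Sum>A\<in>F. \<bar>mom a u A\<bar>) \<le> measure ?p UNIV + measure ?n UNIV"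
    if F: "finite F" "F \<subseteq> sets borel" "disjoint F" for F
  proof -
    have d: "disjoint_family_on (\<lambda>x. x) F" using F(3) by (auto simp: disjoint_family_on_def disjoint_def)
    have "(\<Sum>A\<in>F. \<bar>mom a u A\<bar>) \<le> (\<Sum>A\<in>F. measure ?p A + measure ?n A)"
    proof (rule sum_mono)
      fix A assume "A \<in> F"
      then have "A \<in> sets borel" using F(2) by auto
      then show "\<bar>mom a u A\<bar> \<le> measure ?p A + measure ?n A"
        using measure_nonneg[of ?p A] measure_nonneg[of ?n A] by (simp add: mom_decomp abs_le_iff)
    qed
    also have "\<dots> = measure ?p (\<Union>A\<in>F. A) + measure ?n (\<Union>A\<in>F. A)"
      using F p(1) n(1) d
        P.finite_measure_finite_Union[OF F(1) _ d] N.finite_measure_finite_Union[OF F(1) _ d]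
      by (simp add: sum.distrib)
    also have "\<dots> \<le> measure ?p UNIV + measure ?n UNIV"
      using p(1) n(1) by (intro add_mono P.finite_measure_mono N.finite_measure_mono) auto
    finally show ?thesis .
  qed
  ultimately show ?thesis unfolding signed_measures_def by blast
qed

text \<open>Equality of two differences of measures, kept in additive form so that the induction
  over nonnegative functions can run in \<open>ennreal\<close>.\<close>

lemma nn_integral_signed_unique:
  fixes a b c d :: "real measure"
  assumes s: "sets a = sets borel" "sets b = sets borel" "sets c = sets borel" "sets d = sets borel"
    and e: "\<And>A. A \<in> sets borel \<Longrightarrow> emeasure a A + emeasure d A = emeasure c A + emeasure b A"
    and f: "f \<in> borel_measurable borel"
  shows "(\<integral>\<^sup>+x. f x \<partial>a) + (\<integral>\<^sup>+x. f x \<partial>d) = (\<integral>\<^sup>+x. f x \<partial>c) + (\<integral>\<^sup>+x. f x \<partial>b)"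
  using f
proof (induction rule: borel_measurable_induct)
  case (cong f g)
  then have "f = g" by auto
  then show ?case using cong by simp
next
  case (set A)
  then show ?case using e s by simp
next
  case (mult u c')
  have m: "u \<in> borel_measurable a" "u \<in> borel_measurable b" "u \<in> borel_measurable c" "u \<in> borel_measurable d"
    using mult(2) s by (simp_all cong: measurable_cong_sets)
  show ?case using mult(4) m by (simp add: nn_integral_cmult distrib_left[symmetric])
next
  case (add u v)
  have m: "u \<in> borel_measurable a" "u \<in> borel_measurable b" "u \<in> borel_measurable c" "u \<in> borel_measurable d"
    "v \<in> borel_measurable a" "v \<in> borel_measurable b" "v \<in> borel_measurable c" "v \<in> borel_measurable d"
    using add(1,3) s by (simp_all cong: measurable_cong_sets)
  show ?case using add(6,7) m by (simp add: nn_integral_add) (metis add.assoc add.left_commute)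
next
  case (seq U)
  have m: "U i \<in> borel_measurable a" "U i \<in> borel_measurable b" "U i \<in> borel_measurable c" "U i \<in> borel_measurable d" for i
    using seq(1) s by (simp_all cong: measurable_cong_sets)
  have sup: "(\<integral>\<^sup>+x. (SUP i. U i) x \<partial>M) = (SUP i. \<integral>\<^sup>+x. U i x \<partial>M)" if "\<And>i. U i \<in> borel_measurable M" for M
    using nn_integral_monotone_convergence_SUP[OF seq(3) that] by (simp add: image_comp)
  have inc: "incseq (\<lambda>i. \<integral>\<^sup>+x. U i x \<partial>M)" for M
    using seq(3) by (auto simp: incseq_def le_fun_def intro: nn_integral_mono)
  show ?case
    unfolding sup[OF m(1)] sup[OF m(2)] sup[OF m(3)] sup[OF m(4)]
      ennreal_SUP_add[OF inc inc, symmetric]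
    by (intro SUP_cong refl) (rule seq)
qed

text \<open>Makes \<open>signed_integral\<close> independent of the decomposition; finiteness of the
  measures and boundedness of \<open>f\<close> allow the additive identity to be rearranged.\<close>

lemma integral_signed_unique:
  fixes a b c d :: "real measure" and f :: "real \<Rightarrow> real"
  assumes fin: "finite_measure a" "finite_measure b" "finite_measure c" "finite_measure d"
    and s: "sets a = sets borel" "sets b = sets borel" "sets c = sets borel" "sets d = sets borel"
    and e: "\<And>A. A \<in> sets borel \<Longrightarrow> measure a A - measure b A = measure c A - measure d A"
    and f: "f \<in> borel_measurable borel" and B: "\<And>x. \<bar>f x\<bar> \<le> B"
  shows "(\<integral>x. f x \<partial>a) - (\<integral>x. f x \<partial>b) = (\<integral>x. f x \<partial>c) - (\<integral>x. f x \<partial>d)"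
proof -
  have e': "emeasure a A + emeasure d A = emeasure c A + emeasure b A" if "A \<in> sets borel" for A
    using e[OF that] fin by (simp add: finite_measure.emeasure_eq_measure ennreal_plus[symmetric] del: ennreal_plus)
  have int: "integrable M f" if "finite_measure M" "sets M = sets borel" for M
    using finite_measure.integrable_const_bound[OF that(1), of f B] B f that(2)
    by (simp cong: measurable_cong_sets)
  have finint: "(\<integral>\<^sup>+x. ennreal (f x) \<partial>M) \<noteq> \<infinity>" "(\<integral>\<^sup>+x. ennreal (- f x) \<partial>M) \<noteq> \<infinity>"
    if "finite_measure M" "sets M = sets borel" for M
    using int[OF that] by (auto simp: real_integrable_def)
  have pm: "(\<lambda>x. ennreal (f x)) \<in> borel_measurable borel" "(\<lambda>x. ennreal (- f x)) \<in> borel_measurable borel"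
    using f by auto
  have conv: "enn2real p1 + enn2real p4 = enn2real p3 + enn2real p2"
    if "p1 + p4 = p3 + p2" "p1 \<noteq> \<infinity>" "p2 \<noteq> \<infinity>" "p3 \<noteq> \<infinity>" "p4 \<noteq> \<infinity>" for p1 p2 p3 p4 :: ennreal
    using that enn2real_plus[of p1 p4] enn2real_plus[of p3 p2] by (simp add: less_top)
  have 1: "enn2real (\<integral>\<^sup>+x. ennreal (f x) \<partial>a) + enn2real (\<integral>\<^sup>+x. ennreal (f x) \<partial>d) =
    enn2real (\<integral>\<^sup>+x. ennreal (f x) \<partial>c) + enn2real (\<integral>\<^sup>+x. ennreal (f x) \<partial>b)"
    using nn_integral_signed_unique[OF s e' pm(1)] finint fin s by (intro conv) auto
  have 2: "enn2real (\<integral>\<^sup>+x. ennreal (- f x) \<partial>a) + enn2real (\<integral>\<^sup>+x. ennreal (- f x) \<partial>d) =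
    enn2real (\<integral>\<^sup>+x. ennreal (- f x) \<partial>c) + enn2real (\<integral>\<^sup>+x. ennreal (- f x) \<partial>b)"
    using nn_integral_signed_unique[OF s e' pm(2)] finint fin s by (intro conv) auto
  show ?thesis
    using 1 2 by (simp add: real_lebesgue_integral_def int fin s)
qed

lemma integrable_bounded_comp:
  assumes "f \<in> borel_measurable borel" "\<And>x. \<bar>f x\<bar> \<le> (B::real)"
  shows "(\<lambda>w. f (fn a w)) \<in> SQ"
  using assms by (intro SQ_bounded[of _ B]) (auto intro: measurable_compose[OF fn_measurable])

text \<open>Evaluates the description by the pair of \<open>pmeas\<close> measures. In this form
  weak convergence of momenta becomes convergence of inner products in the Hilbert space.\<close>

lemma signed_integral_mom:
  assumes f: "f \<in> borel_measurable borel" and B: "\<And>x. \<bar>f x\<bar> \<le> B"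
  shows "signed_integral (mom a u) f = inner u (cl (\<lambda>w. f (fn a w)))"
  unfolding signed_integral_def
proof (rule the_equality)
  let ?p = "pmeas a (fn u)" and ?n = "pmeas a (\<lambda>w. - fn u w)"
  have U: "integrable unit_lebesgue (fn u)" "fn u \<in> borel_measurable borel"
    "integrable unit_lebesgue (\<lambda>w. - fn u w)" "(\<lambda>w. - fn u w) \<in> borel_measurable borel"
    using SQ_integrable[OF fn_SQ] by auto
  note p = pmeas[OF U(1,2), where a = a] and n = pmeas[OF U(3,4), where a = a]
  have S: "(\<lambda>w. f (fn a w)) \<in> SQ" by (rule integrable_bounded_comp[OF f B])
  have mx: "(\<lambda>w. max 0 (V w)) \<in> SQ" if "V \<in> SQ" for V
    by (rule SQ_le[OF _ that]) (use SQ_measurable[OF that] in auto)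
  have I: "(\<integral>x. f x \<partial>?p) - (\<integral>x. f x \<partial>?n) = inner u (cl (\<lambda>w. f (fn a w)))"
  proof -
    have "(\<integral>x. f x \<partial>?p) - (\<integral>x. f x \<partial>?n) =
      (\<integral>w. max 0 (fn u w) * f (fn a w) - max 0 (- fn u w) * f (fn a w) \<partial>unit_lebesgue)"
      unfolding pmeas_integral[OF U(1,2) f] pmeas_integral[OF U(3,4) f]
      by (rule Bochner_Integration.integral_diff[symmetric])
        (intro SQ_mult_integrable mx S fn_SQ SQ_uminus)+
    also have "\<dots> = (\<integral>w. fn u w * f (fn a w) \<partial>unit_lebesgue)"
      by (intro Bochner_Integration.integral_cong) (auto simp: max_def)
    also have "\<dots> = inner u (cl (\<lambda>w. f (fn a w)))" using inner_cl[OF fn_SQ S, of u] by simp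
    finally show ?thesis .
  qed
  show "\<exists>c b. finite_measure c \<and> finite_measure b \<and> sets c = sets borel \<and> sets b = sets borel \<and>
    (\<forall>A\<in>sets borel. mom a u A = measure c A - measure b A) \<and>
    inner u (cl (\<lambda>w. f (fn a w))) = (\<integral>x. f x \<partial>c) - (\<integral>x. f x \<partial>b)"
    using p(1,2) n(1,2) mom_decomp I by (intro exI[of _ ?p] exI[of _ ?n]) auto
  fix J assume "\<exists>c b. finite_measure c \<and> finite_measure b \<and> sets c = sets borel \<and> sets b = sets borel \<and>
    (\<forall>A\<in>sets borel. mom a u A = measure c A - measure b A) \<and> J = (\<integral>x. f x \<partial>c) - (\<integral>x. f x \<partial>b)"
  then obtain c b where cb: "finite_measure c" "finite_measure b" "sets c = sets borel" "sets b = sets borel"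
    "\<forall>A\<in>sets borel. mom a u A = measure c A - measure b A" "J = (\<integral>x. f x \<partial>c) - (\<integral>x. f x \<partial>b)" by blast
  have "J = (\<integral>x. f x \<partial>?p) - (\<integral>x. f x \<partial>?n)"
    unfolding cb(6) using cb(5) mom_decomp
    by (intro integral_signed_unique[OF cb(1,2) p(2) n(2) cb(3,4) p(1) n(1) _ f B]) auto
  then show "J = inner u (cl (\<lambda>w. f (fn a w)))" using I by simp
qed

section \<open>States and the sticky semigroup\<close>

text \<open>The Lagrangian velocity of a state. Different choices of \<open>velocity\<close> agree
  almost everywhere and give the same class.\<close>

definition vl :: "state \<Rightarrow> l2" where
  "vl \<mu> = cl (\<lambda>w. velocity \<mu> (rearr (fst \<mu>) w))"

definition sstate :: "l2 \<Rightarrow> l2 \<Rightarrow> state" where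
  "sstate a u = (law a, mom a u)"

lemma sstate_V2: "a \<in> MK \<Longrightarrow> sstate a u \<in> V2"
  unfolding sstate_def V2_def using mom_eq_momentum[of a u] law_P2 mom_signed by simp

lemma momentum_eq_mom:
  assumes \<rho>: "\<rho> \<in> P2" and v: "v \<in> L2 \<rho>"
  shows "(\<lambda>w. v (rearr \<rho> w)) \<in> SQ" "momentum \<rho> v = mom (qf \<rho>) (cl (\<lambda>w. v (rearr \<rho> w)))"
    "cl (\<lambda>w. v (rearr \<rho> w)) \<in> Hs (qf \<rho>)"
proof -
  note Y = rearr_SQ[OF \<rho>]
  have l: "law (cl (rearr \<rho>)) = \<rho>" using law_qf[OF \<rho>] by (simp add: qf_def)
  have vm: "v \<in> borel_measurable borel" using v by (simp add: L2_def)
  show S: "(\<lambda>w. v (rearr \<rho> w)) \<in> SQ" using SQ_comp_L2[OF Y vm] v l by simp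
  show "momentum \<rho> v = mom (qf \<rho>) (cl (\<lambda>w. v (rearr \<rho> w)))"
    using momentum_law[OF Y, of v] v l by (simp add: qf_def)
  show "cl (\<lambda>w. v (rearr \<rho> w)) \<in> Hs (qf \<rho>)" unfolding qf_def by (rule Hs_cl_I[OF Y vm S])
qed

lemma momentum_V2: "\<rho> \<in> P2 \<Longrightarrow> v \<in> L2 \<rho> \<Longrightarrow> (\<rho>, momentum \<rho> v) \<in> V2"
  unfolding V2_def using momentum_eq_mom(2) mom_signed by auto

text \<open>\<open>qf\<close> and \<open>vl\<close> are coordinates on \<open>V2\<close>;
  \<open>qf_sstate\<close> and \<open>vl_sstate\<close> invert them on pairs in which the velocity
  is a function of the position.\<close>

lemma V2D:
  assumes "\<mu> \<in> V2"
  shows "fst \<mu> \<in> P2" "qf (fst \<mu>) \<in> MK" "vl \<mu> \<in> Hs (qf (fst \<mu>))" "\<mu> = sstate (qf (fst \<mu>)) (vl \<mu>)"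
    "(\<lambda>w. velocity \<mu> (rearr (fst \<mu>) w)) \<in> SQ"
proof -
  show \<rho>: "fst \<mu> \<in> P2" using assms by (auto simp: V2_def)
  then show "qf (fst \<mu>) \<in> MK" by (rule qf_MK)
  have "\<exists>v. v \<in> L2 (fst \<mu>) \<and> snd \<mu> = momentum (fst \<mu>) v" using assms by (auto simp: V2_def)
  then have v: "velocity \<mu> \<in> L2 (fst \<mu>)" "snd \<mu> = momentum (fst \<mu>) (velocity \<mu>)"
    unfolding velocity_def by (metis (mono_tags, lifting) someI_ex)+
  show "(\<lambda>w. velocity \<mu> (rearr (fst \<mu>) w)) \<in> SQ" by (rule momentum_eq_mom(1)[OF \<rho> v(1)])
  show "vl \<mu> \<in> Hs (qf (fst \<mu>))" unfolding vl_def by (rule momentum_eq_mom(3)[OF \<rho> v(1)])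
  show "\<mu> = sstate (qf (fst \<mu>)) (vl \<mu>)"
    using momentum_eq_mom(2)[OF \<rho> v(1)] v(2) law_qf[OF \<rho>]
    by (simp add: sstate_def vl_def prod_eq_iff)
qed

lemma vl_sstate: "a \<in> MK \<Longrightarrow> u \<in> Hs a \<Longrightarrow> vl (sstate a u) = u"
  using V2D(3,4)[OF sstate_V2, of a u] mom_inj[of a "vl (sstate a u)" u]
  by (simp add: sstate_def qf_law)

lemma qf_sstate: "a \<in> MK \<Longrightarrow> qf (fst (sstate a u)) = a"
  by (simp add: sstate_def qf_law)

lemma vl_momentum:
  assumes "\<rho> \<in> P2" "v \<in> L2 \<rho>"
  shows "vl (\<rho>, momentum \<rho> v) = cl (\<lambda>w. v (rearr \<rho> w))"
proof -
  have "(\<rho>, momentum \<rho> v) = sstate (qf \<rho>) (cl (\<lambda>w. v (rearr \<rho> w)))"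
    using momentum_eq_mom(2)[OF assms] law_qf[OF assms(1)] by (simp add: sstate_def)
  then show ?thesis using vl_sstate[OF qf_MK momentum_eq_mom(3)] assms by simp
qed

lemma D2_eq:
  assumes "\<mu> \<in> V2" "\<nu> \<in> V2"
  shows "D2 \<mu> \<nu> = sqrt ((norm (qf (fst \<mu>) - qf (fst \<nu>)))\<^sup>2 + (norm (vl \<mu> - vl \<nu>))\<^sup>2)"
  unfolding D2_def using dist_cl_sq[OF V2D(5)[OF assms(1)] V2D(5)[OF assms(2)]]
  by (simp add: W2_sq V2D(1) assms vl_def dist_norm)

lemma D2_tendsto_iff:
  assumes \<mu>n: "\<And>n. \<mu>n n \<in> V2" and \<mu>: "\<mu> \<in> V2"
  shows "(\<lambda>n. D2 (\<mu>n n) \<mu>) \<longlonglongrightarrow> 0 \<longleftrightarrow>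
    (\<lambda>n. qf (fst (\<mu>n n))) \<longlonglongrightarrow> qf (fst \<mu>) \<and> (\<lambda>n. vl (\<mu>n n)) \<longlonglongrightarrow> vl \<mu>"
proof
  let ?p = "\<lambda>n. norm (qf (fst (\<mu>n n)) - qf (fst \<mu>))" and ?q = "\<lambda>n. norm (vl (\<mu>n n) - vl \<mu>)"
  have D: "D2 (\<mu>n n) \<mu> = sqrt ((?p n)\<^sup>2 + (?q n)\<^sup>2)" for n by (rule D2_eq[OF \<mu>n \<mu>])
  {
    assume L: "(\<lambda>n. D2 (\<mu>n n) \<mu>) \<longlonglongrightarrow> 0"
    have p: "\<forall>n. norm (qf (fst (\<mu>n n)) - qf (fst \<mu>)) \<le> D2 (\<mu>n n) \<mu>"
      and q: "\<forall>n. norm (vl (\<mu>n n) - vl \<mu>) \<le> D2 (\<mu>n n) \<mu>"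
      unfolding D by (simp_all add: real_le_rsqrt)
    show "(\<lambda>n. qf (fst (\<mu>n n))) \<longlonglongrightarrow> qf (fst \<mu>) \<and> (\<lambda>n. vl (\<mu>n n)) \<longlonglongrightarrow> vl \<mu>"
      by (rule conjI; rule LIM_zero_cancel)
        (rule Lim_null_comparison[OF always_eventually[OF p] L]
           Lim_null_comparison[OF always_eventually[OF q] L])+
  }
  assume "(\<lambda>n. qf (fst (\<mu>n n))) \<longlonglongrightarrow> qf (fst \<mu>) \<and> (\<lambda>n. vl (\<mu>n n)) \<longlonglongrightarrow> vl \<mu>"
  then have "?p \<longlonglongrightarrow> 0" "?q \<longlonglongrightarrow> 0" by (auto intro: tendsto_norm_zero LIM_zero)
  then have "(\<lambda>n. sqrt ((?p n)\<^sup>2 + (?q n)\<^sup>2)) \<longlonglongrightarrow> sqrt (0\<^sup>2 + 0\<^sup>2)" by (intro tendsto_intros)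
  then show "(\<lambda>n. D2 (\<mu>n n) \<mu>) \<longlonglongrightarrow> 0" unfolding D by simp
qed

text \<open>If convergence failed, it would fail along a subsequence with a uniform gap. A further
  subsequence converges almost everywhere, and dominated convergence closes the gap.\<close>

lemma cl_comp_tendsto:
  fixes f :: "real \<Rightarrow> real"
  assumes X: "X \<longlonglongrightarrow> x" and f: "continuous_on UNIV f" and B: "\<And>y. \<bar>f y\<bar> \<le> B"
  shows "(\<lambda>n. cl (\<lambda>w. f (fn (X n) w))) \<longlonglongrightarrow> cl (\<lambda>w. f (fn x w))"
proof (rule ccontr)
  have fm: "f \<in> borel_measurable borel" by (rule borel_measurable_continuous_onI[OF f])
  note S = integrable_bounded_comp[OF fm B]
  let ?F = "\<lambda>y. cl (\<lambda>w. f (fn y w))"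
  assume "\<not> (\<lambda>n. ?F (X n)) \<longlonglongrightarrow> ?F x"
  then obtain e where e: "e > 0" "\<And>N. \<exists>n\<ge>N. e \<le> dist (?F (X n)) (?F x)"
    unfolding lim_sequentially by (metis not_less)
  then have "infinite {n. e \<le> dist (?F (X n)) (?F x)}"
    unfolding infinite_nat_iff_unbounded_le by auto
  from infinite_enumerate[OF this] obtain r :: "nat \<Rightarrow> nat"
    where r: "strict_mono r" "\<And>n. e \<le> dist (?F (X (r n))) (?F x)" by auto
  obtain q where q: "strict_mono q" "AE w in unit_lebesgue. (\<lambda>n. fn (X (r (q n))) w) \<longlonglongrightarrow> fn x w"
    using l2_LIMSEQ_AE_subseq[OF LIMSEQ_subseq_LIMSEQ[OF X r(1)]] by (auto simp: comp_def)
  have "(\<lambda>n. \<integral>w. (f (fn (X (r (q n))) w) - f (fn x w))\<^sup>2 \<partial>unit_lebesgue) \<longlonglongrightarrow> (\<integral>w. 0 \<partial>unit_lebesgue)"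
  proof (rule integral_dominated_convergence)
    show "integrable unit_lebesgue (\<lambda>_. (2 * B)\<^sup>2)" by simp
    show "AE w in unit_lebesgue. (\<lambda>n. (f (fn (X (r (q n))) w) - f (fn x w))\<^sup>2) \<longlonglongrightarrow> 0"
      using q(2)
    proof eventually_elim
      case (elim w)
      then have "(\<lambda>n. f (fn (X (r (q n))) w)) \<longlonglongrightarrow> f (fn x w)"
        using f continuous_on_tendsto_compose[OF f elim] by simp
      then have "(\<lambda>n. (f (fn (X (r (q n))) w) - f (fn x w))\<^sup>2) \<longlonglongrightarrow> (f (fn x w) - f (fn x w))\<^sup>2"
        by (intro tendsto_intros)
      then show ?case by simp
    qed
    show "AE w in unit_lebesgue. norm ((f (fn (X (r (q n))) w) - f (fn x w))\<^sup>2) \<le> (2 * B)\<^sup>2" for n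
    proof (intro AE_I2)
      fix w
      have "\<bar>f (fn (X (r (q n))) w) - f (fn x w)\<bar> \<le> 2 * B"
        using B[of "fn (X (r (q n))) w"] B[of "fn x w"] by linarith
      then have "\<bar>f (fn (X (r (q n))) w) - f (fn x w)\<bar> \<le> \<bar>2 * B\<bar>" by linarith
      then show "norm ((f (fn (X (r (q n))) w) - f (fn x w))\<^sup>2) \<le> (2 * B)\<^sup>2"
        by (simp only: abs_le_square_iff real_norm_def abs_power2)
    qed
  qed (auto intro!: SQ_measurable_UL borel_measurable_power[of _ _ 2] SQ_diff S)
  moreover have "(\<integral>w. (f (fn (X (r (q n))) w) - f (fn x w))\<^sup>2 \<partial>unit_lebesgue) = (dist (?F (X (r (q n)))) (?F x))\<^sup>2" for n
    by (rule dist_cl_sq[OF S S, symmetric])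
  ultimately have lim: "(\<lambda>n. (dist (?F (X (r (q n)))) (?F x))\<^sup>2) \<longlonglongrightarrow> 0" by simp
  have "e\<^sup>2 \<le> (dist (?F (X (r (q n)))) (?F x))\<^sup>2" for n using r(2) e by (intro power_mono) auto
  then have "e\<^sup>2 \<le> 0" by (intro LIMSEQ_le_const[OF lim]) auto
  then show False using e(1) by simp
qed

lemma weakly_converges_mom:
  assumes X: "X \<longlonglongrightarrow> x" and u: "u \<longlonglongrightarrow> v"
  shows "weakly_converges (\<lambda>n. mom (X n) (u n)) (mom x v)"
  unfolding weakly_converges_def
proof (intro allI impI)
  fix f :: "real \<Rightarrow> real" assume f: "continuous_on UNIV f" and b: "bounded (range f)"
  obtain B where B: "\<And>y. \<bar>f y\<bar> \<le> B" using b by (auto simp: bounded_iff)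
  have fm: "f \<in> borel_measurable borel" by (rule borel_measurable_continuous_onI[OF f])
  show "(\<lambda>n. signed_integral (mom (X n) (u n)) f) \<longlonglongrightarrow> signed_integral (mom x v) f"
    unfolding signed_integral_mom[OF fm B] by (intro tendsto_inner u cl_comp_tendsto[OF X f B])
qed

text \<open>Ramps are admissible test functions and already determine the inner products with all
  functions of \<open>b\<close>.\<close>

lemma weak_limit_unique:
  assumes b: "b \<in> MK" and 1: "weakly_converges mn (mom b u)" and 2: "weakly_converges mn (mom b u')"
  shows "mom b u = mom b u'"
proof -
  have "inner (u - u') (cl (\<lambda>w. ramp x n (fn b w))) = 0" for x n
  proof -
    have c: "continuous_on UNIV (ramp x n)" unfolding ramp_def by (intro continuous_intros)
    have B: "\<bar>ramp x n y\<bar> \<le> 1" for y using ramp_bounds[of x n y] by simp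
    then have "bounded (range (ramp x n))" by (auto simp: bounded_iff)
    then have "signed_integral (mom b u) (ramp x n) = signed_integral (mom b u') (ramp x n)"
      using 1 2 c unfolding weakly_converges_def by (meson LIMSEQ_unique)
    then show ?thesis by (simp add: signed_integral_mom[OF ramp_measurable B] inner_diff_left)
  qed
  then have orth: "inner (u - u') z = 0" if "z \<in> Hs b" for z
    using orth_Hs_ramp[OF fn_SQ[of b], of "u - u'" z] that by simp
  show ?thesis
  proof
    fix A show "mom b u A = mom b u' A"
    proof (cases "A \<in> sets borel")
      case True
      then show ?thesis using orth[OF indicator_Hs[OF True]] by (simp add: mom_inner inner_diff_left)
    qed (simp add: mom_def)
  qed
qed

text \<open>The second argument is the initial velocity and not its average: \<open>mom\<close> sees
  only the average over the current positions, and in this form both arguments depend on the data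
  continuously in norm.\<close>

definition ssemi :: "real \<Rightarrow> state \<Rightarrow> state" where
  "ssemi t \<mu> = sstate (sticky (qf (fst \<mu>)) (vl \<mu>) t) (vl \<mu>)"

lemma ssemi_V2: "ssemi t \<mu> \<in> V2"
  unfolding ssemi_def by (rule sstate_V2[OF sticky_MK])

lemma sticky_tendsto_data:
  assumes "an \<longlonglongrightarrow> a" "vn \<longlonglongrightarrow> v"
  shows "(\<lambda>n. sticky (an n) (vn n) t) \<longlonglongrightarrow> sticky a v t"
proof -
  have "(\<lambda>n. an n + t *\<^sub>R vn n - (a + t *\<^sub>R v)) \<longlonglongrightarrow> a + t *\<^sub>R v - (a + t *\<^sub>R v)"
    by (intro tendsto_intros assms)
  then have "(\<lambda>n. norm (an n + t *\<^sub>R vn n - (a + t *\<^sub>R v))) \<longlonglongrightarrow> 0" by (simp add: tendsto_norm_zero)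
  then have "(\<lambda>n. sticky (an n) (vn n) t - sticky a v t) \<longlonglongrightarrow> 0"
    by (rule Lim_null_comparison[OF always_eventually, rotated]) (use sticky_dist in blast)
  then show ?thesis by (rule LIM_zero_cancel)
qed

lemma ssemi_continuous:
  assumes "\<And>n. \<mu>n n \<in> V2" "\<mu> \<in> V2" "(\<lambda>n. D2 (\<mu>n n) \<mu>) \<longlonglongrightarrow> 0"
  shows "(\<lambda>n. W2 (fst (ssemi t (\<mu>n n))) (fst (ssemi t \<mu>))) \<longlonglongrightarrow> 0"
    "weakly_converges (\<lambda>n. snd (ssemi t (\<mu>n n))) (snd (ssemi t \<mu>))"
proof -
  have L: "(\<lambda>n. qf (fst (\<mu>n n))) \<longlonglongrightarrow> qf (fst \<mu>)" "(\<lambda>n. vl (\<mu>n n)) \<longlonglongrightarrow> vl \<mu>"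
    using D2_tendsto_iff[OF assms(1,2)] assms(3) by auto
  have X: "(\<lambda>n. sticky (qf (fst (\<mu>n n))) (vl (\<mu>n n)) t) \<longlonglongrightarrow> sticky (qf (fst \<mu>)) (vl \<mu>) t"
    by (rule sticky_tendsto_data[OF L])
  then have "(\<lambda>n. dist (sticky (qf (fst (\<mu>n n))) (vl (\<mu>n n)) t) (sticky (qf (fst \<mu>)) (vl \<mu>) t)) \<longlonglongrightarrow> 0"
    by (rule tendsto_dist_iff[THEN iffD1])
  then show "(\<lambda>n. W2 (fst (ssemi t (\<mu>n n))) (fst (ssemi t \<mu>))) \<longlonglongrightarrow> 0"
    by (simp add: ssemi_def sstate_def W2_eq law_P2 qf_law sticky_MK)
  show "weakly_converges (\<lambda>n. snd (ssemi t (\<mu>n n))) (snd (ssemi t \<mu>))"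
    unfolding ssemi_def sstate_def snd_conv by (rule weakly_converges_mom[OF X L(2)])
qed

section \<open>Sticky particle motions\<close>

text \<open>If the cluster changed, there would be a first time at which its final members are
  together, and this is a collision time in the sense of strict growth over every earlier
  time.\<close>

lemma cluster_const:
  assumes cont: "\<And>i. i < N \<Longrightarrow> continuous_on {0..} (\<lambda>t. X t i)"
    and mono: "\<And>i s t. i < N \<Longrightarrow> 0 \<le> s \<Longrightarrow> s \<le> t \<Longrightarrow> cluster N X s i \<subseteq> cluster N X t i"
    and s: "0 \<le> s" and t: "s \<le> t" and nc: "collision_times N X \<inter> {s<..t} = {}" and i: "i < N"
  shows "cluster N X t i = cluster N X s i"
proof (rule ccontr)
  assume ne: "cluster N X t i \<noteq> cluster N X s i"
  have sub: "cluster N X s i \<subseteq> cluster N X t i" by (rule mono[OF i s t])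
  \<comment> \<open>The times at which all members of the final cluster coincide. Continuity makes
    this set compact, so its minimum is attained.\<close>
  define A where "A = {r \<in> {s..t}. \<forall>j\<in>cluster N X t i. X r j = X r i}"
  have A_eq: "A = {s..t} \<inter> (\<Inter>j\<in>cluster N X t i. {r \<in> {s..t}. X r j - X r i = 0})"
    by (auto simp: A_def)
  have cl: "closed {r \<in> {s..t}. X r j - X r i = 0}" if "j \<in> cluster N X t i" for j
  proof (rule continuous_closed_preimage_constant)
    show "continuous_on {s..t} (\<lambda>r. X r j - X r i)"
      using that i s by (intro continuous_on_diff continuous_on_subset[OF cont]) (auto simp: cluster_def)
  qed simp
  have "closed A"
    unfolding A_eq using cl by (intro closed_Int closed_INT) auto
  moreover have "bounded A" by (rule bounded_subset[of "{s..t}"]) (auto simp: A_def)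
  ultimately have "compact A" by (simp add: compact_eq_bounded_closed)
  moreover have "A \<noteq> {}" using t by (auto simp: A_def cluster_def intro!: exI[of _ t])
  ultimately obtain T where T: "T \<in> A" "\<forall>r\<in>A. T \<le> r" using compact_attains_inf[of A] by auto
  have Tst: "s \<le> T" "T \<le> t" using T(1) by (auto simp: A_def)
  have cT: "cluster N X T i = cluster N X t i"
  proof
    show "cluster N X T i \<subseteq> cluster N X t i" using mono[OF i _ Tst(2)] s Tst by simp
    show "cluster N X t i \<subseteq> cluster N X T i" using T(1) by (auto simp: A_def cluster_def)
  qed
  have "T \<in> collision_times N X"
    unfolding collision_times_def
  proof (intro CollectI conjI exI[of _ i] allI impI i)
    have "T \<noteq> s" using ne sub cT by auto
    then show "0 < T" using s Tst by simp
    fix r assume r: "0 \<le> r \<and> r < T"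
    have "cluster N X r i \<subseteq> cluster N X T i" using r by (intro mono[OF i]) auto
    moreover have "cluster N X r i \<noteq> cluster N X T i"
    proof
      assume eq: "cluster N X r i = cluster N X T i"
      show False
      proof (cases "s \<le> r")
        case True
        then have "r \<in> A" using eq cT r Tst by (auto simp: A_def cluster_def)
        then show False using T(2) r by force
      next
        case False
        then have "cluster N X r i \<subseteq> cluster N X s i" using r by (intro mono[OF i]) auto
        then show False using eq cT sub ne by auto
      qed
    qed
    ultimately show "cluster N X r i \<subset> cluster N X T i" by auto
  qed
  moreover have "T \<noteq> s" using ne sub cT by auto
  ultimately show False using nc Tst by auto
qed

text \<open>Along the collision times of one particle the size of its cluster increases strictly and
  never exceeds \<open>N\<close>.\<close>

lemma finite_collision_times: "finite (collision_times N X)"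
proof -
  let ?C = "\<lambda>i. {t. 0 < t \<and> (\<forall>s. 0 \<le> s \<and> s < t \<longrightarrow> cluster N X s i \<subset> cluster N X t i)}"
  have "finite (?C i)" for i
  proof (rule finite_imageD)
    have fc: "finite (cluster N X t i)" for t by (simp add: cluster_def)
    have "card (cluster N X t i) \<le> N" for t
    proof -
      have "cluster N X t i \<subseteq> {..<N}" by (auto simp: cluster_def)
      from card_mono[OF finite_lessThan this] show ?thesis by simp
    qed
    then show "finite ((\<lambda>t. card (cluster N X t i)) ` ?C i)"
      by (intro finite_subset[OF _ finite_atMost[of N]]) auto
    show "inj_on (\<lambda>t. card (cluster N X t i)) (?C i)"
    proof (rule linorder_inj_onI)
      fix s t assume st: "s < t" "s \<in> ?C i" "t \<in> ?C i"
      then have "cluster N X s i \<subset> cluster N X t i" by auto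
      then show "card (cluster N X s i) \<noteq> card (cluster N X t i)"
        using psubset_card_mono[OF fc] by (metis less_irrefl)
    qed auto
  qed
  moreover have "collision_times N X \<subseteq> (\<Union>i<N. ?C i)" by (auto simp: collision_times_def)
  ultimately show ?thesis by (meson finite_UN_I finite_lessThan finite_subset)
qed

text \<open>The starting point of the interval of free motion that ends at \<open>t\<close>; it is 0
  if no collision has occurred before.\<close>

lemma last_collision:
  assumes t: "0 < t"
  obtains s where "0 \<le> s" "s < t" "collision_times N X \<inter> {s<..<t} = {}" "s = 0 \<or> s \<in> collision_times N X"
proof -
  let ?S = "insert 0 (collision_times N X \<inter> {0<..<t})"
  have fin: "finite ?S" using finite_collision_times by auto
  have M: "Max ?S \<in> ?S" by (rule Max_in[OF fin]) auto
  have "r \<le> Max ?S" if "r \<in> collision_times N X" "r < t" for r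
    using that fin by (intro Max_ge) (auto simp: collision_times_def)
  then show thesis using M t by (intro that[of "Max ?S"]) force+
qed

section \<open>Discrete data as step functions\<close>

definition cum :: "(nat \<Rightarrow> real) \<Rightarrow> nat \<Rightarrow> real" where
  "cum m i = (\<Sum>j<i. m j)"

text \<open>Particle \<open>i\<close> occupies an interval of length \<open>m i\<close>. For ordered
  positions this is the rearrangement of the discrete measure almost everywhere, and velocities are
  laid out over the same intervals.\<close>

definition stp :: "nat \<Rightarrow> (nat \<Rightarrow> real) \<Rightarrow> (nat \<Rightarrow> real) \<Rightarrow> real \<Rightarrow> real" where
  "stp N m c w = (\<Sum>i<N. c i * indicator {cum m i..<cum m (Suc i)} w)"

context
  fixes N :: nat and m :: "nat \<Rightarrow> real"
  assumes pos: "\<And>i. i < N \<Longrightarrow> 0 < m i" and sum1: "(\<Sum>i<N. m i) = 1"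
begin

abbreviation "st \<equiv> \<lambda>c. cl (stp N m c)"
abbreviation "grp \<equiv> \<lambda>c i. {j. j < N \<and> c j = (c i :: real)}"
abbreviation "cell \<equiv> \<lambda>i. {cum m i..<cum m (Suc i)}"

lemma cum_mono: "i \<le> j \<Longrightarrow> j \<le> N \<Longrightarrow> cum m i \<le> cum m j"
  unfolding cum_def
proof (rule sum_mono2)
  assume "j \<le> N"
  then show "0 \<le> m b" if "b \<in> {..<j} - {..<i}" for b using pos[of b] that by simp
qed auto

lemma cum_bounds: "i \<le> N \<Longrightarrow> 0 \<le> cum m i \<and> cum m i \<le> 1"
  using cum_mono[of 0 i] cum_mono[of i N] by (simp add: cum_def sum1)

lemma stp_cell: "i < N \<Longrightarrow> w \<in> cell i \<Longrightarrow> stp N m c w = c i"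
proof -
  assume i: "i < N" and w: "w \<in> cell i"
  have "w \<notin> cell j" if "j < N" "j \<noteq> i" for j
    using cum_mono[of "Suc j" i] cum_mono[of "Suc i" j] that i w by (cases "j < i") auto
  then have "(\<Sum>j<N. c j * indicator (cell j) w) = (\<Sum>j<N. if j = i then c i else 0)"
    using w by (intro sum.cong) (auto simp: indicator_def)
  then show ?thesis using i by (simp add: stp_def)
qed

lemma cell_ex:
  assumes w: "0 < w" "w < 1"
  obtains i where "i < N" "w \<in> cell i"
proof -
  define k where "k = (LEAST k. w < cum m k)"
  have ex: "w < cum m N" using w by (simp add: cum_def sum1)
  have k: "w < cum m k" "k \<le> N" unfolding k_def by (rule LeastI[of "\<lambda>k. w < cum m k", OF ex], rule Least_le[of "\<lambda>k. w < cum m k", OF ex])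
  have "k \<noteq> 0" using k(1) w by (auto simp: cum_def intro: gr0I)
  then obtain i where i: "k = Suc i" by (cases k) auto
  have "cum m i \<le> w" using not_less_Least[of i "\<lambda>k. w < cum m k"] i by (simp add: k_def[symmetric] not_less)
  then show thesis using that[of i] k i by auto
qed

lemma stp_measurable: "stp N m c \<in> borel_measurable borel"
  unfolding stp_def by measurable

lemma stp_bounded: "\<bar>stp N m c w\<bar> \<le> (\<Sum>i<N. \<bar>c i\<bar>)"
proof -
  have "\<bar>stp N m c w\<bar> \<le> (\<Sum>i<N. \<bar>c i * indicator (cell i) w\<bar>)" unfolding stp_def by (rule sum_abs)
  also have "\<dots> \<le> (\<Sum>i<N. \<bar>c i\<bar>)" by (intro sum_mono) (auto simp: indicator_def)
  finally show ?thesis .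
qed

lemma stp_SQ: "stp N m c \<in> SQ"
  by (rule SQ_bounded[OF stp_measurable stp_bounded])

lemma stp_comp: "0 < w \<Longrightarrow> w < 1 \<Longrightarrow> g (stp N m c w) (stp N m d w) = stp N m (\<lambda>i. g (c i) (d i)) w"
  by (erule (1) cell_ex) (simp add: stp_cell)

text \<open>The first cell contains 0, which lies outside the unit interval; hence the comparison
  with the full cell from above and with its interior from below.\<close>

lemma measure_cell: "i < N \<Longrightarrow> \<mu>01 ({0<..<1} \<inter> cell i) = m i"
proof (rule antisym)
  assume i: "i < N"
  have b: "0 \<le> cum m i" "cum m (Suc i) \<le> 1" "cum m (Suc i) = cum m i + m i"
    using cum_bounds[of i] cum_bounds[of "Suc i"] i by (auto simp: cum_def)
  have r: "\<mu>01 ({0<..<1} \<inter> cell i) = measure lborel ({0<..<1} \<inter> cell i)"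
    by (rule measure_restrict_space) auto
  have le: "cum m i \<le> cum m (Suc i)" using b(3) pos[OF i] by simp
  have "measure lborel ({0<..<1} \<inter> cell i) \<le> measure lborel (cell i)"
    using le by (intro measure_mono_fmeasurable) (auto simp: fmeasurable_def)
  then show "\<mu>01 ({0<..<1} \<inter> cell i) \<le> m i" unfolding r using b pos[OF i] by simp
  have "measure lborel {cum m i<..<cum m (Suc i)} \<le> measure lborel ({0<..<1} \<inter> cell i)"
  proof (rule measure_mono_fmeasurable)
    have "emeasure lborel ({0<..<1} \<inter> cell i) \<le> emeasure lborel (cell i)" by (rule emeasure_mono) auto
    also have "\<dots> < \<infinity>" using le by simp
    finally show "{0<..<1} \<inter> cell i \<in> fmeasurable lborel" by (auto simp: fmeasurable_def)
  qed (use b in auto)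
  then show "m i \<le> \<mu>01 ({0<..<1} \<inter> cell i)" unfolding r using b pos[OF i] by simp
qed

lemma integral_stp: "(\<integral>w. stp N m c w \<partial>unit_lebesgue) = (\<Sum>i<N. m i * c i)"
proof -
  have s: "{0<..<1} \<inter> cell i \<in> sets unit_lebesgue" for i by (auto simp: sets_restrict_space)
  have "(\<integral>w. stp N m c w \<partial>unit_lebesgue) =
      (\<integral>w. (\<Sum>i<N. c i * indicator ({0<..<1} \<inter> cell i) w) \<partial>unit_lebesgue)"
    by (intro Bochner_Integration.integral_cong) (auto simp: stp_def indicator_def intro!: sum.cong)
  also have "\<dots> = (\<Sum>i<N. \<integral>w. c i * indicator ({0<..<1} \<inter> cell i) w \<partial>unit_lebesgue)"
    using s by (intro Bochner_Integration.integral_sum integrable_mult_right integrable_real_indicator)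
      (auto simp: less_top[symmetric])
  also have "\<dots> = (\<Sum>i<N. m i * c i)"
  proof (intro sum.cong refl)
    fix i assume "i \<in> {..<N}"
    have "(\<integral>w. c i * indicator ({0<..<1} \<inter> cell i) w \<partial>unit_lebesgue) = c i * \<mu>01 ({0<..<1} \<inter> cell i)"
      using s[of i] by (simp add: Int_assoc[symmetric] Int_commute)
    then show "(\<integral>w. c i * indicator ({0<..<1} \<inter> cell i) w \<partial>unit_lebesgue) = m i * c i"
      using measure_cell[of i] \<open>i \<in> {..<N}\<close> by simp
  qed
  finally show ?thesis .
qed

lemma st_comp2: "cl (\<lambda>w. g (stp N m c w) (stp N m d w)) = st (\<lambda>i. g (c i) (d i))"
  if "(\<lambda>w. g (stp N m c w) (stp N m d w)) \<in> SQ"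
proof (rule cl_eqI[OF that stp_SQ])
  show "AE w in unit_lebesgue. g (stp N m c w) (stp N m d w) = stp N m (\<lambda>i. g (c i) (d i)) w"
    using AE_UL_space by eventually_elim (simp add: stp_comp)
qed

lemma st_add: "st c + st d = st (\<lambda>i. c i + d i)"
  using st_comp2[of "(+)" c d] by (simp add: cl_add stp_SQ SQ_add)

lemma st_diff: "st c - st d = st (\<lambda>i. c i - d i)"
  using st_comp2[of "(-)" c d] by (simp add: cl_diff stp_SQ SQ_diff)

lemma st_scale: "r *\<^sub>R st c = st (\<lambda>i. r * c i)"
  using st_comp2[of "\<lambda>x y. r * x" c c] by (simp add: cl_scale stp_SQ SQ_scale)

lemma inner_st: "inner (st c) (st d) = (\<Sum>i<N. m i * (c i * d i))"
proof -
  have "inner (st c) (st d) = (\<integral>w. stp N m c w * stp N m d w \<partial>unit_lebesgue)"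
    by (rule inner_cl[OF stp_SQ stp_SQ])
  also have "\<dots> = (\<integral>w. stp N m (\<lambda>i. c i * d i) w \<partial>unit_lebesgue)"
    by (intro Bochner_Integration.integral_cong) (auto simp: stp_comp)
  finally show ?thesis by (simp add: integral_stp)
qed

text \<open>Positive masses let the norm control each coefficient separately, which yields
  injectivity of the encoding and Lipschitz continuity of individual trajectories.\<close>

lemma norm_st_ge:
  assumes "i < N"
  shows "m i * (c i - d i)\<^sup>2 \<le> (norm (st c - st d))\<^sup>2"
proof -
  have "m i * (c i - d i)\<^sup>2 \<le> (\<Sum>i<N. m i * (c i - d i)\<^sup>2)"
  proof (rule member_le_sum)
    show "0 \<le> m j * (c j - d j)\<^sup>2" if "j \<in> {..<N} - {i}" for j using pos[of j] that by simp
  qed (use assms in auto)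
  also have "\<dots> = (norm (st c - st d))\<^sup>2"
    by (simp add: st_diff power2_norm_eq_inner inner_st) (simp add: power2_eq_square)
  finally show ?thesis .
qed

lemma st_eq_iff: "st c = st d \<longleftrightarrow> (\<forall>i<N. c i = d i)"
proof
  assume eq: "st c = st d"
  show "\<forall>i<N. c i = d i"
  proof (intro allI impI)
    fix i assume i: "i < N"
    have "m i * (c i - d i)\<^sup>2 \<le> 0" using norm_st_ge[OF i, of c d] eq by simp
    then show "c i = d i" using pos[OF i] by (simp add: mult_le_0_iff)
  qed
next
  assume "\<forall>i<N. c i = d i"
  then have "stp N m c = stp N m d" by (auto simp: stp_def intro!: ext sum.cong)
  then show "st c = st d" by simp
qed

lemma st_MK:
  assumes c: "\<And>i j. i \<le> j \<Longrightarrow> j < N \<Longrightarrow> c i \<le> c j"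
  shows "st c \<in> MK"
proof (rule MK_I[OF stp_SQ])
  show "mono01 (stp N m c)"
    unfolding mono01_def
  proof (intro allI impI)
    fix w w' :: real assume w: "0 < w" "w \<le> w'" "w' < 1"
    obtain i where i: "i < N" "w \<in> cell i" using cell_ex[of w] w by auto
    obtain j where j: "j < N" "w' \<in> cell j" using cell_ex[of w'] w by auto
    have "i \<le> j" using cum_mono[of "Suc j" i] i j w by (cases "i \<le> j") auto
    then show "stp N m c w \<le> stp N m c w'" using stp_cell[OF i] stp_cell[OF j] c[of i j] j by simp
  qed
qed

text \<open>Membership in the cone is a statement up to null sets, so single values say nothing. The
  means over the cells \<open>i\<close> and \<open>j\<close> are compared instead with the value of
  the monotone representative at \<open>cum m j\<close>, which separates the cells.\<close>

lemma st_MKD: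
  assumes "st c \<in> MK" and ij: "i \<le> j" "j < N"
  shows "c i \<le> c j"
proof (cases "i = j")
  case False
  then have ij: "i < j" "j < N" using ij by auto
  let ?f = "mrep (st c)"
  note M = mrep[OF assms(1)]
  have cj: "0 < cum m j" "cum m j < 1"
  proof -
    have "cum m 0 + m 0 \<le> cum m j" using cum_mono[of 1 j] ij by (simp add: cum_def)
    then show "0 < cum m j" using pos[of 0] ij by (simp add: cum_def)
    have "cum m j + m j \<le> cum m N" using cum_mono[of "Suc j" N] ij by (simp add: cum_def)
    then show "cum m j < 1" using pos[of j] ij by (simp add: cum_def sum1)
  qed
  \<comment> \<open>Testing with the indicator of cell \<open>k\<close> extracts the coefficient
    \<open>c k\<close>, with \<open>?f\<close> in place of the step function.\<close>
  have e: "m k * c k = (\<integral>w. ?f w * stp N m (\<lambda>i. if i = k then 1 else 0) w \<partial>unit_lebesgue)" if k: "k < N" for k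
  proof -
    have "inner (st c) (st (\<lambda>i. if i = k then 1 else 0)) = (\<Sum>i<N. if i = k then m k * c k else 0)"
      unfolding inner_st by (intro sum.cong) auto
    then show ?thesis using inner_cl[OF M(1) stp_SQ, of "\<lambda>i. if i = k then 1 else 0"] M(3) k by simp
  qed
  have e': "m k * C = (\<integral>w. C * stp N m (\<lambda>i. if i = k then 1 else 0) w \<partial>unit_lebesgue)" if k: "k < N" for k C
  proof -
    have "(\<Sum>i<N. m i * (if i = k then 1 else 0)) = (\<Sum>i<N. if i = k then m k else 0)"
      by (intro sum.cong) auto
    then show ?thesis using k by (simp add: integral_stp)
  qed
  have I: "integrable unit_lebesgue (\<lambda>w. ?f w * stp N m (\<lambda>i. if i = k then 1 else 0) w)"
    "integrable unit_lebesgue (\<lambda>w. C * stp N m (\<lambda>i. if i = k then 1 else 0) w)" for k C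
    by (intro SQ_mult_integrable M stp_SQ) (intro integrable_mult_right SQ_integrable stp_SQ)
  have v: "stp N m (\<lambda>i. if i = k then 1 else 0) w = (if w \<in> cell k then 1 else 0)"
    if "k < N" "0 < w" "w < 1" for k w
  proof -
    from cell_ex[OF that(2,3)] obtain l where l: "l < N" "w \<in> cell l" by blast
    show ?thesis
    proof (cases "l = k")
      case True
      then show ?thesis using stp_cell[OF l] l by simp
    next
      case False
      then have "w \<notin> cell k"
        using cum_mono[of "Suc l" k] cum_mono[of "Suc k" l] that l by (cases "l < k") auto
      then show ?thesis using stp_cell[OF l] False by simp
    qed
  qed
  have iN: "i < N" using ij by simp
  have "(\<integral>w. ?f w * stp N m (\<lambda>k. if k = i then 1 else 0) w \<partial>unit_lebesgue)
      \<le> (\<integral>w. ?f (cum m j) * stp N m (\<lambda>k. if k = i then 1 else 0) w \<partial>unit_lebesgue)"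
  proof (rule integral_mono[OF I])
    fix w assume "w \<in> space unit_lebesgue"
    then have w: "0 < w" "w < 1" by auto
    have "w \<le> cum m j" if "w \<in> cell i" using that cum_mono[of "Suc i" j] ij by auto
    then show "?f w * stp N m (\<lambda>k. if k = i then 1 else 0) w \<le> ?f (cum m j) * stp N m (\<lambda>k. if k = i then 1 else 0) w"
      using mono01D[OF M(2) w(1), of "cum m j"] cj by (simp add: v iN w)
  qed
  then have "m i * c i \<le> m i * ?f (cum m j)" by (simp only: e[OF iN, symmetric] e'[OF iN, symmetric])
  moreover have "(\<integral>w. ?f (cum m j) * stp N m (\<lambda>k. if k = j then 1 else 0) w \<partial>unit_lebesgue)
      \<le> (\<integral>w. ?f w * stp N m (\<lambda>k. if k = j then 1 else 0) w \<partial>unit_lebesgue)"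
  proof (rule integral_mono[OF I(2) I(1)])
    fix w assume "w \<in> space unit_lebesgue"
    then have w: "0 < w" "w < 1" by auto
    show "?f (cum m j) * stp N m (\<lambda>k. if k = j then 1 else 0) w \<le> ?f w * stp N m (\<lambda>k. if k = j then 1 else 0) w"
      using mono01D[OF M(2) cj(1), of w] w by (simp add: v ij w)
  qed
  then have "m j * ?f (cum m j) \<le> m j * c j"
    by (simp only: e[OF ij(2), symmetric] e'[OF ij(2), symmetric])
  ultimately have "c i \<le> ?f (cum m j)" "?f (cum m j) \<le> c j" using pos[OF iN] pos[OF ij(2)] by simp_all
  then show ?thesis by simp
qed simp

lemma st_HsI:
  assumes d: "\<And>i j. i < N \<Longrightarrow> j < N \<Longrightarrow> c i = c j \<Longrightarrow> d i = d j"
  shows "st d \<in> Hs (st c)"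
proof -
  \<comment> \<open>The choice may pick any particle at position \<open>y\<close>, since
    \<open>d\<close> agrees on all of them; as \<open>g\<close> differs from 0 at finitely many
    points only, it is Borel.\<close>
  define g where "g y = (if y \<in> c ` {..<N} then d (SOME i. i < N \<and> c i = y) else 0)" for y
  have g: "g \<in> borel_measurable borel"
    by (rule measurable_discrete_difference[of "\<lambda>_. 0" _ _ "c ` {..<N}"])
      (auto simp: g_def intro: countable_finite)
  have gc: "g (c i) = d i" if i: "i < N" for i
  proof -
    have "(SOME j. j < N \<and> c j = c i) < N \<and> c (SOME j. j < N \<and> c j = c i) = c i"
      by (rule someI[of _ i]) (use i in simp)
    then show ?thesis using d[of "SOME j. j < N \<and> c j = c i" i] i by (simp add: g_def)
  qed
  have S: "(\<lambda>w. g (stp N m c w)) \<in> SQ"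
  proof (rule SQ_cong_AE[OF measurable_compose[OF stp_measurable g] stp_SQ])
    show "AE w in unit_lebesgue. g (stp N m c w) = stp N m (\<lambda>i. g (c i)) w"
      using AE_UL_space by eventually_elim (use stp_comp[of _ "\<lambda>x y. g x" c c] in simp)
  qed
  have "st d = st (\<lambda>i. g (c i))" by (simp add: st_eq_iff gc)
  also have "\<dots> = cl (\<lambda>w. g (stp N m c w))" using st_comp2[of "\<lambda>x y. g x" c c] S by simp
  also have "\<dots> \<in> Hs (st c)" by (rule Hs_cl_I[OF stp_SQ g S])
  finally show ?thesis .
qed

lemma st_HsE:
  assumes "z \<in> Hs (st c)"
  obtains d where "z = st d" "\<And>i j. c i = c j \<Longrightarrow> d i = d j"
proof -
  obtain g where g: "(\<lambda>w. g (stp N m c w)) \<in> SQ" "z = cl (\<lambda>w. g (stp N m c w))"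
    using Hs_cl_E[OF stp_SQ assms] by metis
  then have "z = st (\<lambda>i. g (c i))" using st_comp2[of "\<lambda>x y. g x" c c] by simp
  from that[OF this] show thesis by simp
qed

lemma st_HsD:
  assumes "st d \<in> Hs (st c)" "i < N" "j < N" "c i = c j"
  shows "d i = d j"
  using st_HsE[OF assms(1)] assms(2-4) by (metis st_eq_iff)

lemma grp_mass: "i < N \<Longrightarrow> 0 < (\<Sum>j\<in>grp c i. m j)"
  by (intro sum_pos2[of _ i]) (auto intro: pos less_imp_le)

text \<open>Tested against a function of the clusters, the mass of each cluster cancels once the
  double sum is interchanged; \<open>avg_unique\<close> then identifies the mean.\<close>

lemma avg_st:
  assumes c: "st c \<in> MK"
  shows "avg (st c) (st u) = st (\<lambda>i. (\<Sum>j\<in>grp c i. m j * u j) / (\<Sum>j\<in>grp c i. m j))"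
    (is "_ = st ?a")
proof (rule avg_unique[OF c])
  show "st ?a \<in> Hs (st c)" by (rule st_HsI) simp
  fix z assume "z \<in> Hs (st c)"
  from st_HsE[OF this] obtain d where d: "z = st d" "\<And>i j. c i = c j \<Longrightarrow> d i = d j" by metis
  let ?M = "\<lambda>i. \<Sum>j\<in>grp c i. m j"
  have "(\<Sum>i<N. m i * (?a i * d i)) = (\<Sum>i<N. \<Sum>j<N. if c j = c i then m i * d i / ?M i * (m j * u j) else 0)"
  proof (intro sum.cong refl)
    fix i assume "i \<in> {..<N}"
    have "(\<Sum>j<N. if c j = c i then m i * d i / ?M i * (m j * u j) else 0) = (\<Sum>j\<in>grp c i. m i * d i / ?M i * (m j * u j))"
      by (rule sum.mono_neutral_cong_right) auto
    also have "\<dots> = m i * d i / ?M i * (\<Sum>j\<in>grp c i. m j * u j)" by (rule sum_distrib_left[symmetric])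
    finally show "m i * (?a i * d i) = (\<Sum>j<N. if c j = c i then m i * d i / ?M i * (m j * u j) else 0)" by simp
  qed
  also have "\<dots> = (\<Sum>j<N. \<Sum>i<N. if c j = c i then m i * d i / ?M i * (m j * u j) else 0)" by (rule sum.swap)
  also have "\<dots> = (\<Sum>j<N. m j * (u j * d j))"
  proof (intro sum.cong refl)
    fix j assume j: "j \<in> {..<N}"
    have "(\<Sum>i<N. if c j = c i then m i * d i / ?M i * (m j * u j) else 0) = (\<Sum>i\<in>grp c j. m i * (d j / ?M j * (m j * u j)))"
      by (rule sum.mono_neutral_cong_right) (auto dest: d(2))
    also have "\<dots> = ?M j * (d j / ?M j * (m j * u j))" by (rule sum_distrib_right[symmetric])
    also have "\<dots> = m j * (u j * d j)" using grp_mass[of j c] j by simp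
    finally show "(\<Sum>i<N. if c j = c i then m i * d i / ?M i * (m j * u j) else 0) = m j * (u j * d j)" .
  qed
  finally show "inner (st u - st ?a) z = 0" unfolding d(1) inner_diff_left inner_st by simp
qed

lemma sstate_st: "sstate (st x) (st v) = particle_state N m x v"
proof -
  have ind: "(\<integral>w. indicator A (stp N m x w) * stp N m v w \<partial>unit_lebesgue) = (\<Sum>i<N. m i * v i * indicator A (x i))" for v A
  proof -
    have "(\<integral>w. indicator A (stp N m x w) * stp N m v w \<partial>unit_lebesgue) = (\<integral>w. stp N m (\<lambda>i. indicator A (x i) * v i) w \<partial>unit_lebesgue)"
      by (intro Bochner_Integration.integral_cong)
        (auto simp: stp_comp[of _ "\<lambda>a b. indicator A a * b"])
    then show ?thesis by (simp add: integral_stp ac_simps)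
  qed
  have "law (st x) = distr (point_measure {..<N} (\<lambda>i. ennreal (m i))) borel x"
  proof (rule measure_eqI)
    fix A assume "A \<in> sets (law (st x))"
    then have A: "A \<in> sets borel" by (simp add: law_def)
    note mx = SQ_measurable_UL[OF stp_SQ[of x]]
    have pre: "stp N m x -` A \<inter> {0<..<1} \<in> sets unit_lebesgue"
      using measurable_sets[OF mx A] by simp
    have "emeasure (law (st x)) A = ennreal (\<mu>01 (stp N m x -` A \<inter> {0<..<1}))"
      unfolding law_cl[OF stp_SQ] using A mx by (simp add: emeasure_distr UL.emeasure_eq_measure)
    also have "\<mu>01 (stp N m x -` A \<inter> {0<..<1}) = (\<integral>w. indicator (stp N m x -` A \<inter> {0<..<1}) w \<partial>unit_lebesgue)"
      using pre by (simp add: Int_assoc)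
    also have "\<dots> = (\<integral>w. indicator A (stp N m x w) * stp N m (\<lambda>_. 1) w \<partial>unit_lebesgue)"
    proof (intro Bochner_Integration.integral_cong refl)
      fix w assume "w \<in> space unit_lebesgue"
      then have w: "0 < w" "w < 1" by auto
      then obtain i where "i < N" "w \<in> cell i" using cell_ex by blast
      then show "indicator (stp N m x -` A \<inter> {0<..<1}) w = indicator A (stp N m x w) * stp N m (\<lambda>_. 1) w"
        using w by (simp add: stp_cell indicator_def)
    qed
    also have "\<dots> = (\<Sum>i<N. m i * indicator A (x i))" unfolding ind by simp
    also have "ennreal \<dots> = (\<Sum>i<N. ennreal (m i * indicator A (x i)))"
      by (rule sum_ennreal[symmetric]) (auto intro: mult_nonneg_nonneg less_imp_le pos)
    also have "\<dots> = (\<Sum>i\<in>{i\<in>{..<N}. x i \<in> A}. ennreal (m i))"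
      by (rule sum.mono_neutral_cong_right) auto
    also have "\<dots> = emeasure (point_measure {..<N} (\<lambda>i. ennreal (m i))) {i\<in>{..<N}. x i \<in> A}"
      by (rule emeasure_point_measure_finite[symmetric]) auto
    also have "\<dots> = emeasure (distr (point_measure {..<N} (\<lambda>i. ennreal (m i))) borel x) A"
      using A by (subst emeasure_distr)
        (auto simp: measurable_point_measure_eq1 space_point_measure intro!: arg_cong[where f = "emeasure _"])
    finally show "emeasure (law (st x)) A = emeasure (distr (point_measure {..<N} (\<lambda>i. ennreal (m i))) borel x) A" .
  qed (simp add: law_def)
  moreover have "mom (st x) (st v) = (\<lambda>A. if A \<in> sets borel then (\<Sum>i<N. m i * v i * indicator A (x i)) else 0)"
    using mom_cl[OF stp_SQ stp_SQ] ind by (auto simp: mom_def)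
  ultimately show ?thesis by (simp add: sstate_def particle_state_def)
qed

lemma avg_st_cluster:
  "st (X t) \<in> MK \<Longrightarrow> avg (st (X t)) (st u) =
    st (\<lambda>i. (\<Sum>j\<in>cluster N X t i. m j * u j) / (\<Sum>j\<in>cluster N X t i. m j))"
  using avg_st[of "X t" u] by (simp add: cluster_def)

text \<open>Without merging no information is lost: earlier positions are functions of the later
  ones, the reverse of the inclusion that always holds along the flow.\<close>

lemma Hs_cluster_const:
  assumes "\<And>i. i < N \<Longrightarrow> cluster N X t i = cluster N X s i"
  shows "st (X s) \<in> Hs (st (X t))"
proof (rule st_HsI)
  fix i j assume "i < N" "j < N" "X t i = X t j"
  then have "j \<in> cluster N X t i" by (simp add: cluster_def)
  then show "X s i = X s j" unfolding assms[OF \<open>i < N\<close>] by (simp add: cluster_def)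
qed

context
  fixes x v :: "nat \<Rightarrow> real"
  assumes x: "strict_mono_on {..<N} x"
begin

lemma st_x: "st x \<in> MK"
  using strict_mono_on_leD[OF x] by (intro st_MK) auto

lemma st_v: "st v \<in> Hs (st x)"
proof (rule st_HsI)
  fix i j assume ij: "i < N" "j < N" "x i = x j"
  have "i = j"
    by (rule inj_onD[OF strict_mono_on_imp_inj_on[OF x] ij(3)]) (simp_all add: ij(1,2))
  then show "v i = v j" by simp
qed

text \<open>Between collisions a motion stays in the cone, so the semigroup property of the projection
  identifies it; at a collision the averaging rule composes with the previous average.\<close>

lemma sticky_motion_step:
  assumes M: "sticky_motion N m x v X V"
    and s: "0 \<le> s" and t: "s < t" and nc: "collision_times N X \<inter> {s<..<t} = {}"
    and IH: "st (X s) = sticky (st x) (st v) s" "st (V s) = svel (st x) (st v) s"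
  shows "st (X t) = sticky (st x) (st v) t" "st (V t) = svel (st x) (st v) t"
proof -
  note M' = M[unfolded sticky_motion_def, THEN conjunct2]
  note Mc = M'[THEN conjunct1, rule_format]
  note Mo = M'[THEN conjunct2, THEN conjunct1, rule_format]
  note Mm = M'[THEN conjunct2, THEN conjunct2, THEN conjunct1, rule_format]
  note M'' = M'[THEN conjunct2, THEN conjunct2, THEN conjunct2, THEN conjunct2]
  note MV = M''[THEN conjunct1, rule_format]
  note MX = M''[THEN conjunct2, THEN conjunct1, rule_format]
  note MC = M''[THEN conjunct2, THEN conjunct2, rule_format]
  have XMK: "st (X t) \<in> MK" using Mo[of t] s t by (intro st_MK) auto
  have "st (X t) = st (X s) + (t - s) *\<^sub>R st (V s)"
    unfolding st_scale st_add st_eq_iff using MX[OF _ s less_imp_le[OF t] nc] by simp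
  then have eq: "st (X t) = sticky (st x) (st v) s + (t - s) *\<^sub>R svel (st x) (st v) s" using IH by simp
  have "sticky (st x) (st v) t = cproj MK (st (X t))"
    unfolding eq by (rule sticky_step[OF st_x st_v s less_imp_le[OF t]])
  also have "\<dots> = st (X t)" by (rule cproj_self[OF closed_cone_MK XMK])
  finally show X: "st (X t) = sticky (st x) (st v) t" by simp
  have sv: "svel (st x) (st v) t = avg (st (X t)) (st (V s))"
    using avg_svel[OF st_x st_v s less_imp_le[OF t]] by (simp add: X IH)
  show "st (V t) = svel (st x) (st v) t"
  proof (cases "t \<in> collision_times N X")
    case True
    \<comment> \<open>Velocities are constant strictly between \<open>s\<close> and
      \<open>t\<close>, so the left limits in the collision rule are the velocities at
      \<open>s\<close>.\<close>
    have lim: "Lim (at_left t) (\<lambda>r. V r j) = V s j" if j: "j < N" for j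
    proof -
      have "V r j = V s j" if "s < r" "r < t" for r
        using nc that s by (intro MV[OF j]) auto
      then have "\<forall>\<^sub>F r in at_left t. V r j = V s j"
        unfolding eventually_at_left_field using t by blast
      then have "((\<lambda>r. V r j) \<longlongrightarrow> V s j) (at_left t)" by (rule tendsto_eventually)
      then show ?thesis by (intro tendsto_Lim) simp_all
    qed
    have "V t i = (\<Sum>j\<in>cluster N X t i. m j * V s j) / (\<Sum>j\<in>cluster N X t i. m j)" if i: "i < N" for i
      unfolding MC[OF True i] by (intro arg_cong2[where f = "(/)"] sum.cong) (auto simp: cluster_def lim)
    then show ?thesis unfolding sv avg_st_cluster[of X t "V s", OF XMK] st_eq_iff by simp
  next
    case False
    then have nc': "collision_times N X \<inter> {s<..t} = {}" using nc by (auto simp: less_le)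
    have c: "cluster N X t i = cluster N X s i" if "i < N" for i
      by (rule cluster_const[OF Mc Mm s less_imp_le[OF t] nc' that])
    have "st (V s) \<in> Hs (st (X s))" unfolding IH by (rule svel_Hs)
    then have "st (V s) \<in> Hs (st (X t))" using Hs_trans[OF Hs_cluster_const[OF c]] by blast
    then have "svel (st x) (st v) t = st (V s)" unfolding sv by (rule avg_id[OF XMK])
    then show ?thesis using MV[OF _ s less_imp_le[OF t] nc'] by (simp add: st_eq_iff)
  qed
qed

text \<open>Induction on the number of earlier collisions: the last one before \<open>t\<close> has
  fewer predecessors, and free motion leads from it to \<open>t\<close>.\<close>

lemma sticky_motion_unique:
  assumes M: "sticky_motion N m x v X V" and t: "0 \<le> t"
  shows "st (X t) = sticky (st x) (st v) t \<and> st (V t) = svel (st x) (st v) t"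
  using t
proof (induction "card (collision_times N X \<inter> {0<..<t})" arbitrary: t rule: less_induct)
  case less
  have P0: "st (X 0) = sticky (st x) (st v) 0 \<and> st (V 0) = svel (st x) (st v) 0"
    using M by (simp add: sticky_motion_def sticky_0[OF st_x] svel_0[OF st_x st_v] st_eq_iff)
  show ?case
  proof (cases "t = 0")
    case False
    then have t: "0 < t" using less.prems by simp
    obtain s where s: "0 \<le> s" "s < t" "collision_times N X \<inter> {s<..<t} = {}"
      "s = 0 \<or> s \<in> collision_times N X" using last_collision[OF t] .
    have "st (X s) = sticky (st x) (st v) s \<and> st (V s) = svel (st x) (st v) s"
    proof (cases "s = 0")
      case False
      then have "collision_times N X \<inter> {0<..<s} \<subset> collision_times N X \<inter> {0<..<t}"
        using s by (auto intro: less_trans)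
      then have "card (collision_times N X \<inter> {0<..<s}) < card (collision_times N X \<inter> {0<..<t})"
        using finite_collision_times by (intro psubset_card_mono) auto
      then show ?thesis using less.hyps s(1) by blast
    qed (use P0 in simp)
    then show ?thesis using sticky_motion_step[OF M s(1-3)] by blast
  qed (use P0 in simp)
qed

text \<open>Coefficients exist because the projected curve stays a function of \<open>st x\<close>,
  hence a step function on the same cells. Indices from \<open>N\<close> on carry no
  information.\<close>

definition pX :: "real \<Rightarrow> nat \<Rightarrow> real" where
  "pX t = (if t = 0 then x else (SOME d. sticky (st x) (st v) t = st d))"

definition pV :: "real \<Rightarrow> nat \<Rightarrow> real" where
  "pV t i = (\<Sum>j\<in>cluster N pX t i. m j * v j) / (\<Sum>j\<in>cluster N pX t i. m j)"

lemma pX: "0 \<le> t \<Longrightarrow> st (pX t) = sticky (st x) (st v) t"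
proof (cases "t = 0")
  case True
  then show ?thesis by (simp add: pX_def sticky_0[OF st_x])
next
  case False
  assume t: "0 \<le> t"
  have "sticky (st x) (st v) t \<in> Hs (st x)"
    using sticky_Hs[OF st_x st_v _ t] by (simp add: sticky_0[OF st_x])
  then have "\<exists>d. sticky (st x) (st v) t = st d" using st_HsE by metis
  from someI_ex[OF this] show ?thesis using False by (simp add: pX_def)
qed

lemma pX_MK: "0 \<le> t \<Longrightarrow> st (pX t) \<in> MK"
  by (simp add: pX sticky_MK)

lemma pV: "0 \<le> t \<Longrightarrow> st (pV t) = svel (st x) (st v) t"
  using avg_st_cluster[of pX t v, OF pX_MK] by (simp add: pV_def[abs_def] svel_def pX)

lemma pX_continuous: "i < N \<Longrightarrow> continuous_on {0..} (\<lambda>t. pX t i)"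
proof (rule lipschitz_on_continuous_on)
  assume i: "i < N"
  let ?L = "norm (st v) / sqrt (m i)"
  show "?L-lipschitz_on {0..} (\<lambda>t. pX t i)"
  proof (rule lipschitz_onI)
    fix s t :: real assume st: "s \<in> {0..}" "t \<in> {0..}"
    have "m i * (pX s i - pX t i)\<^sup>2 \<le> (norm (sticky (st x) (st v) s - sticky (st x) (st v) t))\<^sup>2"
      using norm_st_ge[OF i, of "pX s" "pX t"] st by (simp add: pX)
    also have "\<dots> \<le> (\<bar>s - t\<bar> * norm (st v))\<^sup>2"
      by (intro power_mono sticky_lipschitz) auto
    finally have "(pX s i - pX t i)\<^sup>2 \<le> (\<bar>s - t\<bar> * norm (st v))\<^sup>2 / m i"
      using pos[OF i] by (simp add: pos_le_divide_eq mult.commute)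
    also have "\<dots> = (?L * \<bar>s - t\<bar>)\<^sup>2"
      using pos[OF i] by (simp add: power_mult_distrib power_divide)
    finally have "\<bar>pX s i - pX t i\<bar>\<^sup>2 \<le> (?L * \<bar>s - t\<bar>)\<^sup>2" by (simp only: power2_abs)
    then show "dist (pX s i) (pX t i) \<le> ?L * dist s t"
      unfolding dist_real_def by (rule power2_le_imp_le) (use pos[OF i] in simp)
  qed (use pos[OF i] in auto)
qed

lemma pX_cluster_mono: "i < N \<Longrightarrow> 0 \<le> s \<Longrightarrow> s \<le> t \<Longrightarrow> cluster N pX s i \<subseteq> cluster N pX t i"
proof
  fix j assume i: "i < N" and st: "0 \<le> s" "s \<le> t" and j: "j \<in> cluster N pX s i"
  have "st (pX t) \<in> Hs (st (pX s))" using sticky_Hs[OF st_x st_v st] st by (simp add: pX)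
  then show "j \<in> cluster N pX t i" using st_HsD[of "pX t" "pX s" j i] i j by (simp add: cluster_def)
qed

lemma pV_const:
  assumes "i < N" "0 \<le> s" "s \<le> t" "collision_times N pX \<inter> {s<..t} = {}"
  shows "pV t i = pV s i"
  using cluster_const[OF pX_continuous pX_cluster_mono assms(2-4,1)] by (simp add: pV_def)

text \<open>Before \<open>t\<close> the clusters are unchanged, so the displacement is its own
  average and \<open>avg_sticky_diff\<close> applies. The end point may be a collision time and is
  reached by continuity.\<close>

lemma pX_affine:
  assumes i: "i < N" and s: "0 \<le> s" and t: "s \<le> t" and nc: "collision_times N pX \<inter> {s<..<t} = {}"
  shows "pX t i = pX s i + (t - s) * pV s i"
proof (cases "s = t")
  case False
  then have t: "s < t" using t by simp
  have r: "pX r i = pX s i + (r - s) * pV s i" if r: "s < r" "r < t" for r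
  proof -
    have nc': "collision_times N pX \<inter> {s<..r} = {}" using nc r by auto
    have r0: "0 \<le> r" using s r by simp
    have "st (pX s) \<in> Hs (st (pX r))"
      by (rule Hs_cluster_const) (rule cluster_const[OF pX_continuous pX_cluster_mono s less_imp_le[OF r(1)] nc'])
    then have "avg (st (pX r)) (st (pX r) - st (pX s)) = st (pX r) - st (pX s)"
      by (intro avg_id pX_MK r0 Hs_diff Hs_self)
    moreover have "avg (st (pX r)) (st (pX r) - st (pX s)) = (r - s) *\<^sub>R st (pV r)"
      using avg_sticky_diff[OF st_x st_v s less_imp_le[OF r(1)]] r0 s by (simp add: pX pV)
    ultimately have "st (\<lambda>i. pX r i - pX s i) = st (\<lambda>i. (r - s) * pV r i)" by (simp add: st_diff st_scale)
    then have "pX r i - pX s i = (r - s) * pV r i" using i by (simp add: st_eq_iff)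
    then show ?thesis using pV_const[OF i s less_imp_le[OF r(1)] nc'] by simp
  qed
  have "t \<in> interior {0..}" using s t by simp
  from continuous_on_interior[OF pX_continuous[OF i] this]
  have c: "((\<lambda>r. pX r i) \<longlongrightarrow> pX t i) (at_left t)"
    by (simp add: isCont_def filterlim_at_split)
  have "((\<lambda>r. pX s i + (r - s) * pV s i) \<longlongrightarrow> pX s i + (t - s) * pV s i) (at_left t)"
    by (intro tendsto_intros)
  moreover have "\<forall>\<^sub>F y in at_left t. pX s i + (y - s) * pV s i = pX y i"
    unfolding eventually_at_left_field using r t by (intro exI[of _ s]) auto
  ultimately have "((\<lambda>r. pX r i) \<longlongrightarrow> pX s i + (t - s) * pV s i) (at_left t)"
    by (rule Lim_transform_eventually)
  from tendsto_unique[OF _ c this] show ?thesis by simp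
qed simp

text \<open>Supplies a motion for every discrete datum, which the particle clause of
  \<open>is_sticky_semigroup\<close> presupposes; with \<open>sticky_motion_unique\<close> it fixes
  the values of every such semigroup on discrete data.\<close>

lemma sticky_motion_exists: "sticky_motion N m x v pX pV"
  unfolding sticky_motion_def
proof (intro conjI allI impI ballI)
  show "pX 0 i = x i" for i by (simp add: pX_def)
  show "pV 0 i = v i" if "i < N" for i
    using pV[of 0] that by (simp add: svel_0[OF st_x st_v] st_eq_iff)
  show "continuous_on {0..} (\<lambda>t. pX t i)" if "i < N" for i by (rule pX_continuous[OF that])
  show "pX t i \<le> pX t j" if "0 \<le> t" "i \<le> j" "j < N" for t i j
    using st_MKD[OF pX_MK[OF that(1)] that(2,3)] .
  show "cluster N pX s i \<subseteq> cluster N pX t i" if "i < N" "0 \<le> s" "s \<le> t" for i s t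
    by (rule pX_cluster_mono[OF that])
  show "finite (collision_times N pX)" by (rule finite_collision_times)
  show "pV t i = pV s i" if "i < N" "0 \<le> s" "s \<le> t" "collision_times N pX \<inter> {s<..t} = {}" for i s t
    by (rule pV_const[OF that])
  show "pX t i = pX s i + (t - s) * pV s i" if "i < N" "0 \<le> s" "s \<le> t" "collision_times N pX \<inter> {s<..<t} = {}" for i s t
    by (rule pX_affine[OF that])
  fix t i assume t: "t \<in> collision_times N pX" and i: "i < N"
  have t0: "0 < t" using t by (simp add: collision_times_def)
  obtain s where s: "0 \<le> s" "s < t" "collision_times N pX \<inter> {s<..<t} = {}" using last_collision[OF t0] .
  have lim: "Lim (at_left t) (\<lambda>r. pV r j) = pV s j" if j: "j < N" for j
  proof -
    have "pV r j = pV s j" if "s < r" "r < t" for r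
      using s that by (intro pV_const[OF j]) auto
    then have "\<forall>\<^sub>F r in at_left t. pV r j = pV s j"
      unfolding eventually_at_left_field using s by blast
    then have "((\<lambda>r. pV r j) \<longlongrightarrow> pV s j) (at_left t)" by (rule tendsto_eventually)
    then show ?thesis by (intro tendsto_Lim) simp_all
  qed
  have "st (pV t) = avg (st (pX t)) (st (pV s))"
    using avg_svel[OF st_x st_v s(1) less_imp_le[OF s(2)]] s t0 by (simp add: pX pV)
  then have "pV t i = (\<Sum>j\<in>cluster N pX t i. m j * pV s j) / (\<Sum>j\<in>cluster N pX t i. m j)"
    using i avg_st_cluster[of pX t "pV s", OF pX_MK] t0 by (simp add: st_eq_iff)
  also have "\<dots> = (\<Sum>j\<in>cluster N pX t i. m j * Lim (at_left t) (\<lambda>s. pV s j)) / (\<Sum>j\<in>cluster N pX t i. m j)"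
    by (intro arg_cong2[where f = "(/)"] sum.cong) (auto simp: cluster_def lim)
  finally show "pV t i = (\<Sum>j\<in>cluster N pX t i. m j * Lim (at_left t) (\<lambda>s. pV s j)) / (\<Sum>j\<in>cluster N pX t i. m j)" .
qed

lemma particle_state_eq: "particle_state N m x v = sstate (st x) (st v)"
  by (simp add: sstate_st)

lemma ssemi_particles:
  assumes M: "sticky_motion N m x v X V" and t: "0 \<le> t"
  shows "ssemi t (particle_state N m x v) = particle_state N m (X t) (V t)"
proof -
  have "qf (fst (particle_state N m x v)) = st x" "vl (particle_state N m x v) = st v"
    unfolding particle_state_eq by (simp_all add: qf_sstate vl_sstate st_x st_v)
  then have "ssemi t (particle_state N m x v) = sstate (sticky (st x) (st v) t) (st v)"
    by (simp add: ssemi_def)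
  also have "\<dots> = sstate (sticky (st x) (st v) t) (svel (st x) (st v) t)"
    by (simp add: sstate_def svel_def mom_avg sticky_MK)
  also have "\<dots> = sstate (st (X t)) (st (V t))" using sticky_motion_unique[OF M t] by simp
  also have "\<dots> = particle_state N m (X t) (V t)" by (rule sstate_st)
  finally show ?thesis .
qed

end

end

section \<open>Density of discrete data and identification of the semigroup\<close>

text \<open>Step functions \<open>b n\<close> with equal masses approximate the identity of the unit
  interval, of which every element is a function. Averages over \<open>b n\<close> therefore
  approximate positions and velocities at the same time.\<close>

lemma discrete_dense:
  assumes a: "a \<in> MK"
  obtains NN :: "nat \<Rightarrow> nat" and mm xx vv where
    "\<And>n. particle_data (NN n) (mm n) (xx n)"
    "(\<lambda>n. cl (stp (NN n) (mm n) (xx n))) \<longlonglongrightarrow> a"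
    "(\<lambda>n. cl (stp (NN n) (mm n) (vv n))) \<longlonglongrightarrow> u"
proof -
  define M :: "nat \<Rightarrow> nat \<Rightarrow> real" where "M n i = 1 / real (Suc n)" for n i
  have pos: "0 < M n i" for n i by (simp add: M_def)
  have sum1: "(\<Sum>i<Suc n. M n i) = 1" for n by (simp add: M_def)
  note S = pos sum1
  define y :: "nat \<Rightarrow> nat \<Rightarrow> real" where "y n i = real i / real (Suc n)" for n i
  define b where "b n = cl (stp (Suc n) (M n) (y n))" for n
  have yle: "y n i \<le> y n j" if "i \<le> j" for n i j using that by (simp add: y_def divide_right_mono)
  have b: "b n \<in> MK" for n unfolding b_def by (rule st_MK[OF S]) (rule yle)
  have id: "(\<lambda>w. w) \<in> SQ" by (rule SQ_bounded[of _ 1]) auto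
  have ys: "stp (Suc n) (M n) (y n) \<in> SQ" for n by (rule stp_SQ[OF S])
  have bid: "b \<longlonglongrightarrow> cl (\<lambda>w. w)"
  proof -
    have near: "\<bar>stp (Suc n) (M n) (y n) w - w\<bar> \<le> 1 / real (Suc n)" if w: "0 < w" "w < 1" for n w
    proof -
      obtain i where i: "i < Suc n" "w \<in> {cum (M n) i..<cum (M n) (Suc i)}" by (rule cell_ex[OF S w])
      have c: "cum (M n) k = real k / real (Suc n)" for k by (simp add: cum_def M_def)
      show ?thesis using stp_cell[OF pos sum1 i, where c = "y n"] i(2) unfolding c y_def
        by (simp add: add_divide_distrib)
    qed
    have "norm (b n - cl (\<lambda>w. w)) \<le> 1 / real (Suc n)" for n
    proof (rule power2_le_imp_le)
      have "(norm (b n - cl (\<lambda>w. w)))\<^sup>2 = (\<integral>w. (stp (Suc n) (M n) (y n) w - w)\<^sup>2 \<partial>unit_lebesgue)"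
        using dist_cl_sq[OF ys id, of n] by (simp add: b_def dist_norm)
      also have "\<dots> \<le> (\<integral>w. (1 / real (Suc n))\<^sup>2 \<partial>unit_lebesgue)"
      proof (rule integral_mono)
        show "integrable unit_lebesgue (\<lambda>w. (stp (Suc n) (M n) (y n) w - w)\<^sup>2)"
          by (intro SQ_sq_integrable SQ_diff ys id)
        fix w assume "w \<in> space unit_lebesgue"
        then show "(stp (Suc n) (M n) (y n) w - w)\<^sup>2 \<le> (1 / real (Suc n))\<^sup>2"
          using power_mono[OF near[of w n] abs_ge_zero, of 2] by simp
      qed simp
      also have "\<dots> = (1 / real (Suc n))\<^sup>2" using UL.prob_space by simp
      finally show "(norm (b n - cl (\<lambda>w. w)))\<^sup>2 \<le> (1 / real (Suc n))\<^sup>2" .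
    qed simp
    then have "(\<lambda>n. b n - cl (\<lambda>w. w)) \<longlonglongrightarrow> 0"
      by (rule Lim_null_comparison[OF always_eventually LIMSEQ_Suc[OF lim_1_over_n], rule_format])
    then show ?thesis by (rule LIM_zero_cancel)
  qed
  \<comment> \<open>Every \<open>z\<close> is a function of the identity, so averaging over the
    converging \<open>b n\<close> reproduces it in the limit.\<close>
  have conv: "(\<lambda>n. avg (b n) z) \<longlonglongrightarrow> z" for z
  proof (rule avg_tendsto_of_tendsto[OF _ bid])
    show "z \<in> Hs (cl (\<lambda>w. w))" using Hs_cl_I[OF id fn_measurable, of z] fn_SQ by simp
  qed (simp add: b)
  have "\<exists>d. avg (b n) z = cl (stp (Suc n) (M n) d)" for n z
    using st_HsE[OF S avg_Hs[OF b, of n z, unfolded b_def]] by (metis b_def)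
  then obtain D where D: "\<And>n z. avg (b n) z = cl (stp (Suc n) (M n) (D n z))" by metis
  \<comment> \<open>Averaged positions are ordered but may coincide; a vanishing multiple of the
    strictly increasing \<open>y n\<close> separates the particles.\<close>
  define x where "x n i = D n a i + 1 / real (Suc n) * y n i" for n i
  have x: "particle_data (Suc n) (M n) (x n)" for n
    unfolding particle_data_def
  proof (intro conjI allI impI strict_mono_onI)
    fix i j assume ij: "i \<in> {..<Suc n}" "j \<in> {..<Suc n}" "i < j"
    have "D n a i \<le> D n a j"
      by (rule st_MKD[OF S]) (use avg_MK[OF b a, of n] D ij in auto)
    moreover have "1 / real (Suc n) * y n i < 1 / real (Suc n) * y n j"
      using ij by (simp add: y_def divide_strict_right_mono)
    ultimately show "x n i < x n j" unfolding x_def by (rule add_le_less_mono)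
  qed (use S in auto)
  have "cl (stp (Suc n) (M n) (x n)) = avg (b n) a + (1 / real (Suc n)) *\<^sub>R b n" for n
    unfolding x_def D unfolding b_def st_scale[OF S] st_add[OF S] ..
  moreover have "(\<lambda>n. avg (b n) a + (1 / real (Suc n)) *\<^sub>R b n) \<longlonglongrightarrow> a + 0 *\<^sub>R cl (\<lambda>w. w)"
    by (intro tendsto_intros conv bid LIMSEQ_Suc[OF lim_1_over_n])
  ultimately have "(\<lambda>n. cl (stp (Suc n) (M n) (x n))) \<longlonglongrightarrow> a" by simp
  moreover have "(\<lambda>n. cl (stp (Suc n) (M n) (D n u))) \<longlonglongrightarrow> u" using conv[of u] by (simp add: D)
  ultimately show thesis by (rule that[of Suc M x "\<lambda>n. D n u", OF x])
qed

lemma particle_state_V2: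
  assumes "particle_data N m x"
  shows "particle_state N m x v = sstate (cl (stp N m x)) (cl (stp N m v))"
    "particle_state N m x v \<in> V2"
    "qf (fst (particle_state N m x v)) = cl (stp N m x)" "vl (particle_state N m x v) = cl (stp N m v)"
proof -
  have P: "\<And>i. i < N \<Longrightarrow> 0 < m i" "(\<Sum>i<N. m i) = 1" and x: "strict_mono_on {..<N} x"
    using assms by (auto simp: particle_data_def)
  have X: "cl (stp N m x) \<in> MK" by (rule st_x[OF P x])
  have V: "cl (stp N m v) \<in> Hs (cl (stp N m x))" by (rule st_v[OF P x])
  show eq: "particle_state N m x v = sstate (cl (stp N m x)) (cl (stp N m v))"
    by (rule sstate_st[OF P, symmetric])
  show "particle_state N m x v \<in> V2" "qf (fst (particle_state N m x v)) = cl (stp N m x)"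
    "vl (particle_state N m x v) = cl (stp N m v)"
    unfolding eq by (simp_all add: sstate_V2 qf_sstate vl_sstate X V)
qed

lemma is_sticky_semigroup_ssemi: "is_sticky_semigroup ssemi"
  unfolding is_sticky_semigroup_def
proof (intro conjI allI impI ballI)
  show "ssemi t \<mu> \<in> V2" for t \<mu> by (rule ssemi_V2)
  show "ssemi t (particle_state N m x v) = particle_state N m (X t) (V t)"
    if "particle_data N m x" "sticky_motion N m x v X V" "0 \<le> t" for N m x v X V t
    using ssemi_particles[OF _ _ _ that(2,3)] that(1) by (auto simp: particle_data_def)
  fix t \<mu>n \<mu> assume "\<forall>n. \<mu>n n \<in> V2" "\<mu> \<in> V2" "(\<lambda>n. D2 (\<mu>n n) \<mu>) \<longlonglongrightarrow> 0"
  then show "(\<lambda>n. W2 (fst (ssemi t (\<mu>n n))) (fst (ssemi t \<mu>))) \<longlonglongrightarrow> 0"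
    "weakly_converges (\<lambda>n. snd (ssemi t (\<mu>n n))) (snd (ssemi t \<mu>))"
    using ssemi_continuous by auto
qed

lemma W2_limit_unique:
  assumes "\<And>n. \<rho>n n \<in> P2" "\<rho> \<in> P2" "\<eta> \<in> P2"
    and "(\<lambda>n. W2 (\<rho>n n) \<rho>) \<longlonglongrightarrow> 0" "(\<lambda>n. W2 (\<rho>n n) \<eta>) \<longlonglongrightarrow> 0"
  shows "\<rho> = \<eta>"
proof -
  have "(\<lambda>n. qf (\<rho>n n)) \<longlonglongrightarrow> qf \<rho>" "(\<lambda>n. qf (\<rho>n n)) \<longlonglongrightarrow> qf \<eta>"
    using assms by (auto simp: W2_eq intro: tendsto_dist_iff[THEN iffD2])
  then have "qf \<rho> = qf \<eta>" by (rule LIMSEQ_unique)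
  then show ?thesis using qf_inj assms by blast
qed

text \<open>Both maps agree on discrete data and pass to the limit along an approximating sequence.
  Positions have a unique limit for \<open>W2\<close>, and, once these agree, momenta have a unique
  weak limit.\<close>

lemma is_sticky_semigroup_unique:
  assumes S: "is_sticky_semigroup S" and \<mu>: "\<mu> \<in> V2" and t: "0 \<le> t"
  shows "S t \<mu> = ssemi t \<mu>"
proof -
  obtain NN :: "nat \<Rightarrow> nat" and mm xx vv where D:
    "\<And>n. particle_data (NN n) (mm n) (xx n)"
    "(\<lambda>n. cl (stp (NN n) (mm n) (xx n))) \<longlonglongrightarrow> qf (fst \<mu>)"
    "(\<lambda>n. cl (stp (NN n) (mm n) (vv n))) \<longlonglongrightarrow> vl \<mu>"
    using discrete_dense[OF V2D(2)[OF \<mu>], of "vl \<mu>"] by blast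
  define \<mu>n where "\<mu>n n = particle_state (NN n) (mm n) (xx n) (vv n)" for n
  have V: "\<mu>n n \<in> V2" for n unfolding \<mu>n_def by (rule particle_state_V2(2)[OF D(1)])
  have conv: "(\<lambda>n. D2 (\<mu>n n) \<mu>) \<longlonglongrightarrow> 0"
    unfolding D2_tendsto_iff[OF V \<mu>] using D by (simp add: \<mu>n_def particle_state_V2(3,4))
  have eq: "S t (\<mu>n n) = ssemi t (\<mu>n n)" for n
  proof -
    have P: "\<And>i. i < NN n \<Longrightarrow> 0 < mm n i" "(\<Sum>i<NN n. mm n i) = 1" "strict_mono_on {..<NN n} (xx n)"
      using D(1)[of n] by (auto simp: particle_data_def)
    obtain X V where M: "sticky_motion (NN n) (mm n) (xx n) (vv n) X V"
      using sticky_motion_exists[OF P] by blast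
    then show ?thesis
      using S is_sticky_semigroup_ssemi D(1)[of n] t unfolding is_sticky_semigroup_def \<mu>n_def by metis
  qed
  have SV: "S t \<mu> \<in> V2" using S \<mu> t by (simp add: is_sticky_semigroup_def)
  have lim: "(\<lambda>n. W2 (fst (S t (\<mu>n n))) (fst (S t \<mu>))) \<longlonglongrightarrow> 0"
    "weakly_converges (\<lambda>n. snd (S t (\<mu>n n))) (snd (S t \<mu>))"
    using S V \<mu> conv t unfolding is_sticky_semigroup_def by blast+
  note lim' = ssemi_continuous[OF V \<mu> conv, of t]
  have f: "fst (S t \<mu>) = fst (ssemi t \<mu>)"
    by (rule W2_limit_unique[OF V2D(1)[OF ssemi_V2] V2D(1)[OF SV] V2D(1)[OF ssemi_V2] lim(1)[unfolded eq] lim'(1)])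
  let ?b = "qf (fst (S t \<mu>))"
  have s1: "snd (S t \<mu>) = mom ?b (vl (S t \<mu>))"
    using V2D(4)[OF SV] by (metis snd_conv sstate_def)
  have s2: "snd (ssemi t \<mu>) = mom ?b (vl (ssemi t \<mu>))"
    using V2D(4)[OF ssemi_V2[of t \<mu>]] f by (metis snd_conv sstate_def)
  have "snd (S t \<mu>) = snd (ssemi t \<mu>)"
    using weak_limit_unique[OF V2D(2)[OF SV] lim(2)[unfolded eq s1] lim'(2)[unfolded s2]] s1 s2 by simp
  with f show ?thesis by (simp add: prod_eq_iff)
qed

text \<open>The choice is meaningful because \<open>ssemi\<close> satisfies the requirements, and
  uniqueness then identifies what was chosen.\<close>

lemma sticky_semigroup_eq: "\<mu> \<in> V2 \<Longrightarrow> 0 \<le> t \<Longrightarrow> sticky_semigroup t \<mu> = ssemi t \<mu>"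
proof -
  have "is_sticky_semigroup sticky_semigroup"
    unfolding sticky_semigroup_def by (rule someI[of is_sticky_semigroup, OF is_sticky_semigroup_ssemi])
  then show "\<mu> \<in> V2 \<Longrightarrow> 0 \<le> t \<Longrightarrow> sticky_semigroup t \<mu> = ssemi t \<mu>"
    by (rule is_sticky_semigroup_unique)
qed

lemma sticky_semigroup_momentum:
  assumes "\<rho> \<in> P2" "v \<in> L2 \<rho>" "0 \<le> t"
  shows "sticky_semigroup t (\<rho>, momentum \<rho> v) =
    sstate (sticky (qf \<rho>) (cl (\<lambda>w. v (rearr \<rho> w))) t) (cl (\<lambda>w. v (rearr \<rho> w)))"
  using sticky_semigroup_eq[OF momentum_V2[OF assms(1,2)] assms(3)]
  by (simp add: ssemi_def vl_momentum[OF assms(1,2)])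

section \<open>The velocity field\<close>

text \<open>The Eulerian velocity at time \<open>t\<close>. Unlike a choice of velocity made
  separately for each time, this formula is jointly Borel in time and space.\<close>

definition vfield :: "l2 \<Rightarrow> l2 \<Rightarrow> real \<Rightarrow> real \<Rightarrow> real" where
  "vfield a u t = vel (fn (sticky a u t)) (fn u)"

text \<open>\<open>vel\<close> depends on the position function only through integrals over level
  and sublevel sets, so the arbitrary representative \<open>fn\<close> gives the same field as the
  monotone one.\<close>

lemma vel_cong_AE:
  assumes Y: "Y \<in> borel_measurable borel" "Y' \<in> borel_measurable borel"
    and U: "U \<in> borel_measurable borel" and eq: "AE w in unit_lebesgue. Y w = Y' w"
  shows "vel Y U = vel Y' U"
proof
  fix x
  have "\<mu>01 (lev Y x) = \<mu>01 (lev Y' x)"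
  proof (rule measure_eq_AE)
    show "AE w in unit_lebesgue. (w \<in> lev Y x) = (w \<in> lev Y' x)"
      using eq by eventually_elim (simp add: lev_def)
  qed (use Y in auto)
  moreover have "dis Y x = dis Y' x"
    unfolding dis_def
  proof (rule measure_eq_AE)
    show "AE w in unit_lebesgue. (w \<in> {w. 0 < w \<and> w < 1 \<and> Y w \<le> x}) = (w \<in> {w. 0 < w \<and> w < 1 \<and> Y' w \<le> x})"
      using eq by eventually_elim simp
  qed (use Y in auto)
  moreover have "(\<integral>w. U w * indicator (lev Y x) w \<partial>unit_lebesgue) = (\<integral>w. U w * indicator (lev Y' x) w \<partial>unit_lebesgue)"
  proof (rule integral_cong_AE)
    show "AE w in unit_lebesgue. U w * indicator (lev Y x) w = U w * indicator (lev Y' x) w"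
      using eq by eventually_elim (simp add: lev_def indicator_def)
  qed (use Y borel_measurable_UL[OF U] in \<open>auto intro!: borel_measurable_times borel_measurable_indicator\<close>)
  ultimately show "vel Y U x = vel Y' U x" by (simp add: vel_def)
qed

lemma vfield_SQ_cl:
  assumes a: "a \<in> MK"
  shows "(\<lambda>w. vel (fn a) (fn u) (fn a w)) \<in> SQ" "cl (\<lambda>w. vel (fn a) (fn u) (fn a w)) = avg a u"
proof -
  have eq: "vel (fn a) (fn u) = vel (mrep a) (fn u)"
    by (rule vel_cong_AE[OF fn_measurable SQ_measurable[OF mrep(1)[OF a]] fn_measurable fn_mrep[OF a]])
  have AE: "AE w in unit_lebesgue. vel (fn a) (fn u) (fn a w) = vel (mrep a) (fn u) (mrep a w)"
    using fn_mrep[OF a] by eventually_elim (simp add: eq)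
  show S: "(\<lambda>w. vel (fn a) (fn u) (fn a w)) \<in> SQ"
    by (rule SQ_cong_AE[OF measurable_compose[OF fn_measurable vel_measurable[OF fn_measurable fn_measurable]] avg_SQ[OF a] AE])
  show "cl (\<lambda>w. vel (fn a) (fn u) (fn a w)) = avg a u"
    unfolding avg_def by (rule cl_eqI[OF S avg_SQ[OF a] AE])
qed

lemma vfield:
  shows "vfield a u t \<in> borel_measurable borel" "vfield a u t \<in> L2 (law (sticky a u t))"
    "(\<lambda>w. vfield a u t (fn (sticky a u t) w)) \<in> SQ"
    "cl (\<lambda>w. vfield a u t (fn (sticky a u t) w)) = svel a u t"
    "momentum (law (sticky a u t)) (vfield a u t) = mom (sticky a u t) u"
proof -
  show m: "vfield a u t \<in> borel_measurable borel"
    unfolding vfield_def by (rule vel_measurable[OF fn_measurable fn_measurable])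
  show S: "(\<lambda>w. vfield a u t (fn (sticky a u t) w)) \<in> SQ"
    and C: "cl (\<lambda>w. vfield a u t (fn (sticky a u t) w)) = svel a u t"
    using vfield_SQ_cl[OF sticky_MK] by (simp_all add: vfield_def svel_def)
  show L: "vfield a u t \<in> L2 (law (sticky a u t))" using SQ_comp_L2[OF fn_SQ m] S by simp
  show "momentum (law (sticky a u t)) (vfield a u t) = mom (sticky a u t) u"
    using momentum_law[OF fn_SQ, of "vfield a u t" "sticky a u t"] L C
    by (simp add: svel_def mom_avg sticky_MK)
qed

lemma velocity_unique:
  assumes b: "b \<in> MK" and v: "v \<in> L2 (law b)" and v': "v' \<in> L2 (law b)"
    and eq: "momentum (law b) v = momentum (law b) v'"
  shows "AE x in law b. v x = v' x"
proof -
  have m: "v \<in> borel_measurable borel" "v' \<in> borel_measurable borel" using v v' by (auto simp: L2_def)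
  have S: "(\<lambda>w. v (fn b w)) \<in> SQ" "(\<lambda>w. v' (fn b w)) \<in> SQ"
    using SQ_comp_L2[OF fn_SQ m(1), of b] SQ_comp_L2[OF fn_SQ m(2), of b] v v' by auto
  have H: "cl (\<lambda>w. v (fn b w)) \<in> Hs b" "cl (\<lambda>w. v' (fn b w)) \<in> Hs b"
    using Hs_cl_I[OF fn_SQ m(1) S(1)] Hs_cl_I[OF fn_SQ m(2) S(2)] by auto
  have "mom b (cl (\<lambda>w. v (fn b w))) = mom b (cl (\<lambda>w. v' (fn b w)))"
    using momentum_law[OF fn_SQ, of v b] momentum_law[OF fn_SQ, of v' b] v v' eq by simp
  then have "cl (\<lambda>w. v (fn b w)) = cl (\<lambda>w. v' (fn b w))" by (rule mom_inj[OF b _ H])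
  then have "AE w in unit_lebesgue. v (fn b w) = v' (fn b w)" by (simp add: cl_eq_iff S)
  moreover have "{x \<in> space borel. v x = v' x} \<in> sets borel" using m by measurable
  ultimately show ?thesis
    unfolding law_def by (subst AE_distr_iff) (auto intro: borel_measurable_UL)
qed

text \<open>Moving the base point \<open>x\<close> of a ramp amounts to subtracting a constant from
  the position, so the Lipschitz bound for ramps treats time and space together.\<close>

lemma continuous_ramp_inner:
  "continuous_on UNIV (\<lambda>(t, x). inner z (cl (\<lambda>w. ramp x n (fn (sticky a u t) w))))"
proof -
  let ?F = "\<lambda>p. cl (\<lambda>w. ramp (snd p) n (fn (sticky a u (fst p)) w))"
  have "continuous_on UNIV ?F"
  proof -
    have le: "norm (?F p - ?F q) \<le> real n * (norm u * \<bar>fst p - fst q\<bar> + \<bar>snd p - snd q\<bar>)" for p q :: "real \<times> real"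
    proof -
      let ?G = "\<lambda>p. \<lambda>w. fn (sticky a u (fst p)) w - snd p"
      have G: "?G p \<in> SQ" for p :: "real \<times> real" by (intro SQ_diff fn_SQ SQ_const)
      have r: "ramp (snd p) n (fn b w) = ramp 0 n (fn b w - snd p)" for b w and p :: "real \<times> real" by (simp add: ramp_def)
      have c: "cl (?G p) = sticky a u (fst p) - cl (\<lambda>_. snd p)" for p :: "real \<times> real"
        using cl_diff[OF fn_SQ SQ_const, of "sticky a u (fst p)" "snd p"] by simp
      have nc: "norm (cl (\<lambda>_. k)) = \<bar>k\<bar>" for k
      proof (rule power2_eq_imp_eq)
        show "(norm (cl (\<lambda>_. k)))\<^sup>2 = \<bar>k\<bar>\<^sup>2" using UL.prob_space by (simp add: norm_cl_sq[OF SQ_const])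
      qed auto
      have "norm (cl (?G p) - cl (?G q)) \<le> norm (sticky a u (fst p) - sticky a u (fst q)) + norm (cl (\<lambda>_. snd p) - cl (\<lambda>_. snd q))"
        unfolding c using norm_triangle_ineq4[of "sticky a u (fst p) - sticky a u (fst q)" "cl (\<lambda>_. snd p) - cl (\<lambda>_. snd q)"]
        by (simp add: algebra_simps)
      also have "\<dots> \<le> \<bar>fst p - fst q\<bar> * norm u + \<bar>snd p - snd q\<bar>"
        unfolding cl_diff[OF SQ_const SQ_const] nc by (intro add_mono sticky_lipschitz order_refl)
      finally have "norm (cl (?G p) - cl (?G q)) \<le> norm u * \<bar>fst p - fst q\<bar> + \<bar>snd p - snd q\<bar>" by (simp add: mult.commute)
      then have "real n * norm (cl (?G p) - cl (?G q)) \<le> real n * (norm u * \<bar>fst p - fst q\<bar> + \<bar>snd p - snd q\<bar>)"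
        by (rule mult_left_mono) simp
      with norm_ramp_diff_le[OF G G, of 0 n p q] show ?thesis unfolding r by linarith
    qed
    show ?thesis
      unfolding continuous_on_def
    proof
      fix q :: "real \<times> real"
      have "((\<lambda>p. real n * (norm u * \<bar>fst p - fst q\<bar> + \<bar>snd p - snd q\<bar>)) \<longlongrightarrow> real n * (norm u * \<bar>fst q - fst q\<bar> + \<bar>snd q - snd q\<bar>)) (at q)"
        by (intro tendsto_intros)
      then have "((\<lambda>p. real n * (norm u * \<bar>fst p - fst q\<bar> + \<bar>snd p - snd q\<bar>)) \<longlongrightarrow> 0) (at q)" by simp
      then have "((\<lambda>p. ?F p - ?F q) \<longlongrightarrow> 0) (at q)"
        by (rule Lim_null_comparison[OF always_eventually, rotated]) (use le in blast)
      then show "(?F \<longlongrightarrow> ?F q) (at q)" by (rule LIM_zero_cancel)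
    qed
  qed
  then have "continuous_on UNIV (\<lambda>p. inner z (?F p))" by (intro continuous_on_inner continuous_on_const)
  then show ?thesis by (simp add: case_prod_beta')
qed

text \<open>A pointwise limit of the jointly continuous ramp integrals.\<close>

lemma half_line_measurable:
  "(\<lambda>(t, x). \<integral>w. indicator {x<..} (fn (sticky a u t) w) * fn z w \<partial>unit_lebesgue) \<in> borel_measurable borel"
proof (rule borel_measurable_LIMSEQ_real)
  show "(\<lambda>(t, x). inner z (cl (\<lambda>w. ramp x n (fn (sticky a u t) w)))) \<in> borel_measurable borel" for n
    by (rule borel_measurable_continuous_onI[OF continuous_ramp_inner])
  fix p :: "real \<times> real"
  obtain t x where p: "p = (t, x)" by (cases p)
  note [measurable] = borel_measurable_UL[OF fn_measurable]
  have "(\<lambda>n. \<integral>w. ramp x n (fn (sticky a u t) w) * fn z w \<partial>unit_lebesgue) \<longlonglongrightarrow>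
      (\<integral>w. indicator {x<..} (fn (sticky a u t) w) * fn z w \<partial>unit_lebesgue)"
  proof (rule integral_dominated_convergence)
    show "integrable unit_lebesgue (\<lambda>w. \<bar>fn z w\<bar>)" using SQ_integrable[OF fn_SQ[of z]] by simp
    show "AE w in unit_lebesgue. (\<lambda>n. ramp x n (fn (sticky a u t) w) * fn z w) \<longlonglongrightarrow> indicator {x<..} (fn (sticky a u t) w) * fn z w"
      by (intro AE_I2 tendsto_intros ramp_tendsto)
    show "AE w in unit_lebesgue. norm (ramp x n (fn (sticky a u t) w) * fn z w) \<le> \<bar>fn z w\<bar>" for n
    proof (intro AE_I2)
      fix w
      have "\<bar>ramp x n (fn (sticky a u t) w)\<bar> * \<bar>fn z w\<bar> \<le> 1 * \<bar>fn z w\<bar>"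
        using ramp_bounds[of x n "fn (sticky a u t) w"] by (intro mult_right_mono) auto
      then show "norm (ramp x n (fn (sticky a u t) w) * fn z w) \<le> \<bar>fn z w\<bar>" by (simp add: abs_mult)
    qed
  qed measurable
  moreover have "inner z (cl (\<lambda>w. ramp x n (fn (sticky a u t) w))) = (\<integral>w. ramp x n (fn (sticky a u t) w) * fn z w \<partial>unit_lebesgue)" for n
    using inner_cl[OF fn_SQ SQ_ramp[OF fn_measurable], of z x n] by (simp add: mult.commute)
  ultimately show "(\<lambda>n. (\<lambda>(t, x). inner z (cl (\<lambda>w. ramp x n (fn (sticky a u t) w)))) p) \<longlonglongrightarrow>
      (\<lambda>(t, x). \<integral>w. indicator {x<..} (fn (sticky a u t) w) * fn z w \<partial>unit_lebesgue) p"
    by (simp add: p)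
qed

lemma closed_half_line_measurable:
  "(\<lambda>(t, x). \<integral>w. indicator {x..} (fn (sticky a u t) w) * fn z w \<partial>unit_lebesgue) \<in> borel_measurable borel"
proof (rule borel_measurable_LIMSEQ_real)
  let ?H = "\<lambda>(t, x). \<integral>w. indicator {x<..} (fn (sticky a u t) w) * fn z w \<partial>unit_lebesgue"
  have "(\<lambda>p :: real \<times> real. (fst p, snd p - 1 / real (Suc n))) \<in> borel_measurable borel" for n
    by (intro borel_measurable_continuous_onI continuous_intros)
  from measurable_compose[OF this half_line_measurable]
  show "(\<lambda>p. ?H (fst p, snd p - 1 / real (Suc n))) \<in> borel_measurable borel" for n .
  fix p :: "real \<times> real"
  obtain t x where p: "p = (t, x)" by (cases p)
  note [measurable] = borel_measurable_UL[OF fn_measurable]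
  have lim: "(\<lambda>n. indicator {x - 1 / real (Suc n)<..} y) \<longlonglongrightarrow> (indicator {x..} y :: real)" for y
  proof (cases "x \<le> y")
    case True
    have "x - 1 / real (Suc n) < y" for n
    proof -
      have "0 < 1 / real (Suc n)" by simp
      with True show ?thesis by linarith
    qed
    then show ?thesis using True by simp
  next
    case False
    obtain N where N: "1 / real (Suc N) < x - y" using nat_approx_posE[of "x - y"] False by auto
    have "\<not> x - 1 / real (Suc n) < y" if "n \<ge> N" for n
    proof -
      have "1 / real (Suc n) \<le> 1 / real (Suc N)" using that by (simp add: frac_le)
      then show ?thesis using N by linarith
    qed
    then have "\<forall>\<^sub>F n in sequentially. indicator {x - 1 / real (Suc n)<..} y = (0 :: real)"
      by (intro eventually_sequentiallyI[of N]) (simp add: indicator_def)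
    then show ?thesis using False by (simp add: tendsto_eventually)
  qed
  have "(\<lambda>n. \<integral>w. indicator {x - 1 / real (Suc n)<..} (fn (sticky a u t) w) * fn z w \<partial>unit_lebesgue) \<longlonglongrightarrow>
      (\<integral>w. indicator {x..} (fn (sticky a u t) w) * fn z w \<partial>unit_lebesgue)"
  proof (rule integral_dominated_convergence)
    show "integrable unit_lebesgue (\<lambda>w. \<bar>fn z w\<bar>)" using SQ_integrable[OF fn_SQ[of z]] by simp
    show "AE w in unit_lebesgue. (\<lambda>n. indicator {x - 1 / real (Suc n)<..} (fn (sticky a u t) w) * fn z w)
        \<longlonglongrightarrow> indicator {x..} (fn (sticky a u t) w) * fn z w"
      by (intro AE_I2 tendsto_mult lim tendsto_const)
    show "AE w in unit_lebesgue. norm (indicator {x - 1 / real (Suc n)<..} (fn (sticky a u t) w) * fn z w) \<le> \<bar>fn z w\<bar>" for n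
      by (intro AE_I2) (simp add: indicator_def)
  qed measurable
  then show "(\<lambda>n. ?H (fst p, snd p - 1 / real (Suc n))) \<longlonglongrightarrow>
      (\<lambda>(t, x). \<integral>w. indicator {x..} (fn (sticky a u t) w) * fn z w \<partial>unit_lebesgue) p"
    by (simp add: p)
qed

text \<open>The level set at \<open>x\<close> is the difference of the closed and the open half line
  in the range of the position.\<close>

lemma lev_integral_measurable:
  "(\<lambda>(t, x). \<integral>w. fn z w * indicator (lev (fn (sticky a u t)) x) w \<partial>unit_lebesgue) \<in> borel_measurable borel"
proof -
  have "(\<integral>w. fn z w * indicator (lev (fn b) x) w \<partial>unit_lebesgue) =
     (\<integral>w. indicator {x..} (fn b w) * fn z w \<partial>unit_lebesgue) - (\<integral>w. indicator {x<..} (fn b w) * fn z w \<partial>unit_lebesgue)" for b x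
  proof -
    have i: "integrable unit_lebesgue (\<lambda>w. indicator A (fn b w) * fn z w)" if "A \<in> sets borel" for A
      by (intro SQ_mult_integrable SQ_indicator fn_measurable fn_SQ that)
    have "(\<integral>w. indicator {x..} (fn b w) * fn z w \<partial>unit_lebesgue) - (\<integral>w. indicator {x<..} (fn b w) * fn z w \<partial>unit_lebesgue)
       = (\<integral>w. indicator {x..} (fn b w) * fn z w - indicator {x<..} (fn b w) * fn z w \<partial>unit_lebesgue)"
      by (rule Bochner_Integration.integral_diff[symmetric]) (rule i, simp)+
    also have "\<dots> = (\<integral>w. fn z w * indicator (lev (fn b) x) w \<partial>unit_lebesgue)"
      by (intro Bochner_Integration.integral_cong) (auto simp: lev_def indicator_def)
    finally show ?thesis by simp
  qed
  then show ?thesis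
    using borel_measurable_diff[OF closed_half_line_measurable[of a u z] half_line_measurable[of a u z]]
    by (simp add: case_prod_beta')
qed

text \<open>Mass of the level set, integral of the velocity over it and distribution function are
  all integrals over half lines or level sets, with \<open>?one\<close> or \<open>u\<close> as
  density; the cases of \<open>vel\<close> combine them by Borel operations.\<close>

lemma vfield_measurable: "(\<lambda>(t, x). vfield a u t x) \<in> borel_measurable borel"
proof -
  let ?one = "cl (\<lambda>_. 1)"
  have one: "AE w in unit_lebesgue. fn ?one w = 1" by (rule fn_cl[OF SQ_const])
  have m: "\<mu>01 (lev (fn b) x) = (\<integral>w. fn ?one w * indicator (lev (fn b) x) w \<partial>unit_lebesgue)" for b x
  proof -
    have "(\<integral>w. fn ?one w * indicator (lev (fn b) x) w \<partial>unit_lebesgue) = (\<integral>w. indicator (lev (fn b) x) w \<partial>unit_lebesgue)"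
      using lev_sets[OF fn_measurable, of b x] borel_measurable_UL[OF fn_measurable[of ?one]] one
      by (intro integral_cong_AE) (auto elim: eventually_mono)
    then show ?thesis by (simp add: integral_indicator_lev fn_measurable)
  qed
  have d: "dis (fn b) x = 1 - (\<integral>w. indicator {x<..} (fn b w) * fn ?one w \<partial>unit_lebesgue)" for b x
  proof -
    let ?A = "{w. 0 < w \<and> w < 1 \<and> fn b w \<le> x}"
    have A: "?A \<in> sets unit_lebesgue" by (rule dis_sets[OF fn_measurable])
    have Ai: "?A \<inter> {0<..<1} = ?A" by auto
    have "(\<integral>w. indicator {x<..} (fn b w) * fn ?one w \<partial>unit_lebesgue) = (\<integral>w. 1 - indicator ?A w \<partial>unit_lebesgue)"
    proof (rule integral_cong_AE)
      show "AE w in unit_lebesgue. indicator {x<..} (fn b w) * fn ?one w = 1 - indicator ?A w"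
        using one AE_UL_space by eventually_elim (auto simp: indicator_def)
      show "(\<lambda>w. indicator {x<..} (fn b w) * fn ?one w) \<in> borel_measurable unit_lebesgue"
        by (intro borel_measurable_times SQ_measurable_UL SQ_indicator fn_SQ fn_measurable) simp
    qed (use A in auto)
    also have "\<dots> = (\<integral>w. 1 \<partial>unit_lebesgue) - (\<integral>w. indicator ?A w \<partial>unit_lebesgue)"
      using A by (intro Bochner_Integration.integral_diff integrable_real_indicator) (auto simp: less_top[symmetric])
    also have "\<dots> = 1 - \<mu>01 ?A" using A UL.prob_space Ai by simp
    finally show ?thesis by (simp add: dis_def)
  qed
  have eq: "(\<lambda>(t, x). vfield a u t x) = (\<lambda>p.
      if (\<lambda>(t, x). \<integral>w. fn ?one w * indicator (lev (fn (sticky a u t)) x) w \<partial>unit_lebesgue) p > 0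
      then (\<lambda>(t, x). \<integral>w. fn u w * indicator (lev (fn (sticky a u t)) x) w \<partial>unit_lebesgue) p /
        (\<lambda>(t, x). \<integral>w. fn ?one w * indicator (lev (fn (sticky a u t)) x) w \<partial>unit_lebesgue) p
      else fn u (1 - (\<lambda>(t, x). \<integral>w. indicator {x<..} (fn (sticky a u t) w) * fn ?one w \<partial>unit_lebesgue) p))"
    by (auto simp: vfield_def vel_def m d)
  note [measurable] = lev_integral_measurable half_line_measurable
  show ?thesis
    unfolding eq
  proof (rule measurable_If)
    show "{p \<in> space borel. 0 < (\<lambda>(t, x). \<integral>w. fn ?one w * indicator (lev (fn (sticky a u t)) x) w \<partial>unit_lebesgue) p} \<in> sets borel"
      by (rule borel_measurable_less[OF borel_measurable_const lev_integral_measurable])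
    show "(\<lambda>p. (\<lambda>(t, x). \<integral>w. fn u w * indicator (lev (fn (sticky a u t)) x) w \<partial>unit_lebesgue) p /
        (\<lambda>(t, x). \<integral>w. fn ?one w * indicator (lev (fn (sticky a u t)) x) w \<partial>unit_lebesgue) p) \<in> borel_measurable borel"
      by (rule borel_measurable_divide[OF lev_integral_measurable lev_integral_measurable])
    show "(\<lambda>p. fn u (1 - (\<lambda>(t, x). \<integral>w. indicator {x<..} (fn (sticky a u t) w) * fn ?one w \<partial>unit_lebesgue) p)) \<in> borel_measurable borel"
      by (rule measurable_compose[OF borel_measurable_diff[OF borel_measurable_const half_line_measurable] fn_measurable])
  qed
qed

section \<open>The continuity equation\<close>

text \<open>All partial derivatives vanish off the compact support, because its complement is open.
  Hence they are bounded, and they vanish for times outside an interval bounded away from 0.\<close>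

lemma test_function_facts:
  assumes "test_function \<psi>"
  obtains D \<alpha> \<beta> where "D 0 0 = \<psi>" "\<And>i j. continuous_on UNIV (D i j)"
    "\<And>i j t x. ((\<lambda>s. D i j (s, x)) has_real_derivative D (Suc i) j (t, x)) (at t)"
    "\<And>i j t x. ((\<lambda>y. D i j (t, y)) has_real_derivative D i (Suc j) (t, x)) (at x)"
    "0 < \<alpha>" "\<alpha> \<le> \<beta>" "\<And>i j t x. t < \<alpha> \<or> \<beta> < t \<Longrightarrow> D i j (t, x) = 0"
    "\<And>i j. \<exists>B\<ge>0. \<forall>z. \<bar>D i j z\<bar> \<le> B"
proof -
  obtain D K where D: "D 0 0 = \<psi>" "\<And>i j. continuous_on UNIV (D i j)"
    "\<And>i j t x. ((\<lambda>s. D i j (s, x)) has_real_derivative D (Suc i) j (t, x)) (at t)"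
    "\<And>i j t x. ((\<lambda>y. D i j (t, y)) has_real_derivative D i (Suc j) (t, x)) (at x)"
    and K: "compact K" "K \<subseteq> {0<..} \<times> UNIV" "\<And>z. z \<notin> K \<Longrightarrow> \<psi> z = 0"
    using assms unfolding test_function_def smooth_plane_def by metis
  have opn: "open (- K)" using compact_imp_closed[OF K(1)] by auto
  have step1: "D (Suc i) j z = 0" if z: "z \<notin> K" and IH: "\<And>z. z \<notin> K \<Longrightarrow> D i j z = 0" for i j z
  proof -
    obtain t x where tx: "z = (t, x)" by (cases z)
    have "open ((\<lambda>s. (s, x)) -` (- K))"
      by (rule open_vimage[OF opn]) (intro continuous_intros)
    then have "((\<lambda>s. D i j (s, x)) has_real_derivative 0) (at t)"
      by (rule DERIV_cong_open[OF DERIV_const]) (use z tx IH in auto)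
    then show ?thesis using DERIV_unique[OF D(3)] tx by blast
  qed
  have step2: "D i (Suc j) z = 0" if z: "z \<notin> K" and IH: "\<And>z. z \<notin> K \<Longrightarrow> D i j z = 0" for i j z
  proof -
    obtain t x where tx: "z = (t, x)" by (cases z)
    have "open ((\<lambda>s. (t, s)) -` (- K))"
      by (rule open_vimage[OF opn]) (intro continuous_intros)
    then have "((\<lambda>s. D i j (t, s)) has_real_derivative 0) (at x)"
      by (rule DERIV_cong_open[OF DERIV_const]) (use z tx IH in auto)
    then show ?thesis using DERIV_unique[OF D(4)] tx by blast
  qed
  have zero0: "D i 0 z = 0" if "z \<notin> K" for i z
    using that by (induction i arbitrary: z) (auto simp: D(1) K(3) intro: step1)
  have zero: "D i j z = 0" if "z \<notin> K" for i j z
    using that by (induction j arbitrary: z) (auto simp: zero0 intro: step2)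
  \<comment> \<open>The added point 1 keeps the set nonempty if \<open>K\<close> is empty and does
    not spoil the positivity of the minimum.\<close>
  let ?T = "insert 1 (fst ` K)"
  have T: "compact ?T"
    by (intro compact_insert compact_continuous_image K(1) continuous_on_fst continuous_on_id)
  from compact_attains_inf[OF T] obtain \<alpha> where a: "\<alpha> \<in> ?T" "\<forall>t\<in>?T. \<alpha> \<le> t" by auto
  from compact_attains_sup[OF T] obtain \<beta> where b: "\<beta> \<in> ?T" "\<forall>t\<in>?T. t \<le> \<beta>" by auto
  have "0 < \<alpha>" using a(1) K(2) by auto
  moreover have "\<alpha> \<le> \<beta>" using a(2) b(1) by auto
  moreover have "D i j (t, x) = 0" if "t < \<alpha> \<or> \<beta> < t" for i j t x
  proof (rule zero)
    show "(t, x) \<notin> K"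
    proof
      assume "(t, x) \<in> K"
      then have "t \<in> ?T" by force
      then show False using a(2) b(2) that by force
    qed
  qed
  moreover have "\<exists>B\<ge>0. \<forall>z. \<bar>D i j z\<bar> \<le> B" for i j
  proof -
    have "compact (D i j ` K)"
      by (rule compact_continuous_image[OF continuous_on_subset[OF D(2) subset_UNIV] K(1)])
    then obtain B where B: "\<And>z. z \<in> K \<Longrightarrow> \<bar>D i j z\<bar> \<le> B"
      using compact_imp_bounded by (force simp: bounded_iff)
    have "\<bar>D i j z\<bar> \<le> max 0 B" for z
      using B[of z] zero[of z i j] by (cases "z \<in> K") auto
    then show ?thesis by (intro exI[of _ "max 0 B"]) auto
  qed
  ultimately show thesis using that D by blast
qed

lemma bounded_deriv_lipschitz:
  fixes f f' :: "real \<Rightarrow> real"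
  assumes "\<And>x. (f has_real_derivative f' x) (at x)" "\<And>x. \<bar>f' x\<bar> \<le> B"
  shows "\<bar>f x - f y\<bar> \<le> B * \<bar>x - y\<bar>"
proof -
  have "norm (f x - f y) \<le> B * norm (x - y)"
    by (rule field_differentiable_bound[where S = UNIV and f' = f']) (use assms in auto)
  then show ?thesis by simp
qed

text \<open>The mean value inequality applied to \<open>f\<close> minus its linear part at
  \<open>x\<close>; the derivative of this difference is at most \<open>B\<close> times the distance
  to \<open>x\<close>.\<close>

lemma taylor_quadratic:
  fixes f f' f'' :: "real \<Rightarrow> real"
  assumes f: "\<And>x. (f has_real_derivative f' x) (at x)" and f': "\<And>x. (f' has_real_derivative f'' x) (at x)"
    and B: "\<And>x. \<bar>f'' x\<bar> \<le> B"
  shows "\<bar>f y - f x - (y - x) * f' x\<bar> \<le> B * (y - x)\<^sup>2"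
proof -
  have L: "\<bar>f' z - f' x\<bar> \<le> B * \<bar>z - x\<bar>" for z by (rule bounded_deriv_lipschitz[OF f' B])
  have B0: "0 \<le> B" using B[of x] abs_ge_zero[of "f'' x"] by linarith
  let ?S = "cball x \<bar>y - x\<bar>"
  have "norm ((f y - y * f' x) - (f x - x * f' x)) \<le> (B * \<bar>y - x\<bar>) * norm (y - x)"
  proof (rule field_differentiable_bound[where S = ?S and f = "\<lambda>z. f z - z * f' x" and f' = "\<lambda>z. f' z - f' x"])
    show "((\<lambda>z. f z - z * f' x) has_real_derivative f' z - f' x) (at z within ?S)" for z
    proof (rule has_field_derivative_at_within)
      have "((\<lambda>z. f z - z * f' x) has_real_derivative f' z - (1 * f' x + 0 * z)) (at z)"
        by (rule DERIV_diff[OF f DERIV_mult[OF DERIV_ident DERIV_const]])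
      then show "((\<lambda>z. f z - z * f' x) has_real_derivative f' z - f' x) (at z)" by simp
    qed
    show "norm (f' z - f' x) \<le> B * \<bar>y - x\<bar>" if "z \<in> ?S" for z
    proof -
      have "B * \<bar>z - x\<bar> \<le> B * \<bar>y - x\<bar>"
        using that B0 by (intro mult_left_mono) (auto simp: dist_real_def)
      then show ?thesis using L[of z] by simp
    qed
  qed (auto simp: dist_real_def)
  moreover have "(f y - y * f' x) - (f x - x * f' x) = f y - f x - (y - x) * f' x" by (simp add: algebra_simps)
  moreover have "(B * \<bar>y - x\<bar>) * norm (y - x) = B * (y - x)\<^sup>2" by (simp add: power2_eq_square)
  ultimately show ?thesis by (simp only: real_norm_def)
qed

lemma norm_cl_mono:
  assumes f: "f \<in> SQ" and g: "g \<in> SQ" and le: "\<And>w. \<bar>f w\<bar> \<le> \<bar>g w\<bar>"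
  shows "norm (cl f) \<le> norm (cl g)"
proof (rule power2_le_imp_le)
  show "(norm (cl f))\<^sup>2 \<le> (norm (cl g))\<^sup>2"
    unfolding norm_cl_sq[OF f] norm_cl_sq[OF g]
    using le by (intro integral_mono SQ_sq_integrable f g) (simp add: abs_le_square_iff)
qed simp

lemma norm_cl_const: "norm (cl (\<lambda>_. c)) = \<bar>c\<bar>"
proof (rule power2_eq_imp_eq)
  show "(norm (cl (\<lambda>_. c)))\<^sup>2 = \<bar>c\<bar>\<^sup>2" using UL.prob_space by (simp add: norm_cl_sq[OF SQ_const])
qed auto

section \<open>Lagrangian form of the weak continuity equation\<close>

context
  fixes a u :: l2 and D :: "nat \<Rightarrow> nat \<Rightarrow> real \<times> real \<Rightarrow> real"
  assumes a: "a \<in> MK" and u: "u \<in> Hs a"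
    and Dc: "\<And>i j. continuous_on UNIV (D i j)"
    and Dt: "\<And>i j t x. ((\<lambda>s. D i j (s, x)) has_real_derivative D (Suc i) j (t, x)) (at t)"
    and Dx: "\<And>i j t x. ((\<lambda>y. D i j (t, y)) has_real_derivative D i (Suc j) (t, x)) (at x)"
    and DB: "\<And>i j. \<exists>B\<ge>0. \<forall>z. \<bar>D i j z\<bar> \<le> B"
begin

definition bnd :: "nat \<Rightarrow> nat \<Rightarrow> real" where
  "bnd i j = (SOME B. B \<ge> 0 \<and> (\<forall>z. \<bar>D i j z\<bar> \<le> B))"

lemma bnd: "0 \<le> bnd i j" "\<bar>D i j z\<bar> \<le> bnd i j"
proof -
  have "\<exists>B. B \<ge> 0 \<and> (\<forall>z. \<bar>D i j z\<bar> \<le> B)" using DB[of i j] by blast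
  then have "bnd i j \<ge> 0 \<and> (\<forall>z. \<bar>D i j z\<bar> \<le> bnd i j)" unfolding bnd_def by (rule someI_ex)
  then show "0 \<le> bnd i j" "\<bar>D i j z\<bar> \<le> bnd i j" by blast+
qed

text \<open>A partial derivative of the test function evaluated along the flow, as an element of the
  Hilbert space.\<close>

definition cD :: "nat \<Rightarrow> nat \<Rightarrow> real \<Rightarrow> l2" where
  "cD i j t = cl (\<lambda>w. D i j (t, fn (sticky a u t) w))"

lemma D_measurable: "(\<lambda>y. D i j (t, y)) \<in> borel_measurable borel"
proof (rule borel_measurable_continuous_onI)
  show "continuous_on UNIV (\<lambda>y. D i j (t, y))"
    by (rule continuous_on_compose2[OF Dc]) (auto intro!: continuous_intros)
qed

lemma cD_SQ: "(\<lambda>w. D i j (t, fn b w)) \<in> SQ"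
  using bnd(2) by (intro SQ_bounded[of _ "bnd i j"] measurable_compose[OF fn_measurable D_measurable])

lemma D_lipschitz: "\<bar>D i j (t, x) - D i j (s, y)\<bar> \<le> bnd (Suc i) j * \<bar>t - s\<bar> + bnd i (Suc j) * \<bar>x - y\<bar>"
proof -
  have "\<bar>D i j (t, x) - D i j (s, x)\<bar> \<le> bnd (Suc i) j * \<bar>t - s\<bar>"
    by (rule bounded_deriv_lipschitz[OF Dt bnd(2)])
  moreover have "\<bar>D i j (s, x) - D i j (s, y)\<bar> \<le> bnd i (Suc j) * \<bar>x - y\<bar>"
    by (rule bounded_deriv_lipschitz[OF Dx bnd(2)])
  ultimately show ?thesis by linarith
qed

lemma cD_lipschitz: "norm (cD i j t - cD i j s) \<le> (bnd (Suc i) j + bnd i (Suc j) * norm u) * \<bar>t - s\<bar>"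
proof -
  let ?X = "sticky a u"
  let ?p = "bnd (Suc i) j * \<bar>t - s\<bar>" and ?q = "bnd i (Suc j)"
  have A: "(\<lambda>w. \<bar>fn (?X t) w - fn (?X s) w\<bar>) \<in> SQ"
    by (rule SQ_le[OF _ SQ_diff[OF fn_SQ fn_SQ]]) auto
  have "norm (cD i j t - cD i j s) = norm (cl (\<lambda>w. D i j (t, fn (?X t) w) - D i j (s, fn (?X s) w)))"
    by (simp add: cD_def cl_diff cD_SQ)
  also have "\<dots> \<le> norm (cl (\<lambda>w. ?p + ?q * \<bar>fn (?X t) w - fn (?X s) w\<bar>))"
  proof (rule norm_cl_mono)
    show "(\<lambda>w. D i j (t, fn (?X t) w) - D i j (s, fn (?X s) w)) \<in> SQ" by (intro SQ_diff cD_SQ)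
    show "(\<lambda>w. ?p + ?q * \<bar>fn (?X t) w - fn (?X s) w\<bar>) \<in> SQ" by (intro SQ_add SQ_const SQ_scale A)
    show "\<bar>D i j (t, fn (?X t) w) - D i j (s, fn (?X s) w)\<bar> \<le> \<bar>?p + ?q * \<bar>fn (?X t) w - fn (?X s) w\<bar>\<bar>" for w
      using D_lipschitz[of i j t "fn (?X t) w" s "fn (?X s) w"] by linarith
  qed
  also have "cl (\<lambda>w. ?p + ?q * \<bar>fn (?X t) w - fn (?X s) w\<bar>) = cl (\<lambda>_. ?p) + ?q *\<^sub>R cl (\<lambda>w. \<bar>fn (?X t) w - fn (?X s) w\<bar>)"
    by (simp add: cl_scale A cl_add SQ_const SQ_scale)
  also have "norm \<dots> \<le> norm (cl (\<lambda>_. ?p)) + norm (?q *\<^sub>R cl (\<lambda>w. \<bar>fn (?X t) w - fn (?X s) w\<bar>))"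
    by (rule norm_triangle_ineq)
  also have "norm (cl (\<lambda>_. ?p)) = ?p" using bnd(1) by (simp add: norm_cl_const)
  also have "norm (?q *\<^sub>R cl (\<lambda>w. \<bar>fn (?X t) w - fn (?X s) w\<bar>)) = ?q * norm (cl (\<lambda>w. \<bar>fn (?X t) w - fn (?X s) w\<bar>))"
    using bnd(1) by simp
  also have "?p + ?q * norm (cl (\<lambda>w. \<bar>fn (?X t) w - fn (?X s) w\<bar>)) \<le> ?p + ?q * (\<bar>t - s\<bar> * norm u)"
  proof (intro add_left_mono mult_left_mono bnd(1))
    have "norm (cl (\<lambda>w. \<bar>fn (?X t) w - fn (?X s) w\<bar>)) \<le> norm (cl (\<lambda>w. fn (?X t) w - fn (?X s) w))"
      by (rule norm_cl_mono[OF A SQ_diff[OF fn_SQ fn_SQ]]) simp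
    also have "cl (\<lambda>w. fn (?X t) w - fn (?X s) w) = ?X t - ?X s"
      using cl_diff[OF fn_SQ fn_SQ, of "?X t" "?X s"] by simp
    also have "norm (?X t - ?X s) \<le> \<bar>t - s\<bar> * norm u" by (rule sticky_lipschitz)
    finally show "norm (cl (\<lambda>w. \<bar>fn (?X t) w - fn (?X s) w\<bar>)) \<le> \<bar>t - s\<bar> * norm u" .
  qed
  also have "\<dots> = (bnd (Suc i) j + bnd i (Suc j) * norm u) * \<bar>t - s\<bar>" by (simp add: algebra_simps)
  finally show ?thesis .
qed

lemma cD_isCont: "isCont (cD i j) t"
proof -
  let ?C = "bnd (Suc i) j + bnd i (Suc j) * norm u"
  have "((\<lambda>s. ?C * \<bar>s - t\<bar>) \<longlongrightarrow> ?C * \<bar>t - t\<bar>) (at t)" by (intro tendsto_intros)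
  then have "((\<lambda>s. ?C * \<bar>s - t\<bar>) \<longlongrightarrow> 0) (at t)" by simp
  then have "((\<lambda>s. cD i j s - cD i j t) \<longlongrightarrow> 0) (at t)"
    by (rule Lim_null_comparison[OF always_eventually, rotated]) (use cD_lipschitz in blast)
  then show ?thesis unfolding isCont_def by (rule LIM_zero_cancel)
qed

text \<open>The integral of \<open>D 0 0\<close> at time \<open>t\<close> against the law of the
  position, in Lagrangian coordinates.\<close>

definition tG :: "real \<Rightarrow> real" where
  "tG t = inner (cl (\<lambda>_. 1)) (cD 0 0 t)"

text \<open>The inner integral of the weak continuity equation at time \<open>t\<close>; by the
  chain rule it is the expected derivative of \<open>tG\<close>.\<close>

definition tg :: "real \<Rightarrow> real" where
  "tg t = inner (cl (\<lambda>_. 1)) (cD 1 0 t) + inner (svel a u t) (cD 0 1 t)"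

lemma norm_one: "norm (cl (\<lambda>_. 1)) = 1"
  by (simp add: norm_cl_const)

lemma tG_lipschitz: "\<bar>tG t - tG s\<bar> \<le> (bnd 1 0 + bnd 0 1 * norm u) * \<bar>t - s\<bar>"
proof -
  have "\<bar>tG t - tG s\<bar> = \<bar>inner (cl (\<lambda>_. 1)) (cD 0 0 t - cD 0 0 s)\<bar>" by (simp add: tG_def inner_diff_right)
  also have "\<dots> \<le> norm (cl (\<lambda>_. 1)) * norm (cD 0 0 t - cD 0 0 s)" by (rule Cauchy_Schwarz_ineq2)
  also have "\<dots> \<le> (bnd 1 0 + bnd 0 1 * norm u) * \<bar>t - s\<bar>" using cD_lipschitz[of 0 0 t s] by (simp add: norm_one)
  finally show ?thesis .
qed

lemma norm_cD_le: "norm (cD i j t) \<le> bnd i j"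
proof -
  have "norm (cD i j t) \<le> norm (cl (\<lambda>_. bnd i j))"
    unfolding cD_def by (rule norm_cl_mono[OF cD_SQ SQ_const]) (use bnd in \<open>auto intro: order_trans\<close>)
  then show ?thesis using bnd(1) by (simp add: norm_cl_const)
qed

lemma tg_bound: "\<bar>tg t\<bar> \<le> bnd 1 0 + norm u * bnd 0 1"
proof -
  have "\<bar>tg t\<bar> \<le> norm (cl (\<lambda>_. 1)) * norm (cD 1 0 t) + norm (svel a u t) * norm (cD 0 1 t)"
    unfolding tg_def by (rule order_trans[OF abs_triangle_ineq]) (intro add_mono Cauchy_Schwarz_ineq2)
  also have "\<dots> \<le> 1 * bnd 1 0 + norm u * bnd 0 1"
  proof -
    have "norm (svel a u t) \<le> norm u" unfolding svel_def by (rule norm_avg_le[OF sticky_MK])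
    then show ?thesis unfolding norm_one by (intro add_mono mult_mono norm_cD_le) auto
  qed
  finally show ?thesis by simp
qed

lemma tg_isCont: "0 < t \<Longrightarrow> t \<notin> bad_times a u \<Longrightarrow> isCont tg t"
  unfolding tg_def[abs_def]
  by (intro continuous_intros svel_isCont[OF a u] cD_isCont) auto

text \<open>Second order Taylor expansion along the flow; the quadratic remainder is \<open>O(h\<^sup>2)\<close> because
  \<open>sticky a u\<close> is Lipschitz.\<close>

lemma D_taylor:
  defines "B \<equiv> bnd 2 0 + bnd 1 1 + bnd 0 2"
  shows "\<bar>D 0 0 (t + h, x + k) - D 0 0 (t, x) - h * D 1 0 (t, x) - k * D 0 1 (t, x)\<bar> \<le> 2 * B * (h\<^sup>2 + k\<^sup>2)"
proof -
  have 1: "\<bar>D 0 0 (t + h, x + k) - D 0 0 (t, x + k) - h * D 1 0 (t, x + k)\<bar> \<le> bnd 2 0 * h\<^sup>2"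
    using taylor_quadratic[of "\<lambda>s. D 0 0 (s, x + k)" "\<lambda>s. D 1 0 (s, x + k)" "\<lambda>s. D 2 0 (s, x + k)" "bnd 2 0" "t + h" t]
      Dt[of 0 0] Dt[of 1 0] bnd(2)[of 2 0] by (simp add: numeral_2_eq_2)
  have 2: "\<bar>D 0 0 (t, x + k) - D 0 0 (t, x) - k * D 0 1 (t, x)\<bar> \<le> bnd 0 2 * k\<^sup>2"
    using taylor_quadratic[of "\<lambda>y. D 0 0 (t, y)" "\<lambda>y. D 0 1 (t, y)" "\<lambda>y. D 0 2 (t, y)" "bnd 0 2" "x + k" x]
      Dx[of 0 0] Dx[of 0 1] bnd(2)[of 0 2] by (simp add: numeral_2_eq_2)
  have "\<bar>D 1 0 (t, x + k) - D 1 0 (t, x)\<bar> \<le> bnd 1 1 * \<bar>k\<bar>"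
    using D_lipschitz[of 1 0 t "x + k" t x] by simp
  then have "\<bar>h\<bar> * \<bar>D 1 0 (t, x + k) - D 1 0 (t, x)\<bar> \<le> \<bar>h\<bar> * (bnd 1 1 * \<bar>k\<bar>)" by (rule mult_left_mono) simp
  moreover have "\<bar>h\<bar> * (bnd 1 1 * \<bar>k\<bar>) \<le> bnd 1 1 * (h\<^sup>2 + k\<^sup>2)"
  proof -
    have "\<bar>h\<bar> * \<bar>k\<bar> \<le> h\<^sup>2 + k\<^sup>2"
    proof -
      have "0 \<le> \<bar>h\<bar> * \<bar>k\<bar>" by simp
      moreover have "2 * (\<bar>h\<bar> * \<bar>k\<bar>) \<le> h\<^sup>2 + k\<^sup>2"
        using sum_squares_bound[of "\<bar>h\<bar>" "\<bar>k\<bar>"] by (simp add: mult.assoc)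
      ultimately show ?thesis by linarith
    qed
    then have "bnd 1 1 * (\<bar>h\<bar> * \<bar>k\<bar>) \<le> bnd 1 1 * (h\<^sup>2 + k\<^sup>2)" using bnd(1) by (rule mult_left_mono)
    then show ?thesis by (simp add: algebra_simps)
  qed
  ultimately have 3: "\<bar>h * D 1 0 (t, x + k) - h * D 1 0 (t, x)\<bar> \<le> bnd 1 1 * (h\<^sup>2 + k\<^sup>2)"
    by (simp add: right_diff_distrib[symmetric] abs_mult)
  have 4: "bnd 2 0 * h\<^sup>2 \<le> bnd 2 0 * (h\<^sup>2 + k\<^sup>2)" "bnd 0 2 * k\<^sup>2 \<le> bnd 0 2 * (h\<^sup>2 + k\<^sup>2)"
    using bnd(1) by (auto intro!: mult_left_mono)
  have "\<bar>D 0 0 (t + h, x + k) - D 0 0 (t, x) - h * D 1 0 (t, x) - k * D 0 1 (t, x)\<bar> \<le> B * (h\<^sup>2 + k\<^sup>2)"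
    unfolding B_def distrib_right using 1 2 3 4 by linarith
  also have "\<dots> \<le> 2 * B * (h\<^sup>2 + k\<^sup>2)"
    using bnd(1) by (intro mult_right_mono) (auto simp: B_def add_nonneg_nonneg)
  finally show ?thesis .
qed

text \<open>The pointwise expansion is integrated over the unit interval, where the squared
  displacements add up to at most the square of \<open>h * norm u\<close>. The displacement itself
  is left in the linear term.\<close>

lemma tG_increment:
  defines "B \<equiv> bnd 2 0 + bnd 1 1 + bnd 0 2"
  shows "\<bar>tG (t + h) - tG t - h * inner (cl (\<lambda>_. 1)) (cD 1 0 t) - inner (sticky a u (t + h) - sticky a u t) (cD 0 1 t)\<bar>
    \<le> 2 * B * (1 + (norm u)\<^sup>2) * h\<^sup>2"
proof -
  let ?X = "sticky a u" and ?one = "cl (\<lambda>_. 1 :: real)"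
  let ?k = "\<lambda>w. fn (?X (t + h)) w - fn (?X t) w"
  let ?r = "\<lambda>w. D 0 0 (t + h, fn (?X (t + h)) w) - D 0 0 (t, fn (?X t) w) - h * D 1 0 (t, fn (?X t) w) - ?k w * D 0 1 (t, fn (?X t) w)"
  have k: "?k \<in> SQ" by (intro SQ_diff fn_SQ)
  have B0: "0 \<le> B" using bnd(1) by (simp add: B_def)
  have one: "inner ?one (cl f) = (\<integral>w. f w \<partial>unit_lebesgue)" if "f \<in> SQ" for f
    using inner_cl[OF SQ_const that, of 1] by simp
  have ik: "inner (?X (t + h) - ?X t) (cD 0 1 t) = (\<integral>w. ?k w * D 0 1 (t, fn (?X t) w) \<partial>unit_lebesgue)"
    using inner_cl[OF k cD_SQ, of 0 1 t "?X t"] cl_diff[OF fn_SQ fn_SQ, of "?X (t + h)" "?X t"] by (simp add: cD_def)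
  let ?s = "\<lambda>w. D 0 0 (t + h, fn (?X (t + h)) w) - D 0 0 (t, fn (?X t) w) - h * D 1 0 (t, fn (?X t) w)"
  have S: "?s \<in> SQ" by (intro SQ_diff SQ_scale cD_SQ)
  have "tG (t + h) - tG t - h * inner ?one (cD 1 0 t) = inner ?one (cl ?s)"
    unfolding tG_def cD_def inner_diff_right[symmetric] inner_scaleR_right[symmetric]
    by (simp only: cl_diff cD_SQ cl_scale SQ_scale SQ_diff)
  then have "tG (t + h) - tG t - h * inner ?one (cD 1 0 t) - inner (?X (t + h) - ?X t) (cD 0 1 t) =
     (\<integral>w. ?s w \<partial>unit_lebesgue) - (\<integral>w. ?k w * D 0 1 (t, fn (?X t) w) \<partial>unit_lebesgue)"
    unfolding ik one[OF S] by simp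
  also have "\<dots> = (\<integral>w. ?r w \<partial>unit_lebesgue)"
    by (rule Bochner_Integration.integral_diff[symmetric, OF SQ_integrable[OF S] SQ_mult_integrable[OF k cD_SQ]])
  finally have eq: "tG (t + h) - tG t - h * inner ?one (cD 1 0 t) - inner (?X (t + h) - ?X t) (cD 0 1 t) =
    (\<integral>w. ?r w \<partial>unit_lebesgue)" .
  have ri: "integrable unit_lebesgue ?r"
    by (rule Bochner_Integration.integrable_diff[OF SQ_integrable[OF S] SQ_mult_integrable[OF k cD_SQ]])
  have "\<bar>\<integral>w. ?r w \<partial>unit_lebesgue\<bar> \<le> (\<integral>w. \<bar>?r w\<bar> \<partial>unit_lebesgue)" by (rule integral_abs_bound)
  also have "\<dots> \<le> (\<integral>w. 2 * B * (h\<^sup>2 + (?k w)\<^sup>2) \<partial>unit_lebesgue)"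
  proof (rule integral_mono)
    show "integrable unit_lebesgue (\<lambda>w. 2 * B * (h\<^sup>2 + (?k w)\<^sup>2))"
      by (intro integrable_mult_right Bochner_Integration.integrable_add SQ_sq_integrable k SQ_const)
    show "\<bar>?r w\<bar> \<le> 2 * B * (h\<^sup>2 + (?k w)\<^sup>2)" for w
      using D_taylor[of t h "fn (?X t) w" "?k w"] by (simp add: B_def)
  qed (use ri in simp)
  also have "\<dots> = 2 * B * (h\<^sup>2 + (norm (?X (t + h) - ?X t))\<^sup>2)"
  proof -
    have "(\<integral>w. h\<^sup>2 + (?k w)\<^sup>2 \<partial>unit_lebesgue) = (\<integral>w. h\<^sup>2 \<partial>unit_lebesgue) + (\<integral>w. (?k w)\<^sup>2 \<partial>unit_lebesgue)"
      by (rule Bochner_Integration.integral_add) (simp, rule SQ_sq_integrable[OF k])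
    moreover have "(\<integral>w. (?k w)\<^sup>2 \<partial>unit_lebesgue) = (norm (?X (t + h) - ?X t))\<^sup>2"
      using dist_cl_sq[OF fn_SQ fn_SQ, of "?X (t + h)" "?X t"] by (simp add: dist_norm)
    ultimately show ?thesis using UL.prob_space by simp
  qed
  also have "\<dots> \<le> 2 * B * (h\<^sup>2 + (\<bar>h\<bar> * norm u)\<^sup>2)"
    using sticky_lipschitz[of a u "t + h" t] B0 by (intro mult_left_mono add_left_mono power_mono) auto
  also have "\<dots> = 2 * B * (1 + (norm u)\<^sup>2) * h\<^sup>2" by (simp add: power_mult_distrib algebra_simps)
  finally show ?thesis unfolding eq .
qed

lemma tG_deriv:
  assumes t: "0 < t" "t \<notin> bad_times a u"
  shows "(tG has_real_derivative tg t) (at t)"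
proof -
  let ?X = "sticky a u" and ?C = "2 * (bnd 2 0 + bnd 1 1 + bnd 0 2) * (1 + (norm u)\<^sup>2)"
  let ?q = "\<lambda>h. (1 / h) *\<^sub>R (?X (t + h) - ?X t)"
  have "((\<lambda>h. ?C * \<bar>h\<bar> + \<bar>inner (?q h - svel a u t) (cD 0 1 t)\<bar>) \<longlongrightarrow>
      ?C * \<bar>0\<bar> + \<bar>inner (svel a u t - svel a u t) (cD 0 1 t)\<bar>) (at 0)"
    by (intro tendsto_intros sticky_deriv[OF a u t])
  then have lim: "((\<lambda>h. ?C * \<bar>h\<bar> + \<bar>inner (?q h - svel a u t) (cD 0 1 t)\<bar>) \<longlongrightarrow> 0) (at 0)" by simp
  have "\<forall>\<^sub>F h in at 0. norm ((tG (t + h) - tG t) / h - tg t) \<le> ?C * \<bar>h\<bar> + \<bar>inner (?q h - svel a u t) (cD 0 1 t)\<bar>"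
    unfolding eventually_at
  proof (intro exI[of _ 1] conjI ballI impI)
    fix h :: real assume h: "h \<noteq> 0 \<and> dist h 0 < 1"
    define R where "R = tG (t + h) - tG t - h * inner (cl (\<lambda>_. 1)) (cD 1 0 t) - inner (?X (t + h) - ?X t) (cD 0 1 t)"
    have R: "\<bar>R\<bar> \<le> ?C * h\<^sup>2" unfolding R_def by (rule tG_increment)
    have iq: "inner (?X (t + h) - ?X t) (cD 0 1 t) = h * inner (?q h) (cD 0 1 t)" using h by simp
    have "tG (t + h) - tG t - h * tg t = R + h * inner (?q h - svel a u t) (cD 0 1 t)"
      unfolding R_def iq tg_def inner_diff_left[of "?q h"] by (simp add: algebra_simps)
    then have "(tG (t + h) - tG t) / h - tg t = R / h + inner (?q h - svel a u t) (cD 0 1 t)"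
      using h by (simp add: field_simps)
    then have "\<bar>(tG (t + h) - tG t) / h - tg t\<bar> \<le> \<bar>R / h\<bar> + \<bar>inner (?q h - svel a u t) (cD 0 1 t)\<bar>"
      by (simp only: abs_triangle_ineq)
    moreover have "\<bar>R / h\<bar> \<le> ?C * \<bar>h\<bar>"
    proof -
      have "\<bar>R / h\<bar> = \<bar>R\<bar> / \<bar>h\<bar>" by (rule abs_divide)
      also have "\<dots> \<le> ?C * h\<^sup>2 / \<bar>h\<bar>" using R by (intro divide_right_mono) auto
      also have "?C * h\<^sup>2 / \<bar>h\<bar> = ?C * \<bar>h\<bar>"
      proof -
        have "h\<^sup>2 / \<bar>h\<bar> = \<bar>h\<bar>" using h by (metis abs_mult_self_eq abs_eq_0 nonzero_mult_div_cancel_left power2_eq_square)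
        then show ?thesis by (metis times_divide_eq_right)
      qed
      finally show ?thesis .
    qed
    ultimately show "norm ((tG (t + h) - tG t) / h - tg t) \<le> ?C * \<bar>h\<bar> + \<bar>inner (?q h - svel a u t) (cD 0 1 t)\<bar>"
      unfolding real_norm_def by linarith
  qed simp
  then have "((\<lambda>h. (tG (t + h) - tG t) / h - tg t) \<longlongrightarrow> 0) (at 0)" using lim by (rule Lim_null_comparison)
  then show ?thesis unfolding DERIV_def by (rule LIM_zero_cancel)
qed

text \<open>\<open>tG\<close> and the integral of \<open>tg\<close> are Lipschitz and have equal derivatives off a countable set.\<close>

lemma integral_tg:
  assumes p: "0 < p" "p \<le> q" and int: "tg integrable_on {p..q}"
  shows "integral {p..q} tg = tG q - tG p"
proof -
  define \<Phi> where "\<Phi> t = integral {p..t} tg" for t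
  let ?C = "bnd 1 0 + norm u * bnd 0 1"
  have sub: "tg integrable_on {s..t}" if "p \<le> s" "t \<le> q" for s t
    by (rule integrable_subinterval_real[OF int]) (use that in auto)
  have inc: "\<bar>\<Phi> t - \<Phi> s\<bar> \<le> ?C * \<bar>t - s\<bar>" if st: "p \<le> s" "s \<le> t" "t \<le> q" for s t
  proof -
    have "\<Phi> s + integral {s..t} tg = \<Phi> t"
      unfolding \<Phi>_def by (rule Henstock_Kurzweil_Integration.integral_combine[OF st(1,2) sub]) (use st in auto)
    moreover have "norm (integral {s..t} tg) \<le> integral {s..t} (\<lambda>_. ?C)"
      by (rule integral_norm_bound_integral) (use sub st tg_bound in auto)
    ultimately show ?thesis using st by (simp add: mult.commute)
  qed
  have \<Phi>L: "\<bar>\<Phi> s - \<Phi> t\<bar> \<le> ?C * \<bar>s - t\<bar>" if "s \<in> {p..q}" "t \<in> {p..q}" for s t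
    using inc[of s t] inc[of t s] that by (cases "s \<le> t") (auto simp: abs_minus_commute)
  have GL: "\<bar>tG s - tG t\<bar> \<le> ?C * \<bar>s - t\<bar>" for s t using tG_lipschitz[of s t] by (simp add: mult.commute)
  have d: "((\<lambda>t. \<Phi> t - tG t) has_real_derivative 0) (at t)" if t: "t \<in> {p<..<q}" "t \<notin> bad_times a u" for t
  proof -
    have "continuous (at t within ({p..q} - {})) tg"
      using tg_isCont[of t] t p continuous_at_imp_continuous_at_within by auto
    from integral_has_vector_derivative_continuous_at[OF int _ _ this]
    have "(\<Phi> has_vector_derivative tg t) (at t within {p..q})"
      using t by (simp add: \<Phi>_def[abs_def])
    then have "(\<Phi> has_real_derivative tg t) (at t within {p..q})"
      by (simp add: has_real_derivative_iff_has_vector_derivative)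
    then have "(\<Phi> has_real_derivative tg t) (at t)"
      using t at_within_interior[of t "{p..q}"] by simp
    then show ?thesis using DERIV_diff[OF _ tG_deriv[of t]] t p by fastforce
  qed
  have AE: "AE t in lborel. t \<in> {p<..<q} \<longrightarrow> ((\<lambda>t. \<Phi> t - tG t) has_real_derivative 0) (at t)"
    using AE_not_bad[OF a u] by eventually_elim (use d in blast)
  have L1: "\<bar>(\<Phi> s - tG s) - (\<Phi> t - tG t)\<bar> \<le> (2 * ?C) * \<bar>s - t\<bar>" if "s \<in> {p..q}" "t \<in> {p..q}" for s t
  proof -
    have "\<bar>(\<Phi> s - tG s) - (\<Phi> t - tG t)\<bar> \<le> \<bar>\<Phi> s - \<Phi> t\<bar> + \<bar>tG s - tG t\<bar>" by linarith
    also have "\<dots> \<le> ?C * \<bar>s - t\<bar> + ?C * \<bar>s - t\<bar>" by (rule add_mono[OF \<Phi>L[OF that] GL])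
    also have "\<dots> = 2 * ?C * \<bar>s - t\<bar>" by (simp add: algebra_simps)
    finally show ?thesis .
  qed
  \<comment> \<open>The monotonicity lemma is applied to the difference and to its negative, which
    together give constancy.\<close>
  have "\<Phi> q - tG q \<le> \<Phi> p - tG p"
  proof (rule lipschitz_AE_deriv_nonpos[OF p(2) L1])
    show "AE t in lborel. t \<in> {p<..<q} \<longrightarrow> (\<exists>D\<le>0. ((\<lambda>t. \<Phi> t - tG t) has_real_derivative D) (at t))"
      using AE by eventually_elim (auto intro!: exI[of _ 0])
  qed
  moreover have "- (\<Phi> q - tG q) \<le> - (\<Phi> p - tG p)"
  proof (rule lipschitz_AE_deriv_nonpos[OF p(2), where L = "2 * ?C" and f = "\<lambda>t. - (\<Phi> t - tG t)"])
    show "\<bar>- (\<Phi> s - tG s) - - (\<Phi> t - tG t)\<bar> \<le> 2 * ?C * \<bar>s - t\<bar>" if "s \<in> {p..q}" "t \<in> {p..q}" for s t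
      using L1[OF that] by linarith
    show "AE t in lborel. t \<in> {p<..<q} \<longrightarrow> (\<exists>D\<le>0. ((\<lambda>t. - (\<Phi> t - tG t)) has_real_derivative D) (at t))"
      using AE by eventually_elim (use DERIV_minus in \<open>fastforce intro!: exI[of _ 0]\<close>)
  qed
  ultimately show ?thesis by (simp add: \<Phi>_def)
qed

end

text \<open>The integrand is the derivative of \<open>tG\<close> at almost every time, and
  \<open>tG\<close> vanishes at both ends of an interval that contains the time support of the test
  function.\<close>

lemma continuity_equation_sticky:
  assumes a: "a \<in> MK" and u: "u \<in> Hs a" and r: "\<And>t. 0 \<le> t \<Longrightarrow> r t = law (sticky a u t)"
  shows "continuity_equation r (vfield a u)"
  unfolding continuity_equation_def
proof (intro allI impI)
  fix \<psi> assume "test_function \<psi>"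
  then obtain D \<alpha> \<beta> where D: "D 0 0 = \<psi>" "\<And>i j. continuous_on UNIV (D i j)"
    "\<And>i j t x. ((\<lambda>s. D i j (s, x)) has_real_derivative D (Suc i) j (t, x)) (at t)"
    "\<And>i j t x. ((\<lambda>y. D i j (t, y)) has_real_derivative D i (Suc j) (t, x)) (at x)"
    and ab: "0 < \<alpha>" "\<alpha> \<le> \<beta>" and zero: "\<And>i j t x. t < \<alpha> \<or> \<beta> < t \<Longrightarrow> D i j (t, x) = 0"
    and DB: "\<And>i j. \<exists>B\<ge>0. \<forall>z. \<bar>D i j z\<bar> \<le> B"
    by (rule test_function_facts) blast
  let ?g = "tg a u D" and ?X = "sticky a u"
  have inner_int: "(LINT x|r t. deriv (\<lambda>s. \<psi> (s, x)) t + vfield a u t x * deriv (\<lambda>y. \<psi> (t, y)) x) = ?g t"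
    if t: "0 < t" for t
  proof -
    have "deriv (\<lambda>s. \<psi> (s, x)) t = D 1 0 (t, x)" "deriv (\<lambda>y. \<psi> (t, y)) x = D 0 1 (t, x)" for x
      using D(3)[of 0 0 x t] D(4)[of 0 0 t x] D(1) by (auto intro!: DERIV_imp_deriv)
    then have "(LINT x|r t. deriv (\<lambda>s. \<psi> (s, x)) t + vfield a u t x * deriv (\<lambda>y. \<psi> (t, y)) x) =
       (LINT x|law (?X t). D 1 0 (t, x) + vfield a u t x * D 0 1 (t, x))" using r t by simp
    also have "\<dots> = (\<integral>w. D 1 0 (t, fn (?X t) w) + vfield a u t (fn (?X t) w) * D 0 1 (t, fn (?X t) w) \<partial>unit_lebesgue)"
      unfolding law_def
      by (rule integral_distr[OF borel_measurable_UL[OF fn_measurable]])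
        (intro borel_measurable_add borel_measurable_times vfield(1) D_measurable[where D = D, OF a u D(2-4) DB])
    also have "\<dots> = (\<integral>w. D 1 0 (t, fn (?X t) w) \<partial>unit_lebesgue) + (\<integral>w. vfield a u t (fn (?X t) w) * D 0 1 (t, fn (?X t) w) \<partial>unit_lebesgue)"
      by (rule Bochner_Integration.integral_add)
        (intro SQ_integrable SQ_mult_integrable vfield(3) cD_SQ[where D = D, OF a u D(2-4) DB])+
    also have "\<dots> = ?g t"
      using inner_cl[OF SQ_const cD_SQ[where D = D, OF a u D(2-4) DB], of 1 1 0 t "?X t"]
        inner_cl[OF vfield(3)[of a u t] cD_SQ[where D = D, OF a u D(2-4) DB], of 0 1 t "?X t"] vfield(4)[of a u t]
      by (simp add: tg_def[where D = D, OF a u D(2-4) DB] cD_def[where D = D, OF a u D(2-4) DB])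
    finally show ?thesis .
  qed
  \<comment> \<open>Positive and strictly outside the time support, so that \<open>tG\<close> is 0
    at both \<open>p\<close> and \<open>q\<close>.\<close>
  define p q where "p = \<alpha> / 2" and "q = \<beta> + 1"
  have pq: "0 < p" "p \<le> q" using ab by (auto simp: p_def q_def)
  have cz: "cD a u D i j t = 0" if "t < \<alpha> \<or> \<beta> < t" for i j t
    using zero[OF that] by (simp add: cD_def[where D = D, OF a u D(2-4) DB] cl_zero)
  have gz: "?g t = 0" if "t < \<alpha> \<or> \<beta> < t" for t
    using cz[OF that] by (simp add: tg_def[where D = D, OF a u D(2-4) DB])
  have "(LINT t:{0<..}|lborel. (LINT x|r t. deriv (\<lambda>s. \<psi> (s, x)) t + vfield a u t x * deriv (\<lambda>y. \<psi> (t, y)) x))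
      = (LINT t:{p..q}|lborel. ?g t)"
    unfolding set_lebesgue_integral_def
  proof (intro Bochner_Integration.integral_cong refl)
    fix t :: real
    show "indicator {0<..} t *\<^sub>R (LINT x|r t. deriv (\<lambda>s. \<psi> (s, x)) t + vfield a u t x * deriv (\<lambda>y. \<psi> (t, y)) x) =
      indicator {p..q} t *\<^sub>R ?g t"
    proof (cases "0 < t")
      case True
      have "t \<in> {p..q} \<or> t < \<alpha> \<or> \<beta> < t" using ab unfolding p_def q_def by auto
      then show ?thesis using True inner_int[OF True] gz[of t] by (auto simp: indicator_def)
    qed (use pq in \<open>auto simp: indicator_def\<close>)
  qed
  also have "\<dots> = 0"
  \<comment> \<open>Without integrability the Bochner integral is 0 by convention, so the value is 0
    in either case.\<close>
  proof (cases "set_integrable lborel {p..q} ?g")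
    case True
    have "(LINT t:{p..q}|lborel. ?g t) = integral {p..q} ?g" by (rule set_borel_integral_eq_integral(2)[OF True])
    also have "\<dots> = tG a u D q - tG a u D p"
      by (rule integral_tg[where D = D, OF a u D(2-4) DB pq set_borel_integral_eq_integral(1)[OF True]])
    also have "\<dots> = 0" using cz[of q] cz[of p] ab by (simp add: tG_def[where D = D, OF a u D(2-4) DB] p_def q_def)
    finally show ?thesis .
  next
    case False
    then show ?thesis by (simp add: set_lebesgue_integral_def set_integrable_def not_integrable_integral_eq)
  qed
  finally show "(LINT t:{0<..}|lborel. (LINT x|r t. deriv (\<lambda>s. \<psi> (s, x)) t + vfield a u t x * deriv (\<lambda>y. \<psi> (t, y)) x)) = 0" .
qed

text \<open>By the isometry, the metric difference quotient is the norm of the difference quotient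
  of the flow, which converges to the norm of the velocity at all times outside
  \<open>bad_times\<close>.\<close>

lemma wasserstein_velocity_sticky:
  assumes a: "a \<in> MK" and u: "u \<in> Hs a" and r: "\<And>t. 0 \<le> t \<Longrightarrow> r t = law (sticky a u t)"
  shows "wasserstein_velocity r (vfield a u)"
  unfolding wasserstein_velocity_def
proof (intro conjI)
  show "(\<lambda>(t, x). vfield a u t x) \<in> borel_measurable (restrict_space borel ({0<..} \<times> UNIV))"
    by (rule measurable_restrict_space1[OF vfield_measurable])
  show "AE t in lborel. 0 < t \<longrightarrow> vfield a u t \<in> L2 (r t)"
    using vfield(2)[of a u] r by simp
  show "continuity_equation r (vfield a u)" by (rule continuity_equation_sticky[OF a u r])
  show "AE t in lborel. 0 < t \<longrightarrow>
      ((\<lambda>h. W2 (r (t + h)) (r t) / \<bar>h\<bar>) \<longlongrightarrow> sqrt (\<integral>x. (vfield a u t x)\<^sup>2 \<partial>r t)) (at 0)"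
    using AE_not_bad[OF a u]
  proof eventually_elim
    case (elim t)
    show ?case
    proof
      assume t: "0 < t"
      let ?X = "sticky a u"
      have m: "(\<lambda>x. (vfield a u t x)\<^sup>2) \<in> borel_measurable borel" by (intro borel_measurable_power vfield(1))
      have "(\<integral>x. (vfield a u t x)\<^sup>2 \<partial>r t) = (\<integral>w. (vfield a u t (fn (?X t) w))\<^sup>2 \<partial>unit_lebesgue)"
        unfolding r[OF less_imp_le[OF t]] law_def by (rule integral_distr[OF borel_measurable_UL[OF fn_measurable] m])
      also have "\<dots> = (norm (svel a u t))\<^sup>2" using norm_cl_sq[OF vfield(3)[of a u t]] vfield(4)[of a u t] by simp
      finally have n: "sqrt (\<integral>x. (vfield a u t x)\<^sup>2 \<partial>r t) = norm (svel a u t)" by simp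
      have lim: "((\<lambda>h. norm ((1 / h) *\<^sub>R (?X (t + h) - ?X t))) \<longlongrightarrow> norm (svel a u t)) (at 0)"
        by (intro tendsto_norm sticky_deriv[OF a u t elim])
      have "\<forall>\<^sub>F h in at 0. norm ((1 / h) *\<^sub>R (?X (t + h) - ?X t)) = W2 (r (t + h)) (r t) / \<bar>h\<bar>"
        unfolding eventually_at
      proof (intro exI[of _ t] conjI ballI impI t)
        fix h :: real assume h: "h \<noteq> 0 \<and> dist h 0 < t"
        then have "0 \<le> t + h" by (auto simp: dist_real_def)
        then show "norm ((1 / h) *\<^sub>R (?X (t + h) - ?X t)) = W2 (r (t + h)) (r t) / \<bar>h\<bar>"
          using t by (simp add: r W2_eq law_P2 qf_law sticky_MK dist_norm)
      qed
      with lim show "((\<lambda>h. W2 (r (t + h)) (r t) / \<bar>h\<bar>) \<longlongrightarrow> sqrt (\<integral>x. (vfield a u t x)\<^sup>2 \<partial>r t)) (at 0)"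
        unfolding n by (rule Lim_transform_eventually)
    qed
  qed
qed

section \<open>Curves with prescribed initial velocity\<close>

lemma integral_opt_coupling:
  assumes \<rho>: "\<rho> \<in> P2" and \<eta>: "\<eta> \<in> P2" and v: "v \<in> L2 \<rho>"
  shows "(\<integral>z. (fst z + t * v (fst z) - snd z)\<^sup>2 \<partial>opt_coupling \<rho> \<eta>)
    = (norm (qf \<rho> + t *\<^sub>R cl (\<lambda>w. v (rearr \<rho> w)) - qf \<eta>))\<^sup>2"
proof -
  have X: "rearr \<rho> \<in> SQ" "rearr \<eta> \<in> SQ" by (auto intro: rearr_SQ \<rho> \<eta>)
  have m: "rearr \<rho> \<in> borel_measurable borel" "rearr \<eta> \<in> borel_measurable borel"
    using X by (auto simp: SQ_measurable)
  have vm: "v \<in> borel_measurable borel" using v by (simp add: L2_def)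
  note V = momentum_eq_mom(1)[OF \<rho> v]
  have fs: "fst \<in> borel_measurable (borel :: (real \<times> real) measure)"
    "snd \<in> borel_measurable (borel :: (real \<times> real) measure)"
    by (auto intro!: borel_measurable_continuous_onI continuous_intros)
  have "(\<integral>z. (fst z + t * v (fst z) - snd z)\<^sup>2 \<partial>opt_coupling \<rho> \<eta>)
      = (\<integral>w. (rearr \<rho> w + t * v (rearr \<rho> w) - rearr \<eta> w)\<^sup>2 \<partial>unit_lebesgue)"
    unfolding opt_coupling_def
  proof (subst integral_distr)
    show "(\<lambda>w. (rearr \<rho> w, rearr \<eta> w)) \<in> unit_lebesgue \<rightarrow>\<^sub>M borel"
      by (rule borel_measurable_Pair[OF borel_measurable_UL[OF m(1)] borel_measurable_UL[OF m(2)]])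
    show "(\<lambda>z. (fst z + t * v (fst z) - snd z)\<^sup>2) \<in> borel_measurable (borel :: (real \<times> real) measure)"
      using fs measurable_compose[OF fs(1) vm] by measurable
  qed simp
  also have "\<dots> = (norm (cl (\<lambda>w. rearr \<rho> w + t * v (rearr \<rho> w) - rearr \<eta> w)))\<^sup>2"
    by (rule norm_cl_sq[symmetric, OF SQ_diff[OF SQ_add[OF X(1) SQ_scale[OF V]] X(2)]])
  also have "cl (\<lambda>w. rearr \<rho> w + t * v (rearr \<rho> w) - rearr \<eta> w)
      = qf \<rho> + t *\<^sub>R cl (\<lambda>w. v (rearr \<rho> w)) - qf \<eta>"
    unfolding qf_def by (simp only: cl_scale[OF V] cl_add[OF X(1) SQ_scale[OF V]]
        cl_diff[OF SQ_add[OF X(1) SQ_scale[OF V]] X(2)])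
  finally show ?thesis .
qed

text \<open>Both curves are tangent at time 0 to the free motion \<open>a + t *\<^sub>R u\<close>,
  the given one by assumption and the sticky one by \<open>sticky_initial\<close>. Their distance is
  therefore of smaller order than \<open>t\<close>, as \<open>sticky_EVI_unique\<close>
  demands.\<close>

lemma sticky_EVI_initial_velocity_unique:
  assumes a: "a \<in> MK" and u: "u \<in> Hs a" and r: "lipschitz_curve r" "sticky_EVI (law a) r" "r 0 = law a"
    and lim: "((\<lambda>t. (norm (a + t *\<^sub>R u - qf (r t)))\<^sup>2 / t\<^sup>2) \<longlongrightarrow> 0) (at_right 0)" and t: "0 \<le> t"
  shows "r t = law (sticky a u t)"
proof (cases "t = 0")
  case True
  then show ?thesis by (simp add: r(3) sticky_0[OF a])
next
  case False
  define q where "q t = law (sticky a u t)" for t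
  have q: "lipschitz_curve q" "sticky_EVI (law a) q"
    using lipschitz_curve_sticky[OF a u] sticky_EVI_sticky[OF a u] by (auto simp: q_def)
  have lim': "((\<lambda>t. norm (a + t *\<^sub>R u - qf (r t)) / t) \<longlongrightarrow> 0) (at_right 0)"
  proof (rule Lim_transform_eventually)
    show "((\<lambda>t. sqrt ((norm (a + t *\<^sub>R u - qf (r t)))\<^sup>2 / t\<^sup>2)) \<longlongrightarrow> 0) (at_right 0)"
      using tendsto_real_sqrt[OF lim] by simp
    show "\<forall>\<^sub>F t in at_right 0. sqrt ((norm (a + t *\<^sub>R u - qf (r t)))\<^sup>2 / t\<^sup>2) = norm (a + t *\<^sub>R u - qf (r t)) / t"
      using eventually_at_right_less[of "0::real"]
      by eventually_elim (simp add: real_sqrt_divide)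
  qed
  have "((\<lambda>t. W2 (r t) (q t) / t) \<longlongrightarrow> 0) (at_right 0)"
  proof (rule tendsto_sandwich[OF _ _ tendsto_const])
    show "((\<lambda>t. norm (a + t *\<^sub>R u - qf (r t)) / t + norm (sticky a u t - (a + t *\<^sub>R u)) / t) \<longlongrightarrow> 0) (at_right 0)"
      using tendsto_add[OF lim' sticky_initial[OF a u]] by simp
    have P: "r t \<in> P2" "q t \<in> P2" if "0 < t" for t
      using that r(1) q(1) by (auto simp: lipschitz_curve_def)
    show "\<forall>\<^sub>F t in at_right 0. 0 \<le> W2 (r t) (q t) / t"
      using eventually_at_right_less[of "0::real"]
      by eventually_elim (simp add: W2_nonneg P)
    show "\<forall>\<^sub>F t in at_right 0. W2 (r t) (q t) / t
        \<le> norm (a + t *\<^sub>R u - qf (r t)) / t + norm (sticky a u t - (a + t *\<^sub>R u)) / t"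
      using eventually_at_right_less[of "0::real"]
    proof eventually_elim
      case (elim t)
      have "W2 (r t) (q t) = norm (qf (r t) - sticky a u t)"
        using W2_eq[OF P(1)[OF elim] P(2)[OF elim]] qf_law[OF sticky_MK, of a u t]
        by (simp add: q_def dist_norm)
      also have "\<dots> = norm ((a + t *\<^sub>R u - qf (r t)) + (sticky a u t - (a + t *\<^sub>R u)))"
        by (subst norm_minus_commute) simp
      also have "\<dots> \<le> norm (a + t *\<^sub>R u - qf (r t)) + norm (sticky a u t - (a + t *\<^sub>R u))"
        by (rule norm_triangle_ineq)
      finally show ?case
        using elim by (simp add: add_divide_distrib[symmetric] divide_right_mono)
    qed
  qed
  then have "r t = q t"
    using sticky_EVI_unique[OF law_P2 r(1,2) q, of t] t False by simp
  then show ?thesis by (simp add: q_def)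
qed

theorem theorem2p4:
  fixes \<rho>0 :: "real measure"
  assumes "\<rho>0 \<in> P2"
  shows
   "(\<forall>v0\<in>L2 \<rho>0.
       (\<forall>t\<ge>0. sticky_semigroup t (\<rho>0, momentum \<rho>0 v0) \<in> V2) \<and>
       (\<forall>\<rho> :: real \<Rightarrow> real measure.
          (\<forall>t\<ge>0. \<rho> t = fst (sticky_semigroup t (\<rho>0, momentum \<rho>0 v0))) \<longrightarrow>
          lipschitz_curve \<rho> \<and>
          sticky_EVI \<rho>0 \<rho> \<and>
          EVI_on UNIV \<rho>0 (\<lambda>\<tau>. \<rho> (exp \<tau>)) \<and>
          (\<forall>\<tau> \<delta>. \<delta> \<le> \<tau> \<longrightarrow> \<rho> (exp \<tau>) = grad_flow \<rho>0 (\<tau> - \<delta>) (\<rho> (exp \<delta>))) \<and>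
          (\<forall>t \<epsilon>. 0 < \<epsilon> \<longrightarrow> \<epsilon> \<le> t \<longrightarrow> \<rho> t = grad_flow \<rho>0 (ln (t / \<epsilon>)) (\<rho> \<epsilon>)))) \<and>
    (\<forall>\<rho> :: real \<Rightarrow> real measure. lipschitz_curve \<rho> \<and> \<rho> 0 = \<rho>0 \<longrightarrow>
       (sticky_EVI \<rho>0 \<rho> \<longleftrightarrow> EVI_on UNIV \<rho>0 (\<lambda>\<tau>. \<rho> (exp \<tau>)))) \<and>
    (\<forall>\<rho> :: real \<Rightarrow> real measure. \<forall>v0\<in>L2 \<rho>0.
       lipschitz_curve \<rho> \<and> \<rho> 0 = \<rho>0 \<and> sticky_EVI \<rho>0 \<rho> \<and>
       ((\<lambda>t. (\<integral>z. (fst z + t * v0 (fst z) - snd z)\<^sup>2 \<partial>opt_coupling \<rho>0 (\<rho> t)) / t\<^sup>2)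
          \<longlongrightarrow> 0) (at_right 0) \<longrightarrow>
       (\<exists>v :: real \<Rightarrow> real \<Rightarrow> real.
          (\<forall>t\<ge>0. v t \<in> L2 (\<rho> t) \<and>
                 (\<rho> t, momentum (\<rho> t) (v t)) = sticky_semigroup t (\<rho>0, momentum \<rho>0 v0)) \<and>
          (\<forall>u :: real \<Rightarrow> real \<Rightarrow> real.
             (\<forall>t\<ge>0. u t \<in> L2 (\<rho> t) \<and>
                    (\<rho> t, momentum (\<rho> t) (u t)) = sticky_semigroup t (\<rho>0, momentum \<rho>0 v0)) \<longrightarrow>
             (\<forall>t\<ge>0. AE x in \<rho> t. u t x = v t x)) \<and>
          wasserstein_velocity \<rho> v))"
proof (intro conjI ballI allI impI)
  define a where "a = qf \<rho>0"
  \<comment> \<open>The initial velocity in Lagrangian coordinates, a function of the initial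
    position \<open>a\<close>.\<close>
  define U where "U v = cl (\<lambda>w. v (rearr \<rho>0 w))" for v
  have a: "a \<in> MK" and la: "law a = \<rho>0" using qf_MK[OF assms] law_qf[OF assms] by (simp_all add: a_def)
  have U: "U v \<in> Hs a" if "v \<in> L2 \<rho>0" for v
    using momentum_eq_mom(3)[OF assms that] by (simp add: a_def U_def)
  have S: "sticky_semigroup t (\<rho>0, momentum \<rho>0 v) = (law (sticky a (U v) t), mom (sticky a (U v) t) (U v))"
    if "v \<in> L2 \<rho>0" "0 \<le> t" for v t
    using sticky_semigroup_momentum[OF assms that] by (simp add: a_def U_def sstate_def)
  {
    fix v0 assume v0: "v0 \<in> L2 \<rho>0"
    show "sticky_semigroup t (\<rho>0, momentum \<rho>0 v0) \<in> V2" if "0 \<le> t" for t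
      using sstate_V2[OF sticky_MK, of a "U v0" t "U v0"] S[OF v0 that] by (simp add: sstate_def)
    fix \<rho> assume "\<forall>t\<ge>0. \<rho> t = fst (sticky_semigroup t (\<rho>0, momentum \<rho>0 v0))"
    then have r: "\<rho> t = law (sticky a (U v0) t)" if "0 \<le> t" for t using that S[OF v0 that] by simp
    show L: "lipschitz_curve \<rho>" by (rule lipschitz_curve_sticky[OF a U[OF v0] r])
    show E: "sticky_EVI \<rho>0 \<rho>" using sticky_EVI_sticky[OF a U[OF v0] r] la by simp
    show "EVI_on UNIV \<rho>0 (\<lambda>\<tau>. \<rho> (exp \<tau>))" using E sticky_EVI_iff_EVI_exp by simp
    show "\<rho> (exp \<tau>) = grad_flow \<rho>0 (\<tau> - \<delta>) (\<rho> (exp \<delta>))" if "\<delta> \<le> \<tau>" for \<tau> \<delta>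
      by (rule sticky_EVI_flow[OF assms L E that])
    show "\<rho> t = grad_flow \<rho>0 (ln (t / \<epsilon>)) (\<rho> \<epsilon>)" if "0 < \<epsilon>" "\<epsilon> \<le> t" for t \<epsilon>
      by (rule sticky_EVI_flow_log[OF assms L E that])
  }
  show "sticky_EVI \<rho>0 \<rho> \<longleftrightarrow> EVI_on UNIV \<rho>0 (\<lambda>\<tau>. \<rho> (exp \<tau>))" for \<rho> by (rule sticky_EVI_iff_EVI_exp)
  fix \<rho> v0 assume v0: "v0 \<in> L2 \<rho>0" and "lipschitz_curve \<rho> \<and> \<rho> 0 = \<rho>0 \<and> sticky_EVI \<rho>0 \<rho> \<and>
    ((\<lambda>t. (\<integral>z. (fst z + t * v0 (fst z) - snd z)\<^sup>2 \<partial>opt_coupling \<rho>0 (\<rho> t)) / t\<^sup>2) \<longlongrightarrow> 0) (at_right 0)"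
  then have L: "lipschitz_curve \<rho>" and 0: "\<rho> 0 = \<rho>0" and E: "sticky_EVI \<rho>0 \<rho>"
    and lim: "((\<lambda>t. (\<integral>z. (fst z + t * v0 (fst z) - snd z)\<^sup>2 \<partial>opt_coupling \<rho>0 (\<rho> t)) / t\<^sup>2) \<longlongrightarrow> 0) (at_right 0)"
    by auto
  \<comment> \<open>The optimal coupling is the joint law of the two rearrangements, so the initial
    velocity condition is a statement about norms of their classes.\<close>
  have lim': "((\<lambda>t. (norm (a + t *\<^sub>R U v0 - qf (\<rho> t)))\<^sup>2 / t\<^sup>2) \<longlongrightarrow> 0) (at_right 0)"
  proof (rule Lim_transform_eventually[OF lim])
    show "\<forall>\<^sub>F t in at_right 0. (\<integral>z. (fst z + t * v0 (fst z) - snd z)\<^sup>2 \<partial>opt_coupling \<rho>0 (\<rho> t)) / t\<^sup>2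
        = (norm (a + t *\<^sub>R U v0 - qf (\<rho> t)))\<^sup>2 / t\<^sup>2"
      using eventually_at_right_less[of "0::real"]
    proof eventually_elim
      case (elim t)
      then have "\<rho> t \<in> P2" using L by (simp add: lipschitz_curve_def)
      then show ?case using integral_opt_coupling[OF assms _ v0] by (simp add: a_def U_def)
    qed
  qed
  have r: "\<rho> t = law (sticky a (U v0) t)" if "0 \<le> t" for t
    using sticky_EVI_initial_velocity_unique[OF a U[OF v0] L _ _ lim' that] E 0 la by simp
  have m: "momentum (\<rho> t) (vfield a (U v0) t) = mom (sticky a (U v0) t) (U v0)" if "0 \<le> t" for t
    using vfield(5)[of a "U v0" t] r[OF that] by simp
  have V: "vfield a (U v0) t \<in> L2 (\<rho> t)" if "0 \<le> t" for t
    using vfield(2)[of a "U v0" t] r[OF that] by simp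
  show "\<exists>v. (\<forall>t\<ge>0. v t \<in> L2 (\<rho> t) \<and> (\<rho> t, momentum (\<rho> t) (v t)) = sticky_semigroup t (\<rho>0, momentum \<rho>0 v0)) \<and>
      (\<forall>u. (\<forall>t\<ge>0. u t \<in> L2 (\<rho> t) \<and> (\<rho> t, momentum (\<rho> t) (u t)) = sticky_semigroup t (\<rho>0, momentum \<rho>0 v0)) \<longrightarrow>
        (\<forall>t\<ge>0. AE x in \<rho> t. u t x = v t x)) \<and> wasserstein_velocity \<rho> v"
  proof (intro exI[of _ "vfield a (U v0)"] conjI allI impI)
    show "vfield a (U v0) t \<in> L2 (\<rho> t)" if "0 \<le> t" for t by (rule V[OF that])
    show "(\<rho> t, momentum (\<rho> t) (vfield a (U v0) t)) = sticky_semigroup t (\<rho>0, momentum \<rho>0 v0)" if "0 \<le> t" for t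
      using S[OF v0 that] m[OF that] r[OF that] by simp
    show "wasserstein_velocity \<rho> (vfield a (U v0))" by (rule wasserstein_velocity_sticky[OF a U[OF v0] r])
    fix u t
    assume u: "\<forall>t\<ge>0. u t \<in> L2 (\<rho> t) \<and> (\<rho> t, momentum (\<rho> t) (u t)) = sticky_semigroup t (\<rho>0, momentum \<rho>0 v0)"
      and t: "(0::real) \<le> t"
    have ut: "u t \<in> L2 (\<rho> t)" and e: "(\<rho> t, momentum (\<rho> t) (u t)) = sticky_semigroup t (\<rho>0, momentum \<rho>0 v0)"
      using u t by blast+
    \<comment> \<open>The second components of the two representations of the same state; a momentum
      determines its velocity almost everywhere.\<close>
    have "momentum (\<rho> t) (u t) = momentum (\<rho> t) (vfield a (U v0) t)"
      by (rule trans[OF conjunct2[OF e[unfolded S[OF v0 t] prod.inject]] m[OF t, symmetric]])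
    from velocity_unique[OF sticky_MK ut[unfolded r[OF t]] V[OF t, unfolded r[OF t]] this[unfolded r[OF t]]]
    show "AE x in \<rho> t. u t x = vfield a (U v0) t x" by (simp only: r[OF t])
  qed
qed

end
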